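(* Let $l\ge2$. Then $\mathbf v_{l-1}=\mathbf u_{l-1}$ as endomorphisms of the $(A,A)$-bimodule $B^{\otimes(l-1)}$.
   Context: $\Bbbk$ is a field with $\operatorname{char}\Bbbk\ne2$; $q$ is the upward grading shift. $R=\Bbbk[x_1,\dots,x_l]$, $\deg x_i=2$; $N=\{1,-1,2,\dots,l-1\}$; $\alpha_i=x_{i+1}-x_i$ ($1\le i\le l-1$), $\alpha_{-1}=x_2+x_1$; $s_i$ swaps $x_i,x_{i+1}$ ($1\le i\le l-1$), $s_{-1}:x_1\mapsto-x_2,x_2\mapsto-x_1$; these generate $W$ of type $\mathrm D_l$. $\gamma:R\to R$, $x_1\mapsto-x_1$, $x_i\mapsto x_i$ ($i>1$). $\partial_i(f)=(f-s_if)/\alpha_i$. $W_J=\langle s_j:j\in J\rangle$, $R^J=R^{W_J}$, $w_J$ longest element. For $J\subseteq K\subseteq N$, $\mathrm{tr}^J_K:R^J\to R^K$ is the composite of Demazure operators along a reduced expression of $w_Kw_J^{-1}$; dual homogeneous bases $(b),(b^\vee)$ of $R^J$ over $R^K$ satisfy $\mathrm{tr}^J_K(ab^\vee)=\delta_{a,b}$. $O=\{2,\dots,l-1\}$; for $J\subseteq O$, $J+=J\cup\{1\}$, $J-=J\cup\{-1\}$, $J\pm=J\cup\{1,-1\}$; $A=R^{O+}=\Bbbk[x_1,\dots,x_l]^{S_l}$. $B=q^{1-l}R^O$ is the graded $(A,A)$-bimodule with natural right action and left action $a\cdot f=\gamma(a)f$; $B^{\otimes n}$ is its $n$th tensor power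 over $A$. For $1\le n\le l$ put $\epsilon_i=+$ if $n-i$ is even, $\epsilon_i=-$ if $n-i$ is odd ($0\le i\le n-1$). Let $X_n=R^O\otimes_{R^{O\epsilon_1}}R^O\otimes_{R^{O\epsilon_2}}\cdots\otimes_{R^{O\epsilon_{n-1}}}R^O$ ($n$ factors) and $\kappa_n:B^{\otimes n}\to X_n$ the linear isomorphism $f_1\otimes\cdots\otimes f_n\mapsto\gamma^{n-1}(f_1)\otimes\gamma^{n-2}(f_2)\otimes\cdots\otimes f_n$. For $I\subseteq O$, $c\in R^{I+}$ and $f_1,\dots,f_n\in R^O$ put $$F^I_c=\mathrm{tr}^I_{I\epsilon_0}\big(f_1\mathrm{tr}^I_{I\epsilon_1}(f_2\cdots\mathrm{tr}^I_{I\epsilon_{n-1}}(f_nc)\cdots)\big).$$ *Definition of $\mathbf u_n$* ($1\le n\le l$): $\mathbf u_n=\kappa_n^{-1}\circ u_n\circ\kappa_n$, where $u_n(f_1\otimes\cdots\otimes f_n)=\sum_cF^O_c\otimes1\otimes\cdots\otimes1\otimes c^\vee$ (interpreted as $\sum_cF^O_cc^\vee$ if $n=1$), with $c$ running over a homogeneous basis of $R^{O+}$ over $R^{O\pm}$ and $c^\vee$ over the dual basis. *Definition of $\mathbf v_n$* ($1\le n\le l-1$): $\mathbf v_1=\mathrm{id}_B$. For $2\le n\le l-1$ let $I=O\setminus\{n\}$ and $\mathbf v_n=\kappa_n^{-1}\circ v_n\circ\kappa_n$, where $v_n(f_1\otimes\cdots\otimes f_n)=\sum_cT_n(F^I_c\otimes1\otimes\cdots\otimes1\otimes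 c^\vee)$, with $c$ running over a homogeneous basis of $R^{I+}$ over $R^{I\pm}$, $c^\vee$ over the dual basis, and $T_n:R^I\otimes_{R^{I\epsilon_1}}\cdots\otimes_{R^{I\epsilon_{n-1}}}R^I\to X_n$ given by $T_n(g_1\otimes\cdots\otimes g_n)=\sum_{b_1,\dots,b_{n-1}}\mathrm{tr}^I_O(g_1b_1)\otimes\mathrm{tr}^I_O(b_1^\vee g_2b_2)\otimes\cdots\otimes\mathrm{tr}^I_O(b_{n-1}^\vee g_n)$, where $b_i$ runs over a homogeneous basis of $R^{I\epsilon_i}$ over $R^{O\epsilon_i}$ with dual basis $b_i^\vee$. *)

theory Defs
  imports
    "HOL-Library.Poly_Mapping"
    "HOL-Library.FuncSet"
begin

section \<open>Polynomials and the Weyl group of type D\<close>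

text \<open>Polynomials in countably many variables; \<open>Rl l\<close> is the subring of polynomials in
  \<open>x\<^sub>1, \<dots>, x\<^sub>l\<close>. All the operators below are defined on the ambient type, and they fix the
  variables outside \<open>x\<^sub>1, \<dots>, x\<^sub>l\<close>.\<close>

type_synonym 'k mpol = "(nat \<Rightarrow>\<^sub>0 nat) \<Rightarrow>\<^sub>0 'k"

definition X :: "nat \<Rightarrow> 'k::field mpol" where
  "X i = Poly_Mapping.single (Poly_Mapping.single i 1) 1"

definition Rl :: "nat \<Rightarrow> 'k::field mpol set" where
  "Rl l = {f. \<forall>m \<in> Poly_Mapping.keys f. Poly_Mapping.keys m \<subseteq> {1..l}}"

definition homogeneous :: "'k::field mpol \<Rightarrow> bool" where
  "homogeneous f \<longleftrightarrow> (\<exists>d. \<forall>m \<in> Poly_Mapping.keys f.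
     (\<Sum>i \<in> Poly_Mapping.keys m. 2 * Poly_Mapping.lookup m i) = d)"

definition subst :: "(nat \<Rightarrow> 'k::field mpol) \<Rightarrow> 'k mpol \<Rightarrow> 'k mpol" where
  "subst \<sigma> f = (\<Sum>m \<in> Poly_Mapping.keys f. Poly_Mapping.single 0 (Poly_Mapping.lookup f m) *
     (\<Prod>i \<in> Poly_Mapping.keys m. \<sigma> i ^ Poly_Mapping.lookup m i))"

definition gam :: "'k::field mpol \<Rightarrow> 'k mpol" where
  "gam = subst (X(1 := - X 1))"

definition N :: "nat \<Rightarrow> int set" where
  "N l = {-1} \<union> {1..int l - 1}"

definition O2 :: "nat \<Rightarrow> int set" where
  "O2 l = {2..int l - 1}"

definition alpha :: "int \<Rightarrow> 'k::field mpol" where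
  "alpha i = (if i = -1 then X 2 + X 1 else X (nat i + 1) - X (nat i))"

definition refl :: "int \<Rightarrow> 'k::field mpol \<Rightarrow> 'k mpol" where
  "refl i = subst (if i = -1 then X(1 := - X 2, 2 := - X 1)
                   else X(nat i := X (nat i + 1), nat i + 1 := X (nat i)))"

text \<open>The division is exact and the quotient is unique.\<close>

definition demazure :: "int \<Rightarrow> 'k::field mpol \<Rightarrow> 'k mpol" where
  "demazure i f = (THE g. alpha i * g = f - refl i f)"

text \<open>The Weyl group is realised by its (faithful, as the characteristic is not 2) action on
  polynomials. A word \<open>[i\<^sub>1, \<dots>, i\<^sub>k]\<close> stands for \<open>s\<^bsub>i\<^sub>1\<^esub> \<circ> \<dots> \<circ> s\<^bsub>i\<^sub>k\<^esub>\<close>; words suffice to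
  describe generated subgroups because the \<open>s\<^sub>i\<close> are involutions.\<close>

definition word_elt :: "int list \<Rightarrow> 'k::field mpol \<Rightarrow> 'k mpol" where
  "word_elt w = foldr refl w"

definition parab :: "int set \<Rightarrow> ('k::field mpol \<Rightarrow> 'k mpol) set" where
  "parab J = {word_elt w |w. set w \<subseteq> J}"

definition len :: "nat \<Rightarrow> ('k::field mpol \<Rightarrow> 'k mpol) \<Rightarrow> nat" where
  "len l g = (LEAST k. \<exists>w. set w \<subseteq> N l \<and> word_elt w = g \<and> length w = k)"

definition reduced_expr :: "nat \<Rightarrow> int list \<Rightarrow> ('k::field mpol \<Rightarrow> 'k mpol) \<Rightarrow> bool" where
  "reduced_expr l w g \<longleftrightarrow> set w \<subseteq> N l \<and> word_elt w = g \<and> length w = len l g"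

definition longest :: "nat \<Rightarrow> int set \<Rightarrow> 'k::field mpol \<Rightarrow> 'k mpol" where
  "longest l J = (ARG_MAX (len l) g. g \<in> parab J)"

definition inv_ring :: "nat \<Rightarrow> int set \<Rightarrow> 'k::field mpol set" where
  "inv_ring l J = {f \<in> Rl l. \<forall>g \<in> parab J. g f = f}"

text \<open>\<open>tr l J K\<close> is the trace from \<open>J\<close>-invariants to \<open>K\<close>-invariants. By the braid relations it
  does not depend on the chosen reduced expression.\<close>

definition tr :: "nat \<Rightarrow> int set \<Rightarrow> int set \<Rightarrow> 'k::field mpol \<Rightarrow> 'k mpol" where
  "tr l J K = foldr demazure
     (SOME w. reduced_expr l w (longest l K \<circ> inv (longest l J) :: 'k mpol \<Rightarrow> 'k mpol))"

definition hom_basis :: "nat \<Rightarrow> int set \<Rightarrow> int set \<Rightarrow> 'k::field mpol set \<Rightarrow> bool" where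
  "hom_basis l J K B \<longleftrightarrow> finite B \<and> B \<subseteq> inv_ring l J \<and> (\<forall>b \<in> B. homogeneous b) \<and>
     (\<forall>f \<in> inv_ring l J. \<exists>!r. r \<in> B \<rightarrow>\<^sub>E inv_ring l K \<and> f = (\<Sum>b \<in> B. r b * b))"

text \<open>\<open>B\<close> together with \<open>b \<mapsto> b\<^sup>\<or>\<close> given by \<open>d\<close>.\<close>

definition dual_hom_bases ::
  "nat \<Rightarrow> int set \<Rightarrow> int set \<Rightarrow> 'k::field mpol set \<Rightarrow> ('k mpol \<Rightarrow> 'k mpol) \<Rightarrow> bool" where
  "dual_hom_bases l J K B d \<longleftrightarrow>
     hom_basis l J K B \<and> inj_on d B \<and> hom_basis l J K (d ` B) \<and>
     (\<forall>a \<in> B. \<forall>b \<in> B. tr l J K (a * d b) = (if a = b then 1 else 0))"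


section \<open>Iterated tensor products of bimodules\<close>

text \<open>A record \<open>T\<close> describes \<open>M \<otimes>\<^bsub>S 1\<^esub> M \<otimes>\<^bsub>S 2\<^esub> \<dots> \<otimes>\<^bsub>S (n-1)\<^esub> M\<close> with \<open>n = tlen T\<close> factors
  \<open>M = fac T\<close>, where the ring \<open>S i = scal T i\<close> acts on the factor to its left by
  multiplication and on the factor to its right by \<open>lact T\<close>. Its elements are cosets: the tensor
  product is the free abelian group on the \<open>n\<close>-tuples of elements of \<open>M\<close>, modulo the subgroup
  \<open>tens_rel T\<close> generated by the additivity and balancing relations.\<close>

record 'r chain =
  tlen :: nat
  fac :: "'r set"
  scal :: "nat \<Rightarrow> 'r set"
  lact :: "'r \<Rightarrow> 'r \<Rightarrow> 'r"

type_synonym 'r tensor = "('r list \<Rightarrow>\<^sub>0 int) set"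

definition tens_free :: "'r::comm_ring_1 chain \<Rightarrow> ('r list \<Rightarrow>\<^sub>0 int) set" where
  "tens_free T = {p. \<forall>fs \<in> Poly_Mapping.keys p. length fs = tlen T \<and> set fs \<subseteq> fac T}"

inductive_set tens_rel :: "'r::comm_ring_1 chain \<Rightarrow> ('r list \<Rightarrow>\<^sub>0 int) set"
  for T :: "'r chain" where
  zero: "0 \<in> tens_rel T"
| diff: "p \<in> tens_rel T \<Longrightarrow> q \<in> tens_rel T \<Longrightarrow> p - q \<in> tens_rel T"
| additive: "length us + 1 + length vs = tlen T \<Longrightarrow> set us \<subseteq> fac T \<Longrightarrow> set vs \<subseteq> fac T \<Longrightarrow>
    f \<in> fac T \<Longrightarrow> g \<in> fac T \<Longrightarrow>
    frag_of (us @ (f + g) # vs) - frag_of (us @ f # vs) - frag_of (us @ g # vs) \<in> tens_rel T"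
| balanced: "length us + 2 + length vs = tlen T \<Longrightarrow> set us \<subseteq> fac T \<Longrightarrow> set vs \<subseteq> fac T \<Longrightarrow>
    f \<in> fac T \<Longrightarrow> g \<in> fac T \<Longrightarrow> a \<in> scal T (length us + 1) \<Longrightarrow>
    frag_of (us @ (f * a) # g # vs) - frag_of (us @ f # lact T a g # vs) \<in> tens_rel T"

definition tclass :: "'r::comm_ring_1 chain \<Rightarrow> ('r list \<Rightarrow>\<^sub>0 int) \<Rightarrow> 'r tensor" where
  "tclass T p = {q \<in> tens_free T. q - p \<in> tens_rel T}"

definition tensors :: "'r::comm_ring_1 chain \<Rightarrow> 'r tensor set" where
  "tensors T = tclass T ` tens_free T"

text \<open>\<open>tmap T T' h\<close> is the additive map from the tensors of \<open>T\<close> to those of \<open>T'\<close> sending the pure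
  tensor of \<open>fs\<close> to the class of \<open>h fs\<close>. When \<open>h\<close> respects the relations, the classes in the
  union coincide.\<close>

definition tmap :: "'r::comm_ring_1 chain \<Rightarrow> 'r chain \<Rightarrow> ('r list \<Rightarrow> ('r list \<Rightarrow>\<^sub>0 int)) \<Rightarrow>
    'r tensor \<Rightarrow> 'r tensor" where
  "tmap T T' h = (\<lambda>t \<in> tensors T. \<Union>p \<in> t. tclass T' (frag_extend h p))"

definition tadd :: "'r::comm_ring_1 chain \<Rightarrow> 'r tensor \<Rightarrow> 'r tensor \<Rightarrow> 'r tensor" where
  "tadd T s t = (\<Union>p \<in> s. \<Union>q \<in> t. tclass T (p + q))"

definition left_mult :: "'r::comm_ring_1 chain \<Rightarrow> 'r \<Rightarrow> 'r tensor \<Rightarrow> 'r tensor" where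
  "left_mult T a = tmap T T (\<lambda>fs. frag_of (lact T a (hd fs) # tl fs))"

definition right_mult :: "'r::comm_ring_1 chain \<Rightarrow> 'r \<Rightarrow> 'r tensor \<Rightarrow> 'r tensor" where
  "right_mult T a = tmap T T (\<lambda>fs. frag_of (butlast fs @ [last fs * a]))"

definition bimod_endos :: "'r::comm_ring_1 chain \<Rightarrow> 'r set \<Rightarrow>
    ('r tensor \<Rightarrow> 'r tensor) set" where
  "bimod_endos T A = {\<phi> \<in> tensors T \<rightarrow>\<^sub>E tensors T.
     (\<forall>s \<in> tensors T. \<forall>t \<in> tensors T. \<phi> (tadd T s t) = tadd T (\<phi> s) (\<phi> t)) \<and>
     (\<forall>a \<in> A. \<forall>t \<in> tensors T. \<phi> (left_mult T a t) = left_mult T a (\<phi> t)) \<and>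
     (\<forall>a \<in> A. \<forall>t \<in> tensors T. \<phi> (right_mult T a t) = right_mult T a (\<phi> t))}"


section \<open>The endomorphisms \<open>u\<^sub>n\<close> and \<open>v\<^sub>n\<close>\<close>

definition Aring :: "nat \<Rightarrow> 'k::field mpol set" where
  "Aring l = inv_ring l (insert 1 (O2 l))"

text \<open>The grading shift on \<open>B\<close> does not change the underlying bimodule, so it does not appear.\<close>

definition Bpow :: "nat \<Rightarrow> nat \<Rightarrow> 'k::field mpol chain" where
  "Bpow l n = \<lparr>tlen = n, fac = inv_ring l (O2 l), scal = (\<lambda>_. Aring l),
     lact = (\<lambda>a f. gam a * f)\<rparr>"

text \<open>The sign \<open>\<epsilon>\<^sub>i\<close>, as an element of the index set \<open>N l\<close>; thus \<open>insert (sgn_idx n i) J\<close> is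
  \<open>J\<epsilon>\<^sub>i\<close>.\<close>

definition sgn_idx :: "nat \<Rightarrow> nat \<Rightarrow> int" where
  "sgn_idx n i = (if even (n - i) then 1 else -1)"

text \<open>\<open>Xten l n J\<close> is the chain of \<open>n\<close> copies of the \<open>J\<close>-invariants over the
  \<open>J\<epsilon>\<^sub>i\<close>-invariants; \<open>X\<^sub>n\<close> is the case \<open>J = O\<close>.\<close>

definition Xten :: "nat \<Rightarrow> nat \<Rightarrow> int set \<Rightarrow> 'k::field mpol chain" where
  "Xten l n J = \<lparr>tlen = n, fac = inv_ring l J,
     scal = (\<lambda>i. inv_ring l (insert (sgn_idx n i) J)), lact = (*)\<rparr>"

definition kappa :: "nat \<Rightarrow> nat \<Rightarrow>
    'k::field mpol tensor \<Rightarrow> 'k mpol tensor" where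
  "kappa l n = tmap (Bpow l n) (Xten l n (O2 l))
     (\<lambda>fs. frag_of (map (\<lambda>j. (gam ^^ (n - 1 - j)) (fs ! j)) [0..<n]))"

definition kappa_conj :: "nat \<Rightarrow> nat \<Rightarrow>
    ('k::field mpol tensor \<Rightarrow> 'k mpol tensor) \<Rightarrow>
    'k mpol tensor \<Rightarrow> 'k mpol tensor" where
  "kappa_conj l n \<phi> = (\<lambda>t \<in> tensors (Bpow l n).
     inv_into (tensors (Bpow l n)) (kappa l n) (\<phi> (kappa l n t)))"

text \<open>\<open>nest l n I i [f\<^bsub>i+1\<^esub>, \<dots>, f\<^sub>n] c\<close> is the part of \<open>F\<^sup>I\<^sub>c\<close> that starts with the trace to the
  \<open>I\<epsilon>\<^sub>i\<close>-invariants.\<close>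

fun nest :: "nat \<Rightarrow> nat \<Rightarrow> int set \<Rightarrow> nat \<Rightarrow> 'k::field mpol list \<Rightarrow> 'k mpol \<Rightarrow> 'k mpol" where
  "nest l n I i [] c = c"
| "nest l n I i (f # fs) c = tr l I (insert (sgn_idx n i) I) (f * nest l n I (Suc i) fs c)"

definition F :: "nat \<Rightarrow> nat \<Rightarrow> int set \<Rightarrow> 'k::field mpol list \<Rightarrow> 'k mpol \<Rightarrow> 'k mpol" where
  "F l n I fs c = nest l n I 0 fs c"

definition ends :: "nat \<Rightarrow> 'k::field mpol \<Rightarrow> 'k mpol \<Rightarrow> 'k mpol list" where
  "ends n f g = (if n = 1 then [f * g] else f # replicate (n - 2) 1 @ [g])"

text \<open>The map \<open>f\<^sub>1 \<otimes> \<dots> \<otimes> f\<^sub>n \<mapsto> \<Sum>\<^sub>c F\<^sup>I\<^sub>c \<otimes> 1 \<otimes> \<dots> \<otimes> 1 \<otimes> c\<^sup>\<or>\<close> from \<open>X\<^sub>n\<close> to the chain over \<open>I\<close>, for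
  the dual bases \<open>C\<close>, \<open>Cd\<close>. Since \<open>T\<^sub>n\<close> is additive, \<open>v\<^sub>n\<close> is its composite with \<open>T\<^sub>n\<close>.\<close>

definition Fsum :: "nat \<Rightarrow> nat \<Rightarrow> int set \<Rightarrow> 'k::field mpol set \<Rightarrow> ('k mpol \<Rightarrow> 'k mpol) \<Rightarrow>
    'k mpol tensor \<Rightarrow> 'k mpol tensor" where
  "Fsum l n I C Cd = tmap (Xten l n (O2 l)) (Xten l n I)
     (\<lambda>fs. \<Sum>c \<in> C. frag_of (ends n (F l n I fs c) (Cd c)))"

definition u_map :: "nat \<Rightarrow> nat \<Rightarrow> 'k::field mpol set \<Rightarrow> ('k mpol \<Rightarrow> 'k mpol) \<Rightarrow>
    'k mpol tensor \<Rightarrow> 'k mpol tensor" where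
  "u_map l n C Cd = Fsum l n (O2 l) C Cd"

definition bold_u :: "nat \<Rightarrow> nat \<Rightarrow> 'k::field mpol set \<Rightarrow> ('k mpol \<Rightarrow> 'k mpol) \<Rightarrow>
    'k mpol tensor \<Rightarrow> 'k mpol tensor" where
  "bold_u l n C Cd = kappa_conj l n (u_map l n C Cd)"

text \<open>\<open>E i\<close>, \<open>Ed i\<close> are the dual bases used at the \<open>i\<close>-th tensor sign. The list index \<open>j\<close> starts
  at 0, so \<open>g\<^bsub>j+1\<^esub> = gs ! j\<close> sits between the signs \<open>j\<close> and \<open>j + 1\<close>.\<close>

definition T_map :: "nat \<Rightarrow> nat \<Rightarrow> int set \<Rightarrow> (nat \<Rightarrow> 'k::field mpol set) \<Rightarrow>
    (nat \<Rightarrow> 'k mpol \<Rightarrow> 'k mpol) \<Rightarrow>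
    'k mpol tensor \<Rightarrow> 'k mpol tensor" where
  "T_map l n I E Ed = tmap (Xten l n I) (Xten l n (O2 l))
     (\<lambda>gs. \<Sum>b \<in> (\<Pi>\<^sub>E i \<in> {1..n - 1}. E i).
        frag_of (map (\<lambda>j. tr l I (O2 l)
          ((if j = 0 then 1 else Ed j (b j)) * gs ! j * (if j = n - 1 then 1 else b (Suc j))))
        [0..<n]))"

definition Iset :: "nat \<Rightarrow> nat \<Rightarrow> int set" where
  "Iset l n = O2 l - {int n}"

definition bold_v :: "nat \<Rightarrow> nat \<Rightarrow> 'k::field mpol set \<Rightarrow> ('k mpol \<Rightarrow> 'k mpol) \<Rightarrow>
    (nat \<Rightarrow> 'k mpol set) \<Rightarrow> (nat \<Rightarrow> 'k mpol \<Rightarrow> 'k mpol) \<Rightarrow>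
    'k mpol tensor \<Rightarrow> 'k mpol tensor" where
  "bold_v l n D Dd E Ed =
     (if n = 1 then (\<lambda>t \<in> tensors (Bpow l n). t)
      else kappa_conj l n (T_map l n (Iset l n) E Ed \<circ> Fsum l n (Iset l n) D Dd))"

end

theory Submission
  imports Defs "HOL-Computational_Algebra.Computational_Algebra"
begin

text \<open>A tensor is tested by evaluating it. Call a sequence \<open>Q = [q\<^sub>1, \<dots>, q\<^sub>n]\<close> of elements of \<open>{1..l}\<close> a path.
  Along \<open>Q\<close>, the \<open>i\<close>-th factor of \<open>f\<^sub>1 \<otimes> \<dots> \<otimes> f\<^sub>n\<close> is evaluated at the point that arises from
  \<open>(x\<^sub>1, \<dots>, x\<^sub>l)\<close> by flipping the signs of the coordinates \<open>q\<^sub>1, \<dots>, q\<^bsub>i-1\<^esub>\<close> one after the other and then moving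
  coordinate \<open>q\<^sub>i\<close> to the first place, up to a sign prescribed by \<open>\<epsilon>\<^bsub>i-1\<^esub>\<close>; the results are
  multiplied (\<open>val\<close>). The invariants of \<open>O\<close> are symmetric in \<open>x\<^sub>2, \<dots>, x\<^sub>l\<close>, hence see only which
  coordinate comes first. The points of two adjacent factors differ by an element of the
  group \<open>W\<^bsub>O\<epsilon>\<^esub>\<close> of the tensor sign between them, so the value is well defined on the tensor product
  (\<open>val_vanishes_on_rel\<close>). Conversely, the powers of one variable form a basis of the invariants of \<open>O\<close> over
  those of \<open>O\<epsilon>\<close>, and a Vandermonde argument shows that a tensor all of whose evaluations vanish is zero
  (\<open>paths_separate_tensors\<close>). All claims thus become identities between matrices indexed by pairs of paths.

  These matrices are computable. A composite of Demazure operators along a reduced word of a longest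
  element is a sum over the group, and so \<open>tr l J K\<close> is a sum of the \<open>\<sigma> (f / \<pi>)\<close>, where \<open>\<pi>\<close> is the product of
  the positive roots of \<open>K\<close> that are not roots of \<open>J\<close> (\<open>trace_as_group_sum\<close>). By linear independence of automorphisms,
  dual bases satisfy \<open>\<Sum>b. u b * b\<^sup>\<or> = \<pi>\<close> for \<open>u\<close> in \<open>W\<^sub>J\<close>, and \<open>= 0\<close> for the other \<open>u\<close> in \<open>W\<^sub>K\<close> (\<open>dual_bases_orthogonal\<close>). Every
  sum over a basis therefore collapses, whichever basis it is.

  For \<open>u\<close>, the nested traces unfold into a sum over paths \<open>P\<close>, with a weight that is a product of reciprocals of
  roots. The sum over \<open>c\<close> retains the \<open>P\<close> that flip the same coordinates as \<open>Q\<close> does, and contributes the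
  product of all \<open>z\<^sub>i + z\<^sub>j\<close> at the flipped point \<open>z\<close> (\<open>u_kernel\<close>).
  For \<open>v\<close>, the map \<open>T\<close> selects in each factor a coordinate \<open>k\<close> to play the role of \<open>x\<^sub>l\<close>; orthogonality forces the
  same \<open>k\<close> in all factors (\<open>T_formula\<close>), and the remaining \<open>l - 1\<close> coordinates undergo the computation made for \<open>u\<close>.
  The matrix of \<open>v\<close> is that of \<open>u\<close> multiplied by
  \<open>\<Sum>k. N\<^sub>P x\<^sub>k * N\<^sub>Q x\<^sub>k / ((\<Prod>r\<noteq>k. x\<^sub>k - x\<^sub>r) * (\<Prod>r\<noteq>k. x\<^sub>k + z\<^sub>r))\<close>, where \<open>N\<^sub>P\<close> is the monic polynomial whose
  roots are the signed coordinates met along \<open>P\<close>, a polynomial of degree \<open>n\<close>. If \<open>P\<close> and \<open>Q\<close> both flip the set \<open>S\<close>, then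
  \<open>N\<^sub>P t\<close> is \<open>\<Prod>i\<in>S. t - x\<^sub>i\<close> times a monic polynomial in \<open>t\<^sup>2\<close>. After cancellation, the sum is the leading coefficient,
  written by Lagrange interpolation at the nodes \<open>x\<^sub>k\<^sup>2\<close> with \<open>k\<close> outside \<open>S\<close>, of a monic polynomial of degree \<open>n - card S\<close>.
  There are \<open>l - card S\<close> nodes, so for \<open>n = l - 1\<close> the degree is one less than the number of nodes and the sum is \<open>1\<close>
  (\<open>lagrange_paths\<close>). Hence \<open>v = u\<close>.

  The map \<open>u\<close> commutes with the left action because traces are linear over the invariants, and with the right action
  because its matrix couples only paths that flip the same coordinates, along which a right multiplication has
  the same value. For \<open>l = 2\<close>, where \<open>v\<close> is the identity by definition, the matrix of \<open>u\<close> is the unit matrix.\<close>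

section \<open>Substitution homomorphisms\<close>

definition cst :: "'k::field \<Rightarrow> 'k mpol" where "cst c = Poly_Mapping.single 0 c"

lemma cst_add: "cst (a + b) = cst a + cst b" by (simp add: cst_def single_add)
lemma cst_mult: "cst (a * b) = cst a * cst b" by (simp add: cst_def mult_single)
lemma cst_0 [simp]: "cst 0 = 0" by (simp add: cst_def)
lemma cst_1 [simp]: "cst 1 = 1" by (simp add: cst_def single_one)

text \<open>The value of the monomial with exponents \<open>m\<close> at the point \<open>\<sigma>\<close>.\<close>

definition monom_val :: "(nat \<Rightarrow> 'k::field mpol) \<Rightarrow> (nat \<Rightarrow>\<^sub>0 nat) \<Rightarrow> 'k mpol" where
  "monom_val \<sigma> m = (\<Prod>i \<in> Poly_Mapping.keys m. \<sigma> i ^ Poly_Mapping.lookup m i)"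

lemma monom_val_superset: "finite A \<Longrightarrow> Poly_Mapping.keys m \<subseteq> A \<Longrightarrow> monom_val \<sigma> m = (\<Prod>i\<in>A. \<sigma> i ^ Poly_Mapping.lookup m i)"
  unfolding monom_val_def by (rule prod.mono_neutral_left) (auto simp: in_keys_iff)

lemma monom_val_add: "monom_val \<sigma> (m + m') = monom_val \<sigma> m * monom_val \<sigma> m'"
proof -
  let ?A = "Poly_Mapping.keys m \<union> Poly_Mapping.keys m'"
  have "Poly_Mapping.keys (m + m') \<subseteq> ?A" by (rule keys_add)
  then show ?thesis
    by (simp add: monom_val_superset[of ?A] lookup_add power_add prod.distrib)
qed

lemma monom_val_0 [simp]: "monom_val \<sigma> 0 = 1" by (simp add: monom_val_def)

lemma subst_alt: "subst \<sigma> f = (\<Sum>m \<in> Poly_Mapping.keys f. cst (Poly_Mapping.lookup f m) * monom_val \<sigma> m)"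
  by (simp add: subst_def cst_def monom_val_def)

lemma subst_superset: "finite A \<Longrightarrow> Poly_Mapping.keys f \<subseteq> A \<Longrightarrow>
   subst \<sigma> f = (\<Sum>m\<in>A. cst (Poly_Mapping.lookup f m) * monom_val \<sigma> m)"
  unfolding subst_alt by (rule sum.mono_neutral_left) (auto simp: in_keys_iff)

lemma subst_add: "subst \<sigma> (f + g) = subst \<sigma> f + subst \<sigma> g"
proof -
  let ?A = "Poly_Mapping.keys f \<union> Poly_Mapping.keys g"
  have "Poly_Mapping.keys (f + g) \<subseteq> ?A" by (rule keys_add)
  then show ?thesis
    by (simp add: subst_superset[of ?A] lookup_add sum.distrib cst_add distrib_right)
qed

lemma subst_0 [simp]: "subst \<sigma> 0 = 0" by (simp add: subst_alt)
lemma subst_single: "subst \<sigma> (Poly_Mapping.single m c) = cst c * monom_val \<sigma> m"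
  by (cases "c = 0") (simp_all add: subst_alt)

lemma poly_mapping_sum_single: "f = (\<Sum>m\<in>Poly_Mapping.keys f. Poly_Mapping.single m (Poly_Mapping.lookup f m))"
  by (rule poly_mapping_eqI) (auto simp: lookup_sum lookup_single when_def in_keys_iff)

lemma mpol_single_induct [case_names zero add]:
  assumes "P 0" "\<And>f m c. P f \<Longrightarrow> P (f + Poly_Mapping.single m c)"
  shows "P (f :: 'k::field mpol)"
proof -
  have "P (\<Sum>m\<in>A. Poly_Mapping.single m (Poly_Mapping.lookup f m))" if "finite A" for A
    using that by (induction A) (auto simp: assms add.commute[of "Poly_Mapping.single _ _"])
  from this[of "Poly_Mapping.keys f"] show ?thesis using poly_mapping_sum_single[of f] by simp
qed

lemma subst_mult: "subst \<sigma> (f * g) = subst \<sigma> f * subst \<sigma> g"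
proof (induction f rule: mpol_single_induct)
  case zero then show ?case by simp
next
  case (add f m c)
  have "subst \<sigma> (Poly_Mapping.single m c * g) = subst \<sigma> (Poly_Mapping.single m c) * subst \<sigma> g"
    by (induction g rule: mpol_single_induct)
      (simp_all add: distrib_left subst_add subst_single mult_single monom_val_add cst_mult algebra_simps)
  then show ?case using add by (simp add: distrib_right subst_add)
qed

lemma subst_cst [simp]: "subst \<sigma> (cst c) = cst c" unfolding cst_def subst_single by (simp add: cst_def)
lemma subst_1 [simp]: "subst \<sigma> 1 = 1" using subst_cst[of \<sigma> 1] by simp
lemma subst_X [simp]: "subst \<sigma> (X i) = \<sigma> i"
  by (simp add: X_def subst_single monom_val_def)
lemma subst_uminus: "subst \<sigma> (- f) = - subst \<sigma> f"
  using subst_add[of \<sigma> f "-f"] by (simp add: eq_neg_iff_add_eq_0 add.commute)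
lemma subst_diff: "subst \<sigma> (f - g) = subst \<sigma> f - subst \<sigma> g"
  using subst_add[of \<sigma> f "-g"] by (simp add: subst_uminus)
lemma subst_prod: "subst \<sigma> (prod f A) = (\<Prod>a\<in>A. subst \<sigma> (f a))"
  by (induction A rule: infinite_finite_induct) (auto simp: subst_mult)
lemma subst_sum: "subst \<sigma> (sum f A) = (\<Sum>a\<in>A. subst \<sigma> (f a))"
  by (induction A rule: infinite_finite_induct) (auto simp: subst_add)
lemma subst_power: "subst \<sigma> (f ^ n) = subst \<sigma> f ^ n"
  by (induction n) (auto simp: subst_mult)

lemma single_eq_monom_val:
  fixes c :: "'k::field" shows "Poly_Mapping.single m c = cst c * monom_val X m"
proof -
  have pw: "X i ^ n = Poly_Mapping.single (Poly_Mapping.single i n) (1::'k)" for i n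
    by (induction n) (auto simp: X_def mult_single single_add[symmetric] single_one)
  have "(\<Prod>i\<in>A. X i ^ Poly_Mapping.lookup m i) = Poly_Mapping.single (\<Sum>i\<in>A. Poly_Mapping.single i (Poly_Mapping.lookup m i)) (1::'k)" if "finite A" for A
    using that by (induction A) (auto simp: pw mult_single single_one)
  from this[of "Poly_Mapping.keys m"] have "monom_val X m = Poly_Mapping.single m (1::'k)"
    unfolding monom_val_def using poly_mapping_sum_single[of m] by simp
  then show ?thesis by (simp add: cst_def mult_single)
qed

lemma cst_in_Rl: "cst c \<in> Rl l" by (auto simp: Rl_def cst_def split: if_splits)
lemma X_in_Rl: "1 \<le> i \<Longrightarrow> i \<le> l \<Longrightarrow> X i \<in> Rl l" by (auto simp: Rl_def X_def)
lemma Rl_0 [simp]: "0 \<in> Rl l" by (simp add: Rl_def)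
lemma Rl_1 [simp]: "1 \<in> Rl l" using cst_in_Rl[of 1] by simp
lemma Rl_add: "f \<in> Rl l \<Longrightarrow> g \<in> Rl l \<Longrightarrow> f + g \<in> Rl l"
  using keys_add[of f g] by (fastforce simp: Rl_def)
lemma Rl_uminus: "f \<in> Rl l \<Longrightarrow> - f \<in> Rl l"
  by (simp add: Rl_def in_keys_iff)
lemma Rl_diff: "f \<in> Rl l \<Longrightarrow> g \<in> Rl l \<Longrightarrow> f - g \<in> Rl l"
  using Rl_add[of f l "- g"] Rl_uminus[of g] by simp
lemma Rl_mult: assumes "f \<in> Rl l" "g \<in> Rl l" shows "f * g \<in> Rl l"
proof -
  have "Poly_Mapping.keys m \<subseteq> {1..l}" if "m \<in> Poly_Mapping.keys (f * g)" for m
  proof -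
    from that keys_mult[of f g] obtain a b where ab: "a \<in> Poly_Mapping.keys f" "b \<in> Poly_Mapping.keys g" "m = a + b" by blast
    then show ?thesis using assms keys_add[of a b] by (fastforce simp: Rl_def)
  qed
  then show ?thesis by (simp add: Rl_def)
qed
lemma Rl_sum: "(\<And>a. a \<in> A \<Longrightarrow> f a \<in> Rl l) \<Longrightarrow> sum f A \<in> Rl l"
  by (induction A rule: infinite_finite_induct) (auto intro: Rl_add)
lemma Rl_induct [consumes 1, case_names cst var add mult]:
  assumes "f \<in> Rl l" "\<And>c. P (cst c)" "\<And>i. 1 \<le> i \<Longrightarrow> i \<le> l \<Longrightarrow> P (X i)"
    "\<And>f g. P f \<Longrightarrow> P g \<Longrightarrow> P (f + g)" "\<And>f g. P f \<Longrightarrow> P g \<Longrightarrow> P (f * g)"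
  shows "P (f :: 'k::field mpol)"
proof -
  have P1: "P 1" "P 0" using assms(2)[of 1] assms(2)[of 0] by auto
  have pp: "P (x ^ n)" if "P x" for x n using that by (induction n) (auto simp: P1 assms)
  have pr: "P (\<Prod>i\<in>A. X i ^ h i)" if "finite A" "A \<subseteq> {1..l}" for A h
    using that by (induction A) (auto simp: P1 assms pp)
  have sg: "P (Poly_Mapping.single m (Poly_Mapping.lookup f m))" if "m \<in> Poly_Mapping.keys f" for m
  proof -
    have "Poly_Mapping.keys m \<subseteq> {1..l}" using that assms(1) by (auto simp: Rl_def)
    then show ?thesis unfolding single_eq_monom_val monom_val_def by (intro assms pr) auto
  qed
  have "P (\<Sum>m\<in>A. Poly_Mapping.single m (Poly_Mapping.lookup f m))" if "finite A" "A \<subseteq> Poly_Mapping.keys f" for A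
    using that by (induction A) (auto simp: P1 sg assms)
  from this[of "Poly_Mapping.keys f"] show ?thesis using poly_mapping_sum_single[of f] by simp
qed

lemma mpol_induct [case_names cst var add mult]:
  assumes "\<And>c. P (cst c)" "\<And>i. P (X i)"
    "\<And>f g. P f \<Longrightarrow> P g \<Longrightarrow> P (f + g)" "\<And>f g. P f \<Longrightarrow> P g \<Longrightarrow> P (f * g)"
  shows "P (f :: 'k::field mpol)"
proof -
  have P1: "P 1" "P 0" using assms(1)[of 1] assms(1)[of 0] by auto
  have pp: "P (x ^ n)" if "P x" for x n using that by (induction n) (auto simp: P1 assms)
  have pr: "P (\<Prod>i\<in>A. X i ^ h i)" if "finite A" for A h
    using that by (induction A) (auto simp: P1 assms pp)
  show ?thesis
    by (induction f rule: mpol_single_induct) (auto simp: P1 single_eq_monom_val monom_val_def intro!: assms pr)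
qed

lemma subst_comp: "subst \<sigma> (subst \<tau> f) = subst (\<lambda>i. subst \<sigma> (\<tau> i)) f"
  by (induction f rule: mpol_induct) (auto simp: subst_add subst_mult)

lemma subst_id: "subst X f = f"
  by (induction f rule: mpol_induct) (auto simp: subst_add subst_mult)

section \<open>Signed permutations and their action\<close>

text \<open>Signed variables \<open>x\<^sub>-\<^sub>a = - x\<^sub>a\<close>: a signed permutation then acts on variables through their indices, and \<open>s\<^sub>-\<^sub>1\<close> becomes
  an exchange of two indices, like the other generators.\<close>

definition Xs :: "int \<Rightarrow> 'k::field mpol" where
  "Xs k = (if k \<ge> 0 then X (nat k) else - X (nat (- k)))"

lemma Xs_uminus: "a \<noteq> 0 \<Longrightarrow> Xs (- a) = - Xs a" by (auto simp: Xs_def)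

definition sperm :: "nat \<Rightarrow> (int \<Rightarrow> int) set" where
  "sperm l = {\<sigma>. bij \<sigma> \<and> (\<forall>a. \<sigma> (- a) = - \<sigma> a) \<and> (\<forall>a. int l < \<bar>a\<bar> \<longrightarrow> \<sigma> a = a)}"

definition act :: "(int \<Rightarrow> int) \<Rightarrow> 'k::field mpol \<Rightarrow> 'k mpol" where
  "act \<sigma> = subst (\<lambda>i. Xs (\<sigma> (int i)))"

lemma sperm_odd: "\<sigma> \<in> sperm l \<Longrightarrow> \<sigma> (- a) = - \<sigma> a" by (simp add: sperm_def)
lemma sperm_0: "\<sigma> \<in> sperm l \<Longrightarrow> \<sigma> 0 = 0" using sperm_odd[of \<sigma> l 0] by simp
lemma sperm_bij: "\<sigma> \<in> sperm l \<Longrightarrow> bij \<sigma>" by (simp add: sperm_def)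
lemma sperm_inj: "\<sigma> \<in> sperm l \<Longrightarrow> \<sigma> a = \<sigma> b \<longleftrightarrow> a = b"
  using sperm_bij bij_is_inj inj_eq by metis
lemma sperm_eq0: "\<sigma> \<in> sperm l \<Longrightarrow> \<sigma> a = 0 \<longleftrightarrow> a = 0"
  using sperm_inj[of \<sigma> l a 0] sperm_0 by metis
lemma sperm_out: "\<sigma> \<in> sperm l \<Longrightarrow> int l < \<bar>a\<bar> \<Longrightarrow> \<sigma> a = a" by (simp add: sperm_def)
lemma sperm_in: "\<sigma> \<in> sperm l \<Longrightarrow> \<bar>\<sigma> a\<bar> \<le> int l \<longleftrightarrow> \<bar>a\<bar> \<le> int l"
proof -
  assume s: "\<sigma> \<in> sperm l"
  have "\<bar>a\<bar> \<le> int l" if "\<bar>\<sigma> a\<bar> \<le> int l" using that sperm_out[OF s, of a] by force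
  moreover have "\<bar>\<sigma> a\<bar> \<le> int l" if "\<bar>a\<bar> \<le> int l"
  proof (rule ccontr)
    assume "\<not> \<bar>\<sigma> a\<bar> \<le> int l"
    then have "\<sigma> (\<sigma> a) = \<sigma> a" using sperm_out[OF s] by simp
    then show False using sperm_inj[OF s] that \<open>\<not> _\<close> by simp
  qed
  ultimately show ?thesis by blast
qed
lemma id_sperm [simp]: "id \<in> sperm l" by (simp add: sperm_def)
lemma sperm_comp: "\<sigma> \<in> sperm l \<Longrightarrow> \<tau> \<in> sperm l \<Longrightarrow> \<sigma> \<circ> \<tau> \<in> sperm l"
  by (simp add: sperm_def bij_comp)
lemma sperm_inv: assumes "\<sigma> \<in> sperm l" shows "inv \<sigma> \<in> sperm l"
proof -
  have b: "bij \<sigma>" using assms by (rule sperm_bij)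
  have o: "inv \<sigma> (- a) = - inv \<sigma> a" for a
    by (metis assms b bij_inv_eq_iff sperm_odd)
  have "inv \<sigma> a = a" if "int l < \<bar>a\<bar>" for a
    using sperm_out[OF assms that] b by (metis bij_inv_eq_iff)
  then show ?thesis using b o by (simp add: sperm_def bij_imp_bij_inv)
qed
lemma sperm_inv_f: "\<sigma> \<in> sperm l \<Longrightarrow> inv \<sigma> (\<sigma> a) = a"
  by (simp add: sperm_bij bij_is_inj)
lemma sperm_f_inv: "\<sigma> \<in> sperm l \<Longrightarrow> \<sigma> (inv \<sigma> a) = a"
  by (simp add: sperm_bij bij_is_surj surj_f_inv_f)
lemma sperm_inv_o: "\<sigma> \<in> sperm l \<Longrightarrow> inv \<sigma> \<circ> \<sigma> = id"
  by (auto simp: sperm_inv_f)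
lemma sperm_o_inv: "\<sigma> \<in> sperm l \<Longrightarrow> \<sigma> \<circ> inv \<sigma> = id"
  by (auto simp: sperm_f_inv)
lemma sperm_inv_inv: "\<sigma> \<in> sperm l \<Longrightarrow> inv (inv \<sigma>) = \<sigma>"
  by (simp add: sperm_bij inv_inv_eq)
lemma sperm_inv_comp: "\<sigma> \<in> sperm l \<Longrightarrow> \<tau> \<in> sperm l \<Longrightarrow> inv (\<sigma> \<circ> \<tau>) = inv \<tau> \<circ> inv \<sigma>"
  by (simp add: sperm_bij o_inv_distrib)
lemma sperm_eqI: "\<sigma> \<in> sperm l \<Longrightarrow> \<tau> \<in> sperm l \<Longrightarrow> (\<And>a. 1 \<le> a \<Longrightarrow> a \<le> int l \<Longrightarrow> \<sigma> a = \<tau> a) \<Longrightarrow> \<sigma> = \<tau>"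
proof
  fix x assume a: "\<sigma> \<in> sperm l" "\<tau> \<in> sperm l" "\<And>a. 1 \<le> a \<Longrightarrow> a \<le> int l \<Longrightarrow> \<sigma> a = \<tau> a"
  consider "x = 0" | "1 \<le> x" "x \<le> int l" | "1 \<le> - x" "- x \<le> int l" | "int l < \<bar>x\<bar>" by linarith
  then show "\<sigma> x = \<tau> x"
  proof cases
    case 3 then show ?thesis using a(3)[of "-x"] sperm_odd[OF a(1), of x] sperm_odd[OF a(2), of x] by simp
  next
    case 1 then show ?thesis using sperm_0[OF a(1)] sperm_0[OF a(2)] by simp
  qed (use a in \<open>auto simp: sperm_out\<close>)
qed

lemma finite_sperm: "finite (sperm l)"
proof -
  let ?A = "{- int l..int l}"
  have "inj_on (\<lambda>\<sigma>. restrict \<sigma> ?A) (sperm l)"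
  proof (rule inj_onI)
    fix \<sigma> \<tau> assume a: "\<sigma> \<in> sperm l" "\<tau> \<in> sperm l" "restrict \<sigma> ?A = restrict \<tau> ?A"
    show "\<sigma> = \<tau>"
    proof (rule sperm_eqI[OF a(1,2)])
      fix x assume "1 \<le> x" "x \<le> int l"
      then show "\<sigma> x = \<tau> x" using fun_cong[OF a(3), of x] by simp
    qed
  qed
  moreover have "(\<lambda>\<sigma>. restrict \<sigma> ?A) ` sperm l \<subseteq> ?A \<rightarrow>\<^sub>E ?A"
  proof (clarsimp)
    fix \<sigma> x assume "\<sigma> \<in> sperm l" "- int l \<le> x" "x \<le> int l"
    then show "- int l \<le> \<sigma> x \<and> \<sigma> x \<le> int l" using sperm_in[of \<sigma> l x] by linarith
  qed
  ultimately show ?thesis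
    by (meson finite_PiE finite_atLeastAtMost_int finite_imageD finite_subset)
qed

lemma act_Xs: "\<sigma> \<in> sperm l \<Longrightarrow> act \<sigma> (Xs a) = Xs (\<sigma> a)"
proof (cases "a \<ge> 0")
  case False
  assume s: "\<sigma> \<in> sperm l"
  have "act \<sigma> (Xs a) = - Xs (\<sigma> (- a))" using False by (simp add: Xs_def act_def subst_uminus)
  also have "\<dots> = Xs (\<sigma> a)" using False s by (simp add: sperm_odd[OF s] sperm_eq0[OF s] Xs_uminus)
  finally show ?thesis .
qed (simp add: Xs_def act_def)

lemma act_X: "act \<sigma> (X i) = Xs (\<sigma> (int i))" by (simp add: act_def)

lemma act_add: "act \<sigma> (f + g) = act \<sigma> f + act \<sigma> g" by (simp add: act_def subst_add)
lemma act_mult: "act \<sigma> (f * g) = act \<sigma> f * act \<sigma> g" by (simp add: act_def subst_mult)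
lemma act_diff: "act \<sigma> (f - g) = act \<sigma> f - act \<sigma> g" by (simp add: act_def subst_diff)
lemma act_uminus: "act \<sigma> (- f) = - act \<sigma> f" by (simp add: act_def subst_uminus)
lemma act_sum: "act \<sigma> (sum f A) = (\<Sum>a\<in>A. act \<sigma> (f a))" by (simp add: act_def subst_sum)
lemma act_prod: "act \<sigma> (prod f A) = (\<Prod>a\<in>A. act \<sigma> (f a))" by (simp add: act_def subst_prod)
lemma act_power: "act \<sigma> (f ^ n) = act \<sigma> f ^ n" by (simp add: act_def subst_power)
lemma act_0 [simp]: "act \<sigma> 0 = 0" by (simp add: act_def)
lemma act_1 [simp]: "act \<sigma> 1 = 1" by (simp add: act_def)
lemma act_cst [simp]: "act \<sigma> (cst c) = cst c" by (simp add: act_def)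

lemma act_comp: "\<sigma> \<in> sperm l \<Longrightarrow> act \<sigma> (act \<tau> f) = act (\<sigma> \<circ> \<tau>) f"
proof -
  assume "\<sigma> \<in> sperm l"
  then have "subst (\<lambda>i. Xs (\<sigma> (int i))) (Xs (\<tau> (int i))) = (Xs (\<sigma> (\<tau> (int i))) :: 'a mpol)" for i
    using act_Xs[of \<sigma> l] by (simp add: act_def)
  then show ?thesis by (simp add: act_def subst_comp)
qed
lemma act_id [simp]: "act id f = f" "act (\<lambda>a. a) f = f"
  by (simp_all add: act_def Xs_def subst_id)
lemma act_inv: "\<sigma> \<in> sperm l \<Longrightarrow> act (inv \<sigma>) (act \<sigma> f) = f" "\<sigma> \<in> sperm l \<Longrightarrow> act \<sigma> (act (inv \<sigma>) f) = f"
   apply (metis act_comp act_id sperm_inv sperm_inv_o)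
  by (metis act_comp act_id sperm_o_inv)
lemma act_inj: "\<sigma> \<in> sperm l \<Longrightarrow> act \<sigma> f = act \<sigma> g \<longleftrightarrow> f = g" by (metis act_inv(1))
lemma act_Rl: assumes "\<sigma> \<in> sperm l" "f \<in> Rl l" shows "act \<sigma> f \<in> Rl l"
  using assms(2)
proof (induction f rule: Rl_induct)
  case (var i)
  have "\<bar>\<sigma> (int i)\<bar> \<le> int l" "\<sigma> (int i) \<noteq> 0"
    using var sperm_in[OF assms(1), of "int i"] sperm_eq0[OF assms(1), of "int i"] by auto
  then show ?case by (auto simp: act_X Xs_def intro!: X_in_Rl Rl_uminus)
qed (auto simp: act_add act_mult cst_in_Rl intro: Rl_add Rl_mult)
text \<open>The signed permutation that exchanges \<open>a\<close> and \<open>b\<close>, and hence also \<open>- a\<close> and \<open>- b\<close>.\<close>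

definition sp :: "int \<Rightarrow> int \<Rightarrow> int \<Rightarrow> int" where
  "sp a b x = (if x = a then b else if x = b then a else if x = - a then - b else if x = - b then - a else x)"
definition fl :: "int \<Rightarrow> int \<Rightarrow> int" where
  "fl a x = (if \<bar>x\<bar> = \<bar>a\<bar> then - x else x)"
text \<open>With signed indices the generator \<open>s\<^sub>i\<close> exchanges \<open>i\<close> and \<open>\<bar>i\<bar> + 1\<close> for every \<open>i\<close>, including \<open>i = - 1\<close>.\<close>

abbreviation sr :: "int \<Rightarrow> int \<Rightarrow> int" where "sr i \<equiv> sp i (\<bar>i\<bar> + 1)"

lemma sp_invol: "a \<noteq> 0 \<Longrightarrow> b \<noteq> 0 \<Longrightarrow> a \<noteq> - b \<Longrightarrow> sp a b (sp a b x) = x" by (auto simp: sp_def)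
lemma sp_self: "sp a a = id" by (auto simp: sp_def)
lemma fl_invol: "fl a (fl a x) = x" by (auto simp: fl_def)
lemma sp_sperm: "a \<noteq> 0 \<Longrightarrow> b \<noteq> 0 \<Longrightarrow> a \<noteq> - b \<Longrightarrow> \<bar>a\<bar> \<le> int l \<Longrightarrow> \<bar>b\<bar> \<le> int l \<Longrightarrow> sp a b \<in> sperm l"
  unfolding sperm_def by (auto intro!: o_bij[of "sp a b"] simp: sp_invol) (auto simp: sp_def)
lemma fl_sperm: "\<bar>a\<bar> \<le> int l \<Longrightarrow> fl a \<in> sperm l"
  unfolding sperm_def by (auto intro!: o_bij[of "fl a"] simp: fl_invol) (auto simp: fl_def)
lemma inv_sp: "a \<noteq> 0 \<Longrightarrow> b \<noteq> 0 \<Longrightarrow> a \<noteq> - b \<Longrightarrow> inv (sp a b) = sp a b"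
  by (rule inv_equality) (auto simp: sp_invol)
lemma inv_fl: "inv (fl a) = fl a"
  by (rule inv_equality) (auto simp: fl_invol)

text \<open>In this convention a root \<open>rt a b\<close> with \<open>a < b\<close> is positive.\<close>

definition rt :: "int \<Rightarrow> int \<Rightarrow> 'k::field mpol" where "rt a b = Xs b - Xs a"

lemma act_rt: "\<sigma> \<in> sperm l \<Longrightarrow> act \<sigma> (rt a b) = rt (\<sigma> a) (\<sigma> b)"
  by (simp add: rt_def act_diff act_Xs)
lemma rt_neg: "a \<noteq> 0 \<Longrightarrow> b \<noteq> 0 \<Longrightarrow> rt (- b) (- a) = rt a b" by (simp add: rt_def Xs_uminus)
lemma rt_swap: "rt b a = - rt a b" by (simp add: rt_def)

text \<open>The type argument fixes the coefficient field also in facts that mention no polynomial.\<close>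

locale typeD =
  fixes l :: nat and ty :: "'k::field itself"
  assumes l2: "l \<ge> 2" and two: "(2::'k) \<noteq> 0"
begin

lemma one_neq: "(1::'k) \<noteq> - 1" "(- 1::'k) \<noteq> 1"
proof -
  show "(1::'k) \<noteq> - 1" using two by (metis eq_neg_iff_add_eq_0 one_add_one)
  then show "(- 1::'k) \<noteq> 1" by metis
qed

text \<open>Linear coefficients tell signed variables and roots apart, since \<open>1\<close> and \<open>- 1\<close> differ.\<close>

definition lin_coeff :: "nat \<Rightarrow> 'k mpol \<Rightarrow> 'k" where "lin_coeff i f = Poly_Mapping.lookup f (Poly_Mapping.single i 1)"
lemma lin_coeff_diff: "lin_coeff i (f - g) = lin_coeff i f - lin_coeff i g" by (simp add: lin_coeff_def lookup_minus)
lemma lin_coeff_Xs: "a \<noteq> 0 \<Longrightarrow> lin_coeff i (Xs a) = (if a = int i then 1 else if a = - int i then - 1 else 0)"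
proof -
  have "lin_coeff i (X j) = (if i = j then 1 else 0)" for j
  proof -
    have "Poly_Mapping.single j (1::nat) = Poly_Mapping.single i 1 \<longleftrightarrow> i = j"
      by (metis keys_single one_neq_zero singleton_inject)
    then show ?thesis by (simp add: lin_coeff_def X_def lookup_single when_def)
  qed
  moreover have "lin_coeff i (- f) = - lin_coeff i f" for f by (simp add: lin_coeff_def)
  ultimately show "a \<noteq> 0 \<Longrightarrow> ?thesis" by (auto simp: Xs_def)
qed

lemma Xs_inj: "a \<noteq> 0 \<Longrightarrow> b \<noteq> 0 \<Longrightarrow> (Xs a :: 'k mpol) = Xs b \<longleftrightarrow> a = b"
proof
  assume ab: "a \<noteq> 0" "b \<noteq> 0" "(Xs a :: 'k mpol) = Xs b"
  obtain i where i: "\<bar>a\<bar> = int i" using zero_le_imp_eq_int[of "\<bar>a\<bar>"] by auto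
  have "lin_coeff i (Xs a) = lin_coeff i (Xs b)" using ab by simp
  then have "(if a = \<bar>a\<bar> then 1 else if a = - \<bar>a\<bar> then - 1 else 0) = (if b = \<bar>a\<bar> then 1 else if b = - \<bar>a\<bar> then - 1 else (0::'k))"
    unfolding lin_coeff_Xs[OF ab(1)] lin_coeff_Xs[OF ab(2)] i .
  then show "a = b" using ab(1) two by (cases "a > 0") (auto split: if_splits)
qed auto

text \<open>A root determines its pair of indices up to the symmetry \<open>(a, b) \<mapsto> (- b, - a)\<close>. The linear coefficients \<open>1\<close> and \<open>- 1\<close> differ, so each
  \<open>y \<noteq> 0\<close> can be tested for being one of \<open>b\<close> and \<open>- a\<close>.\<close>

lemma rt_eq_iff:
  assumes "a \<noteq> 0" "b \<noteq> 0" "\<bar>a\<bar> \<noteq> \<bar>b\<bar>" "c \<noteq> 0" "d \<noteq> 0" "\<bar>c\<bar> \<noteq> \<bar>d\<bar>"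
  shows "(rt a b :: 'k mpol) = rt c d \<longleftrightarrow> (a = c \<and> b = d) \<or> (a = - d \<and> b = - c)"
proof
  assume e: "(rt a b :: 'k mpol) = rt c d"
  have lin_coeff_rt: "lin_coeff (nat y) (rt a' b') = (if b' = y \<or> a' = - y then 1 else if b' = - y \<or> a' = y then - 1 else 0)"
    if "a' \<noteq> 0" "b' \<noteq> 0" "\<bar>a'\<bar> \<noteq> \<bar>b'\<bar>" "0 < y" for a' b' y
    using that unfolding rt_def lin_coeff_diff by (simp add: lin_coeff_Xs) auto
  have P: "(b = y \<or> a = - y) \<longleftrightarrow> (d = y \<or> c = - y)" "(b = - y \<or> a = y) \<longleftrightarrow> (d = - y \<or> c = y)" if "0 < y" for y
  proof -
    have nc: "\<not> ((b' = y \<or> a' = - y) \<and> (b' = - y \<or> a' = y))" if "a' \<noteq> 0" "b' \<noteq> 0" "\<bar>a'\<bar> \<noteq> \<bar>b'\<bar>" "0 < y" for a' b' y :: int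
      using that by auto
    have B: "(A \<longleftrightarrow> A') \<and> (\<not> A \<longrightarrow> (B \<longleftrightarrow> B'))" if "(if A then 1 else if B then - 1 else (0::'k)) = (if A' then 1 else if B' then - 1 else 0)" for A B A' B'
      using that one_neq by (cases A; cases B; cases A'; cases B') auto
    have "(if b = y \<or> a = - y then 1 else if b = - y \<or> a = y then - 1 else (0::'k)) = (if d = y \<or> c = - y then 1 else if d = - y \<or> c = y then - 1 else 0)"
      using arg_cong[OF e, of "lin_coeff (nat y)"] unfolding lin_coeff_rt[OF assms(1,2,3) that] lin_coeff_rt[OF assms(4,5,6) that] .
    from B[OF this] show "(b = y \<or> a = - y) \<longleftrightarrow> (d = y \<or> c = - y)" "(b = - y \<or> a = y) \<longleftrightarrow> (d = - y \<or> c = y)"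
      using nc[OF assms(1-3) that] nc[OF assms(4-6) that] by blast+
  qed
  have Q: "(b = y \<or> a = - y) \<longleftrightarrow> (d = y \<or> c = - y)" if "y \<noteq> 0" for y
    using P[of y] P[of "- y"] that by (cases "0 < y") auto
  show "(a = c \<and> b = d) \<or> (a = - d \<and> b = - c)"
  proof -
    have "d = b \<or> c = - b" "d = - a \<or> c = a" using Q[of b] Q[of "- a"] assms(1,2) by simp_all
    then show ?thesis using assms(3) by auto
  qed
qed (use assms rt_neg in auto)

lemma rt_nz: "a \<noteq> 0 \<Longrightarrow> b \<noteq> 0 \<Longrightarrow> a \<noteq> b \<Longrightarrow> (rt a b :: 'k mpol) \<noteq> 0"
  using Xs_inj[of a b] by (simp add: rt_def)

lemma act_faithful: assumes "\<sigma> \<in> sperm l" "\<tau> \<in> sperm l" "\<And>f :: 'k mpol. f \<in> Rl l \<Longrightarrow> act \<sigma> f = act \<tau> f"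
  shows "\<sigma> = \<tau>"
proof (rule sperm_eqI[OF assms(1,2)])
  fix a assume a: "1 \<le> a" "a \<le> int l"
  have "(X (nat a) :: 'k mpol) \<in> Rl l" using a by (intro X_in_Rl) auto
  from assms(3)[OF this] have "(Xs (\<sigma> a) :: 'k mpol) = Xs (\<tau> a)" using a by (simp add: act_X)
  then show "\<sigma> a = \<tau> a" using Xs_inj a assms(1,2) by (simp add: sperm_eq0)
qed

end

section \<open>Words and parabolic subgroups\<close>

lemma N_iff: "i \<in> N l \<longleftrightarrow> i = - 1 \<or> (1 \<le> i \<and> i < int l)" by (auto simp: N_def)

context typeD begin

lemma sr_sperm: "i \<in> N l \<Longrightarrow> sr i \<in> sperm l" using l2 by (intro sp_sperm) (auto simp: N_iff)
lemma sr_invol: "i \<in> N l \<Longrightarrow> sr i (sr i x) = x" by (intro sp_invol) (auto simp: N_iff)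
lemma sr_invol': "i \<in> N l \<Longrightarrow> sr i \<circ> sr i = id" by (simp add: fun_eq_iff sr_invol)
lemma inv_sr: "i \<in> N l \<Longrightarrow> inv (sr i) = sr i" by (intro inv_sp) (auto simp: N_iff)

lemma refl_act: "i \<in> N l \<Longrightarrow> refl i = (act (sr i) :: 'k mpol \<Rightarrow> 'k mpol)"
  unfolding refl_def act_def
proof (rule arg_cong[of _ _ subst], rule ext)
  fix j assume i: "i \<in> N l"
  show "(if i = - 1 then X(1 := - X 2, 2 := - X 1) else X(nat i := X (nat i + 1), nat i + 1 := X (nat i))) j
      = (Xs (sr i (int j)) :: 'k mpol)"
  proof (cases "i = - 1")
    case True then show ?thesis by (auto simp: Xs_def sp_def)
  next
    case False
    then obtain m where m: "i = int m" "m \<ge> 1" using i by (auto simp: N_iff intro: that[of "nat i"])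
    then show ?thesis by (auto simp: Xs_def sp_def nat_add_distrib)
  qed
qed

lemma alpha_rt: "i \<in> N l \<Longrightarrow> alpha i = (rt i (\<bar>i\<bar> + 1) :: 'k mpol)"
  by (auto simp: alpha_def rt_def Xs_def N_iff nat_add_distrib) (simp add: numeral_2_eq_2)?

definition word_perm :: "int list \<Rightarrow> int \<Rightarrow> int" where "word_perm w = foldr (\<lambda>i \<sigma>. sr i \<circ> \<sigma>) w id"
lemma word_perm_Nil [simp]: "word_perm [] = id" by (simp add: word_perm_def)
lemma word_perm_Cons: "word_perm (i # w) = sr i \<circ> word_perm w" by (simp add: word_perm_def)
lemma word_perm_append: "word_perm (v @ w) = word_perm v \<circ> word_perm w" by (induction v) (auto simp: fun_eq_iff word_perm_Cons)
lemma word_perm_sperm: "set w \<subseteq> N l \<Longrightarrow> word_perm w \<in> sperm l" by (induction w) (auto simp: word_perm_Cons intro!: sperm_comp sr_sperm)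
lemma word_perm_rev: "set w \<subseteq> N l \<Longrightarrow> word_perm (rev w) = inv (word_perm w)"
  by (induction w) (auto simp: word_perm_append word_perm_Cons sperm_inv_comp[OF sr_sperm word_perm_sperm] inv_sr)
lemma word_elt_act: "set w \<subseteq> N l \<Longrightarrow> word_elt w = (act (word_perm w) :: 'k mpol \<Rightarrow> 'k mpol)"
proof (induction w)
  case Nil then show ?case by (simp add: word_elt_def fun_eq_iff)
next
  case (Cons i w)
  then have "word_elt (i # w) f = refl i (act (word_perm w) f)" for f :: "'k mpol" by (simp add: word_elt_def)
  then show ?case using Cons.prems unfolding word_perm_Cons by (auto simp: fun_eq_iff refl_act act_comp[OF sr_sperm] simp del: comp_apply)
qed

definition G :: "int set \<Rightarrow> (int \<Rightarrow> int) set" where "G K = {word_perm w | w. set w \<subseteq> K}"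

lemma G_id [simp]: "id \<in> G K" unfolding G_def by (auto intro!: exI[of _ "[]"])
lemma G_comp: "\<sigma> \<in> G K \<Longrightarrow> \<tau> \<in> G K \<Longrightarrow> \<sigma> \<circ> \<tau> \<in> G K"
  unfolding G_def by clarsimp (metis le_sup_iff set_append word_perm_append)
lemma G_sr: "i \<in> K \<Longrightarrow> sr i \<in> G K" unfolding G_def by (auto simp: word_perm_Cons intro!: exI[of _ "[i]"])
lemma G_sperm: "K \<subseteq> N l \<Longrightarrow> G K \<subseteq> sperm l" unfolding G_def using word_perm_sperm by auto
lemma G_mono: "J \<subseteq> K \<Longrightarrow> G J \<subseteq> G K" unfolding G_def by auto
lemma G_inv: "K \<subseteq> N l \<Longrightarrow> \<sigma> \<in> G K \<Longrightarrow> inv \<sigma> \<in> G K"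
  unfolding G_def by clarsimp (metis set_rev word_perm_rev subset_trans)
lemma finite_G: "K \<subseteq> N l \<Longrightarrow> finite (G K)" by (rule finite_subset[OF G_sperm finite_sperm])
lemma G_induct [consumes 1, case_names id step]:
  assumes "\<sigma> \<in> G K" "P id" "\<And>i \<sigma>. i \<in> K \<Longrightarrow> \<sigma> \<in> G K \<Longrightarrow> P \<sigma> \<Longrightarrow> P (sr i \<circ> \<sigma>)"
  shows "P \<sigma>"
proof -
  have "set w \<subseteq> K \<Longrightarrow> P (word_perm w)" for w
    by (induction w) (auto intro!: assms(2,3) simp: G_def word_perm_Cons)
  then show ?thesis using assms(1) by (auto simp: G_def)
qed
lemma parab_G: "K \<subseteq> N l \<Longrightarrow> parab K = (act ` G K :: ('k mpol \<Rightarrow> 'k mpol) set)"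
  unfolding parab_def G_def using word_elt_act by (auto simp: image_iff) (metis subset_trans)+
lemma inv_ring_iff: "K \<subseteq> N l \<Longrightarrow> f \<in> inv_ring l K \<longleftrightarrow> (f :: 'k mpol) \<in> Rl l \<and> (\<forall>\<sigma>\<in>G K. act \<sigma> f = f)"
  by (auto simp: inv_ring_def parab_G)
lemma inv_ring_iff': "K \<subseteq> N l \<Longrightarrow> f \<in> inv_ring l K \<longleftrightarrow> (f :: 'k mpol) \<in> Rl l \<and> (\<forall>i\<in>K. act (sr i) f = f)"
proof -
  assume K: "K \<subseteq> N l"
  have "act \<sigma> f = f" if "\<sigma> \<in> G K" "\<forall>i\<in>K. act (sr i) f = f" for \<sigma>
    using that(1)
  proof (induction rule: G_induct)
    case (step i \<sigma>)
    then show ?case using that(2) K act_comp[OF sr_sperm, of i \<sigma> f] by (auto simp del: comp_apply)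
  qed auto
  then show ?thesis using inv_ring_iff[OF K] G_sr by blast
qed

section \<open>Length and inversions\<close>

text \<open>Pairs indexing the positive roots; each root has the two index pairs \<open>(a, b)\<close> and \<open>(- b, - a)\<close>.\<close>

definition RI :: "(int \<times> int) set" where
  "RI = {(a, b). a < b \<and> a \<noteq> - b \<and> a \<noteq> 0 \<and> b \<noteq> 0 \<and> \<bar>a\<bar> \<le> int l \<and> \<bar>b\<bar> \<le> int l}"
text \<open>The positive roots that \<open>\<sigma>\<close> inverse makes negative. They are taken as polynomials rather than as index pairs because
  the leading coefficient of a product of Demazure operators is, up to sign, the inverse of their product.\<close>

definition inv_roots :: "(int \<Rightarrow> int) \<Rightarrow> 'k mpol set" where
  "inv_roots \<sigma> = {rt a b | a b. (a, b) \<in> RI \<and> inv \<sigma> b < inv \<sigma> a}"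
definition ell :: "(int \<Rightarrow> int) \<Rightarrow> nat" where "ell \<sigma> = card (inv_roots \<sigma>)"

lemma finite_RI: "finite RI"
  by (rule finite_subset[of _ "{- int l..int l} \<times> {- int l..int l}"]) (auto simp: RI_def)
lemma finite_inv_roots: "finite (inv_roots \<sigma>)"
proof -
  have "inv_roots \<sigma> \<subseteq> (\<lambda>(a, b). rt a b) ` RI" by (auto simp: inv_roots_def)
  then show ?thesis using finite_RI finite_surj by blast
qed

lemma sr_less: "i \<in> N l \<Longrightarrow> (a, b) \<in> RI \<Longrightarrow> (a, b) \<noteq> (i, \<bar>i\<bar> + 1) \<Longrightarrow> (a, b) \<noteq> (- (\<bar>i\<bar> + 1), - i) \<Longrightarrow>
  (sr i a, sr i b) \<in> RI"
proof -
  assume i: "i \<in> N l" and ab: "(a, b) \<in> RI" and ne: "(a, b) \<noteq> (i, \<bar>i\<bar> + 1)" "(a, b) \<noteq> (- (\<bar>i\<bar> + 1), - i)"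
  define q where "q = \<bar>i\<bar> + 1"
  have iq: "i = - 1 \<and> q = 2 \<or> 1 \<le> i \<and> q = i + 1" using i by (auto simp: N_iff q_def)
  have s: "sr i \<in> sperm l" by (rule sr_sperm[OF i])
  have v: "sr i x = x \<and> x \<noteq> i \<and> x \<noteq> q \<and> x \<noteq> - i \<and> x \<noteq> - q \<or> x = i \<and> sr i x = q \<or> x = q \<and> sr i x = i
     \<or> x = - i \<and> sr i x = - q \<or> x = - q \<and> sr i x = - i" for x
    using iq unfolding q_def[symmetric] by (auto simp: sp_def)
  have ab': "a < b" "a \<noteq> - b" "a \<noteq> 0" "b \<noteq> 0" using ab by (auto simp: RI_def)
  have ne': "\<not> (a = i \<and> b = q)" "\<not> (a = - q \<and> b = - i)" using ne by (auto simp: q_def)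
  have "sr i a < sr i b"
    using v[of a] v[of b] iq ab' ne' by (elim disjE conjE; hypsubst?; presburger)
  moreover have "sr i a \<noteq> - sr i b" using ab'(2) sperm_odd[OF s, of b] sperm_inj[OF s, of a "- b"] by simp
  ultimately show ?thesis using ab sperm_in[OF s] sperm_eq0[OF s] by (simp add: RI_def)
qed
lemma simple_RI: "i \<in> N l \<Longrightarrow> (i, \<bar>i\<bar> + 1) \<in> RI" "i \<in> N l \<Longrightarrow> (- (\<bar>i\<bar> + 1), - i) \<in> RI"
  using l2 by (auto simp: RI_def N_iff)
lemma sr_simple: "sr i i = \<bar>i\<bar> + 1" "i \<noteq> 0 \<Longrightarrow> sr i (\<bar>i\<bar> + 1) = i" by (auto simp: sp_def)

text \<open>The simple reflection \<open>s\<^sub>i\<close> permutes the positive roots other than \<open>\<alpha>\<^sub>i\<close>.\<close>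

lemma inv_roots_step:
  assumes i: "i \<in> N l" and s: "\<sigma> \<in> sperm l" and lt: "inv \<sigma> i < inv \<sigma> (\<bar>i\<bar> + 1)"
  shows "inv_roots (sr i \<circ> \<sigma>) = insert (alpha i) (act (sr i) ` inv_roots \<sigma>)" "alpha i \<notin> act (sr i) ` inv_roots \<sigma>"
proof -
  let ?q = "\<bar>i\<bar> + 1"
  have inv': "inv (sr i \<circ> \<sigma>) x = inv \<sigma> (sr i x)" for x
    using sperm_inv_comp[OF sr_sperm[OF i] s] inv_sr[OF i] by simp
  have i0: "i \<noteq> 0" "?q \<noteq> 0" using i by (auto simp: N_iff)
  have odd: "inv \<sigma> (- x) = - inv \<sigma> x" for x using sperm_odd[OF sperm_inv[OF s]] .
  show "alpha i \<notin> act (sr i) ` inv_roots \<sigma>"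
  proof
    assume "alpha i \<in> act (sr i) ` inv_roots \<sigma>"
    then obtain a b where ab: "(a, b) \<in> RI" "rt i ?q = (act (sr i) (rt a b) :: 'k mpol)"
      by (auto simp: inv_roots_def alpha_rt[OF i])
    have "act (sr i) (rt i ?q) = (act (sr i) (act (sr i) (rt a b)) :: 'k mpol)" using ab(2) by (rule arg_cong)
    then have "rt ?q i = (rt a b :: 'k mpol)"
      by (simp add: act_rt[OF sr_sperm[OF i]] sr_simple i0 sr_invol[OF i])
    then have "(?q = a \<and> i = b) \<or> (?q = - b \<and> i = - a)"
      using ab(1) i0 by (subst (asm) rt_eq_iff) (auto simp: RI_def)
    then show False using ab(1) by (auto simp: RI_def)
  qed
  show "inv_roots (sr i \<circ> \<sigma>) = insert (alpha i) (act (sr i) ` inv_roots \<sigma>)"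
  proof (intro set_eqI iffI)
    fix x assume "x \<in> inv_roots (sr i \<circ> \<sigma>)"
    then obtain a b where ab: "x = rt a b" "(a, b) \<in> RI" "inv \<sigma> (sr i b) < inv \<sigma> (sr i a)"
      by (auto simp: inv_roots_def inv')
    show "x \<in> insert (alpha i) (act (sr i) ` inv_roots \<sigma>)"
    proof (cases "(a, b) = (i, ?q) \<or> (a, b) = (- ?q, - i)")
      case True then show ?thesis using ab(1) rt_neg[OF i0] by (auto simp: alpha_rt[OF i])
    next
      case False
      then have r: "(sr i a, sr i b) \<in> RI" using sr_less[OF i ab(2)] by auto
      then have "rt (sr i a) (sr i b) \<in> inv_roots \<sigma>" using ab(3) by (auto simp: inv_roots_def)
      moreover have "x = act (sr i) (rt (sr i a) (sr i b))" using ab(1)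
        by (simp add: act_rt[OF sr_sperm[OF i]] sr_invol[OF i])
      ultimately show ?thesis by blast
    qed
  next
    fix x assume "x \<in> insert (alpha i) (act (sr i) ` inv_roots \<sigma>)"
    then consider "x = rt i ?q" | a b where "x = rt (sr i a) (sr i b)" "(a, b) \<in> RI" "inv \<sigma> b < inv \<sigma> a"
      by (auto simp: alpha_rt[OF i] inv_roots_def act_rt[OF sr_sperm[OF i]])
    then show "x \<in> inv_roots (sr i \<circ> \<sigma>)"
    proof cases
      case 1 then show ?thesis using simple_RI(1)[OF i] lt i0
        unfolding inv_roots_def mem_Collect_eq inv' by (intro exI[of _ i] exI[of _ ?q]) (simp add: sr_simple)
    next
      case (2 a b)
      have "(a, b) \<noteq> (i, ?q)" "(a, b) \<noteq> (- ?q, - i)" using 2(3) lt odd[of i] odd[of ?q] by auto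
      then have "(sr i a, sr i b) \<in> RI" using sr_less[OF i 2(2)] by auto
      then show ?thesis using 2 unfolding inv_roots_def mem_Collect_eq inv'
        by (intro exI[of _ "sr i a"] exI[of _ "sr i b"]) (simp add: sr_invol[OF i])
    qed
  qed
qed

lemma ell_up: assumes "i \<in> N l" "\<sigma> \<in> sperm l" "inv \<sigma> i < inv \<sigma> (\<bar>i\<bar> + 1)" shows "ell (sr i \<circ> \<sigma>) = Suc (ell \<sigma>)"
proof -
  have "card (act (sr i) ` inv_roots \<sigma>) = card (inv_roots \<sigma>)"
    using act_inj[OF sr_sperm[OF assms(1)]] by (intro card_image) (auto simp: inj_on_def)
  then show ?thesis using inv_roots_step[OF assms] finite_inv_roots[of \<sigma>] by (simp add: ell_def)
qed

lemma ell_down: assumes "i \<in> N l" "\<sigma> \<in> sperm l" "inv \<sigma> (\<bar>i\<bar> + 1) < inv \<sigma> i" shows "ell \<sigma> = Suc (ell (sr i \<circ> \<sigma>))"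
proof -
  have i0: "i \<noteq> 0" using assms(1) by (auto simp: N_iff)
  have inv': "inv (sr i \<circ> \<sigma>) x = inv \<sigma> (sr i x)" for x
    using sperm_inv_comp[OF sr_sperm[OF assms(1)] assms(2)] inv_sr[OF assms(1)] by simp
  have "ell (sr i \<circ> (sr i \<circ> \<sigma>)) = Suc (ell (sr i \<circ> \<sigma>))"
    using assms i0 by (intro ell_up sperm_comp sr_sperm) (auto simp: inv' sr_simple)
  then show ?thesis using sr_invol'[OF assms(1)] by (simp flip: comp_assoc)
qed

lemma ell_cases: "i \<in> N l \<Longrightarrow> \<sigma> \<in> sperm l \<Longrightarrow> inv \<sigma> i < inv \<sigma> (\<bar>i\<bar> + 1) \<or> inv \<sigma> (\<bar>i\<bar> + 1) < inv \<sigma> i"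
  using sperm_inj[OF sperm_inv, of \<sigma> l i "\<bar>i\<bar> + 1"] by linarith

lemma ell_id [simp]: "ell id = 0"
proof -
  have "inv_roots id = {}" by (auto simp: inv_roots_def RI_def inv_id)
  then show ?thesis by (simp add: ell_def)
qed

lemma ell_le_length: "set w \<subseteq> N l \<Longrightarrow> ell (word_perm w) \<le> length w"
proof (induction w)
  case (Cons i w)
  then have "i \<in> N l" "word_perm w \<in> sperm l" using word_perm_sperm by auto
  from ell_cases[OF this] show ?case unfolding word_perm_Cons using Cons ell_up[of i "word_perm w"] ell_down[of i "word_perm w"] \<open>i \<in> N l\<close> \<open>word_perm w \<in> _\<close> by (auto simp del: comp_apply)
qed simp

end

section \<open>The action on rational functions\<close>

text \<open>The automorphism of the field of rational functions induced by \<open>act\<close>.\<close>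

definition actF :: "(int \<Rightarrow> int) \<Rightarrow> 'k::field mpol fract \<Rightarrow> 'k mpol fract" where
  "actF \<sigma> q = (SOME r. \<exists>a b. b \<noteq> 0 \<and> q = Fract a b \<and> r = Fract (act \<sigma> a) (act \<sigma> b))"

lemma act_eq0: "\<sigma> \<in> sperm l \<Longrightarrow> act \<sigma> f = 0 \<longleftrightarrow> f = 0" using act_inj[of \<sigma> l f 0] by simp

lemma actF_Fract:
  assumes "\<sigma> \<in> sperm l" "b \<noteq> 0" shows "actF \<sigma> (Fract a b) = Fract (act \<sigma> a) (act \<sigma> b)"
proof -
  have "\<exists>r a' b'. b' \<noteq> 0 \<and> Fract a b = Fract a' b' \<and> r = Fract (act \<sigma> a') (act \<sigma> b')" using assms(2) by blast
  from someI_ex[OF this] obtain a' b' where *: "b' \<noteq> 0" "Fract a b = Fract a' b'" "actF \<sigma> (Fract a b) = Fract (act \<sigma> a') (act \<sigma> b')"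
    unfolding actF_def by blast
  have "a * b' = a' * b" using * assms(2) by (simp add: eq_fract)
  then have "act \<sigma> a * act \<sigma> b' = act \<sigma> a' * act \<sigma> b" by (metis act_mult)
  then show ?thesis using * assms by (simp add: eq_fract act_eq0[OF assms(1)])
qed

lemma actF_to_fract: "\<sigma> \<in> sperm l \<Longrightarrow> actF \<sigma> (to_fract f) = to_fract (act \<sigma> f)"
  using actF_Fract[of \<sigma> l 1 f] by (simp add: to_fract_def)
lemma actF_add: "\<sigma> \<in> sperm l \<Longrightarrow> actF \<sigma> (p + q) = actF \<sigma> p + actF \<sigma> q"
  by (cases p rule: Fract_cases; cases q rule: Fract_cases) (simp add: actF_Fract act_add act_mult act_eq0)
lemma actF_mult: "\<sigma> \<in> sperm l \<Longrightarrow> actF \<sigma> (p * q) = actF \<sigma> p * actF \<sigma> q"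
  by (cases p rule: Fract_cases; cases q rule: Fract_cases) (simp add: actF_Fract act_mult)
lemma actF_0 [simp]: "\<sigma> \<in> sperm l \<Longrightarrow> actF \<sigma> 0 = 0" using actF_to_fract[of \<sigma> l 0] by simp
lemma actF_1 [simp]: "\<sigma> \<in> sperm l \<Longrightarrow> actF \<sigma> 1 = 1" using actF_to_fract[of \<sigma> l 1] by simp
lemma actF_uminus: "\<sigma> \<in> sperm l \<Longrightarrow> actF \<sigma> (- p) = - actF \<sigma> p"
  using actF_add[of \<sigma> l p "- p"] by (simp add: eq_neg_iff_add_eq_0 add.commute)
lemma actF_diff: "\<sigma> \<in> sperm l \<Longrightarrow> actF \<sigma> (p - q) = actF \<sigma> p - actF \<sigma> q"
  using actF_add[of \<sigma> l p "- q"] by (simp add: actF_uminus)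
lemma actF_sum: "\<sigma> \<in> sperm l \<Longrightarrow> actF \<sigma> (sum f A) = (\<Sum>a\<in>A. actF \<sigma> (f a))"
  by (induction A rule: infinite_finite_induct) (auto simp: actF_add)
lemma actF_comp: "\<sigma> \<in> sperm l \<Longrightarrow> \<tau> \<in> sperm l \<Longrightarrow> actF \<sigma> (actF \<tau> p) = actF (\<sigma> \<circ> \<tau>) p"
  by (cases p rule: Fract_cases) (simp add: actF_Fract[of _ l] actF_Fract[OF sperm_comp[of \<sigma> l \<tau>]] act_comp[of _ l] act_eq0[of _ l])
lemma actF_id [simp]: "actF id p = p"
  by (cases p rule: Fract_cases) (simp add: actF_Fract[of id 0])
lemma actF_inv: "\<sigma> \<in> sperm l \<Longrightarrow> actF (inv \<sigma>) (actF \<sigma> p) = p" "\<sigma> \<in> sperm l \<Longrightarrow> actF \<sigma> (actF (inv \<sigma>) p) = p"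
  by (simp_all add: actF_comp[of _ l] sperm_inv sperm_inv_o sperm_o_inv del: comp_apply)
lemma actF_inj: "\<sigma> \<in> sperm l \<Longrightarrow> actF \<sigma> p = actF \<sigma> q \<longleftrightarrow> p = q" by (metis actF_inv(1))
lemma actF_eq0: "\<sigma> \<in> sperm l \<Longrightarrow> actF \<sigma> p = 0 \<longleftrightarrow> p = 0" using actF_inj[of \<sigma> l p 0] by simp
lemma actF_inverse: "\<sigma> \<in> sperm l \<Longrightarrow> actF \<sigma> (inverse p) = inverse (actF \<sigma> p)"
proof (cases "p = 0")
  case False
  assume s: "\<sigma> \<in> sperm l"
  have "actF \<sigma> (inverse p) * actF \<sigma> p = 1" using False s actF_mult[OF s, of "inverse p" p] by simp
  then show ?thesis by (metis inverse_unique mult.commute)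
qed auto
lemma actF_divide: "\<sigma> \<in> sperm l \<Longrightarrow> actF \<sigma> (p / q) = actF \<sigma> p / actF \<sigma> q"
  by (simp add: divide_inverse actF_mult actF_inverse)

lemma to_fract_prod: "to_fract (prod f A) = (\<Prod>a\<in>A. to_fract (f a))"
  by (induction A rule: infinite_finite_induct) auto

context typeD begin

text \<open>Linear independence of automorphisms, tested on polynomials in \<open>x\<^sub>1, \<dots>, x\<^sub>l\<close> alone: two signed permutations are separated by
  one of these, which allows an element to be removed from the relation.\<close>

lemma dedekind:
  assumes "finite S" "S \<subseteq> sperm l" "\<And>h :: 'k mpol. h \<in> Rl l \<Longrightarrow> (\<Sum>\<sigma>\<in>S. c \<sigma> * to_fract (act \<sigma> h)) = 0" "\<sigma> \<in> S"
  shows "c \<sigma> = 0"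
  using assms
proof (induction S arbitrary: c \<sigma> rule: finite_induct)
  case (insert \<rho> S)
  have z: "c \<tau> = 0" if t: "\<tau> \<in> S" for \<tau>
  proof -
    have "\<tau> \<noteq> \<rho>" using t insert.hyps by auto
    then obtain p :: "'k mpol" where p: "p \<in> Rl l" "act \<tau> p \<noteq> act \<rho> p"
      using act_faithful[of \<tau> \<rho>] t insert.prems(1) by auto
    have "c \<tau> * (to_fract (act \<tau> p) - to_fract (act \<rho> p)) = 0"
    proof (rule insert.IH[of "\<lambda>\<sigma>. c \<sigma> * (to_fract (act \<sigma> p) - to_fract (act \<rho> p))", OF _ _ t])
      fix h :: "'k mpol" assume h: "h \<in> Rl l"
      \<comment> \<open>The relation at \<open>p * h\<close> minus \<open>act \<rho> p\<close> times the relation at \<open>h\<close> loses the term of \<open>\<rho>\<close>.\<close>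
      have "0 = (\<Sum>\<sigma>\<in>insert \<rho> S. c \<sigma> * to_fract (act \<sigma> (p * h))) - to_fract (act \<rho> p) * (\<Sum>\<sigma>\<in>insert \<rho> S. c \<sigma> * to_fract (act \<sigma> h))"
        using insert.prems(2)[OF h] insert.prems(2)[OF Rl_mult[OF p(1) h]] by simp
      also have "\<dots> = (\<Sum>\<sigma>\<in>insert \<rho> S. c \<sigma> * (to_fract (act \<sigma> p) - to_fract (act \<rho> p)) * to_fract (act \<sigma> h))"
        by (simp add: sum_distrib_left sum_subtractf[symmetric] act_mult algebra_simps)
      also have "\<dots> = (\<Sum>\<sigma>\<in>S. c \<sigma> * (to_fract (act \<sigma> p) - to_fract (act \<rho> p)) * to_fract (act \<sigma> h))"
        using insert.hyps by simp
      finally show "(\<Sum>\<sigma>\<in>S. c \<sigma> * (to_fract (act \<sigma> p) - to_fract (act \<rho> p)) * to_fract (act \<sigma> h)) = 0" by simp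
    qed (use insert.prems in auto)
    then show ?thesis using p(2) by simp
  qed
  have "c \<rho> = 0" using insert.prems(2)[OF Rl_1] insert.hyps z by simp
  then show ?case using z insert.prems(3) by auto
qed simp

section \<open>Demazure operators and braid relations\<close>

definition alphaF :: "int \<Rightarrow> 'k mpol fract" where "alphaF i = to_fract (alpha i)"
text \<open>Demazure operators on rational functions, where division is unproblematic and they become combinations of automorphisms.\<close>

definition demF :: "int \<Rightarrow> 'k mpol fract \<Rightarrow> 'k mpol fract" where
  "demF i q = (q - actF (sr i) q) / alphaF i"
definition dem_word :: "int list \<Rightarrow> 'k mpol fract \<Rightarrow> 'k mpol fract" where "dem_word w = foldr demF w"
lemma dem_word_Nil [simp]: "dem_word [] q = q" by (simp add: dem_word_def)
lemma dem_word_Cons [simp]: "dem_word (i # w) q = demF i (dem_word w q)" by (simp add: dem_word_def)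
lemma dem_word_append: "dem_word (v @ w) q = dem_word v (dem_word w q)" by (simp add: dem_word_def)

lemma alpha_nz: "i \<in> N l \<Longrightarrow> (alpha i :: 'k mpol) \<noteq> 0"
  by (simp add: alpha_rt) (rule rt_nz, auto simp: N_iff)
lemma alphaF_nz: "i \<in> N l \<Longrightarrow> alphaF i \<noteq> 0" by (simp add: alphaF_def alpha_nz)
lemma act_sr_alpha: "i \<in> N l \<Longrightarrow> act (sr i) (alpha i) = (- alpha i :: 'k mpol)"
proof -
  assume i: "i \<in> N l"
  then have "act (sr i) (alpha i) = (rt (\<bar>i\<bar> + 1) i :: 'k mpol)"
    using sr_simple[of i] by (auto simp: alpha_rt act_rt[OF sr_sperm] N_iff)
  then show ?thesis using i rt_swap[of "\<bar>i\<bar> + 1" i] by (simp add: alpha_rt)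
qed

text \<open>The quotient exists for constants and variables, and by the twisted Leibniz rule
  \<open>f * g - s (f * g) = (f - s f) * g + s f * (g - s g)\<close> also for products.\<close>

lemma demazure_exists: assumes i: "i \<in> N l" and f: "(f :: 'k mpol) \<in> Rl l" shows "f \<in> Rl l \<and> (\<exists>g\<in>Rl l. alpha i * g = f - act (sr i) f)"
  using f
proof (induction f rule: Rl_induct)
  case (cst c) then show ?case by (auto intro!: bexI[of _ 0] cst_in_Rl)
next
  case (var j)
  have "X j - Xs (sr i (int j)) \<in> {0, alpha i, - alpha i :: 'k mpol}"
  proof (cases "i = - 1")
    case True then show ?thesis by (auto simp: sp_def Xs_def alpha_def numeral_2_eq_2)
  next
    case False
    then obtain m where "i = int m" "m \<ge> 1" using i by (auto simp: N_iff intro: that[of "nat i"])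
    then show ?thesis by (cases "j = m"; cases "j = Suc m") (auto simp: sp_def Xs_def alpha_def nat_add_distrib)
  qed
  then have "X j - act (sr i) (X j) = (0::'k mpol) \<or> X j - act (sr i) (X j) = (alpha i :: 'k mpol) \<or> X j - act (sr i) (X j) = (- alpha i :: 'k mpol)"
    unfolding act_X by blast
  then have "\<exists>u\<in>Rl l. alpha i * u = X j - act (sr i) (X j :: 'k mpol)"
  proof (elim disjE)
    assume "X j - act (sr i) (X j) = (0::'k mpol)"
    then show ?thesis unfolding \<open>_ = _\<close> by (intro bexI[of _ 0]) simp_all
  next
    assume "X j - act (sr i) (X j) = (alpha i :: 'k mpol)"
    then show ?thesis unfolding \<open>_ = _\<close> by (intro bexI[of _ 1]) simp_all
  next
    assume "X j - act (sr i) (X j) = (- alpha i :: 'k mpol)"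
    then show ?thesis unfolding \<open>_ = _\<close> by (intro bexI[of _ "- 1"]) (simp_all add: Rl_uminus)
  qed
  then show ?case using X_in_Rl[OF var] by blast
next
  case (add f g)
  then obtain a b where "a \<in> Rl l" "b \<in> Rl l" "alpha i * a = f - act (sr i) f" "alpha i * b = g - act (sr i) g" by auto
  then show ?case using add by (auto simp: algebra_simps act_add intro!: bexI[of _ "a + b"] Rl_add)
next
  case (mult f g)
  then obtain a b where ab: "a \<in> Rl l" "b \<in> Rl l" "alpha i * a = f - act (sr i) f" "alpha i * b = g - act (sr i) g" by auto
  have "alpha i * (a * g + act (sr i) f * b) = (alpha i * a) * g + act (sr i) f * (alpha i * b)" by (simp add: algebra_simps)
  also have "\<dots> = f * g - act (sr i) (f * g)" unfolding ab(3,4) by (simp add: act_mult algebra_simps)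
  finally show ?case using mult ab act_Rl[OF sr_sperm[OF i], of f] by (auto intro!: bexI[of _ "a * g + act (sr i) f * b"] Rl_add Rl_mult)
qed

lemma demazure: assumes i: "i \<in> N l" and f: "(f :: 'k mpol) \<in> Rl l"
  shows "demazure i f \<in> Rl l" "to_fract (demazure i f) = demF i (to_fract f)"
proof -
  obtain g where g: "g \<in> Rl l" "alpha i * g = f - act (sr i) f" using demazure_exists[OF i f] by blast
  have "demazure i f = g" unfolding demazure_def refl_act[OF i]
    using g(2) alpha_nz[OF i] by (intro the_equality) (simp, metis mult_left_cancel)
  moreover have "to_fract g = demF i (to_fract f)"
    using arg_cong[OF g(2), of to_fract] alphaF_nz[OF i] unfolding demF_def actF_to_fract[OF sr_sperm[OF i]] alphaF_def
    by (simp add: nonzero_eq_divide_eq mult.commute)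
  ultimately show "demazure i f \<in> Rl l" "to_fract (demazure i f) = demF i (to_fract f)" using g by auto
qed

lemma foldr_demazure: assumes "set w \<subseteq> N l" "(f :: 'k mpol) \<in> Rl l"
  shows "foldr demazure w f \<in> Rl l \<and> to_fract (foldr demazure w f) = dem_word w (to_fract f)"
  using assms(1) by (induction w) (auto simp: assms(2) demazure)

lemma actF_alphaF: "i \<in> N l \<Longrightarrow> actF (sr i) (alphaF i) = - alphaF i"
  by (simp add: alphaF_def actF_to_fract[OF sr_sperm] act_sr_alpha)
lemma actF_sr2: "i \<in> N l \<Longrightarrow> actF (sr i) (actF (sr i) q) = q"
  by (simp add: actF_comp[OF sr_sperm sr_sperm] sr_invol' del: comp_apply)

lemma demF_DF: assumes "i \<in> N l" shows "demF i (demF i q) = 0"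
proof -
  have "demF i (demF i q) = ((q - actF (sr i) q) / alphaF i - (actF (sr i) q - q) / (- alphaF i)) / alphaF i"
    unfolding demF_def by (simp only: actF_divide[OF sr_sperm[OF assms]] actF_diff[OF sr_sperm[OF assms]] actF_alphaF[OF assms] actF_sr2[OF assms])
  then show ?thesis using alphaF_nz[OF assms] by (simp add: divide_simps)
qed
lemma demF_invariant: "i \<in> N l \<Longrightarrow> demF i q = 0 \<longleftrightarrow> actF (sr i) q = q"
  using alphaF_nz[of i] by (auto simp: demF_def)

lemma sp_other: "\<bar>x\<bar> \<noteq> \<bar>a\<bar> \<Longrightarrow> \<bar>x\<bar> \<noteq> \<bar>b\<bar> \<Longrightarrow> sp a b x = x" by (auto simp: sp_def)
lemma sp_range: "\<bar>x\<bar> = \<bar>a\<bar> \<or> \<bar>x\<bar> = \<bar>b\<bar> \<Longrightarrow> \<bar>sp a b x\<bar> = \<bar>a\<bar> \<or> \<bar>sp a b x\<bar> = \<bar>b\<bar>" by (auto simp: sp_def)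
lemma sp_disjoint:
  assumes "\<bar>a\<bar> \<noteq> \<bar>c\<bar>" "\<bar>a\<bar> \<noteq> \<bar>d\<bar>" "\<bar>b\<bar> \<noteq> \<bar>c\<bar>" "\<bar>b\<bar> \<noteq> \<bar>d\<bar>"
  shows "sp a b (sp c d x) = sp c d (sp a b x)"
proof -
  consider "\<bar>x\<bar> = \<bar>a\<bar> \<or> \<bar>x\<bar> = \<bar>b\<bar>" | "\<bar>x\<bar> = \<bar>c\<bar> \<or> \<bar>x\<bar> = \<bar>d\<bar>" | "\<bar>x\<bar> \<noteq> \<bar>a\<bar>" "\<bar>x\<bar> \<noteq> \<bar>b\<bar>" "\<bar>x\<bar> \<noteq> \<bar>c\<bar>" "\<bar>x\<bar> \<noteq> \<bar>d\<bar>"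
    by blast
  then show ?thesis
  proof cases
    case 1
    then have "sp c d x = x" "sp c d (sp a b x) = sp a b x"
      using assms sp_range[of x a b] sp_other[of x c d] sp_other[of "sp a b x" c d] by metis+
    then show ?thesis by simp
  next
    case 2
    then have "sp a b x = x" "sp a b (sp c d x) = sp c d x"
      using assms sp_range[of x c d] sp_other[of x a b] sp_other[of "sp c d x" a b] by metis+
    then show ?thesis by simp
  qed (simp add: sp_other)
qed
lemma sp_odd: "a \<noteq> 0 \<Longrightarrow> b \<noteq> 0 \<Longrightarrow> a \<noteq> - b \<Longrightarrow> sp a b (- x) = - sp a b x" by (auto simp: sp_def)
lemma sp_1: "sp a b a = b" by (simp add: sp_def)
lemma sp_2: "sp a b b = a" by (simp add: sp_def)
lemma sp_braid:
  assumes "a \<noteq> 0" "b \<noteq> 0" "c \<noteq> 0" "\<bar>a\<bar> \<noteq> \<bar>b\<bar>" "\<bar>a\<bar> \<noteq> \<bar>c\<bar>" "\<bar>b\<bar> \<noteq> \<bar>c\<bar>"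
  shows "sp a b (sp b c (sp a b x)) = sp b c (sp a b (sp b c x))"
proof -
  have o: "sp a b (- x) = - sp a b x" "sp b c (- x) = - sp b c x" for x using assms by (auto intro!: sp_odd)
  have f: "sp a b c = c" "sp b c a = a" using assms by (auto intro!: sp_other)
  have p: "sp a b (sp b c (sp a b x)) = sp b c (sp a b (sp b c x))" if "x = a \<or> x = b \<or> x = c" for x using that by (elim disjE; hypsubst; simp only: sp_1 sp_2 f)
  consider "x = a \<or> x = b \<or> x = c" | "- x = a \<or> - x = b \<or> - x = c" | "\<bar>x\<bar> \<noteq> \<bar>a\<bar>" "\<bar>x\<bar> \<noteq> \<bar>b\<bar>" "\<bar>x\<bar> \<noteq> \<bar>c\<bar>" by linarith
  then show ?thesis
  proof cases
    case 2 from p[OF 2] show ?thesis by (simp add: o)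
  qed (simp_all add: p sp_other)
qed

text \<open>The generators commute when they are not adjacent in the Dynkin diagram. Node \<open>- 1\<close> is adjacent to \<open>2\<close> only, and the test
  \<open>\<bar>i\<bar> + 1 = j\<close> accounts for this because \<open>\<bar>- 1\<bar> + 1 = 2\<close>. The pair \<open>{1, - 1}\<close> is the case in which \<open>s\<^sub>i\<close> maps the index pair of \<open>\<alpha>\<^sub>j\<close> to its other index pair.\<close>

lemma comm_cases: assumes "i \<in> N l" "j \<in> N l" "i \<noteq> j" "\<bar>i\<bar> + 1 \<noteq> j" "\<bar>j\<bar> + 1 \<noteq> i"
  shows "sr i \<circ> sr j = sr j \<circ> sr i \<and> (sr i j, sr i (\<bar>j\<bar> + 1)) \<in> {(j, \<bar>j\<bar> + 1), (- (\<bar>j\<bar> + 1), - j)}"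
proof -
  have "i = - 1 \<and> j = 1 \<or> i = 1 \<and> j = - 1 \<or> i = - 1 \<and> j \<ge> 3 \<or> j = - 1 \<and> i \<ge> 3 \<or> 1 \<le> i \<and> i + 2 \<le> j \<or> 1 \<le> j \<and> j + 2 \<le> i"
    using assms unfolding N_iff by presburger
  then consider "i = - 1" "j = 1" | "i = 1" "j = - 1" | "i = - 1" "j \<ge> 3" | "j = - 1" "i \<ge> 3" | "1 \<le> i" "i + 2 \<le> j" | "1 \<le> j" "j + 2 \<le> i"
    by blast
  then show ?thesis
  proof cases
    case 3 then have "sr i j = j" "sr i (\<bar>j\<bar> + 1) = \<bar>j\<bar> + 1" "sr i (sr j x) = sr j (sr i x)" for x by (auto intro!: sp_other sp_disjoint)
    then show ?thesis by (simp add: fun_eq_iff)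
  next
    case 4 then have "sr i j = j" "sr i (\<bar>j\<bar> + 1) = \<bar>j\<bar> + 1" "sr i (sr j x) = sr j (sr i x)" for x by (auto intro!: sp_other sp_disjoint)
    then show ?thesis by (simp add: fun_eq_iff)
  next
    case 5 then have "sr i j = j" "sr i (\<bar>j\<bar> + 1) = \<bar>j\<bar> + 1" "sr i (sr j x) = sr j (sr i x)" for x by (auto intro!: sp_other sp_disjoint)
    then show ?thesis by (simp add: fun_eq_iff)
  next
    case 6 then have "sr i j = j" "sr i (\<bar>j\<bar> + 1) = \<bar>j\<bar> + 1" "sr i (sr j x) = sr j (sr i x)" for x by (auto intro!: sp_other sp_disjoint)
    then show ?thesis by (simp add: fun_eq_iff)
  qed (simp_all add: sp_def fun_eq_iff)
qed

lemma actF_alphaF_comm: assumes "i \<in> N l" "j \<in> N l" "i \<noteq> j" "\<bar>i\<bar> + 1 \<noteq> j" "\<bar>j\<bar> + 1 \<noteq> i"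
  shows "actF (sr i) (alphaF j) = alphaF j"
proof -
  have "act (sr i) (rt j (\<bar>j\<bar> + 1)) = (rt j (\<bar>j\<bar> + 1) :: 'k mpol)"
    using comm_cases[OF assms] assms(2) rt_neg[of j "\<bar>j\<bar> + 1"] by (auto simp: act_rt[OF sr_sperm[OF assms(1)]] N_iff)
  then show ?thesis using assms by (simp add: alphaF_def actF_to_fract[OF sr_sperm] alpha_rt)
qed

lemma demF_comm: assumes "i \<in> N l" "j \<in> N l" "i \<noteq> j" "\<bar>i\<bar> + 1 \<noteq> j" "\<bar>j\<bar> + 1 \<noteq> i"
  shows "demF i (demF j q) = demF j (demF i q)"
proof -
  have "actF (sr i) (actF (sr j) q) = actF (sr j) (actF (sr i) q)"
    using comm_cases[OF assms] by (simp add: actF_comp[OF sr_sperm sr_sperm] assms(1,2) del: comp_apply)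
  moreover have "demF i (demF j q) = ((q - actF (sr j) q) / alphaF j - (actF (sr i) q - actF (sr i) (actF (sr j) q)) / alphaF j) / alphaF i"
    unfolding demF_def by (simp only: actF_divide[OF sr_sperm[OF assms(1)]] actF_diff[OF sr_sperm[OF assms(1)]] actF_alphaF_comm[OF assms])
  moreover have "demF j (demF i q) = ((q - actF (sr i) q) / alphaF i - (actF (sr j) q - actF (sr j) (actF (sr i) q)) / alphaF i) / alphaF j"
    unfolding demF_def by (simp only: actF_divide[OF sr_sperm[OF assms(2)]] actF_diff[OF sr_sperm[OF assms(2)]] actF_alphaF_comm[OF assms(2,1) assms(3)[symmetric] assms(5,4)])
  ultimately show ?thesis using alphaF_nz[OF assms(1)] alphaF_nz[OF assms(2)] by (simp only:) (simp add: field_simps)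
qed

lemma braid_sp: assumes "i \<in> N l" "j \<in> N l" "\<bar>i\<bar> + 1 = j"
  shows "sr i (sr j (sr i x)) = sr j (sr i (sr j x))" "sr i j = i" "sr i (\<bar>j\<bar> + 1) = \<bar>j\<bar> + 1" "sr j i = i" "sr j (\<bar>i\<bar> + 1) = \<bar>j\<bar> + 1"
proof -
  define c where "c = \<bar>j\<bar> + 1"
  have d: "i \<noteq> 0" "j \<noteq> 0" "c \<noteq> 0" "\<bar>i\<bar> \<noteq> \<bar>j\<bar>" "\<bar>i\<bar> \<noteq> \<bar>c\<bar>" "\<bar>j\<bar> \<noteq> \<bar>c\<bar>" using assms by (auto simp: N_iff c_def)
  show "sr i (sr j (sr i x)) = sr j (sr i (sr j x))" unfolding assms(3) c_def[symmetric] by (rule sp_braid[OF d])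
  show "sr i j = i" "sr j (\<bar>i\<bar> + 1) = \<bar>j\<bar> + 1" by (simp_all add: assms(3) sp_1 sp_2)
  show "sr i (\<bar>j\<bar> + 1) = \<bar>j\<bar> + 1" "sr j i = i"
    unfolding assms(3) c_def[symmetric] using d by (auto intro!: sp_other)
qed

text \<open>The symmetric right-hand side gives the braid relation: exchanging the roles of \<open>s\<close> and \<open>t\<close>, and of \<open>a\<close> and \<open>b\<close>, changes only the last term, and there \<open>s t s = t s t\<close>.\<close>

lemma demF_braid1:
  fixes s t :: "'a::field \<Rightarrow> 'a"
  assumes s: "\<And>x y. s (x - y) = s x - s y" "\<And>x y. s (x / y) = s x / s y" "\<And>x y. s (x + y) = s x + s y"
    and t: "\<And>x y. t (x - y) = t x - t y" "\<And>x y. t (x / y) = t x / t y"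
    and a: "s a = - a" "t a = a + b" "s b = a + b" "\<And>x. s (s x) = x" "a \<noteq> 0" "b \<noteq> 0" "a + b \<noteq> 0"
  defines "D \<equiv> \<lambda>q. (q - s q) / a" and "E \<equiv> \<lambda>q. (q - t q) / b"
  shows "D (E (D q)) = (q - s q - t q + t (s q) + s (t q) - s (t (s q))) / (a * b * (a + b))"
proof -
  have "D (E (D q)) = (((q - s q) / a - (t q - t (s q)) / (a + b)) / b - ((s q - q) / (- a) - (s (t q) - s (t (s q))) / b) / (a + b)) / a"
    unfolding D_def E_def by (simp add: s t a)
  also have "\<dots> = (q - s q - t q + t (s q) + s (t q) - s (t (s q))) / (a * b * (a + b))"
    using a(5,6,7) by (simp add: divide_simps) (simp add: algebra_simps)
  finally show ?thesis .
qed

lemma demF_braid: assumes "i \<in> N l" "j \<in> N l" "\<bar>i\<bar> + 1 = j"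
  shows "demF i (demF j (demF i q)) = demF j (demF i (demF j q))"
proof -
  note si = sr_sperm[OF assms(1)] and sj = sr_sperm[OF assms(2)]
  have e: "actF (sr i) (actF (sr j) (actF (sr i) q)) = actF (sr j) (actF (sr i) (actF (sr j) q))"
  proof -
    have "sr i \<circ> (sr j \<circ> sr i) = sr j \<circ> (sr i \<circ> sr j)" using braid_sp(1)[OF assms] by (simp add: fun_eq_iff)
    then show ?thesis by (simp only: actF_comp[OF si sj] actF_comp[OF sj si] actF_comp[OF si sperm_comp[OF sj si]] actF_comp[OF sj sperm_comp[OF si sj]])
  qed
  have c: "alphaF i + alphaF j = to_fract (rt i (\<bar>j\<bar> + 1))"
    using assms by (simp add: alphaF_def alpha_rt rt_def flip: to_fract_add)
  have 1: "actF (sr i) (alphaF j) = alphaF i + alphaF j"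
    unfolding c unfolding alphaF_def alpha_rt[OF assms(2)] by (simp only: actF_to_fract[OF si] act_rt[OF si] braid_sp(2,3)[OF assms])
  have 2: "actF (sr j) (alphaF i) = alphaF i + alphaF j"
    unfolding c unfolding alphaF_def alpha_rt[OF assms(1)] by (simp only: actF_to_fract[OF sj] act_rt[OF sj] braid_sp(4,5)[OF assms])
  have nz: "alphaF i + alphaF j \<noteq> 0" unfolding c using assms by (simp add: to_fract_eq_0_iff) (rule rt_nz, auto simp: N_iff)
  have r1: "actF (sr i) (alphaF j) = alphaF j + alphaF i" and r2: "actF (sr j) (alphaF i) = alphaF j + alphaF i" and nz': "alphaF j + alphaF i \<noteq> 0"
    using 1 2 nz by (simp_all add: add.commute)
  have A: "demF i (demF j (demF i q)) = (q - actF (sr i) q - actF (sr j) q + actF (sr j) (actF (sr i) q) + actF (sr i) (actF (sr j) q) - actF (sr i) (actF (sr j) (actF (sr i) q))) / (alphaF i * alphaF j * (alphaF i + alphaF j))"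
    unfolding demF_def by (rule demF_braid1[of "actF (sr i)" "actF (sr j)"])
      (simp_all only: actF_diff[OF si] actF_divide[OF si] actF_add[OF si] actF_diff[OF sj] actF_divide[OF sj] 1 2 actF_alphaF[OF assms(1)] actF_sr2[OF assms(1)] alphaF_nz[OF assms(1)] alphaF_nz[OF assms(2)] nz not_False_eq_True)
  have B: "demF j (demF i (demF j q)) = (q - actF (sr j) q - actF (sr i) q + actF (sr i) (actF (sr j) q) + actF (sr j) (actF (sr i) q) - actF (sr j) (actF (sr i) (actF (sr j) q))) / (alphaF j * alphaF i * (alphaF j + alphaF i))"
    unfolding demF_def by (rule demF_braid1[of "actF (sr j)" "actF (sr i)"])
      (simp_all only: actF_diff[OF si] actF_divide[OF si] actF_add[OF sj] actF_diff[OF sj] actF_divide[OF sj] r1 r2 actF_alphaF[OF assms(2)] actF_sr2[OF assms(2)] alphaF_nz[OF assms(1)] alphaF_nz[OF assms(2)] nz' not_False_eq_True)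
  show ?thesis unfolding A B e by (simp add: algebra_simps)
qed

end

section \<open>Reduced words\<close>

context typeD begin

text \<open>Distinguishes type D from type B: the number of negative values is even on the group generated by the reflections of type D.\<close>

definition sign_prod :: "nat \<Rightarrow> (int \<Rightarrow> int) \<Rightarrow> int" where "sign_prod m \<sigma> = (\<Prod>a\<in>{1..int m}. sgn (inv \<sigma> a))"

text \<open>\<open>L\<close> is the set of signed indices whose differences are the roots of the parabolic subgroup \<open>W\<^sub>K\<close>. The conditions express that the positive roots in
  these indices are sums of simple roots of \<open>K\<close> (a function that increases along the simple roots increases on \<open>L\<close>), and that an element
  of \<open>W\<^sub>K\<close> without descents in \<open>K\<close> is the identity. They are all that the general theory of lengths and
  longest elements uses.\<close>

definition adapted :: "int set \<Rightarrow> int set \<Rightarrow> bool" where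
  "adapted K L \<longleftrightarrow> K \<subseteq> N l \<and> (\<forall>a\<in>L. a \<noteq> 0 \<and> \<bar>a\<bar> \<le> int l) \<and> (\<forall>i\<in>K. i \<in> L \<and> \<bar>i\<bar> + 1 \<in> L \<and> sr i ` L = L) \<and>
    (\<forall>h::int\<Rightarrow>int. (\<forall>a. h (- a) = - h a) \<longrightarrow> (\<forall>i\<in>K. h i < h (\<bar>i\<bar> + 1)) \<longrightarrow> (\<forall>a\<in>L. \<forall>b\<in>L. a < b \<longrightarrow> a \<noteq> - b \<longrightarrow> h a < h b)) \<and>
    (\<forall>\<sigma>\<in>G K. (\<forall>i\<in>K. inv \<sigma> i < inv \<sigma> (\<bar>i\<bar> + 1)) \<longrightarrow> \<sigma> = id)"

definition PosL :: "int set \<Rightarrow> 'k mpol set" where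
  "PosL L = {rt a b | a b. a \<in> L \<and> b \<in> L \<and> a < b \<and> a \<noteq> - b}"

text \<open>Removing descents shortens an element, so a set closed under the \<open>s\<^sub>i\<close> in which only the identity lacks
  descents consists of elements that have words in \<open>K\<close> of length \<open>ell\<close>.\<close>

lemma reduced_word_gen:
  assumes K: "K \<subseteq> N l" and S: "S \<subseteq> sperm l" "\<And>i \<sigma>. i \<in> K \<Longrightarrow> \<sigma> \<in> S \<Longrightarrow> sr i \<circ> \<sigma> \<in> S"
    "\<And>\<sigma>. \<sigma> \<in> S \<Longrightarrow> (\<forall>i\<in>K. inv \<sigma> i < inv \<sigma> (\<bar>i\<bar> + 1)) \<Longrightarrow> \<sigma> = id" and s: "\<sigma> \<in> S"
  shows "\<exists>w. set w \<subseteq> K \<and> word_perm w = \<sigma> \<and> length w = ell \<sigma>"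
  using s
proof (induction "ell \<sigma>" arbitrary: \<sigma> rule: less_induct)
  case less
  show ?case
  proof (cases "\<forall>i\<in>K. inv \<sigma> i < inv \<sigma> (\<bar>i\<bar> + 1)")
    case True
    then have "\<sigma> = id" using S(3) less by blast
    then show ?thesis by (intro exI[of _ "[]"]) simp
  next
    case False
    then obtain i where i: "i \<in> K" "\<not> inv \<sigma> i < inv \<sigma> (\<bar>i\<bar> + 1)" by blast
    have iN: "i \<in> N l" using i K by auto
    have sg: "\<sigma> \<in> sperm l" using less S by auto
    have d: "ell \<sigma> = Suc (ell (sr i \<circ> \<sigma>))" using ell_cases[OF iN sg] i(2) by (intro ell_down[OF iN sg]) auto
    obtain w where w: "set w \<subseteq> K" "word_perm w = sr i \<circ> \<sigma>" "length w = ell (sr i \<circ> \<sigma>)"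
      using less(1)[of "sr i \<circ> \<sigma>"] d S(2)[OF i(1) less(2)] by auto
    have "word_perm (i # w) = \<sigma>" unfolding word_perm_Cons w(2) comp_assoc[symmetric] sr_invol'[OF iN] by simp
    then show ?thesis using w i d by (intro exI[of _ "i # w"]) auto
  qed
qed

lemma G_step: "i \<in> K \<Longrightarrow> \<sigma> \<in> G K \<Longrightarrow> sr i \<circ> \<sigma> \<in> G K" by (intro G_comp G_sr)

lemma reduced_word_exists: "adapted K L \<Longrightarrow> \<sigma> \<in> G K \<Longrightarrow> \<exists>w. set w \<subseteq> K \<and> word_perm w = \<sigma> \<and> length w = ell \<sigma>"
  by (rule reduced_word_gen[of K "G K"]) (use G_sperm G_step in \<open>auto simp: adapted_def simp del: comp_apply\<close>)

lemma reduced_tail: assumes "set (i # w) \<subseteq> N l" "length (i # w) = ell (word_perm (i # w))"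
  shows "length w = ell (word_perm w)" "inv (word_perm (i # w)) (\<bar>i\<bar> + 1) < inv (word_perm (i # w)) i" "inv (word_perm w) i < inv (word_perm w) (\<bar>i\<bar> + 1)"
proof -
  have i: "i \<in> N l" and w: "word_perm w \<in> sperm l" "set w \<subseteq> N l" using assms(1) word_perm_sperm by auto
  have e: "inv (word_perm (i # w)) x = inv (word_perm w) (sr i x)" for x
    unfolding word_perm_Cons sperm_inv_comp[OF sr_sperm[OF i] w(1)] inv_sr[OF i] by simp
  have le: "ell (word_perm w) \<le> length w" using ell_le_length[OF w(2)] .
  show lt: "inv (word_perm w) i < inv (word_perm w) (\<bar>i\<bar> + 1)"
  proof (rule ccontr)
    assume "\<not> inv (word_perm w) i < inv (word_perm w) (\<bar>i\<bar> + 1)"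
    then have "ell (word_perm w) = Suc (ell (sr i \<circ> word_perm w))" using ell_cases[OF i w(1)] by (intro ell_down[OF i w(1)]) auto
    then show False using assms(2) le unfolding word_perm_Cons by simp
  qed
  from ell_up[OF i w(1) this] show "length w = ell (word_perm w)" using assms(2) unfolding word_perm_Cons by simp
  show "inv (word_perm (i # w)) (\<bar>i\<bar> + 1) < inv (word_perm (i # w)) i" unfolding e
    using lt i sr_simple[of i] by (auto simp: N_iff)
qed

lemma inv_sr_comp: "i \<in> N l \<Longrightarrow> \<sigma> \<in> sperm l \<Longrightarrow> inv (sr i \<circ> \<sigma>) x = inv \<sigma> (sr i x)"
  using sperm_inv_comp[OF sr_sperm, of i \<sigma>] inv_sr[of i] by simp

lemma G_N_sr: "i \<in> N l \<Longrightarrow> \<sigma> \<in> G (N l) \<Longrightarrow> sr i \<circ> \<sigma> \<in> G (N l)" by (rule G_step)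

text \<open>Matsumoto's theorem, for the operators only: two reduced words with different first letters \<open>i\<close> and \<open>j\<close> are both compared
  with words that begin with the longest element of \<open>\<langle>s\<^sub>i, s\<^sub>j\<rangle>\<close>; the latter two agree by the braid relations.\<close>

lemma matsumoto:
  assumes N: "\<And>\<sigma>. \<sigma> \<in> G (N l) \<Longrightarrow> \<exists>w. set w \<subseteq> N l \<and> word_perm w = \<sigma> \<and> length w = ell \<sigma>"
  shows "set w \<subseteq> N l \<Longrightarrow> set w' \<subseteq> N l \<Longrightarrow> word_perm w = word_perm w' \<Longrightarrow> length w = ell (word_perm w) \<Longrightarrow> length w' = ell (word_perm w) \<Longrightarrow> dem_word w q = dem_word w' q"
proof (induction "length w" arbitrary: w w' q rule: less_induct)
  case less
  show ?case
  proof (cases w)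
    case Nil then show ?thesis using less.prems by auto
  next
    case (Cons i w1)
    then obtain j w2 where w': "w' = j # w2" using less.prems by (cases w') auto
    define g where "g = word_perm w"
    have g': "g = word_perm w'" using less.prems by (simp add: g_def)
    have i: "i \<in> N l" and j: "j \<in> N l" and w1: "set w1 \<subseteq> N l" and w2: "set w2 \<subseteq> N l" using less.prems Cons w' by auto
    have gs: "g \<in> sperm l" unfolding g_def by (rule word_perm_sperm[OF less.prems(1)])
    have gG: "g \<in> G (N l)" unfolding g_def G_def using less.prems(1) by blast
    have r1: "length w1 = ell (word_perm w1)" "inv g (\<bar>i\<bar> + 1) < inv g i"
      using reduced_tail[of i w1] less.prems Cons by (auto simp: g_def)
    have r2: "length w2 = ell (word_perm w2)" "inv g (\<bar>j\<bar> + 1) < inv g j"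
      using reduced_tail[of j w2] less.prems w' g' by (auto simp: g_def)
    have s1: "word_perm w1 = sr i \<circ> g" unfolding g_def Cons word_perm_Cons comp_assoc[symmetric] sr_invol'[OF i] by simp
    have s2: "word_perm w2 = sr j \<circ> g" unfolding g' w' word_perm_Cons comp_assoc[symmetric] sr_invol'[OF j] by simp
    have IH: "dem_word v q = dem_word v' q" if "set v \<subseteq> N l" "set v' \<subseteq> N l" "word_perm v = word_perm v'" "length v = ell (word_perm v)" "length v' = length v" "length v < length w" for v v' q
      using less.hyps[OF that(6) that(1-4)] that by simp
    have len: "length w1 < length w" "length w2 < length w" "length w = Suc (length w1)" "length w = Suc (length w2)"
      using Cons w' less.prems by auto
    have odd: "inv g (- x) = - inv g x" for x by (rule sperm_odd[OF sperm_inv[OF gs]])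
    \<comment> \<open>Adjacent nodes: both words are replaced by words beginning with \<open>i j i\<close> and \<open>j i j\<close> and continued by the same reduced word \<open>u\<close>.\<close>
    have braid: "demF i (dem_word w1 q) = demF j (dem_word w2 q)"
      if ij: "\<bar>i\<bar> + 1 = j" and i: "i \<in> N l" and j: "j \<in> N l" and d: "inv g (\<bar>i\<bar> + 1) < inv g i" "inv g (\<bar>j\<bar> + 1) < inv g j"
        and w1: "set w1 \<subseteq> N l" "word_perm w1 = sr i \<circ> g" "length w1 = ell (word_perm w1)" "length w1 < length w"
        and w2: "set w2 \<subseteq> N l" "word_perm w2 = sr j \<circ> g" "length w2 = ell (word_perm w2)" "length w2 < length w"
      for i j w1 w2
    proof -
      note b = braid_sp[OF i j ij]
      define g1 where "g1 = sr i \<circ> g"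
      define g2 where "g2 = sr j \<circ> g1"
      define g3 where "g3 = sr i \<circ> g2"
      have gs1: "g1 \<in> sperm l" unfolding g1_def by (intro sperm_comp sr_sperm i gs)
      have gs2: "g2 \<in> sperm l" unfolding g2_def by (intro sperm_comp sr_sperm j gs1)
      have G3: "g3 \<in> G (N l)" unfolding g3_def g2_def g1_def by (intro G_N_sr i j gG)
      have e1: "inv g1 x = inv g (sr i x)" for x unfolding g1_def by (rule inv_sr_comp[OF i gs])
      have e2: "inv g2 x = inv g (sr i (sr j x))" for x unfolding g2_def inv_sr_comp[OF j gs1] e1 ..
      have "inv g1 (\<bar>j\<bar> + 1) < inv g1 j" unfolding e1 b using d ij by simp
      from ell_down[OF j gs1 this] have l2: "ell g1 = Suc (ell g2)" by (simp add: g2_def)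
      have "sr i (sr j i) = j" "sr i (sr j (\<bar>i\<bar> + 1)) = \<bar>j\<bar> + 1" using b ij by (simp_all add: sp_1)
      then have "inv g2 (\<bar>i\<bar> + 1) < inv g2 i" unfolding e2 using d(2) by simp
      from ell_down[OF i gs2 this] have l3: "ell g2 = Suc (ell g3)" by (simp add: g3_def)
      obtain u where u: "set u \<subseteq> N l" "word_perm u = g3" "length u = ell g3" using N[OF G3] by blast
      have g2': "sr i \<circ> g3 = g2" unfolding g3_def comp_assoc[symmetric] sr_invol'[OF i] by simp
      have g1': "sr j \<circ> g2 = g1" unfolding g2_def comp_assoc[symmetric] sr_invol'[OF j] by simp
      have h: "word_perm (j # i # u) = word_perm w1" unfolding word_perm_Cons u g2' g1' w1 g1_def ..
      have jg: "sr i \<circ> (sr j \<circ> g3) = sr j \<circ> g"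
      proof -
        have "sr i (sr j (sr i (sr j (sr i (g x))))) = sr j (g x)" for x
          using b(1)[of "g x"] sr_invol[OF i] sr_invol[OF j] by metis
        then show ?thesis by (simp add: fun_eq_iff g3_def g2_def g1_def)
      qed
      have h2: "word_perm (i # j # u) = word_perm w2" unfolding word_perm_Cons u w2 using jg .
      have "ell (word_perm w1) = Suc (Suc (length u))" using l2 l3 u w1(2) by (simp add: g1_def)
      moreover have "ell (word_perm w2) = ell (word_perm w1)"
        using ell_down[OF i gs d(1)] ell_down[OF j gs d(2)] w1(2) w2(2) by simp
      ultimately have "dem_word w1 q = dem_word (j # i # u) q" "dem_word w2 q = dem_word (i # j # u) q"
        using i j u w1 w2 h h2 by (intro IH; simp)+
      then show ?thesis using demF_braid[OF i j ij] by simp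
    qed
    consider "i = j" | "\<bar>i\<bar> + 1 = j" | "\<bar>j\<bar> + 1 = i" | "i \<noteq> j" "\<bar>i\<bar> + 1 \<noteq> j" "\<bar>j\<bar> + 1 \<noteq> i" by blast
    then show ?thesis
    proof cases
      case 1
      then have "dem_word w1 q = dem_word w2 q" using s1 s2 r1 r2 w1 w2 len by (intro IH) auto
      then show ?thesis using Cons w' 1 by simp
    next
      case 2
      from braid[OF 2 i j r1(2) r2(2) w1 s1 r1(1) len(1) w2 s2 r2(1) len(2)] show ?thesis using Cons w' by simp
    next
      case 3
      from braid[OF 3 j i r2(2) r1(2) w2 s2 r2(1) len(2) w1 s1 r1(1) len(1)] show ?thesis using Cons w' by simp
    next
      case 4
      note c = comm_cases[OF i j 4]
      define g1 where "g1 = sr i \<circ> g"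
      define g2 where "g2 = sr j \<circ> g1"
      have gs1: "g1 \<in> sperm l" unfolding g1_def by (intro sperm_comp sr_sperm i gs)
      have G2: "g2 \<in> G (N l)" unfolding g2_def g1_def by (intro G_N_sr i j gG)
      have e1: "inv g1 x = inv g (sr i x)" for x unfolding g1_def by (rule inv_sr_comp[OF i gs])
      have "inv g1 (\<bar>j\<bar> + 1) < inv g1 j" unfolding e1 using c r2(2) odd[of j] odd[of "\<bar>j\<bar> + 1"] by auto
      from ell_down[OF j gs1 this] have l2: "ell g1 = Suc (ell g2)" by (simp add: g2_def)
      obtain u where u: "set u \<subseteq> N l" "word_perm u = g2" "length u = ell g2" using N[OF G2] by blast
      have h: "word_perm (j # u) = word_perm w1" unfolding word_perm_Cons u s1 g2_def comp_assoc[symmetric] sr_invol'[OF j] by (simp add: g1_def)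
      have "sr i \<circ> sr j \<circ> sr i = sr j" using c sr_invol'[OF i] by (metis comp_assoc comp_id)
      then have h2: "word_perm (i # u) = word_perm w2" unfolding word_perm_Cons u s2 g2_def g1_def by (metis comp_assoc)
      have "ell (word_perm w1) = Suc (length u)" using l2 u s1 by (simp add: g1_def)
      moreover have "ell (word_perm w2) = ell (word_perm w1)" using ell_down[OF i gs r1(2)] ell_down[OF j gs r2(2)] s1 s2 by simp
      ultimately have "dem_word w1 q = dem_word (j # u) q" "dem_word w2 q = dem_word (i # u) q"
        using i j u w1 w2 h h2 r1 r2 len by (intro IH; simp)+
      then show ?thesis using demF_comm[OF i j 4] Cons w' by simp
    qed
  qed
qed

lemma G_reindex: assumes "K \<subseteq> N l" "i \<in> K" shows "(\<Sum>\<sigma>\<in>G K. f (sr i \<circ> \<sigma>)) = (\<Sum>\<sigma>\<in>G K. f \<sigma>)"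
proof (rule sum.reindex_bij_witness[of _ "\<lambda>\<sigma>. sr i \<circ> \<sigma>" "\<lambda>\<sigma>. sr i \<circ> \<sigma>"])
  have i: "i \<in> N l" using assms by auto
  show "sr i \<circ> (sr i \<circ> a) = a" for a unfolding comp_assoc[symmetric] sr_invol'[OF i] by simp
  then show "sr i \<circ> (sr i \<circ> a) = a" for a .
qed (use assms G_step in auto)

text \<open>Triangularity: an operator along a word of length \<open>n\<close> involves automorphisms of length at most \<open>n\<close>, and along a reduced word of \<open>\<sigma>\<close>
  the coefficient of \<open>\<sigma>\<close> is, up to sign, the inverse of the product of the inverted roots.\<close>

lemma expansion:
  assumes K: "K \<subseteq> N l"
  shows "set w \<subseteq> K \<Longrightarrow> \<exists>c. (\<forall>q. dem_word w q = (\<Sum>\<sigma>\<in>G K. c \<sigma> * actF \<sigma> q)) \<and> (\<forall>\<sigma>\<in>G K. length w < ell \<sigma> \<longrightarrow> c \<sigma> = 0) \<and>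
     (length w = ell (word_perm w) \<longrightarrow> c (word_perm w) * to_fract (\<Prod>(inv_roots (word_perm w))) = (- 1) ^ length w)"
proof (induction w)
  case Nil
  have "inv_roots id = {}" using ell_id finite_inv_roots[of id] by (simp add: ell_def)
  have nm: "(\<Sum>\<sigma>\<in>G K. (if \<sigma> = id then 1 else 0) * actF \<sigma> q) = q" for q
    using finite_G[OF K] by (simp add: if_distrib[of "\<lambda>x. x * _"] cong: if_cong)
  show ?case
  proof (intro exI[of _ "\<lambda>\<sigma>. if \<sigma> = id then 1 else 0"] conjI allI ballI impI)
    fix q show "dem_word [] q = (\<Sum>\<sigma>\<in>G K. (if \<sigma> = id then 1 else 0) * actF \<sigma> q)" unfolding nm by simp
  next
    fix \<sigma> assume "length ([]::int list) < ell \<sigma>"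
    then show "(if \<sigma> = id then 1 else 0 :: 'k mpol fract) = 0" by auto
  next
    show "(if word_perm [] = id then 1 else 0) * to_fract (\<Prod>(inv_roots (word_perm []))) = (- 1) ^ length ([] :: int list)"
      unfolding word_perm_Nil \<open>inv_roots id = {}\<close> by simp
  qed
next
  case (Cons i w)
  then have iK: "i \<in> K" and i: "i \<in> N l" and w: "set w \<subseteq> K" and wN: "set w \<subseteq> N l" using K by auto
  obtain c where c: "\<And>q. dem_word w q = (\<Sum>\<sigma>\<in>G K. c \<sigma> * actF \<sigma> q)" "\<And>\<sigma>. \<sigma> \<in> G K \<Longrightarrow> length w < ell \<sigma> \<Longrightarrow> c \<sigma> = 0"
     "length w = ell (word_perm w) \<Longrightarrow> c (word_perm w) * to_fract (\<Prod>(inv_roots (word_perm w))) = (- 1) ^ length w"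
    using Cons.IH[OF w] by blast
  note si = sr_sperm[OF i]
  have ii: "sr i \<circ> (sr i \<circ> \<sigma>) = \<sigma>" for \<sigma> :: "int \<Rightarrow> int" unfolding comp_assoc[symmetric] sr_invol'[OF i] by simp
  \<comment> \<open>The coefficients after one more operator, from the reindexing \<open>\<sigma> \<mapsto> s\<^sub>i \<sigma>\<close>.\<close>
  define d where "d \<sigma> = (c \<sigma> - actF (sr i) (c (sr i \<circ> \<sigma>))) / alphaF i" for \<sigma>
  have 1: "dem_word (i # w) q = (\<Sum>\<sigma>\<in>G K. d \<sigma> * actF \<sigma> q)" for q
  proof -
    have "actF (sr i) (dem_word w q) = (\<Sum>\<sigma>\<in>G K. actF (sr i) (c \<sigma>) * actF (sr i \<circ> \<sigma>) q)"
      unfolding c(1) actF_sum[OF si] using G_sperm[OF K]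
      by (intro sum.cong refl) (auto simp: actF_mult[OF si] actF_comp[OF si] simp del: comp_apply)
    also have "\<dots> = (\<Sum>\<sigma>\<in>G K. actF (sr i) (c (sr i \<circ> \<sigma>)) * actF \<sigma> q)"
      using G_reindex[OF K iK, of "\<lambda>\<sigma>. actF (sr i) (c (sr i \<circ> \<sigma>)) * actF \<sigma> q"] unfolding ii .
    finally have "dem_word (i # w) q = ((\<Sum>\<sigma>\<in>G K. c \<sigma> * actF \<sigma> q) - (\<Sum>\<sigma>\<in>G K. actF (sr i) (c (sr i \<circ> \<sigma>)) * actF \<sigma> q)) / alphaF i"
      unfolding dem_word_Cons demF_def c(1) by simp
    then show ?thesis by (simp add: d_def sum_subtractf[symmetric] sum_divide_distrib algebra_simps diff_divide_distrib del: comp_apply)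
  qed
  have 2: "d \<sigma> = 0" if "\<sigma> \<in> G K" "length (i # w) < ell \<sigma>" for \<sigma>
  proof -
    have s: "\<sigma> \<in> sperm l" using that G_sperm[OF K] by auto
    have "length w < ell (sr i \<circ> \<sigma>)"
      using ell_cases[OF i s] ell_up[OF i s] ell_down[OF i s] that(2) by auto
    then show ?thesis using that c(2)[of \<sigma>] c(2)[of "sr i \<circ> \<sigma>"] G_step[OF iK that(1)] si by (simp add: d_def del: comp_apply)
  qed
  have 3: "d (word_perm (i # w)) * to_fract (\<Prod>(inv_roots (word_perm (i # w)))) = (- 1) ^ length (i # w)" if r: "length (i # w) = ell (word_perm (i # w))"
  proof -
    have wG: "word_perm w \<in> G K" using w by (auto simp: G_def)
    have ws: "word_perm w \<in> sperm l" by (rule word_perm_sperm[OF wN])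
    note ds = reduced_tail[OF _ r]
    have lw: "length w = ell (word_perm w)" and up: "inv (word_perm w) i < inv (word_perm w) (\<bar>i\<bar> + 1)" using ds i wN by auto
    have "c (sr i \<circ> word_perm w) = 0" using r G_step[OF iK wG] unfolding word_perm_Cons by (intro c(2)) auto
    then have "d (word_perm (i # w)) = - actF (sr i) (c (word_perm w)) / alphaF i" unfolding d_def word_perm_Cons ii by simp
    moreover have "\<Prod>(inv_roots (word_perm (i # w))) = alpha i * act (sr i) (\<Prod>(inv_roots (word_perm w)))"
      unfolding word_perm_Cons inv_roots_step(1)[OF i ws up] act_prod using inv_roots_step(2)[OF i ws up] finite_inv_roots
      by (simp add: prod.reindex inj_on_def act_inj[OF si])
    ultimately have "d (word_perm (i # w)) * to_fract (\<Prod>(inv_roots (word_perm (i # w)))) = - actF (sr i) (c (word_perm w) * to_fract (\<Prod>(inv_roots (word_perm w))))"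
      using alphaF_nz[OF i] by (simp add: actF_mult[OF si] actF_to_fract[OF si] flip: alphaF_def)
    also have "\<dots> = (- 1) ^ length (i # w)" unfolding c(3)[OF lw]
      by (cases "even (length w)") (simp_all add: actF_uminus[OF si] si actF_1[OF si])
    finally show ?thesis .
  qed
  show ?case using 1 2 3 by blast
qed

end

section \<open>Parabolic subgroups of types A and D\<close>

context typeD begin

text \<open>The permutations of \<open>L\<close>, extended to be odd. When \<open>L\<close> contains no pair \<open>a, - a\<close> this is a symmetric group.\<close>

definition GS :: "int set \<Rightarrow> (int \<Rightarrow> int) set" where
  "GS L = {\<sigma> \<in> sperm l. \<sigma> ` L = L \<and> (\<forall>a. a \<notin> L \<longrightarrow> - a \<notin> L \<longrightarrow> \<sigma> a = a)}"

lemma mono_image_id: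
  fixes h :: "int \<Rightarrow> int"
  assumes L: "finite L" "h ` L = L" and m: "\<And>a b. a \<in> L \<Longrightarrow> b \<in> L \<Longrightarrow> a < b \<Longrightarrow> h a < h b" and a: "a \<in> L"
  shows "h a = a"
proof -
  have lt: "h x < h y \<longleftrightarrow> x < y" if "x \<in> L" "y \<in> L" for x y
    using m[of x y] m[of y x] that by (cases x y rule: linorder_cases) auto
  have inj: "inj_on h L" by (rule inj_onI) (metis m less_irrefl linorder_neqE)
  have "{x \<in> L. x < h a} = h ` {x \<in> L. x < a}"
    using L(2) a lt by (auto simp: image_iff) (metis imageE)
  then have c: "card {x \<in> L. x < h a} = card {x \<in> L. x < a}"
    using inj by (simp add: card_image inj_on_subset[OF inj])
  have ha: "h a \<in> L" using L(2) a by auto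
  have "{x \<in> L. x < a} \<subset> {x \<in> L. x < h a}" if "a < h a" using that a by force
  moreover have "{x \<in> L. x < h a} \<subset> {x \<in> L. x < a}" if "h a < a" using that ha by force
  ultimately show ?thesis using c L(1) psubset_card_mono[of "{x \<in> L. x < h a}" "{x \<in> L. x < a}"] psubset_card_mono[of "{x \<in> L. x < a}" "{x \<in> L. x < h a}"]
    by (cases "h a" a rule: linorder_cases) auto
qed

lemma involution_image: "(\<And>a. a \<in> L \<Longrightarrow> f a \<in> L) \<Longrightarrow> (\<And>x. f (f x) = x) \<Longrightarrow> f ` L = L"
proof (intro subset_antisym subsetI)
  fix x assume a: "\<And>a. a \<in> L \<Longrightarrow> f a \<in> L" "\<And>x. f (f x) = x" "x \<in> L"
  then have "x = f (f x)" "f x \<in> L" by simp_all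
  then show "x \<in> f ` L" by (rule image_eqI)
qed auto

lemma GS_inv: assumes "\<sigma> \<in> GS L" shows "inv \<sigma> \<in> GS L"
proof -
  have s: "\<sigma> \<in> sperm l" using assms by (simp add: GS_def)
  have "inv \<sigma> ` L = L"
  proof -
    have "inv \<sigma> ` (\<sigma> ` L) = L" using sperm_inv_f[OF s] by (simp add: image_comp comp_def)
    then show ?thesis using assms by (simp add: GS_def)
  qed
  moreover have "inv \<sigma> a = a" if "a \<notin> L" "- a \<notin> L" for a
  proof -
    have "\<sigma> a = a" using assms that by (simp add: GS_def)
    then show ?thesis using sperm_inv_f[OF s, of a] by simp
  qed
  ultimately show ?thesis using sperm_inv[OF s] by (simp add: GS_def)
qed

lemma GS_comp: "\<sigma> \<in> GS L \<Longrightarrow> \<tau> \<in> GS L \<Longrightarrow> \<sigma> \<circ> \<tau> \<in> GS L"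
  unfolding GS_def by (auto simp: sperm_comp image_comp[symmetric] simp del: comp_apply) (simp add: comp_def)

text \<open>Type A: \<open>L\<close> contains no pair \<open>a, - a\<close> and the elements of \<open>K\<close> are exactly those of \<open>L\<close> that have a successor in \<open>L\<close>, so that increasing along the simple roots
  is increasing on \<open>L\<close>. An increasing permutation of \<open>L\<close> is the identity, and therefore every permutation of \<open>L\<close> has a word in \<open>K\<close>.\<close>

lemma
  assumes K: "K \<subseteq> N l" and L: "\<And>a. a \<in> L \<Longrightarrow> a \<noteq> 0 \<and> \<bar>a\<bar> \<le> int l \<and> - a \<notin> L"
    and KL: "\<And>i. i \<in> K \<Longrightarrow> i \<in> L \<and> \<bar>i\<bar> + 1 \<in> L" and ch: "\<And>a b. a \<in> L \<Longrightarrow> b \<in> L \<Longrightarrow> a < b \<Longrightarrow> a \<in> K \<and> \<bar>a\<bar> + 1 \<le> b"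
  shows adapted_A: "adapted K L" and G_GS: "G K = GS L"
proof -
  have fin: "finite L" by (rule finite_subset[of _ "{- int l..int l}"]) (use L in fastforce)+
  have srL: "sr i ` L = L" if i: "i \<in> K" for i
  proof -
    have iN: "i \<in> N l" using i K by auto
    have "sr i a \<in> L" if "a \<in> L" for a using KL[OF i] L[of i] L[of "\<bar>i\<bar> + 1"] that by (auto simp: sp_def)
    then show ?thesis using sr_invol[OF iN] by (intro involution_image) auto
  qed
  have srGS: "sr i \<in> GS L" if i: "i \<in> K" for i
  proof -
    have "sr i a = a" if "a \<notin> L" "- a \<notin> L" for a
    proof -
      have "a \<noteq> i" "a \<noteq> - i" "a \<noteq> \<bar>i\<bar> + 1" "a \<noteq> - (\<bar>i\<bar> + 1)" using that KL[OF i] by (auto simp del: minus_add_distrib)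
      then show ?thesis by (simp add: sp_def)
    qed
    then show ?thesis using srL[OF i] sr_sperm[of i] K i by (auto simp: GS_def)
  qed
  have mono: "h a < h b" if "\<forall>i\<in>K. h i < h (\<bar>i\<bar> + 1)" "a \<in> L" "b \<in> L" "a < b" for h :: "int \<Rightarrow> int" and a b
    using that(2-4)
  proof (induction "nat (b - a)" arbitrary: a rule: less_induct)
    case less
    have c: "a \<in> K" "\<bar>a\<bar> + 1 \<le> b" using ch[OF less.prems] by auto
    then have h1: "h a < h (\<bar>a\<bar> + 1)" using that(1) by auto
    show ?case
    proof (cases "\<bar>a\<bar> + 1 = b")
      case False
      then have "h (\<bar>a\<bar> + 1) < h b" using c KL[OF c(1)] less.prems by (intro less.hyps) auto
      then show ?thesis using h1 by simp
    qed (use h1 in simp)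
  qed
  have nodesc: "\<sigma> = id" if s: "\<sigma> \<in> GS L" and d: "\<forall>i\<in>K. inv \<sigma> i < inv \<sigma> (\<bar>i\<bar> + 1)" for \<sigma>
  proof -
    have ss: "\<sigma> \<in> sperm l" using s by (simp add: GS_def)
    have iG: "inv \<sigma> ` L = L" using GS_inv[OF s] by (simp add: GS_def)
    have "inv \<sigma> a = a" if "a \<in> L" for a
      using mono_image_id[OF fin iG mono[OF d] that] .
    then have 1: "\<sigma> a = a" if "a \<in> L" for a using that sperm_f_inv[OF ss] by metis
    have "\<sigma> a = a" for a
    proof -
      consider "a \<in> L" | "- a \<in> L" | "a \<notin> L" "- a \<notin> L" by blast
      then show ?thesis
      proof cases
        case 2 then show ?thesis using 1[of "- a"] sperm_odd[OF ss, of a] by simp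
      qed (use 1 s in \<open>auto simp: GS_def\<close>)
    qed
    then show ?thesis by auto
  qed
  have id: "id \<in> GS L" by (simp add: GS_def)
  have sub: "G K \<subseteq> GS L"
  proof
    fix \<sigma> assume "\<sigma> \<in> G K" then show "\<sigma> \<in> GS L"
      by (induction rule: G_induct) (rule id, intro GS_comp srGS)
  qed
  have "GS L \<subseteq> G K"
  proof
    fix \<sigma> assume s: "\<sigma> \<in> GS L"
    have "\<exists>w. set w \<subseteq> K \<and> word_perm w = \<sigma> \<and> length w = ell \<sigma>"
    proof (rule reduced_word_gen[of K "GS L"])
      show "GS L \<subseteq> sperm l" by (auto simp: GS_def)
      show "sr i \<circ> \<sigma> \<in> GS L" if "i \<in> K" "\<sigma> \<in> GS L" for i \<sigma> by (rule GS_comp[OF srGS[OF that(1)] that(2)])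
      show "\<sigma> = id" if "\<sigma> \<in> GS L" "\<forall>i\<in>K. inv \<sigma> i < inv \<sigma> (\<bar>i\<bar> + 1)" for \<sigma> by (rule nodesc[OF that])
    qed (rule K, rule s)
    then show "\<sigma> \<in> G K" by (auto simp: G_def)
  qed
  then show "G K = GS L" using sub by blast
  show "adapted K L" unfolding adapted_def
  proof (intro conjI)
    show "\<forall>a\<in>L. a \<noteq> 0 \<and> \<bar>a\<bar> \<le> int l" using L by blast
    show "\<forall>i\<in>K. i \<in> L \<and> \<bar>i\<bar> + 1 \<in> L \<and> sr i ` L = L" using KL srL by blast
    show "\<forall>h::int\<Rightarrow>int. (\<forall>a. h (- a) = - h a) \<longrightarrow> (\<forall>i\<in>K. h i < h (\<bar>i\<bar> + 1)) \<longrightarrow> (\<forall>a\<in>L. \<forall>b\<in>L. a < b \<longrightarrow> a \<noteq> - b \<longrightarrow> h a < h b)"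
      using mono by blast
    show "\<forall>\<sigma>\<in>G K. (\<forall>i\<in>K. inv \<sigma> i < inv \<sigma> (\<bar>i\<bar> + 1)) \<longrightarrow> \<sigma> = id"
      using nodesc sub by blast
  qed (rule K)
qed

lemma sign_prod_step:
  assumes K: "i \<in> {-1} \<union> {1..int m - 1}" and m: "2 \<le> m" "m \<le> l" and s: "\<sigma> \<in> sperm l"
  shows "sign_prod m (sr i \<circ> \<sigma>) = sign_prod m \<sigma>"
proof -
  have i: "i \<in> N l" using K m by (auto simp: N_iff)
  have e: "inv (sr i \<circ> \<sigma>) x = inv \<sigma> (sr i x)" for x by (rule inv_sr_comp[OF i s])
  have odd: "inv \<sigma> (- x) = - inv \<sigma> x" for x using sperm_odd[OF sperm_inv[OF s]] .
  show ?thesis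
  proof (cases "i = - 1")
    case True
    have S: "{1..int m} = insert 1 (insert 2 {3..int m})" using m by auto
    have v: "sr i 1 = - 2" "sr i 2 = - 1" using True by (auto simp: sp_def)
    have o: "sr i x = x" if "x \<in> {3..int m}" for x using True that by (auto simp: sp_def)
    have "(\<Prod>a\<in>{1..int m}. sgn (inv \<sigma> (sr i a))) = sgn (inv \<sigma> (- 2)) * (sgn (inv \<sigma> (- 1)) * (\<Prod>a\<in>{3..int m}. sgn (inv \<sigma> a)))"
      unfolding S using o by (simp add: v)
    also have "\<dots> = (\<Prod>a\<in>{1..int m}. sgn (inv \<sigma> a))" unfolding S odd by (simp add: sgn_minus)
    finally show ?thesis unfolding sign_prod_def e .
  next
    case False
    then have i1: "1 \<le> i" "i < int m" using K by auto
    show ?thesis unfolding sign_prod_def e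
      by (rule prod.reindex_bij_witness[of _ "sr i" "sr i"]) (use i1 sr_invol[OF i] in \<open>auto simp: sp_def\<close>)
  qed
qed

text \<open>A signed permutation without descents satisfies \<open>\<bar>h 1\<bar> < h 2 < \<dots> < h m\<close> and so fixes \<open>2, \<dots>, m\<close>; the parity of the number of
  sign changes then excludes \<open>h 1 = - 1\<close>.\<close>

lemma adapted_D:
  assumes m: "2 \<le> m" "m \<le> l"
  shows "adapted ({-1} \<union> {1..int m - 1}) {a. a \<noteq> 0 \<and> \<bar>a\<bar> \<le> int m}" (is "adapted ?K ?L")
proof -
  have K: "?K \<subseteq> N l" using m by (auto simp: N_def)
  have i0: "i \<in> ?L \<and> \<bar>i\<bar> + 1 \<in> ?L" if "i \<in> ?K" for i using that m by auto
  have srL: "sr i ` ?L = ?L" if i: "i \<in> ?K" for i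
  proof -
    have iN: "i \<in> N l" using i K by auto
    have "sr i a \<in> ?L" if "a \<in> ?L" for a using i0[OF i] that by (auto simp: sp_def)
    then show ?thesis using sr_invol[OF iN] by (intro involution_image) blast+
  qed
  have C1: "h a < h b" if h: "\<forall>i\<in>?K. h i < h (\<bar>i\<bar> + 1)" "1 \<le> a" "a < b" "b \<le> int m" for h :: "int \<Rightarrow> int" and a b
    using that(3,4)
  proof (induction b rule: int_gr_induct)
    case base
    have "a \<in> ?K" using h base by auto
    then show ?case using h(1) h(2) by auto
  next
    case (step b)
    have "b \<in> ?K" using h(2) step by auto
    then have "h b < h (b + 1)" using h(1,2) step by fastforce
    then show ?case using step by simp
  qed
  have pos: "\<bar>h 1\<bar> < h b" if h: "\<forall>i\<in>?K. h i < h (\<bar>i\<bar> + 1)" and o: "\<forall>a. h (- a) = - h a" and b: "2 \<le> b" "b \<le> int m" for h :: "int \<Rightarrow> int" and b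
  proof -
    have "h (-1) < h (\<bar>-1\<bar> + 1)" using h by blast
    then have "- h 1 < h 2" using o by simp
    moreover have "h 1 < h 2" using C1[OF h, of 1 2] m by simp
    moreover have "h 2 \<le> h b" using C1[OF h, of 2 b] b by (cases "b = 2") auto
    ultimately show ?thesis by simp
  qed
  have mono: "h a < h b" if h: "\<forall>i\<in>?K. h i < h (\<bar>i\<bar> + 1)" and o: "\<forall>a. h (- a) = - h a" and ab: "a \<in> ?L" "b \<in> ?L" "a < b" "a \<noteq> - b" for h :: "int \<Rightarrow> int" and a b
  proof -
    consider "0 < a" | "b < 0" | "a < 0" "0 < b" using ab by fastforce
    then show ?thesis
    proof cases
      case 1 then show ?thesis using C1[OF h, of a b] ab by auto
    next
      case 2 then show ?thesis using C1[OF h, of "- b" "- a"] ab o by auto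
    next
      case 3
      have na: "h a = - h (- a)" using o by simp
      have "\<bar>h x\<bar> < h y" if "1 \<le> x" "x < y" "y \<le> int m" for x y
      proof (cases "x = 1")
        case True then show ?thesis using pos[OF h o, of y] that by simp
      next
        case False
        then have "0 < h x" using pos[OF h o, of x] that by linarith
        then show ?thesis using C1[OF h, of x y] that by simp
      qed
      from this[of "- a" b] this[of b "- a"] show ?thesis using 3 ab na by (cases "- a < b") auto
    qed
  qed
  have parG: "sign_prod m \<sigma> = 1" if "\<sigma> \<in> G ?K" for \<sigma>
    using that
  proof (induction rule: G_induct)
    case id
    have "(\<Prod>a\<in>{1..int m}. sgn a) = (\<Prod>a\<in>{1..int m}. 1)" by (rule prod.cong) auto
    then show ?case by (simp add: sign_prod_def inv_id)
  next
    case (step i \<sigma>)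
    then have "\<sigma> \<in> sperm l" using G_sperm[OF K] by blast
    from sign_prod_step[OF step(1) m this] show ?case using step by (simp only:)
  qed
  have pres: "\<sigma> ` ?L = ?L" if "\<sigma> \<in> G ?K" for \<sigma>
    using that
  proof (induction rule: G_induct)
    case (step i \<sigma>) then show ?case using srL[OF step(1)] by (simp only: image_comp[symmetric])
  qed simp
  have out: "\<sigma> a = a" if "\<sigma> \<in> G ?K" "int m < \<bar>a\<bar>" for \<sigma> a
    using that
  proof (induction rule: G_induct)
    case (step i \<sigma>) then show ?case using m by (auto intro!: sp_other)
  qed simp
  have nodesc: "\<sigma> = id" if s: "\<sigma> \<in> G ?K" and d: "\<forall>i\<in>?K. inv \<sigma> i < inv \<sigma> (\<bar>i\<bar> + 1)" for \<sigma>
  proof -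
    define h where "h = inv \<sigma>"
    have ss: "\<sigma> \<in> sperm l" using s G_sperm[OF K] by auto
    have hG: "h \<in> G ?K" unfolding h_def by (rule G_inv[OF K s])
    have hs: "h \<in> sperm l" using hG G_sperm[OF K] by auto
    have o: "\<forall>a. h (- a) = - h a" using sperm_odd[OF hs] by simp
    note d' = d[folded h_def]
    have rng: "\<bar>h a\<bar> \<le> int m \<and> h a \<noteq> 0" if "1 \<le> a" "a \<le> int m" for a
    proof -
      have "a \<in> ?L" using that by simp
      then have "h a \<in> ?L" using pres[OF hG] by blast
      then show ?thesis by simp
    qed
    have ge: "a \<le> h a" if "2 \<le> a" "a \<le> int m" for a
      using that
    proof (induction a rule: int_ge_induct)
      case base
      have "\<bar>h 1\<bar> < h 2" "h 1 \<noteq> 0" using pos[OF d' o, of 2] rng[of 1] m by simp_all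
      then show ?case by linarith
    next
      case (step a)
      then show ?case using C1[OF d', of a "a + 1"] by simp
    qed
    have le: "h a \<le> a" if "1 \<le> a" "a \<le> int m" for a
      using that(2,1)
    proof (induction a rule: int_le_induct)
      case base
      have "\<bar>h (int m)\<bar> \<le> int m" using rng[of "int m"] m by simp
      then show ?case by linarith
    next
      case (step a)
      then show ?case using C1[OF d', of "a - 1" a] by simp
    qed
    have h2: "h a = a" if "2 \<le> a" "a \<le> int m" for a using ge[OF that] le[of a] that by simp
    have "\<bar>h 1\<bar> < 2" using pos[OF d' o, of 2] h2[of 2] m by simp
    then have h1: "h 1 = 1 \<or> h 1 = - 1" using rng[of 1] m by auto
    have S: "{1..int m} = insert 1 {2..int m}" using m by auto
    have "(\<Prod>a\<in>{2..int m}. sgn (h a)) = (\<Prod>a\<in>{2..int m}. 1)" by (rule prod.cong) (auto simp: h2)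
    then have "sign_prod m \<sigma> = sgn (h 1)" unfolding sign_prod_def S h_def[symmetric] by simp
    then have h1: "h 1 = 1" using h1 parG[OF s] by auto
    have "h = id"
    proof (rule sperm_eqI[OF hs id_sperm])
      fix a assume a: "1 \<le> a" "a \<le> int l"
      show "h a = id a"
        using h1 h2[of a] out[OF hG, of a] a by (cases "a = 1"; cases "a \<le> int m") auto
    qed
    then show ?thesis using sperm_inv_inv[OF ss] by (simp add: h_def inv_id)
  qed
  show ?thesis unfolding adapted_def
  proof (intro conjI)
    show "\<forall>a\<in>?L. a \<noteq> 0 \<and> \<bar>a\<bar> \<le> int l" using m by auto
    show "\<forall>i\<in>?K. i \<in> ?L \<and> \<bar>i\<bar> + 1 \<in> ?L \<and> sr i ` ?L = ?L" using i0 srL by blast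
    show "\<forall>h::int\<Rightarrow>int. (\<forall>a. h (- a) = - h a) \<longrightarrow> (\<forall>i\<in>?K. h i < h (\<bar>i\<bar> + 1)) \<longrightarrow> (\<forall>a\<in>?L. \<forall>b\<in>?L. a < b \<longrightarrow> a \<noteq> - b \<longrightarrow> h a < h b)"
      using mono by blast
    show "\<forall>\<sigma>\<in>G ?K. (\<forall>i\<in>?K. inv \<sigma> i < inv \<sigma> (\<bar>i\<bar> + 1)) \<longrightarrow> \<sigma> = id"
      using nodesc by blast
  qed (rule K)
qed

lemma adapted_N: "adapted (N l) {a. a \<noteq> 0 \<and> \<bar>a\<bar> \<le> int l}"
  using adapted_D[of l] l2 by (simp add: N_def)

lemma reduced_word_exists_N: "\<sigma> \<in> G (N l) \<Longrightarrow> \<exists>w. set w \<subseteq> N l \<and> word_perm w = \<sigma> \<and> length w = ell \<sigma>"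
  by (rule reduced_word_exists[OF adapted_N])

lemma dem_word_unique: "set w \<subseteq> N l \<Longrightarrow> set w' \<subseteq> N l \<Longrightarrow> word_perm w = word_perm w' \<Longrightarrow> length w = ell (word_perm w) \<Longrightarrow> length w' = ell (word_perm w) \<Longrightarrow> dem_word w q = dem_word w' q"
  by (rule matsumoto[OF reduced_word_exists_N])

lemma act_eq_iff: "\<sigma> \<in> sperm l \<Longrightarrow> \<tau> \<in> sperm l \<Longrightarrow> (act \<sigma> :: 'k mpol \<Rightarrow> 'k mpol) = act \<tau> \<longleftrightarrow> \<sigma> = \<tau>"
proof (intro iffI)
  assume s: "\<sigma> \<in> sperm l" "\<tau> \<in> sperm l" and e: "(act \<sigma> :: 'k mpol \<Rightarrow> 'k mpol) = act \<tau>"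
  show "\<sigma> = \<tau>" by (rule act_faithful[OF s]) (simp only: e)
next
  assume "\<sigma> = \<tau>" then show "(act \<sigma> :: 'k mpol \<Rightarrow> 'k mpol) = act \<tau>" by (simp only:)
qed

lemma len_ell: assumes "\<sigma> \<in> G (N l)" shows "len l (act \<sigma> :: 'k mpol \<Rightarrow> 'k mpol) = ell \<sigma>"
proof -
  have s: "\<sigma> \<in> sperm l" using assms G_sperm by auto
  obtain w where w: "set w \<subseteq> N l" "word_perm w = \<sigma>" "length w = ell \<sigma>" using reduced_word_exists_N[OF assms] by blast
  show ?thesis unfolding len_def
  proof (rule Least_equality)
    show "\<exists>w. set w \<subseteq> N l \<and> word_elt w = (act \<sigma> :: 'k mpol \<Rightarrow> 'k mpol) \<and> length w = ell \<sigma>"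
      using w word_elt_act[OF w(1)] by auto
  next
    fix k assume "\<exists>w. set w \<subseteq> N l \<and> word_elt w = (act \<sigma> :: 'k mpol \<Rightarrow> 'k mpol) \<and> length w = k"
    then obtain v where v: "set v \<subseteq> N l" "word_elt v = (act \<sigma> :: 'k mpol \<Rightarrow> 'k mpol)" "length v = k" by blast
    then have "word_perm v = \<sigma>" using word_elt_act[OF v(1)] act_eq_iff[OF word_perm_sperm[OF v(1)] s] by simp
    then show "ell \<sigma> \<le> k" using ell_le_length[OF v(1)] v by simp
  qed
qed

lemma reduced_expr_iff: assumes "\<sigma> \<in> G (N l)"
  shows "reduced_expr l w (act \<sigma> :: 'k mpol \<Rightarrow> 'k mpol) \<longleftrightarrow> set w \<subseteq> N l \<and> word_perm w = \<sigma> \<and> length w = ell \<sigma>"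
proof -
  have s: "\<sigma> \<in> sperm l" using assms G_sperm by auto
  show ?thesis
  proof (cases "set w \<subseteq> N l")
    case True
    show ?thesis unfolding reduced_expr_def len_ell[OF assms] word_elt_act[OF True] act_eq_iff[OF word_perm_sperm[OF True] s] ..
  next
    case False then show ?thesis unfolding reduced_expr_def by blast
  qed
qed

lemma ell_inv: assumes "\<sigma> \<in> G (N l)" shows "ell (inv \<sigma>) = ell \<sigma>"
proof -
  have le: "ell (inv \<sigma>) \<le> ell \<sigma>" if s: "\<sigma> \<in> G (N l)" for \<sigma>
  proof -
    obtain w where w: "set w \<subseteq> N l" "word_perm w = \<sigma>" "length w = ell \<sigma>" using reduced_word_exists_N[OF s] by blast
    show ?thesis using ell_le_length[of "rev w"] w word_perm_rev[OF w(1)] by simp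
  qed
  have s: "\<sigma> \<in> sperm l" using assms G_sperm by auto
  show ?thesis using le[OF assms] le[OF G_inv[OF subset_refl assms]] sperm_inv_inv[OF s] by simp
qed

end

section \<open>Traces as sums over the group\<close>

context typeD begin

lemma RI_D: "(a, b) \<in> RI \<Longrightarrow> a \<noteq> 0" "(a, b) \<in> RI \<Longrightarrow> b \<noteq> 0" "(a, b) \<in> RI \<Longrightarrow> \<bar>a\<bar> \<noteq> \<bar>b\<bar>"
  by (auto simp: RI_def)

lemma adapted_sub: "adapted K L \<Longrightarrow> K \<subseteq> N l" by (simp add: adapted_def)
lemma adapted_L: "adapted K L \<Longrightarrow> a \<in> L \<Longrightarrow> a \<noteq> 0 \<and> \<bar>a\<bar> \<le> int l" by (simp add: adapted_def)
lemma adapted_pq: "adapted K L \<Longrightarrow> i \<in> K \<Longrightarrow> i \<in> L \<and> \<bar>i\<bar> + 1 \<in> L \<and> sr i ` L = L" by (simp add: adapted_def)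
lemma adapted_sperm: "adapted K L \<Longrightarrow> \<sigma> \<in> G K \<Longrightarrow> \<sigma> \<in> sperm l" using G_sperm adapted_sub by blast
lemma finite_L: "adapted K L \<Longrightarrow> finite L"
  by (rule finite_subset[of _ "{- int l..int l}"]) (auto dest: adapted_L simp: abs_le_iff)
lemma finite_PosL: "adapted K L \<Longrightarrow> finite (PosL L)"
proof -
  assume a: "adapted K L"
  have "PosL L \<subseteq> (\<lambda>(a, b). rt a b) ` (L \<times> L)" by (auto simp: PosL_def)
  then show ?thesis using finite_L[OF a] by (meson finite_SigmaI finite_surj)
qed

lemma adapted_image: assumes "adapted K L" "\<sigma> \<in> G K" shows "\<sigma> ` L = L"
  using assms(2)
proof (induction rule: G_induct)
  case (step i \<sigma>) then show ?case using adapted_pq[OF assms(1) step(1)] by (simp only: image_comp[symmetric])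
qed simp

lemma adapted_mem: assumes "adapted K L" "\<sigma> \<in> G K" shows "\<sigma> a \<in> L \<longleftrightarrow> a \<in> L"
proof -
  have s: "\<sigma> \<in> sperm l" using adapted_sperm[OF assms] .
  show ?thesis using adapted_image[OF assms] sperm_inj[OF s] by (metis imageE imageI)
qed

lemma adapted_order:
  assumes "adapted K L" "\<sigma> \<in> G K" "(a, b) \<in> RI" "\<not> (a \<in> L \<and> b \<in> L)" "\<not> (- a \<in> L \<and> - b \<in> L)"
  shows "(\<sigma> a, \<sigma> b) \<in> RI"
  using assms(2)
proof (induction rule: G_induct)
  case id then show ?case using assms by simp
next
  case (step i \<sigma>)
  have s: "\<sigma> \<in> sperm l" using adapted_sperm[OF assms(1) step(2)] .
  have i: "i \<in> N l" using step(1) adapted_sub[OF assms(1)] by auto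
  have n: "\<not> (\<sigma> a \<in> L \<and> \<sigma> b \<in> L)" "\<not> (- \<sigma> a \<in> L \<and> - \<sigma> b \<in> L)"
    using assms(4,5) adapted_mem[OF assms(1) step(2)] sperm_odd[OF s] by metis+
  have "(\<sigma> a, \<sigma> b) \<noteq> (i, \<bar>i\<bar> + 1)" "(\<sigma> a, \<sigma> b) \<noteq> (- (\<bar>i\<bar> + 1), - i)"
  proof -
    show "(\<sigma> a, \<sigma> b) \<noteq> (i, \<bar>i\<bar> + 1)" using n adapted_pq[OF assms(1) step(1)] by auto
    have "- \<sigma> a = \<bar>i\<bar> + 1" "- \<sigma> b = i" if "(\<sigma> a, \<sigma> b) = (- (\<bar>i\<bar> + 1), - i)" using that by auto
    then show "(\<sigma> a, \<sigma> b) \<noteq> (- (\<bar>i\<bar> + 1), - i)" using n adapted_pq[OF assms(1) step(1)] by metis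
  qed
  then show ?case using sr_less[OF i step(3)] by simp
qed

text \<open>The defining property of the longest element of \<open>W\<^sub>K\<close> that the computations use: it makes all positive roots of \<open>K\<close> negative.\<close>

definition order_reversing :: "int set \<Rightarrow> int set \<Rightarrow> (int \<Rightarrow> int) \<Rightarrow> bool" where
  "order_reversing K L w \<longleftrightarrow> w \<in> G K \<and> (\<forall>a\<in>L. \<forall>b\<in>L. a < b \<longrightarrow> a \<noteq> - b \<longrightarrow> inv w b < inv w a)"

lemma max_length_reversing: assumes ad: "adapted K L" and w: "w \<in> G K" "\<And>\<tau>. \<tau> \<in> G K \<Longrightarrow> ell \<tau> \<le> ell w" shows "order_reversing K L w"
proof -
  have ws: "w \<in> sperm l" using adapted_sperm[OF ad w(1)] .
  have d: "inv w (\<bar>i\<bar> + 1) < inv w i" if i: "i \<in> K" for i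
  proof (rule ccontr)
    assume n: "\<not> ?thesis"
    have iN: "i \<in> N l" using i adapted_sub[OF ad] by auto
    then have "ell (sr i \<circ> w) = Suc (ell w)" using n ell_cases[OF iN ws] by (intro ell_up[OF iN ws]) auto
    then show False using w(2)[OF G_step[OF i w(1)]] by simp
  qed
  have o: "inv w (- x) = - inv w x" for x using sperm_odd[OF sperm_inv[OF ws]] .
  have "\<forall>h::int\<Rightarrow>int. (\<forall>a. h (- a) = - h a) \<longrightarrow> (\<forall>i\<in>K. h i < h (\<bar>i\<bar> + 1)) \<longrightarrow> (\<forall>a\<in>L. \<forall>b\<in>L. a < b \<longrightarrow> a \<noteq> - b \<longrightarrow> h a < h b)"
    using ad by (simp add: adapted_def)
  from this[rule_format, of "\<lambda>x. - inv w x"] have "\<forall>a\<in>L. \<forall>b\<in>L. a < b \<longrightarrow> a \<noteq> - b \<longrightarrow> inv w b < inv w a"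
    using d o by simp
  then show ?thesis using w(1) by (simp add: order_reversing_def)
qed

lemma reversing_fwd: assumes ad: "adapted K L" and w: "order_reversing K L w" and ab: "a \<in> L" "b \<in> L" "a < b" "a \<noteq> - b" shows "w b < w a"
proof (rule ccontr)
  have wG: "w \<in> G K" and ws: "w \<in> sperm l" using w adapted_sperm[OF ad] by (auto simp: order_reversing_def)
  assume "\<not> ?thesis"
  then have "w a < w b" using sperm_inj[OF ws, of a b] ab by linarith
  moreover have "w a \<noteq> - w b" using sperm_odd[OF ws, of b] sperm_inj[OF ws, of a "- b"] ab by auto
  ultimately have "inv w (w b) < inv w (w a)"
    using w ab adapted_mem[OF ad wG] by (auto simp: order_reversing_def)
  then show False using ab by (simp add: sperm_inv_f[OF ws])
qed

lemma inv_roots_subset: assumes ad: "adapted K L" and s: "\<sigma> \<in> G K" shows "inv_roots \<sigma> \<subseteq> PosL L"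
proof
  fix x assume "x \<in> inv_roots \<sigma>"
  then obtain a b where ab: "x = rt a b" "(a, b) \<in> RI" "inv \<sigma> b < inv \<sigma> a" by (auto simp: inv_roots_def)
  have "(a \<in> L \<and> b \<in> L) \<or> (- a \<in> L \<and> - b \<in> L)"
  proof (rule ccontr)
    assume "\<not> ?thesis"
    then have "(inv \<sigma> a, inv \<sigma> b) \<in> RI"
      using adapted_order[OF ad G_inv[OF adapted_sub[OF ad] s] ab(2)] by blast
    then show False using ab(3) by (simp add: RI_def)
  qed
  then show "x \<in> PosL L"
  proof
    assume "a \<in> L \<and> b \<in> L" then show ?thesis using ab by (auto simp: PosL_def RI_def)
  next
    assume "- a \<in> L \<and> - b \<in> L"
    moreover have "x = rt (- b) (- a)" unfolding ab(1) by (rule rt_neg[OF RI_D(1,2)[OF ab(2)], symmetric])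
    moreover have "- b < - a" "- b \<noteq> - (- a)" using ab(2) by (auto simp: RI_def)
    ultimately show ?thesis unfolding PosL_def by blast
  qed
qed

lemma PosL_RI: "adapted K L \<Longrightarrow> a \<in> L \<Longrightarrow> b \<in> L \<Longrightarrow> a < b \<Longrightarrow> a \<noteq> - b \<Longrightarrow> (a, b) \<in> RI"
  using adapted_L[of K L a] adapted_L[of K L b] by (auto simp: RI_def)

lemma inv_roots_reversing: assumes ad: "adapted K L" and w: "order_reversing K L w" shows "inv_roots w = PosL L"
proof
  show "inv_roots w \<subseteq> PosL L" using inv_roots_subset[OF ad] w by (auto simp: order_reversing_def)
  show "PosL L \<subseteq> inv_roots w" using w PosL_RI[OF ad] unfolding PosL_def inv_roots_def order_reversing_def by blast
qed

lemma longest_ex: assumes ad: "adapted K L" shows "\<exists>w. order_reversing K L w \<and> longest l K = (act w :: 'k mpol \<Rightarrow> 'k mpol)"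
proof -
  have K: "K \<subseteq> N l" using adapted_sub[OF ad] .
  let ?P = "parab K :: ('k mpol \<Rightarrow> 'k mpol) set"
  have "finite ?P" "?P \<noteq> {}" unfolding parab_G[OF K] using finite_G[OF K] G_id[of K] by blast+
  then have "Max (len l ` ?P) \<in> len l ` ?P" "\<forall>y\<in>?P. len l y \<le> Max (len l ` ?P)" by simp_all
  then obtain g where "g \<in> ?P" "\<forall>y\<in>?P. len l y \<le> len l g" by auto
  then have "is_arg_max (len l) (\<lambda>x. x \<in> ?P) g" unfolding is_arg_max_def by (auto simp: not_less)
  then have m: "is_arg_max (len l) (\<lambda>x. x \<in> ?P) (longest l K)"
    unfolding longest_def arg_max_def by (rule someI[of "is_arg_max (len l) (\<lambda>x. x \<in> ?P)" g])
  then obtain w where w: "w \<in> G K" "longest l K = (act w :: 'k mpol \<Rightarrow> 'k mpol)"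
    unfolding is_arg_max_def parab_G[OF K] by blast
  have "ell \<tau> \<le> ell w" if "\<tau> \<in> G K" for \<tau>
  proof -
    have "\<not> len l (longest l K :: 'k mpol \<Rightarrow> 'k mpol) < len l (act \<tau> :: 'k mpol \<Rightarrow> 'k mpol)"
      using m that unfolding is_arg_max_def parab_G[OF K] by blast
    then show ?thesis using that w G_mono[OF K] len_ell by (metis linorder_not_less subsetD)
  qed
  then show ?thesis using max_length_reversing[OF ad w(1)] w(2) by blast
qed

lemma reversing_act_prod: assumes ad: "adapted K L" and w: "order_reversing K L w"
  shows "act w (\<Prod>(PosL L)) = (- 1) ^ card (PosL L) * \<Prod>(PosL L)"
proof -
  have wG: "w \<in> G K" and ws: "w \<in> sperm l" using w adapted_sperm[OF ad] by (auto simp: order_reversing_def)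
  have fin: "finite (PosL L)" by (rule finite_PosL[OF ad])
  let ?f = "\<lambda>\<beta> :: 'k mpol. - act w \<beta>"
  have inj: "inj_on ?f (PosL L)" by (auto simp: inj_on_def act_inj[OF ws])
  have "?f ` PosL L \<subseteq> PosL L"
  proof clarify
    fix \<beta> assume "\<beta> \<in> PosL L"
    then obtain a b where ab: "\<beta> = rt a b" "a \<in> L" "b \<in> L" "a < b" "a \<noteq> - b" by (auto simp: PosL_def)
    have "- act w \<beta> = rt (w b) (w a)" unfolding ab(1) act_rt[OF ws] by (simp add: rt_def)
    moreover have "w b < w a" by (rule reversing_fwd[OF ad w ab(2-)])
    moreover have "w b \<noteq> - w a" using sperm_odd[OF ws, of a] sperm_inj[OF ws, of b "- a"] ab by auto
    ultimately show "- act w \<beta> \<in> PosL L" using adapted_mem[OF ad wG] ab unfolding PosL_def by blast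
  qed
  then have im: "?f ` PosL L = PosL L" using inj fin by (simp add: endo_inj_surj)
  have "\<Prod>(PosL L) = (\<Prod>\<beta>\<in>PosL L. ?f \<beta>)" using prod.reindex[OF inj, of id] im by simp
  also have "\<dots> = (\<Prod>\<beta>\<in>PosL L. (- 1) * act w \<beta>)" by simp
  also have "\<dots> = (- 1) ^ card (PosL L) * act w (\<Prod>(PosL L))" unfolding prod.distrib act_prod by simp
  finally have P: "\<Prod>(PosL L) = (- 1) ^ card (PosL L) * act w (\<Prod>(PosL L))" .
  have "(- 1) ^ card (PosL L) * \<Prod>(PosL L) = ((- 1) ^ card (PosL L) * (- 1) ^ card (PosL L)) * act w (\<Prod>(PosL L))"
    unfolding mult.assoc P[symmetric] ..
  also have "(- 1) ^ card (PosL L) * (- 1) ^ card (PosL L) = (1 :: 'k mpol)" by (simp flip: power_add power_mult_distrib)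
  finally show ?thesis by simp
qed

lemma PosL_nz: "adapted K L \<Longrightarrow> \<Prod>(PosL L) \<noteq> 0"
proof -
  assume ad: "adapted K L"
  have "\<beta> \<noteq> 0" if b: "\<beta> \<in> PosL L" for \<beta>
  proof -
    obtain a b where "\<beta> = rt a b" "a \<in> L" "b \<in> L" "a < b" using b unfolding PosL_def by blast
    then show ?thesis using rt_nz[of a b] adapted_L[OF ad] by auto
  qed
  then show ?thesis using finite_PosL[OF ad] by auto
qed

text \<open>The operator is annihilated by every \<open>1 - s\<^sub>i\<close>, as the word can be chosen to begin with \<open>i\<close> and \<open>\<partial>\<^sub>i\<close> has square zero. So its coefficients are
  conjugate to each other under the group, and the leading one is known.\<close>

lemma dem_word_longest:
  assumes ad: "adapted K L" and w: "order_reversing K L g" "set w \<subseteq> N l" "word_perm w = g" "length w = ell g"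
  shows "dem_word w q = (\<Sum>\<sigma>\<in>G K. actF \<sigma> (q / to_fract (\<Prod>(PosL L))))"
proof -
  have K: "K \<subseteq> N l" using adapted_sub[OF ad] .
  have gG: "g \<in> G K" and gs: "g \<in> sperm l" using w adapted_sperm[OF ad] by (auto simp: order_reversing_def)
  let ?pi = "to_fract (\<Prod>(PosL L))"
  have pi0: "?pi \<noteq> 0" using PosL_nz[OF ad] by simp
  obtain v where v: "set v \<subseteq> K" "word_perm v = g" "length v = ell g" using reduced_word_exists[OF ad gG] by blast
  have eq: "dem_word w q = dem_word v q" for q using v w K by (intro dem_word_unique) auto
  obtain c where c: "\<And>q. dem_word v q = (\<Sum>\<sigma>\<in>G K. c \<sigma> * actF \<sigma> q)"
     "length v = ell (word_perm v) \<longrightarrow> c (word_perm v) * to_fract (\<Prod>(inv_roots (word_perm v))) = (- 1) ^ length v"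
    using expansion[OF K v(1)] by blast
  have cg: "c g * ?pi = (- 1) ^ ell g" using c(2) v inv_roots_reversing[OF ad w(1)] by simp
  \<comment> \<open>Invariance of the values under \<open>s\<^sub>i\<close>, transferred to the coefficients by linear independence.\<close>
  have step: "c (sr i \<circ> \<sigma>) = actF (sr i) (c \<sigma>)" if i: "i \<in> K" and s: "\<sigma> \<in> G K" for i \<sigma>
  proof -
    have iN: "i \<in> N l" using i K by auto
    note si = sr_sperm[OF iN]
    have lt: "inv g (\<bar>i\<bar> + 1) < inv g i"
      using w(1) adapted_pq[OF ad i] iN by (auto simp: order_reversing_def N_iff)
    have l: "ell g = Suc (ell (sr i \<circ> g))" by (rule ell_down[OF iN gs lt])
    obtain u where u: "set u \<subseteq> K" "word_perm u = sr i \<circ> g" "length u = ell (sr i \<circ> g)" using reduced_word_exists[OF ad G_step[OF i gG]] by blast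
    have su: "word_perm (i # u) = g" unfolding word_perm_Cons u comp_assoc[symmetric] sr_invol'[OF iN] by simp
    have inv: "actF (sr i) (dem_word v q) = dem_word v q" for q
    proof -
      have "dem_word v q = dem_word (i # u) q" using v u su l i K by (intro dem_word_unique) auto
      then have "demF i (dem_word v q) = 0" using demF_DF[OF iN] by simp
      then show ?thesis using demF_invariant[OF iN] by simp
    qed
    have ii: "sr i \<circ> (sr i \<circ> \<sigma>) = \<sigma>" for \<sigma> :: "int \<Rightarrow> int" unfolding comp_assoc[symmetric] sr_invol'[OF iN] by simp
    have "(\<Sum>\<sigma>\<in>G K. (c \<sigma> - actF (sr i) (c (sr i \<circ> \<sigma>))) * to_fract (act \<sigma> h)) = 0" for h
    proof -
      have "actF (sr i) (dem_word v (to_fract h)) = (\<Sum>\<sigma>\<in>G K. actF (sr i) (c \<sigma>) * actF (sr i \<circ> \<sigma>) (to_fract h))"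
        unfolding c(1) actF_sum[OF si] using G_sperm[OF K]
        by (intro sum.cong refl) (auto simp: actF_mult[OF si] actF_comp[OF si] simp del: comp_apply)
      also have "\<dots> = (\<Sum>\<sigma>\<in>G K. actF (sr i) (c (sr i \<circ> \<sigma>)) * actF \<sigma> (to_fract h))"
        using G_reindex[OF K i, of "\<lambda>\<sigma>. actF (sr i) (c (sr i \<circ> \<sigma>)) * actF \<sigma> (to_fract h)"] unfolding ii .
      finally have "(\<Sum>\<sigma>\<in>G K. c \<sigma> * actF \<sigma> (to_fract h)) = (\<Sum>\<sigma>\<in>G K. actF (sr i) (c (sr i \<circ> \<sigma>)) * actF \<sigma> (to_fract h))"
        unfolding inv unfolding c(1) .
      then have "(\<Sum>\<sigma>\<in>G K. (c \<sigma> - actF (sr i) (c (sr i \<circ> \<sigma>))) * actF \<sigma> (to_fract h)) = 0"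
        by (simp add: sum_subtractf left_diff_distrib del: comp_apply)
      moreover have "actF \<sigma> (to_fract h) = to_fract (act \<sigma> h)" if "\<sigma> \<in> G K" for \<sigma>
        using that G_sperm[OF K] actF_to_fract[of \<sigma> l] by blast
      ultimately show ?thesis by simp
    qed
    from dedekind[OF finite_G[OF K] G_sperm[OF K] this G_step[OF i s]]
    show ?thesis unfolding ii by simp
  qed
  have cs: "c \<sigma> = actF \<sigma> (c id)" if "\<sigma> \<in> G K" for \<sigma>
    using that
  proof (induction rule: G_induct)
    case (step i \<sigma>)
    have "i \<in> N l" "\<sigma> \<in> sperm l" using step K G_sperm[OF K] by auto
    then show ?case using step \<open>\<And>\<sigma> i. i \<in> K \<Longrightarrow> \<sigma> \<in> G K \<Longrightarrow> c (sr i \<circ> \<sigma>) = actF (sr i) (c \<sigma>)\<close>[OF step(1,2)]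
      by (simp add: actF_comp[OF sr_sperm] del: comp_apply)
  next
    case id show ?case unfolding actF_id ..
  qed
  have N: "ell g = card (PosL L)" unfolding ell_def inv_roots_reversing[OF ad w(1)] ..
  have "actF g ?pi = (- 1) ^ card (PosL L) * ?pi"
    unfolding actF_to_fract[OF gs] reversing_act_prod[OF ad w(1)] by (cases "even (card (PosL L))") simp_all
  then have "actF g (c id * ?pi) = (- 1) ^ card (PosL L) * (c g * ?pi)"
    unfolding actF_mult[OF gs] cs[OF gG] by (simp add: algebra_simps)
  also have "\<dots> = 1" unfolding cg N by (simp flip: power_add power_mult_distrib)
  finally have "actF g (c id * ?pi) = actF g 1" using gs by (simp add: actF_1[OF gs])
  then have "c id * ?pi = 1" using actF_inj[OF gs] by blast
  then have cid: "c id = 1 / ?pi" using pi0 by (simp add: nonzero_eq_divide_eq)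
  have "dem_word v q = (\<Sum>\<sigma>\<in>G K. actF \<sigma> (q / ?pi))" unfolding c(1)
  proof (rule sum.cong[OF refl])
    fix \<sigma> assume s: "\<sigma> \<in> G K"
    then have ss: "\<sigma> \<in> sperm l" using G_sperm[OF K] by auto
    show "c \<sigma> * actF \<sigma> q = actF \<sigma> (q / ?pi)" unfolding cs[OF s] cid actF_mult[OF ss, symmetric] by simp
  qed
  then show ?thesis unfolding eq .
qed

text \<open>The product of the positive roots of \<open>K\<close> that are not roots of \<open>J\<close>.\<close>

definition quot_rootsF :: "int set \<Rightarrow> int set \<Rightarrow> 'k mpol fract" where
  "quot_rootsF LJ LK = to_fract (\<Prod>(PosL LK - PosL LJ))"

text \<open>The lengths add in \<open>w\<^sub>K = (w\<^sub>K w\<^sub>J\<inverse>) w\<^sub>J\<close>, so the trace precomposed with \<open>\<partial>\<^bsub>w\<^sub>J\<^esub>\<close> is \<open>\<partial>\<^bsub>w\<^sub>K\<^esub>\<close>. The formula is stated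
  for any way of writing \<open>f\<close> as a sum over \<open>W\<^sub>J\<close>, which avoids a choice of coset representatives.\<close>

theorem trace_as_group_sum:
  assumes adJ: "adapted J LJ" and adK: "adapted K LK" and JK: "J \<subseteq> K" "LJ \<subseteq> LK"
    and f: "f \<in> Rl l" and q: "(\<Sum>\<sigma>\<in>G J. actF \<sigma> q) = to_fract f"
  shows "tr l J K f \<in> Rl l" "to_fract (tr l J K f) = (\<Sum>\<sigma>\<in>G K. actF \<sigma> (q / quot_rootsF LJ LK))"
proof -
  have K: "K \<subseteq> N l" and J: "J \<subseteq> N l" using adapted_sub adJ adK by auto
  obtain wK where wK: "order_reversing K LK wK" "longest l K = (act wK :: 'k mpol \<Rightarrow> 'k mpol)" using longest_ex[OF adK] by blast
  obtain wJ where wJ: "order_reversing J LJ wJ" "longest l J = (act wJ :: 'k mpol \<Rightarrow> 'k mpol)" using longest_ex[OF adJ] by blast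
  have wKG: "wK \<in> G K" and wJG: "wJ \<in> G J" using wK wJ by (auto simp: order_reversing_def)
  have wJK: "wJ \<in> G K" using wJG G_mono[OF JK(1)] by auto
  have wKs: "wK \<in> sperm l" and wJs: "wJ \<in> sperm l" using adapted_sperm adJ adK wKG wJG by auto
  define h where "h = wK \<circ> inv wJ"
  have hK: "h \<in> G K" unfolding h_def by (intro G_comp wKG G_inv[OF K wJK])
  have hN: "h \<in> G (N l)" using hK G_mono[OF K] by auto
  have hs: "h \<in> sperm l" using hK adapted_sperm[OF adK] by auto
  have "inv (longest l J) = (act (inv wJ) :: 'k mpol \<Rightarrow> 'k mpol)"
    unfolding wJ(2) by (rule inv_equality) (simp_all add: act_inv[OF wJs])
  then have he: "longest l K \<circ> inv (longest l J) = (act h :: 'k mpol \<Rightarrow> 'k mpol)"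
    unfolding wK(2) h_def by (simp add: fun_eq_iff act_comp[OF wKs] del: comp_apply) (simp add: act_comp[OF wKs])
  define w where "w = (SOME w. reduced_expr l w (longest l K \<circ> inv (longest l J) :: 'k mpol \<Rightarrow> 'k mpol))"
  have "\<exists>w. reduced_expr l w (act h :: 'k mpol \<Rightarrow> 'k mpol)" unfolding reduced_expr_iff[OF hN] by (rule reduced_word_exists_N[OF hN])
  then have "reduced_expr l w (act h :: 'k mpol \<Rightarrow> 'k mpol)" unfolding w_def he by (rule someI_ex)
  then have w: "set w \<subseteq> N l" "word_perm w = h" "length w = ell h" unfolding reduced_expr_iff[OF hN] by auto
  have tr: "tr l J K f = foldr demazure w f" by (simp add: tr_def w_def)
  note fd = foldr_demazure[OF w(1) f]
  show "tr l J K f \<in> Rl l" using fd tr by simp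
  obtain v where v: "set v \<subseteq> J" "word_perm v = wJ" "length v = ell wJ" using reduced_word_exists[OF adJ wJG] by blast
  have swv: "word_perm (w @ v) = wK" unfolding word_perm_append w v h_def comp_assoc sperm_inv_o[OF wJs] by simp
  have PJK: "PosL LJ \<subseteq> PosL LK" using JK(2) by (auto simp: PosL_def)
  have "ell h = ell (inv h)" using ell_inv[OF hN] by simp
  also have "\<dots> \<le> card (PosL LK - PosL LJ)"
    unfolding ell_def
  proof (rule card_mono)
    show "finite (PosL LK - PosL LJ)" using finite_PosL[OF adK] by simp
    show "inv_roots (inv h) \<subseteq> PosL LK - PosL LJ"
    proof
      fix x assume x: "x \<in> inv_roots (inv h)"
      \<comment> \<open>A positive root of \<open>J\<close> stays positive under \<open>h\<close>: the inverse of \<open>w\<^sub>J\<close> makes it negative and \<open>w\<^sub>K\<close> then makes it positive again.\<close>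
      have "x \<notin> PosL LJ"
      proof
        assume "x \<in> PosL LJ"
        then obtain a b where ab: "x = rt a b" "a \<in> LJ" "b \<in> LJ" "a < b" "a \<noteq> - b" by (auto simp: PosL_def)
        from x obtain c d where cd: "x = rt c d" "(c, d) \<in> RI" "h d < h c"
          unfolding inv_roots_def sperm_inv_inv[OF hs] by blast
        have "(a = c \<and> b = d) \<or> (a = - d \<and> b = - c)"
          using rt_eq_iff[THEN iffD1, OF RI_D[OF PosL_RI[OF adJ ab(2-)]] RI_D[OF cd(2)]] ab(1) cd(1) by simp
        then have "h b < h a" using cd(3) sperm_odd[OF hs] by auto
        moreover have "inv wJ b < inv wJ a" using wJ(1) ab by (auto simp: order_reversing_def)
        moreover have "inv wJ a \<in> LK" "inv wJ b \<in> LK" using ab adapted_mem[OF adJ G_inv[OF J wJG]] JK(2) by blast+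
        moreover have "inv wJ b \<noteq> - inv wJ a"
          using sperm_odd[OF sperm_inv[OF wJs], of a] sperm_inj[OF sperm_inv[OF wJs], of b "- a"] ab(5) by auto
        ultimately show False using reversing_fwd[OF adK wK(1), of "inv wJ b" "inv wJ a"] by (simp add: h_def)
      qed
      then show "x \<in> PosL LK - PosL LJ" using inv_roots_subset[OF adK G_inv[OF K hK]] x by blast
    qed
  qed
  also have "\<dots> = ell wK - ell wJ"
    using card_Diff_subset[OF finite_PosL[OF adJ] PJK] by (simp add: ell_def inv_roots_reversing[OF adJ wJ(1)] inv_roots_reversing[OF adK wK(1)])
  finally have "length (w @ v) \<le> ell wK"
    using w v card_mono[OF finite_PosL[OF adK] PJK] by (simp add: ell_def inv_roots_reversing[OF adJ wJ(1)] inv_roots_reversing[OF adK wK(1)])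
  moreover have wv: "set (w @ v) \<subseteq> N l" using w v J by auto
  ultimately have len: "length (w @ v) = ell wK" using ell_le_length[OF wv] swv by simp
  have vN: "set v \<subseteq> N l" using v J by auto
  define piJ where "piJ = to_fract (\<Prod>(PosL LJ))"
  define piK where "piK = to_fract (\<Prod>(PosL LK))"
  have J0: "piJ \<noteq> 0" using PosL_nz[OF adJ] by (simp add: piJ_def)
  have "dem_word v (q * piJ) = to_fract f"
    using dem_word_longest[OF adJ wJ(1) vN v(2,3)] J0 q by (simp add: piJ_def[symmetric])
  then have "to_fract (tr l J K f) = dem_word (w @ v) (q * piJ)" using fd by (simp add: tr dem_word_append)
  also have "\<dots> = (\<Sum>\<sigma>\<in>G K. actF \<sigma> (q * piJ / piK))"
    using dem_word_longest[OF adK wK(1) wv swv len] by (simp add: piK_def)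
  also have "piK = quot_rootsF LJ LK * piJ"
    unfolding piK_def quot_rootsF_def piJ_def using prod.subset_diff[OF PJK finite_PosL[OF adK], of "\<lambda>x. x"] by simp
  finally show "to_fract (tr l J K f) = (\<Sum>\<sigma>\<in>G K. actF \<sigma> (q / quot_rootsF LJ LK))" using J0 by simp
qed

end

section \<open>Linearity of traces and orthogonality of dual bases\<close>

context typeD begin

lemma G_reindex_left: assumes K: "K \<subseteq> N l" and t: "\<tau> \<in> G K"
  shows "(\<Sum>\<sigma>\<in>G K. f (\<tau> \<circ> \<sigma>)) = (\<Sum>\<sigma>\<in>G K. f \<sigma>)"
proof (rule sum.reindex_bij_witness[of _ "\<lambda>\<sigma>. inv \<tau> \<circ> \<sigma>" "\<lambda>\<sigma>. \<tau> \<circ> \<sigma>"])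
  have s: "\<tau> \<in> sperm l" using G_sperm[OF K] t by auto
  show "inv \<tau> \<circ> (\<tau> \<circ> a) = a" "\<tau> \<circ> (inv \<tau> \<circ> a) = a" for a
    unfolding comp_assoc[symmetric] sperm_inv_o[OF s] sperm_o_inv[OF s] by simp_all
  show "inv \<tau> \<circ> a \<in> G K" "\<tau> \<circ> a \<in> G K" if "a \<in> G K" for a
    using that t G_inv[OF K t] by (auto intro!: G_comp simp del: comp_apply)
qed simp

text \<open>Writes the constant 1 as a sum over \<open>W\<^sub>J\<close> without dividing by the order of the group, which may vanish in the
  field: by linear independence some polynomial has a nonzero orbit sum, and one divides by that sum.\<close>

lemma unit_trace_exists: assumes ad: "adapted J LJ" shows "\<exists>q :: 'k mpol fract. (\<Sum>\<sigma>\<in>G J. actF \<sigma> q) = 1"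
proof -
  have J: "J \<subseteq> N l" using adapted_sub[OF ad] .
  have "\<exists>h \<in> Rl l. (\<Sum>\<sigma>\<in>G J. 1 * to_fract (act \<sigma> (h :: 'k mpol))) \<noteq> 0"
  proof (rule ccontr)
    assume "\<not> ?thesis"
    then have "(1 :: 'k mpol fract) = 0" by (intro dedekind[OF finite_G[OF J] G_sperm[OF J] _ G_id]) auto
    then show False by simp
  qed
  then obtain h where h: "(\<Sum>\<sigma>\<in>G J. to_fract (act \<sigma> (h :: 'k mpol))) \<noteq> 0" by auto
  define s where "s = (\<Sum>\<sigma>\<in>G J. actF \<sigma> (to_fract h))"
  have s0: "s \<noteq> 0"
  proof -
    have "s = (\<Sum>\<sigma>\<in>G J. to_fract (act \<sigma> h))" unfolding s_def
      using G_sperm[OF J] by (intro sum.cong refl actF_to_fract) auto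
    then show ?thesis using h by simp
  qed
  have inv: "actF \<tau> s = s" if t: "\<tau> \<in> G J" for \<tau>
  proof -
    have ts: "\<tau> \<in> sperm l" using t G_sperm[OF J] by auto
    have "actF \<tau> s = (\<Sum>\<sigma>\<in>G J. actF (\<tau> \<circ> \<sigma>) (to_fract h))" unfolding s_def actF_sum[OF ts]
      using G_sperm[OF J] by (intro sum.cong refl actF_comp[OF ts]) auto
    also have "\<dots> = s" unfolding s_def by (rule G_reindex_left[OF J t])
    finally show ?thesis .
  qed
  have "(\<Sum>\<sigma>\<in>G J. actF \<sigma> (to_fract h / s)) = (\<Sum>\<sigma>\<in>G J. actF \<sigma> (to_fract h) / s)"
  proof (intro sum.cong refl)
    fix \<sigma> assume s: "\<sigma> \<in> G J"
    then have ss: "\<sigma> \<in> sperm l" using G_sperm[OF J] by auto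
    show "actF \<sigma> (to_fract h / s) = actF \<sigma> (to_fract h) / s" by (simp only: actF_divide[OF ss] inv[OF s])
  qed
  also have "\<dots> = 1" using s0 by (simp add: sum_divide_distrib[symmetric] s_def)
  finally show ?thesis by blast
qed

lemma actF_inv_ring: "K \<subseteq> N l \<Longrightarrow> f \<in> inv_ring l K \<Longrightarrow> \<sigma> \<in> G K \<Longrightarrow> actF \<sigma> (to_fract f) = (to_fract f :: 'k mpol fract)"
  using G_sperm[of K] actF_to_fract[of \<sigma> l f] inv_ring_iff[of K f] by auto

lemma inv_ring_Rl: "f \<in> inv_ring l K \<Longrightarrow> f \<in> Rl l" by (simp add: inv_ring_def)

lemma inv_ring_act: "K \<subseteq> N l \<Longrightarrow> f \<in> inv_ring l K \<Longrightarrow> \<sigma> \<in> G K \<Longrightarrow> act \<sigma> f = (f :: 'k mpol)"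
  by (simp add: inv_ring_iff)

lemma inv_ring_mono: "J \<subseteq> K \<Longrightarrow> K \<subseteq> N l \<Longrightarrow> inv_ring l K \<subseteq> (inv_ring l J :: 'k mpol set)"
  using inv_ring_iff'[of K] inv_ring_iff'[of J] by blast

lemma inv_ring_closed:
  assumes K: "K \<subseteq> N l"
  shows "f \<in> inv_ring l K \<Longrightarrow> g \<in> inv_ring l K \<Longrightarrow> f + g \<in> (inv_ring l K :: 'k mpol set)"
    "f \<in> inv_ring l K \<Longrightarrow> g \<in> inv_ring l K \<Longrightarrow> f * g \<in> (inv_ring l K :: 'k mpol set)"
    "f \<in> inv_ring l K \<Longrightarrow> - f \<in> (inv_ring l K :: 'k mpol set)"
    "0 \<in> (inv_ring l K :: 'k mpol set)" "1 \<in> (inv_ring l K :: 'k mpol set)"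
  by (auto simp: inv_ring_iff'[OF K] act_add act_mult act_uminus intro: Rl_add Rl_mult Rl_uminus)

lemma inv_ring_sum: "K \<subseteq> N l \<Longrightarrow> (\<And>a. a \<in> A \<Longrightarrow> f a \<in> inv_ring l K) \<Longrightarrow> sum f A \<in> (inv_ring l K :: 'k mpol set)"
  by (induction A rule: infinite_finite_induct) (auto intro: inv_ring_closed)

context
  fixes J K LJ LK
  assumes adJ: "adapted J LJ" and adK: "adapted K LK" and JK: "J \<subseteq> K" "LJ \<subseteq> LK"
begin

lemma JN: "J \<subseteq> N l" and KN: "K \<subseteq> N l" using adapted_sub adJ adK by auto

lemma tr_formula:
  fixes q :: "'k mpol fract" and f :: "'k mpol"
  assumes q: "(\<Sum>\<sigma>\<in>G J. actF \<sigma> q) = 1" and f: "f \<in> inv_ring l J"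
  shows "tr l J K f \<in> Rl l" "to_fract (tr l J K f) = (\<Sum>\<sigma>\<in>G K. actF \<sigma> (q * to_fract f / quot_rootsF LJ LK))"
proof -
  have "(\<Sum>\<sigma>\<in>G J. actF \<sigma> (q * to_fract f)) = (\<Sum>\<sigma>\<in>G J. actF \<sigma> q * to_fract f)"
  proof (intro sum.cong refl)
    fix \<sigma> assume s: "\<sigma> \<in> G J"
    then have "\<sigma> \<in> sperm l" using G_sperm[OF JN] by auto
    from actF_mult[OF this, of q "to_fract f"] show "actF \<sigma> (q * to_fract f) = actF \<sigma> q * to_fract f" unfolding actF_inv_ring[OF JN f s] .
  qed
  also have "\<dots> = to_fract f" by (simp add: sum_distrib_right[symmetric] q)
  finally have "(\<Sum>\<sigma>\<in>G J. actF \<sigma> (q * to_fract f)) = to_fract f" .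
  from trace_as_group_sum[OF adJ adK JK inv_ring_Rl[OF f] this]
  show "tr l J K f \<in> Rl l" "to_fract (tr l J K f) = (\<Sum>\<sigma>\<in>G K. actF \<sigma> (q * to_fract f / quot_rootsF LJ LK))" .
qed

lemma tr_inv: fixes f :: "'k mpol" assumes f: "f \<in> inv_ring l J" shows "tr l J K f \<in> inv_ring l K"
proof -
  obtain q :: "'k mpol fract" where q: "(\<Sum>\<sigma>\<in>G J. actF \<sigma> q) = 1" using unit_trace_exists[OF adJ] by blast
  note t = tr_formula[OF q f]
  have "act \<tau> (tr l J K f) = tr l J K f" if tK: "\<tau> \<in> G K" for \<tau>
  proof -
    have ts: "\<tau> \<in> sperm l" using tK G_sperm[OF KN] by auto
    have "to_fract (act \<tau> (tr l J K f)) = (\<Sum>\<sigma>\<in>G K. actF (\<tau> \<circ> \<sigma>) (q * to_fract f / quot_rootsF LJ LK))"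
      unfolding actF_to_fract[OF ts, symmetric] t(2) actF_sum[OF ts]
      using G_sperm[OF KN] by (intro sum.cong refl actF_comp[OF ts]) auto
    also have "\<dots> = to_fract (tr l J K f)" unfolding t(2) by (rule G_reindex_left[OF KN tK])
    finally show ?thesis by simp
  qed
  then show ?thesis using t(1) by (simp add: inv_ring_iff[OF KN])
qed

lemma tr_add: fixes f g :: "'k mpol" assumes "f \<in> inv_ring l J" "g \<in> inv_ring l J" shows "tr l J K (f + g) = tr l J K f + tr l J K g"
proof -
  obtain q :: "'k mpol fract" where q: "(\<Sum>\<sigma>\<in>G J. actF \<sigma> q) = 1" using unit_trace_exists[OF adJ] by blast
  have "to_fract (tr l J K (f + g)) = to_fract (tr l J K f + tr l J K g)"
    unfolding to_fract_add tr_formula(2)[OF q assms(1)] tr_formula(2)[OF q assms(2)] tr_formula(2)[OF q inv_ring_closed(1)[OF JN assms]] sum.distrib[symmetric]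
  proof (intro sum.cong refl)
    fix \<sigma> assume "\<sigma> \<in> G K"
    then have "\<sigma> \<in> sperm l" using G_sperm[OF KN] by auto
    from actF_add[OF this] show "actF \<sigma> (q * (to_fract f + to_fract g) / quot_rootsF LJ LK) = actF \<sigma> (q * to_fract f / quot_rootsF LJ LK) + actF \<sigma> (q * to_fract g / quot_rootsF LJ LK)"
      unfolding distrib_left add_divide_distrib .
  qed
  then show ?thesis by (simp only: to_fract_eq_iff)
qed

lemma tr_linear: fixes f r :: "'k mpol" assumes "r \<in> inv_ring l K" "f \<in> inv_ring l J" shows "tr l J K (r * f) = r * tr l J K f"
proof -
  obtain q :: "'k mpol fract" where q: "(\<Sum>\<sigma>\<in>G J. actF \<sigma> q) = 1" using unit_trace_exists[OF adJ] by blast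
  have rJ: "r \<in> inv_ring l J" using assms(1) inv_ring_mono[OF JK(1) KN] by auto
  have "to_fract (tr l J K (r * f)) = to_fract (r * tr l J K f)"
    unfolding to_fract_mult tr_formula(2)[OF q assms(2)] tr_formula(2)[OF q inv_ring_closed(2)[OF JN rJ assms(2)]] sum_distrib_left
  proof (intro sum.cong refl)
    fix \<sigma> assume s: "\<sigma> \<in> G K"
    then have ss: "\<sigma> \<in> sperm l" using G_sperm[OF KN] by auto
    have "actF \<sigma> (to_fract r * (q * to_fract f / quot_rootsF LJ LK)) = to_fract r * actF \<sigma> (q * to_fract f / quot_rootsF LJ LK)"
      unfolding actF_mult[OF ss] actF_inv_ring[OF KN assms(1) s] ..
    then show "actF \<sigma> (q * (to_fract r * to_fract f) / quot_rootsF LJ LK) = to_fract r * actF \<sigma> (q * to_fract f / quot_rootsF LJ LK)"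
      by (simp add: algebra_simps)
  qed
  then show ?thesis by (simp only: to_fract_eq_iff)
qed

lemma tr_0: "tr l J K 0 = (0 :: 'k mpol)"
proof -
  have "tr l J K 0 + 0 = tr l J K 0 + (tr l J K 0 :: 'k mpol)" using tr_add[of 0 0] inv_ring_closed(4)[OF JN] by (simp only: add_0_right)
  then show ?thesis by (simp only: add_left_cancel)
qed

lemma tr_sum: fixes f :: "_ \<Rightarrow> 'k mpol" shows "(\<And>a. a \<in> A \<Longrightarrow> f a \<in> inv_ring l J) \<Longrightarrow> tr l J K (sum f A) = (\<Sum>a\<in>A. tr l J K (f a))"
proof (induction A rule: infinite_finite_induct)
  case (insert x F)
  then show ?case using tr_add[of "f x" "sum f F"] inv_ring_sum[OF JN, of F f] by simp
qed (simp_all add: tr_0)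

lemma PosL_diff_image: assumes t: "\<tau> \<in> G J" shows "act \<tau> ` (PosL LK - PosL LJ) = PosL LK - PosL LJ"
proof -
  have ts: "\<tau> \<in> sperm l" using t G_sperm[OF JN] by auto
  have tK: "\<tau> \<in> G K" using t G_mono[OF JK(1)] by auto
  have "act \<tau> ` (PosL LK - PosL LJ) \<subseteq> PosL LK - PosL LJ"
  proof clarify
    fix \<beta> assume b: "\<beta> \<in> PosL LK" "\<beta> \<notin> PosL LJ"
    then obtain a b where ab: "\<beta> = rt a b" "a \<in> LK" "b \<in> LK" "a < b" "a \<noteq> - b" unfolding PosL_def by blast
    have RI: "(a, b) \<in> RI" using PosL_RI[OF adK ab(2-)] .
    have n1: "\<not> (a \<in> LJ \<and> b \<in> LJ)" using b(2) ab unfolding PosL_def by blast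
    have n2: "\<not> (- a \<in> LJ \<and> - b \<in> LJ)"
    proof
      assume "- a \<in> LJ \<and> - b \<in> LJ"
      moreover have "\<beta> = rt (- b) (- a)" unfolding ab(1) by (rule rt_neg[OF RI_D(1,2)[OF RI], symmetric])
      moreover have "- b < - a" "- b \<noteq> - (- a)" using ab by auto
      ultimately have "\<beta> \<in> PosL LJ" unfolding PosL_def by blast
      then show False using b(2) by blast
    qed
    have R2: "(\<tau> a, \<tau> b) \<in> RI" by (rule adapted_order[OF adJ t RI n1 n2])
    have e: "act \<tau> \<beta> = rt (\<tau> a) (\<tau> b)" unfolding ab(1) by (rule act_rt[OF ts])
    have "act \<tau> \<beta> \<in> PosL LK" unfolding e using R2 adapted_mem[OF adK tK] ab unfolding PosL_def RI_def by blast
    moreover have "act \<tau> \<beta> \<notin> PosL LJ"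
    proof
      assume "act \<tau> \<beta> \<in> PosL LJ"
      then obtain c d where cd: "rt (\<tau> a) (\<tau> b) = (rt c d :: 'k mpol)" "c \<in> LJ" "d \<in> LJ" "c < d" "c \<noteq> - d" unfolding e PosL_def by blast
      have "(\<tau> a = c \<and> \<tau> b = d) \<or> (\<tau> a = - d \<and> \<tau> b = - c)"
        using rt_eq_iff[THEN iffD1, OF RI_D[OF R2] RI_D[OF PosL_RI[OF adJ cd(2-)]] cd(1)] .
      then show False
      proof
        assume "\<tau> a = c \<and> \<tau> b = d"
        then have "a \<in> LJ \<and> b \<in> LJ" using adapted_mem[OF adJ t] cd(2,3) by blast
        then show False using n1 by blast
      next
        assume "\<tau> a = - d \<and> \<tau> b = - c"
        then have "\<tau> (- a) = d" "\<tau> (- b) = c" using sperm_odd[OF ts] by auto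
        then have "- a \<in> LJ \<and> - b \<in> LJ" using adapted_mem[OF adJ t, of "- a"] adapted_mem[OF adJ t, of "- b"] cd(2,3) by blast
        then show False using n2 by blast
      qed
    qed
    ultimately show "act \<tau> \<beta> \<in> PosL LK - PosL LJ" by blast
  qed
  moreover have "inj_on (act \<tau>) (PosL LK - PosL LJ)" using act_inj[OF ts] by (auto simp: inj_on_def)
  ultimately show ?thesis using finite_PosL[OF adK] by (intro endo_inj_surj) auto
qed

lemma quot_roots_invariant: assumes t: "\<tau> \<in> G J" shows "act \<tau> (\<Prod>(PosL LK - PosL LJ)) = \<Prod>(PosL LK - PosL LJ)"
proof -
  have ts: "\<tau> \<in> sperm l" using t G_sperm[OF JN] by auto
  have inj: "inj_on (act \<tau>) (PosL LK - PosL LJ)" using act_inj[OF ts] by (auto simp: inj_on_def)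
  show ?thesis unfolding act_prod using prod.reindex[OF inj, of id] PosL_diff_image[OF t] by simp
qed

lemma quot_rootsF_nz: "quot_rootsF LJ LK \<noteq> 0"
proof -
  have "PosL LJ \<subseteq> PosL LK" using JK(2) by (auto simp: PosL_def)
  then have "\<Prod>(PosL LK) = \<Prod>(PosL LK - PosL LJ) * \<Prod>(PosL LJ)" by (rule prod.subset_diff[OF _ finite_PosL[OF adK]])
  then show ?thesis using PosL_nz[OF adK] by (auto simp: quot_rootsF_def)
qed

lemma actF_quot_rootsF: "\<tau> \<in> G J \<Longrightarrow> actF \<tau> (quot_rootsF LJ LK) = quot_rootsF LJ LK"
proof -
  assume t: "\<tau> \<in> G J"
  then have ts: "\<tau> \<in> sperm l" using G_sperm[OF JN] by auto
  show ?thesis unfolding quot_rootsF_def by (simp only: actF_to_fract[OF ts] quot_roots_invariant[OF t])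
qed

text \<open>The coefficient of \<open>d b\<close> is found by applying the trace to the product with \<open>b\<close>.\<close>

lemma dual_expand:
  fixes f :: "'k mpol" and d :: "'k mpol \<Rightarrow> 'k mpol"
  assumes B: "dual_hom_bases l J K B d" and f: "f \<in> inv_ring l J"
  shows "f = (\<Sum>b\<in>B. tr l J K (f * b) * d b)"
proof -
  have hb: "finite B" "B \<subseteq> inv_ring l J" "d ` B \<subseteq> inv_ring l J" "inj_on d B"
    using B by (auto simp: dual_hom_bases_def hom_basis_def)
  obtain r where r: "r \<in> d ` B \<rightarrow>\<^sub>E inv_ring l K" "f = (\<Sum>b\<in>d ` B. r b * b)"
    using B f unfolding dual_hom_bases_def hom_basis_def by meson
  have rK: "r (d b) \<in> inv_ring l K" if "b \<in> B" for b using r(1) that by (auto simp: PiE_def Pi_def)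
  have f': "f = (\<Sum>b\<in>B. r (d b) * d b)" using r(2) by (simp add: sum.reindex[OF hb(4)])
  have db: "d b \<in> inv_ring l J" "b \<in> inv_ring l J" if "b \<in> B" for b using hb that by auto
  have "tr l J K (f * a) = r (d a)" if a: "a \<in> B" for a
  proof -
    have "tr l J K (f * a) = tr l J K (\<Sum>b\<in>B. r (d b) * (a * d b))"
      unfolding f' sum_distrib_right by (intro arg_cong[of _ _ "tr l J K"] sum.cong refl) (simp add: mult_ac)
    also have "\<dots> = (\<Sum>b\<in>B. tr l J K (r (d b) * (a * d b)))"
    proof (rule tr_sum)
      fix b assume b: "b \<in> B"
      have "r (d b) \<in> inv_ring l J" using rK[OF b] inv_ring_mono[OF JK(1) KN] by blast
      then show "r (d b) * (a * d b) \<in> inv_ring l J" using db[OF b] db[OF a] by (intro inv_ring_closed[OF JN])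
    qed
    also have "\<dots> = (\<Sum>b\<in>B. r (d b) * (if a = b then 1 else 0))"
    proof (intro sum.cong refl)
      fix b assume b: "b \<in> B"
      have "tr l J K (r (d b) * (a * d b)) = r (d b) * tr l J K (a * d b)"
        by (rule tr_linear[OF rK[OF b] inv_ring_closed(2)[OF JN db(2)[OF a] db(1)[OF b]]])
      moreover have "tr l J K (a * d b) = (if a = b then 1 else 0)" using B a b by (auto simp: dual_hom_bases_def)
      ultimately show "tr l J K (r (d b) * (a * d b)) = r (d b) * (if a = b then 1 else 0)" by simp
    qed
    also have "\<dots> = r (d a)" using a hb(1) by (simp add: if_distrib cong: if_cong)
    finally show ?thesis .
  qed
  then show ?thesis using f' by simp
qed

text \<open>The expansion of the orbit sum of \<open>h\<close> over \<open>W\<^sub>J\<close> in the dual basis compares two linear combinations of the \<open>\<sigma> h\<close> over \<open>W\<^sub>K\<close> for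
  every \<open>h\<close>; linear independence identifies the coefficients.\<close>

lemma dual_bases_orthogonal:
  fixes d :: "'k mpol \<Rightarrow> 'k mpol"
  assumes B: "dual_hom_bases l J K B d" and u: "u \<in> G K"
  shows "(\<Sum>b\<in>B. act u b * d b) = (if u \<in> G J then \<Prod>(PosL LK - PosL LJ) else 0)"
proof -
  have hb: "B \<subseteq> inv_ring l J" using B by (auto simp: dual_hom_bases_def hom_basis_def)
  have sp: "\<sigma> \<in> sperm l" if "\<sigma> \<in> G K" for \<sigma> using that G_sperm[OF KN] by auto
  define D where "D \<sigma> = (\<Sum>b\<in>B. to_fract (act \<sigma> b) * to_fract (d b))" for \<sigma>
  let ?pi = "quot_rootsF LJ LK"
  \<comment> \<open>The difference of the two coefficients of \<open>\<sigma> h\<close>, to be shown zero.\<close>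
  define c where "c \<sigma> = D \<sigma> / actF \<sigma> ?pi - (if \<sigma> \<in> G J then 1 else 0)" for \<sigma>
  have "c u = 0"
  proof (rule dedekind[OF finite_G[OF KN] G_sperm[OF KN] _ u])
    fix h :: "'k mpol" assume h: "h \<in> Rl l"
    define f where "f = (\<Sum>\<sigma>\<in>G J. act \<sigma> h)"
    have Jsp: "\<sigma> \<in> sperm l" if "\<sigma> \<in> G J" for \<sigma> using that G_sperm[OF JN] by auto
    have fJ: "f \<in> inv_ring l J"
    proof -
      have "act \<tau> f = f" if t: "\<tau> \<in> G J" for \<tau>
      proof -
        have "act \<tau> f = (\<Sum>\<sigma>\<in>G J. act (\<tau> \<circ> \<sigma>) h)" unfolding f_def act_sum
          by (intro sum.cong refl act_comp[OF Jsp[OF t]])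
        also have "\<dots> = f" unfolding f_def by (rule G_reindex_left[OF JN t])
        finally show ?thesis .
      qed
      moreover have "f \<in> Rl l" unfolding f_def by (intro Rl_sum act_Rl Jsp h)
      ultimately show ?thesis by (simp add: inv_ring_iff[OF JN])
    qed
    have tb: "to_fract (tr l J K (f * b)) = (\<Sum>\<sigma>\<in>G K. to_fract (act \<sigma> h) * to_fract (act \<sigma> b) / actF \<sigma> ?pi)" if b: "b \<in> B" for b
    proof -
      have bJ: "b \<in> inv_ring l J" using hb b by auto
      have "(\<Sum>\<sigma>\<in>G J. actF \<sigma> (to_fract (h * b))) = to_fract (f * b)"
        unfolding f_def sum_distrib_right to_fract_sum
      proof (intro sum.cong refl)
        fix \<sigma> assume s: "\<sigma> \<in> G J"
        show "actF \<sigma> (to_fract (h * b)) = to_fract (act \<sigma> h * b)"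
          unfolding actF_to_fract[OF Jsp[OF s]] act_mult inv_ring_act[OF JN bJ s] ..
      qed
      from trace_as_group_sum(2)[OF adJ adK JK _ this]
      have "to_fract (tr l J K (f * b)) = (\<Sum>\<sigma>\<in>G K. actF \<sigma> (to_fract (h * b) / ?pi))"
        using inv_ring_Rl[OF inv_ring_closed(2)[OF JN fJ bJ]] by blast
      also have "\<dots> = (\<Sum>\<sigma>\<in>G K. to_fract (act \<sigma> h) * to_fract (act \<sigma> b) / actF \<sigma> ?pi)"
      proof (intro sum.cong refl)
        fix \<sigma> assume s: "\<sigma> \<in> G K"
        show "actF \<sigma> (to_fract (h * b) / ?pi) = to_fract (act \<sigma> h) * to_fract (act \<sigma> b) / actF \<sigma> ?pi"
          by (simp only: actF_divide[OF sp[OF s]] actF_to_fract[OF sp[OF s]] act_mult flip: to_fract_mult)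
      qed
      finally show ?thesis .
    qed
    have "to_fract f = (\<Sum>b\<in>B. to_fract (tr l J K (f * b)) * to_fract (d b))"
      using arg_cong[OF dual_expand[OF B fJ], of to_fract] by (simp add: to_fract_sum)
    also have "\<dots> = (\<Sum>b\<in>B. \<Sum>\<sigma>\<in>G K. to_fract (act \<sigma> h) * to_fract (act \<sigma> b) / actF \<sigma> ?pi * to_fract (d b))"
      by (intro sum.cong refl) (simp add: tb sum_distrib_right)
    also have "\<dots> = (\<Sum>\<sigma>\<in>G K. \<Sum>b\<in>B. to_fract (act \<sigma> h) * to_fract (act \<sigma> b) / actF \<sigma> ?pi * to_fract (d b))"
      by (rule sum.swap)
    also have "\<dots> = (\<Sum>\<sigma>\<in>G K. D \<sigma> / actF \<sigma> ?pi * to_fract (act \<sigma> h))"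
      by (intro sum.cong refl) (simp add: D_def sum_distrib_left sum_distrib_right sum_divide_distrib algebra_simps)
    finally have 1: "to_fract f = (\<Sum>\<sigma>\<in>G K. D \<sigma> / actF \<sigma> ?pi * to_fract (act \<sigma> h))" .
    have "to_fract f = (\<Sum>\<sigma>\<in>G J. to_fract (act \<sigma> h))" by (simp add: f_def to_fract_sum)
    also have "\<dots> = (\<Sum>\<sigma>\<in>G K. if \<sigma> \<in> G J then to_fract (act \<sigma> h) else 0)"
      using G_mono[OF JK(1)] finite_G[OF KN] by (simp add: sum.inter_restrict[symmetric] Int_absorb1)
    also have "\<dots> = (\<Sum>\<sigma>\<in>G K. (if \<sigma> \<in> G J then 1 else 0) * to_fract (act \<sigma> h))" by (intro sum.cong refl) simp
    finally show "(\<Sum>\<sigma>\<in>G K. c \<sigma> * to_fract (act \<sigma> h)) = 0"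
      unfolding c_def left_diff_distrib sum_subtractf using 1 by simp
  qed
  then have Du: "D u = (if u \<in> G J then actF u ?pi else 0)"
    using quot_rootsF_nz actF_eq0[OF sp[OF u]] by (auto simp: c_def split: if_splits)
  have "to_fract (\<Sum>b\<in>B. act u b * d b) = to_fract (if u \<in> G J then \<Prod>(PosL LK - PosL LJ) else 0)"
    using Du actF_quot_rootsF[of u] by (simp add: D_def to_fract_sum quot_rootsF_def)
  then show ?thesis by (simp only: to_fract_eq_iff)
qed

lemma dual_bases_orthogonal_twisted:
  fixes d :: "'k mpol \<Rightarrow> 'k mpol"
  assumes B: "dual_hom_bases l J K B d" and t: "\<tau> \<in> sperm l" "\<tau>' \<in> sperm l" "inv \<tau>' \<circ> \<tau> \<in> G K"
  shows "(\<Sum>b\<in>B. act \<tau> b * act \<tau>' (d b)) = (if inv \<tau>' \<circ> \<tau> \<in> G J then act \<tau>' (\<Prod>(PosL LK - PosL LJ)) else 0)"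
proof -
  have "\<tau>' \<circ> (inv \<tau>' \<circ> \<tau>) = \<tau>" unfolding comp_assoc[symmetric] sperm_o_inv[OF t(2)] by simp
  then have "act \<tau>' (act (inv \<tau>' \<circ> \<tau>) b) = act \<tau> b" for b :: "'k mpol" unfolding act_comp[OF t(2)] by simp
  then have "act \<tau>' (\<Sum>b\<in>B. act (inv \<tau>' \<circ> \<tau>) b * d b) = (\<Sum>b\<in>B. act \<tau> b * act \<tau>' (d b))"
    unfolding act_sum act_mult by simp
  then show ?thesis unfolding dual_bases_orthogonal[OF B t(3)] by (auto split: if_splits)
qed

end

end

section \<open>The index sets and their roots\<close>

text \<open>\<open>OS l\<close> is \<open>O\<close> and \<open>OS (l - 1)\<close> is the index set \<open>I\<close> of the second endomorphism; \<open>LO\<close>, \<open>LE e\<close> and \<open>LD\<close> are the signed indices of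
  \<open>OS m\<close>, of \<open>OS m\<close> with \<open>e\<close> added and of \<open>OS m\<close> with \<open>1, - 1\<close> added.\<close>

definition OS :: "nat \<Rightarrow> int set" where "OS m = {2..int m - 1}"
definition LO :: "nat \<Rightarrow> int set" where "LO m = {2..int m}"
definition LE :: "int \<Rightarrow> nat \<Rightarrow> int set" where "LE e m = insert e {2..int m}"
definition LD :: "nat \<Rightarrow> int set" where "LD m = {a. a \<noteq> 0 \<and> \<bar>a\<bar> \<le> int m}"
text \<open>The change of sign that makes the index \<open>\<epsilon>\<close> to \<open>1\<close>.\<close>

definition et :: "int \<Rightarrow> int \<Rightarrow> int" where "et e = (if e = 1 then id else fl 1)"
text \<open>The product of all \<open>x\<^sub>i + x\<^sub>j\<close> with \<open>i < j \<le> m\<close>: the roots of type D that are not of type A.\<close>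

definition prod_sums :: "nat \<Rightarrow> 'k::field mpol" where "prod_sums m = (\<Prod>j\<in>{1..int m}. \<Prod>i\<in>{1..<j}. rt (- i) j)"

lemma O2_OS: "O2 l = OS l" by (simp add: O2_def OS_def)
lemma Iset_OS: "l \<ge> 2 \<Longrightarrow> Iset l (l - 1) = OS (l - 1)" by (auto simp: Iset_def O2_def OS_def of_nat_diff)

context typeD begin

lemma adapted_O: assumes "2 \<le> m" "m \<le> l" shows "adapted (OS m) (LO m)" "G (OS m) = GS (LO m)"
proof -
  have 1: "OS m \<subseteq> N l" using assms by (auto simp: OS_def N_iff)
  have 2: "a \<noteq> 0 \<and> \<bar>a\<bar> \<le> int l \<and> - a \<notin> LO m" if "a \<in> LO m" for a using that assms by (auto simp: LO_def)
  have 3: "i \<in> LO m \<and> \<bar>i\<bar> + 1 \<in> LO m" if "i \<in> OS m" for i using that by (auto simp: LO_def OS_def)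
  have 4: "a \<in> OS m \<and> \<bar>a\<bar> + 1 \<le> b" if "a \<in> LO m" "b \<in> LO m" "a < b" for a b using that by (auto simp: LO_def OS_def)
  show "adapted (OS m) (LO m)" by (rule adapted_A[OF 1 2 3 4])
  show "G (OS m) = GS (LO m)" by (rule G_GS[OF 1 2 3 4])
qed

lemmas OS_sub_N = adapted_sub[OF adapted_O(1)]

lemma adapted_Oe: assumes "2 \<le> m" "m \<le> l" "e = 1 \<or> e = - 1" shows "adapted (insert e (OS m)) (LE e m)" "G (insert e (OS m)) = GS (LE e m)"
proof -
  have 1: "insert e (OS m) \<subseteq> N l" using assms by (auto simp: OS_def N_iff)
  have 2: "a \<noteq> 0 \<and> \<bar>a\<bar> \<le> int l \<and> - a \<notin> LE e m" if "a \<in> LE e m" for a using that assms by (auto simp: LE_def)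
  have 3: "i \<in> LE e m \<and> \<bar>i\<bar> + 1 \<in> LE e m" if "i \<in> insert e (OS m)" for i using that assms by (auto simp: LE_def OS_def)
  have 4: "a \<in> insert e (OS m) \<and> \<bar>a\<bar> + 1 \<le> b" if "a \<in> LE e m" "b \<in> LE e m" "a < b" for a b using that assms by (auto simp: LE_def OS_def)
  show "adapted (insert e (OS m)) (LE e m)" by (rule adapted_A[OF 1 2 3 4])
  show "G (insert e (OS m)) = GS (LE e m)" by (rule G_GS[OF 1 2 3 4])
qed

lemma adapted_Opm: assumes "2 \<le> m" "m \<le> l" shows "adapted ({1, - 1} \<union> OS m) (LD m)"
proof -
  have "{1, - 1} \<union> OS m = {- 1} \<union> {1..int m - 1}" using assms by (auto simp: OS_def)
  then show ?thesis using adapted_D[OF assms] by (simp add: LD_def)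
qed

lemma et_sperm [simp]: "et e \<in> sperm l" using l2 by (auto simp: et_def intro!: fl_sperm)

text \<open>The value of an invariant under a signed permutation depends only on where the set \<open>L\<close> goes, and on the indices outside \<open>L\<close>.\<close>

lemma act_eqI:
  fixes f :: "'k mpol"
  assumes K: "K \<subseteq> N l" "G K = GS L" and f: "f \<in> inv_ring l K" and t: "\<tau> \<in> sperm l" "\<tau>' \<in> sperm l"
    and im: "\<tau> ` L = \<tau>' ` L" and out: "\<And>a. 1 \<le> a \<Longrightarrow> a \<le> int l \<Longrightarrow> a \<notin> L \<Longrightarrow> - a \<notin> L \<Longrightarrow> \<tau> a = \<tau>' a"
  shows "act \<tau> f = act \<tau>' f"
proof -
  define v where "v = inv \<tau>' \<circ> \<tau>"
  have vs: "v \<in> sperm l" unfolding v_def by (intro sperm_comp sperm_inv t)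
  have "v ` L = inv \<tau>' ` (\<tau>' ` L)" unfolding v_def image_comp[symmetric] im ..
  also have "\<dots> = L" by (simp add: image_comp comp_def sperm_inv_f[OF t(2)])
  finally have "v ` L = L" .
  moreover have "v a = a" if a: "a \<notin> L" "- a \<notin> L" for a
  proof -
    have p: "v a = a" if "1 \<le> a" "a \<le> int l" "a \<notin> L" "- a \<notin> L" for a
      using out[OF that] by (simp add: v_def sperm_inv_f[OF t(2)])
    consider "a = 0" | "1 \<le> a" "a \<le> int l" | "1 \<le> - a" "- a \<le> int l" | "int l < \<bar>a\<bar>" by linarith
    then show ?thesis
    proof cases
      case 1 then show ?thesis using sperm_0[OF vs] by simp
    next
      case 3 then show ?thesis using p[of "- a"] a sperm_odd[OF vs, of a] by simp
    next
      case 4 then show ?thesis using sperm_out[OF vs] by simp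
    qed (use p a in auto)
  qed
  ultimately have "v \<in> G K" unfolding K(2) GS_def using vs by simp
  then have "act v f = f" by (rule inv_ring_act[OF K(1) f])
  moreover have "act \<tau>' (act v f) = act \<tau> f"
    unfolding act_comp[OF t(2)] v_def comp_assoc[symmetric] sperm_o_inv[OF t(2)] by simp
  ultimately show ?thesis by simp
qed

lemma sp_GS:
  assumes L: "\<And>a. a \<in> L \<Longrightarrow> a \<noteq> 0 \<and> \<bar>a\<bar> \<le> int l \<and> - a \<notin> L" and ek: "e \<in> L" "k \<in> L"
  shows "sp e k \<in> GS L"
proof -
  have c: "e \<noteq> 0" "k \<noteq> 0" "e \<noteq> - k" "- e \<notin> L" "- k \<notin> L" using L[OF ek(1)] L[OF ek(2)] ek by auto
  have s: "sp e k \<in> sperm l" using c L[OF ek(1)] L[OF ek(2)] by (intro sp_sperm) auto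
  have "sp e k ` L = L" using c ek by (intro involution_image sp_invol) (auto simp: sp_def)
  moreover have "sp e k a = a" if "a \<notin> L" "- a \<notin> L" for a
  proof -
    have "a \<noteq> e" "a \<noteq> - e" "a \<noteq> k" "a \<noteq> - k" using that ek by auto
    then show ?thesis by (simp add: sp_def)
  qed
  ultimately show ?thesis using s by (simp add: GS_def)
qed

text \<open>If \<open>W\<^sub>J\<close> is the stabiliser of \<open>e\<close> in the symmetric group on \<open>LK\<close>, the exchanges of \<open>e\<close> with the elements of \<open>LK\<close> represent the cosets, so the
  sum over the group shrinks to one over \<open>LK\<close>.\<close>

lemma trace_single_coset:
  fixes f :: "'k mpol"
  assumes adJ: "adapted J LJ" "G J = GS LJ" and adK: "adapted K LK" "G K = GS LK" and JK: "J \<subseteq> K" "LJ = LK - {e}" and e: "e \<in> LK"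
    and L: "\<And>a. a \<in> LK \<Longrightarrow> a \<noteq> 0 \<and> \<bar>a\<bar> \<le> int l \<and> - a \<notin> LK" and f: "f \<in> inv_ring l J" and t: "\<tau> \<in> sperm l"
  shows "to_fract (act \<tau> (tr l J K f)) = (\<Sum>k\<in>LK. to_fract (act (\<tau> \<circ> sp e k) f) / to_fract (act (\<tau> \<circ> sp e k) (\<Prod>(PosL LK - PosL LJ))))"
proof -
  have LJK: "LJ \<subseteq> LK" using JK by auto
  have J: "J \<subseteq> N l" and K: "K \<subseteq> N l" using adapted_sub adJ adK by auto
  have Gs: "\<sigma> \<in> sperm l" if "\<sigma> \<in> G J \<or> \<sigma> \<in> G K" for \<sigma> using that G_sperm[OF J] G_sperm[OF K] by auto
  obtain q :: "'k mpol fract" where q: "(\<Sum>\<sigma>\<in>G J. actF \<sigma> q) = 1" using unit_trace_exists[OF adJ(1)] by blast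
  let ?p = "to_fract f / quot_rootsF LJ LK"
  have sK: "sp e k \<in> G K" if "k \<in> LK" for k unfolding adK(2) by (rule sp_GS[OF L e that])
  have spi: "sp e k \<circ> (sp e k \<circ> \<sigma>) = \<sigma>" if "k \<in> LK" for k \<sigma>
  proof -
    have "e \<noteq> 0" "k \<noteq> 0" "e \<noteq> - k" using L[OF e] L[OF that] e that by auto
    from sp_invol[OF this] show ?thesis by (simp add: fun_eq_iff)
  qed
  \<comment> \<open>The elements that send \<open>e\<close> to \<open>k\<close> form the coset of \<open>W\<^sub>J\<close> represented by the exchange of \<open>e\<close> and \<open>k\<close>.\<close>
  have inner: "(\<Sum>\<sigma>\<in>{\<sigma> \<in> G K. \<sigma> e = k}. actF \<sigma> (q * ?p)) = actF (sp e k) ?p" if k: "k \<in> LK" for k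
  proof -
    have "(\<Sum>\<sigma>\<in>{\<sigma> \<in> G K. \<sigma> e = k}. actF \<sigma> (q * ?p)) = (\<Sum>\<sigma>\<in>G J. actF (sp e k \<circ> \<sigma>) (q * ?p))"
    proof (rule sum.reindex_bij_witness[of _ "\<lambda>\<sigma>. sp e k \<circ> \<sigma>" "\<lambda>\<sigma>. sp e k \<circ> \<sigma>"])
      fix \<sigma> assume s: "\<sigma> \<in> {\<sigma> \<in> G K. \<sigma> e = k}"
      show "sp e k \<circ> (sp e k \<circ> \<sigma>) = \<sigma>" by (rule spi[OF k])
      have sG: "\<sigma> \<in> G K" "\<sigma> e = k" using s by auto
      define v where "v = sp e k \<circ> \<sigma>"
      have v: "v \<in> G K" unfolding v_def by (intro G_comp sK k sG)
      have ve: "v e = e" unfolding v_def using sG(2) by (simp add: sp_2)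
      have vs: "v \<in> sperm l" using v Gs by blast
      have "v ` LJ = v ` LK - v ` {e}" unfolding JK(2) using sperm_bij[OF vs] by (simp add: image_set_diff bij_is_inj)
      also have "\<dots> = LJ" using v ve unfolding adK(2) GS_def JK(2) by simp
      finally have "v ` LJ = LJ" .
      moreover have "v a = a" if n: "a \<notin> LJ" "- a \<notin> LJ" for a
      proof -
        consider "a = e" | "- a = e" | "a \<notin> LK" "- a \<notin> LK" using n JK(2) by blast
        then show ?thesis
        proof cases
          case 2
          then have "a = - e" by simp
          then show ?thesis using ve sperm_odd[OF vs, of e] by simp
        qed (use ve v adK(2) in \<open>auto simp: GS_def\<close>)
      qed
      ultimately have "v \<in> G J" unfolding adJ(2) GS_def using vs by simp
      then show "sp e k \<circ> \<sigma> \<in> G J" unfolding v_def .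
    next
      fix \<sigma> assume s: "\<sigma> \<in> G J"
      show "sp e k \<circ> (sp e k \<circ> \<sigma>) = \<sigma>" by (rule spi[OF k])
      have "\<sigma> e = e" using s JK(2) L[OF e] unfolding adJ(2) GS_def by blast
      then have "(sp e k \<circ> \<sigma>) e = k" by (simp add: sp_1)
      moreover have "sp e k \<circ> \<sigma> \<in> G K" using s G_mono[OF JK(1)] by (intro G_comp sK k) auto
      ultimately show "sp e k \<circ> \<sigma> \<in> {\<sigma> \<in> G K. \<sigma> e = k}" by simp
    next
      fix \<sigma> assume "\<sigma> \<in> {\<sigma> \<in> G K. \<sigma> e = k}"
      show "actF (sp e k \<circ> (sp e k \<circ> \<sigma>)) (q * ?p) = actF \<sigma> (q * ?p)" unfolding spi[OF k] ..
    qed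
    also have "\<dots> = (\<Sum>\<sigma>\<in>G J. actF (sp e k) (actF \<sigma> q * ?p))"
    proof (intro sum.cong refl)
      fix \<sigma> assume s: "\<sigma> \<in> G J"
      then have ss: "\<sigma> \<in> sperm l" and ks: "sp e k \<in> sperm l" using Gs sK[OF k] by auto
      have "actF \<sigma> (q * ?p) = actF \<sigma> q * ?p" unfolding actF_mult[OF ss] actF_divide[OF ss] actF_inv_ring[OF J f s] actF_quot_rootsF[OF adJ(1) adK(1) JK(1) LJK s] ..
      then show "actF (sp e k \<circ> \<sigma>) (q * ?p) = actF (sp e k) (actF \<sigma> q * ?p)" unfolding actF_comp[OF ks ss, symmetric] by simp
    qed
    also have "\<dots> = actF (sp e k) ((\<Sum>\<sigma>\<in>G J. actF \<sigma> q) * ?p)"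
      unfolding sum_distrib_right using sK[OF k] Gs by (intro actF_sum[symmetric]) auto
    also have "\<dots> = actF (sp e k) ?p" unfolding q by simp
    finally show ?thesis .
  qed
  have "to_fract (tr l J K f) = (\<Sum>\<sigma>\<in>G K. actF \<sigma> (q * ?p))"
    unfolding tr_formula(2)[OF adJ(1) adK(1) JK(1) LJK q f] by simp
  also have "\<dots> = (\<Sum>k\<in>LK. \<Sum>\<sigma>\<in>{\<sigma> \<in> G K. \<sigma> e = k}. actF \<sigma> (q * ?p))"
  proof (rule sum.group[symmetric])
    show "(\<lambda>\<sigma>. \<sigma> e) ` G K \<subseteq> LK" using e unfolding adK(2) GS_def by auto
  qed (use finite_G[OF K] finite_L[OF adK(1)] in auto)
  also have "\<dots> = (\<Sum>k\<in>LK. actF (sp e k) ?p)" by (intro sum.cong refl inner)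
  finally have *: "to_fract (tr l J K f) = (\<Sum>k\<in>LK. actF (sp e k) ?p)" .
  have "to_fract (act \<tau> (tr l J K f)) = (\<Sum>k\<in>LK. actF \<tau> (actF (sp e k) ?p))"
    unfolding actF_to_fract[OF t, symmetric] * by (rule actF_sum[OF t])
  also have "\<dots> = (\<Sum>k\<in>LK. to_fract (act (\<tau> \<circ> sp e k) f) / to_fract (act (\<tau> \<circ> sp e k) (\<Prod>(PosL LK - PosL LJ))))"
  proof (intro sum.cong refl)
    fix k assume k: "k \<in> LK"
    have s: "sp e k \<in> sperm l" using Gs sK[OF k] by auto
    have ts: "\<tau> \<circ> sp e k \<in> sperm l" by (rule sperm_comp[OF t s])
    show "actF \<tau> (actF (sp e k) ?p) = to_fract (act (\<tau> \<circ> sp e k) f) / to_fract (act (\<tau> \<circ> sp e k) (\<Prod>(PosL LK - PosL LJ)))"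
      unfolding actF_comp[OF t s] actF_divide[OF ts] actF_to_fract[OF ts] quot_rootsF_def ..
  qed
  finally show ?thesis .
qed

lemma prod_roots_extreme:
  assumes L: "\<And>a. a \<in> LK \<Longrightarrow> a \<noteq> 0 \<and> - a \<notin> LK" and e: "e \<in> LK"
  shows "(\<forall>a\<in>LK - {e}. e < a) \<Longrightarrow> \<Prod>(PosL LK - PosL (LK - {e})) = (\<Prod>a\<in>LK - {e}. rt e a)"
    "(\<forall>a\<in>LK - {e}. a < e) \<Longrightarrow> \<Prod>(PosL LK - PosL (LK - {e})) = (\<Prod>a\<in>LK - {e}. rt a e)"
proof -
  have ab: "\<bar>a\<bar> \<noteq> \<bar>b\<bar>" if "a \<in> LK" "b \<in> LK" "a \<noteq> b" for a b using L[OF that(1)] L[OF that(2)] that by (auto simp: abs_eq_iff)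
  have r: "(rt a b :: 'k mpol) = rt c d \<longleftrightarrow> a = c \<and> b = d" if "a \<in> LK" "b \<in> LK" "a \<noteq> b" "c \<in> LK" "d \<in> LK" "c \<noteq> d" for a b c d
  proof -
    have "a \<noteq> - d" using L[of d] that by auto
    then show ?thesis using rt_eq_iff[of a b c d] ab[of a b] ab[of c d] L that by auto
  qed
  { assume m: "\<forall>a\<in>LK - {e}. e < a"
    have "PosL LK - PosL (LK - {e}) = rt e ` (LK - {e})"
    proof (intro set_eqI iffI)
      fix x :: "'k mpol" assume "x \<in> PosL LK - PosL (LK - {e})"
      then obtain a b where x: "x = rt a b" "a \<in> LK" "b \<in> LK" "a < b" "a \<noteq> - b" "x \<notin> PosL (LK - {e})" unfolding PosL_def by blast
      then have "a = e \<or> b = e" unfolding PosL_def by blast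
      moreover have "b \<noteq> e" if "a \<noteq> e"
      proof -
        have "e < a" using m x(2) that by blast
        then show ?thesis using x(4) by simp
      qed
      ultimately have "a = e" by blast
      then show "x \<in> rt e ` (LK - {e})" using x by auto
    next
      fix x :: "'k mpol" assume "x \<in> rt e ` (LK - {e})"
      then obtain a where a: "x = rt e a" "a \<in> LK" "a \<noteq> e" by auto
      then have "x \<in> PosL LK" using m e L[of e] L[of a] unfolding PosL_def by fastforce
      moreover have "x \<notin> PosL (LK - {e})"
      proof
        assume "x \<in> PosL (LK - {e})"
        then obtain c d where cd: "x = rt c d" "c \<in> LK - {e}" "d \<in> LK" "c < d" unfolding PosL_def by blast
        have "rt e a = (rt c d :: 'k mpol)" using a(1) cd(1) by simp
        then show False using r[of e a c d] a e cd by auto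
      qed
      ultimately show "x \<in> PosL LK - PosL (LK - {e})" by blast
    qed
    moreover have "inj_on (rt e :: _ \<Rightarrow> 'k mpol) (LK - {e})" using r e by (auto simp: inj_on_def)
    ultimately show "\<Prod>(PosL LK - PosL (LK - {e})) = (\<Prod>a\<in>LK - {e}. rt e a)" by (simp add: prod.reindex) }
  { assume m: "\<forall>a\<in>LK - {e}. a < e"
    have "PosL LK - PosL (LK - {e}) = (\<lambda>a. rt a e) ` (LK - {e})"
    proof (intro set_eqI iffI)
      fix x :: "'k mpol" assume "x \<in> PosL LK - PosL (LK - {e})"
      then obtain a b where x: "x = rt a b" "a \<in> LK" "b \<in> LK" "a < b" "a \<noteq> - b" "x \<notin> PosL (LK - {e})" unfolding PosL_def by blast
      then have "a = e \<or> b = e" unfolding PosL_def by blast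
      moreover have "a \<noteq> e" if "b \<noteq> e"
      proof -
        have "b < e" using m x(3) that by blast
        then show ?thesis using x(4) by simp
      qed
      ultimately have "b = e" by blast
      then show "x \<in> (\<lambda>a. rt a e) ` (LK - {e})" using x by auto
    next
      fix x :: "'k mpol" assume "x \<in> (\<lambda>a. rt a e) ` (LK - {e})"
      then obtain a where a: "x = rt a e" "a \<in> LK" "a \<noteq> e" by auto
      then have "x \<in> PosL LK" using m e L[of e] L[of a] unfolding PosL_def by fastforce
      moreover have "x \<notin> PosL (LK - {e})"
      proof
        assume "x \<in> PosL (LK - {e})"
        then obtain c d where cd: "x = rt c d" "c \<in> LK" "d \<in> LK - {e}" "c < d" unfolding PosL_def by blast
        have "rt a e = (rt c d :: 'k mpol)" using a(1) cd(1) by simp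
        then show False using r[of a e c d] a e cd by auto
      qed
      ultimately show "x \<in> PosL LK - PosL (LK - {e})" by blast
    qed
    moreover have "inj_on (\<lambda>a. rt a e :: 'k mpol) (LK - {e})" using r e by (auto simp: inj_on_def)
    ultimately show "\<Prod>(PosL LK - PosL (LK - {e})) = (\<Prod>a\<in>LK - {e}. rt a e)" by (simp add: prod.reindex) }
qed

lemma prod_roots_D: assumes m: "2 \<le> m" shows "\<Prod>(PosL (LD m) - PosL (LE 1 m)) = (prod_sums m :: 'k mpol)"
proof -
  let ?S = "SIGMA j:{1..int m}. {1..<j}"
  let ?f = "\<lambda>(j, i). rt (- i) j :: 'k mpol"
  have LE: "LE 1 m = {1..int m}" using m by (auto simp: LE_def)
  have "PosL (LD m) - PosL (LE 1 m) = ?f ` ?S"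
  proof (intro set_eqI iffI)
    fix x :: "'k mpol" assume "x \<in> PosL (LD m) - PosL (LE 1 m)"
    then obtain a b where x: "x = rt a b" "a \<in> LD m" "b \<in> LD m" "a < b" "a \<noteq> - b" "x \<notin> PosL (LE 1 m)" unfolding PosL_def by blast
    have na: "\<not> 0 < a"
    proof
      assume "0 < a"
      then have "x \<in> PosL (LE 1 m)" using x unfolding PosL_def LE LD_def by fastforce
      then show False using x by blast
    qed
    have nb: "\<not> b < 0"
    proof
      assume b: "b < 0"
      have "a \<noteq> 0" "b \<noteq> 0" using x by (auto simp: LD_def)
      then have "x = rt (- b) (- a)" unfolding x(1) by (rule rt_neg[symmetric])
      moreover have "- b \<in> LE 1 m" "- a \<in> LE 1 m" "- b < - a" "- b \<noteq> - (- a)" using x b by (auto simp: LE LD_def)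
      ultimately have "x \<in> PosL (LE 1 m)" unfolding PosL_def by blast
      then show False using x by blast
    qed
    have s: "a < 0" "0 < b" using na nb x by (auto simp: LD_def)
    show "x \<in> ?f ` ?S"
    proof (cases "- a < b")
      case True
      then have "(b, - a) \<in> ?S" using s x by (auto simp: LD_def)
      moreover have "x = ?f (b, - a)" using x by simp
      ultimately show ?thesis by blast
    next
      case False
      then have "(- a, b) \<in> ?S" using s x by (auto simp: LD_def)
      moreover have "x = rt (- b) (- a)" unfolding x(1) by (rule rt_neg[symmetric]) (use s in auto)
      then have "x = ?f (- a, b)" by simp
      ultimately show ?thesis by blast
    qed
  next
    fix x :: "'k mpol" assume "x \<in> ?f ` ?S"
    then obtain i j where ij: "x = rt (- i) j" "1 \<le> i" "i < j" "j \<le> int m" by auto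
    have "x \<in> PosL (LD m)" using ij unfolding PosL_def LD_def mem_Collect_eq
      by (intro exI[of _ "- i"] exI[of _ j]) auto
    moreover have "x \<notin> PosL (LE 1 m)"
    proof
      assume "x \<in> PosL (LE 1 m)"
      then obtain c d where cd: "x = rt c d" "c \<in> LE 1 m" "d \<in> LE 1 m" "c < d" unfolding PosL_def by blast
      have "rt (- i) j = (rt c d :: 'k mpol)" using ij(1) cd(1) by simp
      then show False using rt_eq_iff[of "- i" j c d] ij cd by (auto simp: LE)
    qed
    ultimately show "x \<in> PosL (LD m) - PosL (LE 1 m)" by blast
  qed
  moreover have "inj_on ?f ?S"
  proof (rule inj_onI, clarify)
    fix j i j' i' assume "j \<in> {1..int m}" "i \<in> {1..<j}" "j' \<in> {1..int m}" "i' \<in> {1..<j'}" "rt (- i) j = (rt (- i') j' :: 'k mpol)"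
    then show "j = j' \<and> i = i'" using rt_eq_iff[of "- i" j "- i'" j'] by auto
  qed
  ultimately have "\<Prod>(PosL (LD m) - PosL (LE 1 m)) = prod ?f ?S" by (simp add: prod.reindex case_prod_unfold)
  also have "\<dots> = prod_sums m" unfolding prod_sums_def by (subst prod.Sigma) (auto simp: case_prod_unfold)
  finally show ?thesis .
qed

lemma prod_sums_last: "2 \<le> l \<Longrightarrow> prod_sums l = prod_sums (l - 1) * (\<Prod>i\<in>{1..<int l}. rt (- i) (int l))"
proof -
  assume "2 \<le> l"
  then have "{1..int l} = insert (int l) {1..int (l - 1)}" "int l \<notin> {1..int (l - 1)}" by auto
  then show ?thesis by (simp add: prod_sums_def mult.commute)
qed

lemma act_prod_sums_sp: assumes "k \<in> {1..int l}" shows "act (sp (int l) k) (prod_sums l) = (prod_sums l :: 'k mpol)"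
proof -
  note E = adapted_Oe[OF l2 le_refl disjI1[OF refl]]
  have L: "LE 1 l = {1..int l}" using l2 by (auto simp: LE_def)
  have "sp (int l) k \<in> G (insert 1 (OS l))" unfolding E(2) using assms l2 by (intro sp_GS) (auto simp: L)
  then have "act (sp (int l) k) (\<Prod>(PosL (LD l) - PosL (LE 1 l))) = \<Prod>(PosL (LD l) - PosL (LE 1 l))"
    by (intro quot_roots_invariant[OF E(1) adapted_Opm[OF l2 le_refl]]) (auto simp: L LD_def)
  then show ?thesis unfolding prod_roots_D[OF l2] .
qed

end

section \<open>Evaluation along paths\<close>

text \<open>The evaluation of \<open>f\<^bsub>i+1\<^esub> \<otimes> \<dots> \<otimes> f\<^sub>n\<close> along a path. The signed permutation \<open>\<zeta>\<close> is the point reached so far: after a factor with path entry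
  \<open>q\<close>, the coordinate \<open>q\<close> of the point has changed its sign. Factors beyond the end of the path are ignored.\<close>

fun val :: "nat \<Rightarrow> nat \<Rightarrow> (int \<Rightarrow> int) \<Rightarrow> 'k::field mpol list \<Rightarrow> int list \<Rightarrow> 'k mpol" where
  "val n i \<zeta> (f # fs) (q # Q) = act (\<zeta> \<circ> sp 1 q \<circ> et (sgn_idx n i)) f * val n (Suc i) (\<zeta> \<circ> fl q) fs Q"
| "val n i \<zeta> _ _ = 1"

definition flips :: "int list \<Rightarrow> int \<Rightarrow> int" where "flips Q = foldr (\<lambda>q \<sigma>. fl q \<circ> \<sigma>) Q id"
definition paths :: "nat \<Rightarrow> nat \<Rightarrow> int list set" where "paths m n = {P. length P = n \<and> set P \<subseteq> {1..int m}}"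
definition rtF :: "(int \<Rightarrow> int) \<Rightarrow> int \<Rightarrow> int \<Rightarrow> 'k::field mpol fract" where "rtF \<zeta> a b = to_fract (rt (\<zeta> a) (\<zeta> b))"

text \<open>The denominators that the iterated traces produce along a path.\<close>

fun path_wt :: "nat \<Rightarrow> (int \<Rightarrow> int) \<Rightarrow> int list \<Rightarrow> 'k::field mpol fract" where
  "path_wt m \<zeta> [] = 1"
| "path_wt m \<zeta> (p # P) = path_wt m (\<zeta> \<circ> fl p) P / (\<Prod>j\<in>{1..int m} - {p}. rtF \<zeta> p j)"

lemma flips_Nil [simp]: "flips [] = id" by (simp add: flips_def)
lemma flips_Cons: "flips (q # Q) = fl q \<circ> flips Q" by (simp add: flips_def)
lemma flips_append: "flips (P @ Q) = flips P \<circ> flips Q" by (induction P) (auto simp: flips_Cons comp_assoc)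

lemma finite_paths: "finite (paths m n)"
  using finite_lists_length_eq[of "{1..int m}" n] by (simp add: paths_def conj_commute)

lemma paths_0: "paths m 0 = {[]}" by (auto simp: paths_def)
lemma sum_paths_Suc: "(\<Sum>P\<in>paths m (Suc n). f P) = (\<Sum>p\<in>{1..int m}. \<Sum>P\<in>paths m n. f (p # P))"
proof -
  have "paths m (Suc n) = (\<lambda>(p, P). p # P) ` ({1..int m} \<times> paths m n)"
    by (auto simp: paths_def length_Suc_conv image_iff)
  moreover have "inj_on (\<lambda>(p, P). p # P) ({1..int m} \<times> paths m n)" by (auto simp: inj_on_def)
  ultimately have "(\<Sum>P\<in>paths m (Suc n). f P) = (\<Sum>(p, P)\<in>{1..int m} \<times> paths m n. f (p # P))"
    by (simp add: sum.reindex case_prod_unfold)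
  then show ?thesis by (simp add: sum.cartesian_product)
qed

lemma sgn_idx_cases: "sgn_idx n i = 1 \<or> sgn_idx n i = - 1" by (simp add: sgn_idx_def)
lemma sgn_idx_Suc: "i < n \<Longrightarrow> sgn_idx n (Suc i) = - sgn_idx n i"
proof -
  assume "i < n"
  then have "n - i = Suc (n - Suc i)" by simp
  then show ?thesis by (simp add: sgn_idx_def)
qed
lemma sgn_idx_n [simp]: "sgn_idx n n = 1" by (simp add: sgn_idx_def)

lemma et_1 [simp]: "et 1 = id" by (simp add: et_def)
lemma et_et: "et e (et e x) = x" by (simp add: et_def fl_invol)
lemma et_ge2: "2 \<le> a \<Longrightarrow> et e a = a" by (simp add: et_def fl_def)
lemma et_e: "e = 1 \<or> e = - 1 \<Longrightarrow> et e e = 1" "e = 1 \<or> e = - 1 \<Longrightarrow> et e 1 = e" by (auto simp: et_def fl_def)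
lemma LE_et: "e = 1 \<or> e = - 1 \<Longrightarrow> 1 \<le> m \<Longrightarrow> et e ` {1..int m} = LE e m"
proof -
  assume a: "e = 1 \<or> e = - 1" "1 \<le> m"
  have "{1..int m} = insert 1 {2..int m}" using a(2) by auto
  moreover have "et e ` {2..int m} = {2..int m}" by (auto simp: et_ge2 image_iff)
  ultimately show ?thesis using et_e(2)[OF a(1)] by (simp add: LE_def)
qed

lemma sp_conj: "\<sigma> \<in> sperm l \<Longrightarrow> \<sigma> (sp a b x) = sp (\<sigma> a) (\<sigma> b) (\<sigma> x)"
proof -
  assume s: "\<sigma> \<in> sperm l"
  have n: "\<sigma> x = - \<sigma> c \<longleftrightarrow> x = - c" for c using sperm_odd[OF s, of c] sperm_inj[OF s, of x "- c"] by simp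
  show ?thesis unfolding sp_def n sperm_inj[OF s] using sperm_odd[OF s] by auto
qed
lemma fl_conj: "\<sigma> \<in> sperm l \<Longrightarrow> \<sigma> (fl a x) = fl (\<sigma> a) (\<sigma> x)"
proof -
  assume s: "\<sigma> \<in> sperm l"
  have "\<bar>\<sigma> x\<bar> = \<bar>\<sigma> a\<bar> \<longleftrightarrow> \<bar>x\<bar> = \<bar>a\<bar>"
    using sperm_odd[OF s, of a] sperm_inj[OF s, of x "- a"] sperm_inj[OF s, of x a] by (simp add: abs_eq_iff)
  then show ?thesis unfolding fl_def using sperm_odd[OF s] by auto
qed
lemma sp_image: "a \<in> A \<Longrightarrow> b \<in> A \<Longrightarrow> (\<And>x. x \<in> A \<Longrightarrow> x > 0) \<Longrightarrow> sp a b ` A = A"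
proof (rule set_eqI)
  fix x assume a: "a \<in> A" "b \<in> A" "\<And>x. x \<in> A \<Longrightarrow> x > 0"
  have p: "a > 0" "b > 0" using a by auto
  have i: "sp a b (sp a b x) = x" for x using p by (intro sp_invol) auto
  have m: "sp a b y \<in> A" if "y \<in> A" for y
  proof -
    have "0 < y" using a(3)[OF that] .
    then have "y \<noteq> - a" "y \<noteq> - b" using p by auto
    then show ?thesis using that a by (simp add: sp_def)
  qed
  show "x \<in> sp a b ` A \<longleftrightarrow> x \<in> A"
  proof
    assume "x \<in> sp a b ` A" then show "x \<in> A" using m by auto
  next
    assume "x \<in> A"
    then have "x = sp a b (sp a b x)" "sp a b x \<in> A" using i m by simp_all
    then show "x \<in> sp a b ` A" by (rule image_eqI)
  qed
qed

context typeD begin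

lemma sp1_sperm: "q \<in> {1..int l} \<Longrightarrow> sp 1 q \<in> sperm l" using l2 by (intro sp_sperm) auto
lemma spl_sperm: "q \<in> {1..int l} \<Longrightarrow> sp (int l) q \<in> sperm l" using l2 by (intro sp_sperm) auto
lemma flq_sperm: "q \<in> {1..int l} \<Longrightarrow> fl q \<in> sperm l" by (intro fl_sperm) auto
lemma flips_sperm: "set Q \<subseteq> {1..int l} \<Longrightarrow> flips Q \<in> sperm l"
  by (induction Q) (auto simp: flips_Cons intro!: sperm_comp flq_sperm)

lemma rtF_nz: "\<zeta> \<in> sperm l \<Longrightarrow> a \<noteq> 0 \<Longrightarrow> b \<noteq> 0 \<Longrightarrow> a \<noteq> b \<Longrightarrow> (rtF \<zeta> a b :: 'k mpol fract) \<noteq> 0"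
  using rt_nz[of "\<zeta> a" "\<zeta> b"] by (simp add: rtF_def sperm_eq0 sperm_inj)

text \<open>The trace from \<open>O\<close> to \<open>O\<epsilon>\<close> sums over the coordinate \<open>k\<close> that takes the first place.\<close>

lemma trace_Oe_formula:
  fixes f :: "'k mpol"
  assumes m: "2 \<le> m" "m \<le> l" and e: "e = 1 \<or> e = - 1" and z: "\<zeta> \<in> sperm l" and f: "f \<in> inv_ring l (OS m)"
  shows "to_fract (act (\<zeta> \<circ> et e) (tr l (OS m) (insert e (OS m)) f)) =
    (\<Sum>k\<in>{1..int m}. to_fract (act (\<zeta> \<circ> sp 1 k \<circ> et e) f) / (\<Prod>j\<in>{1..int m} - {k}. rtF \<zeta> k j))"
proof -
  note a1 = adapted_O[OF m] and a2 = adapted_Oe[OF m e]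
  have L: "a \<noteq> 0 \<and> \<bar>a\<bar> \<le> int l \<and> - a \<notin> LE e m" if "a \<in> LE e m" for a using that m e by (auto simp: LE_def)
  have LOE: "LO m = LE e m - {e}" using e by (auto simp: LE_def LO_def)
  have eL: "e \<in> LE e m" by (simp add: LE_def)
  have ts: "\<zeta> \<circ> et e \<in> sperm l" by (intro sperm_comp z et_sperm)
  have pr: "\<Prod>(PosL (LE e m) - PosL (LO m)) = (\<Prod>a\<in>{2..int m}. rt e a :: 'k mpol)"
  proof -
    have "\<Prod>(PosL (LE e m) - PosL (LE e m - {e})) = (\<Prod>a\<in>LE e m - {e}. rt e a :: 'k mpol)"
      by (rule prod_roots_extreme(1)) (use L eL e in \<open>auto simp: LE_def\<close>)
    then show ?thesis unfolding LOE[symmetric] by (simp add: LO_def)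
  qed
  have inj: "inj_on (et e) {1..int m}" by (rule inj_on_inverseI[of _ "et e"]) (simp add: et_et)
  have "to_fract (act (\<zeta> \<circ> et e) (tr l (OS m) (insert e (OS m)) f)) =
    (\<Sum>k\<in>LE e m. to_fract (act (\<zeta> \<circ> et e \<circ> sp e k) f) / to_fract (act (\<zeta> \<circ> et e \<circ> sp e k) (\<Prod>a\<in>{2..int m}. rt e a)))"
    using trace_single_coset[OF a1 a2 subset_insertI LOE eL L f ts] unfolding pr .
  also have "\<dots> = (\<Sum>k\<in>{1..int m}. to_fract (act (\<zeta> \<circ> et e \<circ> sp e (et e k)) f) / to_fract (act (\<zeta> \<circ> et e \<circ> sp e (et e k)) (\<Prod>a\<in>{2..int m}. rt e a)))"
    unfolding LE_et[OF e, symmetric, of m, OF order_trans[OF one_le_numeral m(1)]] by (simp add: sum.reindex[OF inj] comp_def)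
  also have "\<dots> = (\<Sum>k\<in>{1..int m}. to_fract (act (\<zeta> \<circ> sp 1 k \<circ> et e) f) / (\<Prod>j\<in>{1..int m} - {k}. rtF \<zeta> k j))"
  proof (intro sum.cong refl)
    fix k assume k: "k \<in> {1..int m}"
    have c: "et e \<circ> sp e (et e k) = sp 1 k \<circ> et e"
      using sp_conj[OF et_sperm[of e], of e "et e k"] et_e(1)[OF e] by (simp add: fun_eq_iff et_et)
    have zs: "\<zeta> \<circ> sp 1 k \<circ> et e \<in> sperm l" using k m by (intro sperm_comp z et_sperm sp1_sperm) auto
    have im: "sp 1 k ` {2..int m} = {1..int m} - {k}"
    proof -
      have i: "inj (sp 1 k)" using k by (intro inj_on_inverseI[of _ "sp 1 k"]) (auto simp: sp_invol)
      have "{2..int m} = {1..int m} - {1}" by auto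
      then have "sp 1 k ` {2..int m} = sp 1 k ` {1..int m} - {sp 1 k 1}" using image_set_diff[OF i] by (metis image_empty image_insert)
      also have "sp 1 k ` {1..int m} = {1..int m}" using k by (intro sp_image) auto
      finally show ?thesis by (simp add: sp_1)
    qed
    have i: "inj_on (sp 1 k) {2..int m}" using k by (intro inj_on_inverseI[of _ "sp 1 k"]) (auto simp: sp_invol)
    have "to_fract (act (\<zeta> \<circ> sp 1 k \<circ> et e) (\<Prod>a\<in>{2..int m}. rt e a)) = (\<Prod>a\<in>{2..int m}. rtF \<zeta> k (sp 1 k a) :: 'k mpol fract)"
      unfolding act_prod to_fract_prod act_rt[OF zs]
      by (intro prod.cong refl) (simp add: rtF_def et_e(1)[OF e] et_ge2 sp_1)
    also have "\<dots> = (\<Prod>j\<in>{1..int m} - {k}. rtF \<zeta> k j)" unfolding im[symmetric] prod.reindex[OF i] by simp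
    finally show "to_fract (act (\<zeta> \<circ> et e \<circ> sp e (et e k)) f) / to_fract (act (\<zeta> \<circ> et e \<circ> sp e (et e k)) (\<Prod>a\<in>{2..int m}. rt e a)) =
       to_fract (act (\<zeta> \<circ> sp 1 k \<circ> et e) f) / (\<Prod>j\<in>{1..int m} - {k}. rtF \<zeta> k j)"
      unfolding comp_assoc c unfolding comp_assoc[symmetric] by simp
  qed
  finally show ?thesis .
qed

text \<open>At a slot with sign \<open>\<epsilon>\<close>, an invariant of \<open>O\<close> with \<open>- \<epsilon>\<close> added becomes a symmetric function of \<open>- x\<^sub>k\<close> and the other
  \<open>x\<^sub>j\<close>: the choice of \<open>k\<close> matters only through the change of its sign. The next slot, of sign \<open>- \<epsilon>\<close>, starts from the point with this sign changed.\<close>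

lemma eval_adjacent:
  fixes g :: "'k mpol"
  assumes m: "2 \<le> m" "m \<le> l" and e: "e = 1 \<or> e = - 1" and z: "\<zeta> \<in> sperm l" and g: "g \<in> inv_ring l (insert (- e) (OS m))" and k: "k \<in> {1..int m}"
  shows "act (\<zeta> \<circ> sp 1 k \<circ> et e) g = act (\<zeta> \<circ> fl k \<circ> et (- e)) g"
proof -
  have e': "- e = 1 \<or> - e = - 1" using e by auto
  note a2 = adapted_Oe[OF m e']
  have kl: "k \<in> {1..int l}" using k m by auto
  show ?thesis
  proof (rule act_eqI[OF adapted_sub[OF a2(1)] a2(2) g])
    show "\<zeta> \<circ> sp 1 k \<circ> et e \<in> sperm l" "\<zeta> \<circ> fl k \<circ> et (- e) \<in> sperm l" using kl by (auto intro!: sperm_comp z sp1_sperm flq_sperm)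
    have 1: "LE (- e) m = et (- e) ` {1..int m}" using LE_et[OF e', of m] m by simp
    have "(\<zeta> \<circ> sp 1 k \<circ> et e) ` LE (- e) m = \<zeta> ` (sp 1 k ` (et e ` (et (- e) ` {1..int m})))" unfolding 1 by (simp add: image_comp comp_assoc)
    also have "et e ` (et (- e) ` {1..int m}) = fl 1 ` {1..int m}"
    proof -
      have "et e (et (- e) x) = fl 1 x" for x using e by (auto simp: et_def)
      then show ?thesis by (simp add: image_image)
    qed
    also have "sp 1 k ` (fl 1 ` {1..int m}) = fl k ` {1..int m}"
    proof -
      have "sp 1 k (fl 1 x) = fl k (sp 1 k x)" for x using fl_conj[OF sp1_sperm[OF kl], of 1 x] by (simp add: sp_1)
      then have "sp 1 k ` (fl 1 ` {1..int m}) = fl k ` (sp 1 k ` {1..int m})" by (simp add: image_comp comp_def)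
      also have "sp 1 k ` {1..int m} = {1..int m}" using k by (intro sp_image) auto
      finally show ?thesis .
    qed
    also have "\<zeta> ` (fl k ` {1..int m}) = (\<zeta> \<circ> fl k \<circ> et (- e)) ` LE (- e) m"
      unfolding 1 by (simp add: image_comp comp_def et_et)
    finally show "(\<zeta> \<circ> sp 1 k \<circ> et e) ` LE (- e) m = (\<zeta> \<circ> fl k \<circ> et (- e)) ` LE (- e) m" .
    fix a assume a: "1 \<le> a" "a \<le> int l" "a \<notin> LE (- e) m" "- a \<notin> LE (- e) m"
    then have "a > int m" using e by (cases "a = 1") (auto simp: LE_def)
    then show "(\<zeta> \<circ> sp 1 k \<circ> et e) a = (\<zeta> \<circ> fl k \<circ> et (- e)) a" using k m by (simp add: et_ge2 sp_other) (simp add: fl_def)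
  qed
qed

lemma inv_ring_OE: assumes m: "2 \<le> m" "m \<le> l" and e: "e = 1 \<or> e = - 1"
  shows "inv_ring l (insert e (OS m)) \<subseteq> (inv_ring l (OS m) :: 'k mpol set)"
  by (rule inv_ring_mono[OF subset_insertI adapted_sub[OF adapted_Oe(1)[OF m e]]])

lemma trace_Oe_inv: assumes m: "2 \<le> m" "m \<le> l" and e: "e = 1 \<or> e = - 1" and f: "(f :: 'k mpol) \<in> inv_ring l (OS m)"
  shows "tr l (OS m) (insert e (OS m)) f \<in> inv_ring l (insert e (OS m))"
  by (rule tr_inv[OF adapted_O(1)[OF m] adapted_Oe(1)[OF m e] subset_insertI _ f]) (auto simp: LO_def LE_def)

lemma nest_in:
  fixes fs :: "'k mpol list"
  assumes m: "2 \<le> m" "m \<le> l"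
  shows "set fs \<subseteq> inv_ring l (OS m) \<Longrightarrow> i + length fs = n \<Longrightarrow> c \<in> inv_ring l (insert 1 (OS m)) \<Longrightarrow>
     nest l n (OS m) i fs c \<in> inv_ring l (insert (sgn_idx n i) (OS m))"
proof (induction fs arbitrary: i)
  case (Cons f fs)
  have "nest l n (OS m) (Suc i) fs c \<in> inv_ring l (insert (sgn_idx n (Suc i)) (OS m))" using Cons by auto
  then have "nest l n (OS m) (Suc i) fs c \<in> inv_ring l (OS m)" using inv_ring_OE[OF m sgn_idx_cases] by blast
  then have "f * nest l n (OS m) (Suc i) fs c \<in> inv_ring l (OS m)"
    using Cons by (intro inv_ring_closed[OF OS_sub_N[OF m]]) auto
  from trace_Oe_inv[OF m sgn_idx_cases this] show ?case by simp
qed simp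

text \<open>Each trace contributes one entry of the path, and by \<open>eval_adjacent\<close> the inner trace is evaluated where the remaining path starts.\<close>

lemma nest_formula:
  fixes fs :: "'k mpol list"
  assumes m: "2 \<le> m" "m \<le> l"
  shows "set fs \<subseteq> inv_ring l (OS m) \<Longrightarrow> i + length fs = n \<Longrightarrow> c \<in> inv_ring l (insert 1 (OS m)) \<Longrightarrow> \<zeta> \<in> sperm l \<Longrightarrow>
     to_fract (act (\<zeta> \<circ> et (sgn_idx n i)) (nest l n (OS m) i fs c)) =
     (\<Sum>P\<in>paths m (length fs). path_wt m \<zeta> P * to_fract (val n i \<zeta> fs P) * to_fract (act (\<zeta> \<circ> flips P) c))"
proof (induction fs arbitrary: i \<zeta>)
  case Nil
  then show ?case by (simp add: paths_0)
next
  case (Cons f fs)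
  let ?e = "sgn_idx n i"
  let ?g = "nest l n (OS m) (Suc i) fs c"
  note e = sgn_idx_cases[of n i]
  have e': "sgn_idx n (Suc i) = - ?e" using Cons.prems(2) by (intro sgn_idx_Suc) auto
  have g: "?g \<in> inv_ring l (insert (- ?e) (OS m))" using nest_in[OF m, of fs "Suc i" n c] Cons.prems e' by auto
  then have gO: "?g \<in> inv_ring l (OS m)" using inv_ring_OE[OF m, of "- ?e"] e by auto
  have fg: "f * ?g \<in> inv_ring l (OS m)"
    using Cons.prems gO by (intro inv_ring_closed[OF OS_sub_N[OF m]]) auto
  have z: "\<zeta> \<in> sperm l" by fact
  have "to_fract (act (\<zeta> \<circ> et ?e) (nest l n (OS m) i (f # fs) c)) =
     (\<Sum>k\<in>{1..int m}. to_fract (act (\<zeta> \<circ> sp 1 k \<circ> et ?e) (f * ?g)) / (\<Prod>j\<in>{1..int m} - {k}. rtF \<zeta> k j))"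
    using trace_Oe_formula[OF m e z fg] by simp
  also have "\<dots> = (\<Sum>k\<in>{1..int m}. \<Sum>P\<in>paths m (length fs). path_wt m \<zeta> (k # P) * to_fract (val n i \<zeta> (f # fs) (k # P)) * to_fract (act (\<zeta> \<circ> flips (k # P)) c))"
  proof (intro sum.cong refl)
    fix k assume k: "k \<in> {1..int m}"
    have zk: "\<zeta> \<circ> fl k \<in> sperm l" using k m by (intro sperm_comp z flq_sperm) auto
    have IH: "to_fract (act (\<zeta> \<circ> fl k \<circ> et (- ?e)) ?g) = (\<Sum>P\<in>paths m (length fs). path_wt m (\<zeta> \<circ> fl k) P * to_fract (val n (Suc i) (\<zeta> \<circ> fl k) fs P) * to_fract (act (\<zeta> \<circ> fl k \<circ> flips P) c))"
    proof -
      have "set fs \<subseteq> inv_ring l (OS m)" "Suc i + length fs = n" using Cons.prems by auto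
      from Cons.IH[OF this Cons.prems(3) zk] show ?thesis unfolding e' .
    qed
    have "to_fract (act (\<zeta> \<circ> sp 1 k \<circ> et ?e) (f * ?g)) = to_fract (act (\<zeta> \<circ> sp 1 k \<circ> et ?e) f) *
      (\<Sum>P\<in>paths m (length fs). path_wt m (\<zeta> \<circ> fl k) P * to_fract (val n (Suc i) (\<zeta> \<circ> fl k) fs P) * to_fract (act (\<zeta> \<circ> fl k \<circ> flips P) c))"
      unfolding act_mult to_fract_mult eval_adjacent[OF m e z g k] IH ..
    then show "to_fract (act (\<zeta> \<circ> sp 1 k \<circ> et ?e) (f * ?g)) / (\<Prod>j\<in>{1..int m} - {k}. rtF \<zeta> k j) =
      (\<Sum>P\<in>paths m (length fs). path_wt m \<zeta> (k # P) * to_fract (val n i \<zeta> (f # fs) (k # P)) * to_fract (act (\<zeta> \<circ> flips (k # P)) c))"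
      by (simp only: path_wt.simps val.simps flips_Cons comp_assoc to_fract_mult sum_distrib_left sum_divide_distrib)
        (intro sum.cong refl, simp add: field_simps)
  qed
  also have "\<dots> = (\<Sum>P\<in>paths m (length (f # fs)). path_wt m \<zeta> P * to_fract (val n i \<zeta> (f # fs) P) * to_fract (act (\<zeta> \<circ> flips P) c))"
    by (simp only: sum_paths_Suc list.size) (simp add: sum_paths_Suc)
  finally show ?case .
qed

section \<open>Orthogonality of dual bases along paths\<close>

lemma flips_rev: "set Q \<subseteq> {1..int l} \<Longrightarrow> inv (flips Q) = flips (rev Q)"
  by (induction Q) (auto simp: flips_append flips_Cons sperm_inv_comp[OF flq_sperm flips_sperm] inv_fl)

lemma fl_fl_G: assumes m: "2 \<le> m" "m \<le> l" and ab: "a \<in> {1..int m}" "b \<in> {1..int m}"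
  shows "fl a \<circ> fl b \<in> G ({1, - 1} \<union> OS m)"
proof (cases "a = b")
  case True
  then have "fl a \<circ> fl b = id" by (simp add: fun_eq_iff fl_invol)
  then show ?thesis using G_id by metis
next
  case False
  have L: "LE 1 m = {1..int m}" using m by (auto simp: LE_def)
  have K: "{1, - 1} \<union> OS m \<subseteq> N l" by (rule adapted_sub[OF adapted_Opm[OF m]])
  define c where "c = sp 1 a b"
  have c: "c \<in> {1..int m}" "c \<noteq> 1" using ab False sp_image[of 1 "{1..int m}" a] unfolding c_def by (auto simp: sp_def)
  define \<sigma> where "\<sigma> = sp 1 a \<circ> sp 2 c"
  have "sp 1 a \<in> GS (LE 1 m)" "sp 2 c \<in> GS (LE 1 m)" using ab c m by (auto intro!: sp_GS simp: L)
  then have "\<sigma> \<in> G (insert 1 (OS m))" unfolding \<sigma>_def adapted_Oe(2)[OF m disjI1[OF refl]] by (rule GS_comp)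
  then have sG: "\<sigma> \<in> G ({1, - 1} \<union> OS m)" using G_mono[of "insert 1 (OS m)" "{1, - 1} \<union> OS m"] by auto
  have ss: "\<sigma> \<in> sperm l" using sG G_sperm[OF K] by auto
  have s2: "\<sigma> 2 = b" unfolding \<sigma>_def c_def using ab by (simp add: sp_1 sp_invol)
  have s1: "\<sigma> 1 = a" unfolding \<sigma>_def using c by (simp add: sp_1 sp_other)
  have 12: "fl 1 \<circ> fl 2 = sr (- 1) \<circ> sr 1" by (auto simp: fun_eq_iff fl_def sp_def)
  have "sr (- 1) \<in> G ({1, - 1} \<union> OS m)" "sr 1 \<in> G ({1, - 1} \<union> OS m)" by (intro G_sr; simp)+
  then have "fl 1 \<circ> fl 2 \<in> G ({1, - 1} \<union> OS m)" unfolding 12 by (rule G_comp)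
  then have *: "\<sigma> \<circ> ((fl 1 \<circ> fl 2) \<circ> inv \<sigma>) \<in> G ({1, - 1} \<union> OS m)" using G_comp[OF sG G_comp[OF _ G_inv[OF K sG]]] by blast
  have "\<sigma> \<circ> ((fl 1 \<circ> fl 2) \<circ> inv \<sigma>) = fl a \<circ> fl b"
    by (simp add: fun_eq_iff fl_conj[OF ss] s1 s2 sperm_f_inv[OF ss])
  then show ?thesis using * by (simp only:)
qed

lemma flips_even_G: assumes m: "2 \<le> m" "m \<le> l"
  shows "set Q \<subseteq> {1..int m} \<Longrightarrow> even (length Q) \<Longrightarrow> flips Q \<in> G ({1, - 1} \<union> OS m)"
proof (induction "length Q" arbitrary: Q rule: less_induct)
  case less
  show ?case
  proof (cases Q)
    case Nil then show ?thesis by (simp only: flips_Nil G_id)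
  next
    case (Cons a Q1)
    then obtain b Q2 where Q: "Q = a # b # Q2" using less.prems by (cases Q1) auto
    have "flips Q2 \<in> G ({1, - 1} \<union> OS m)" using less Q by auto
    moreover have "fl a \<circ> fl b \<in> G ({1, - 1} \<union> OS m)" using less.prems Q by (intro fl_fl_G m) auto
    ultimately show ?thesis unfolding Q flips_Cons comp_assoc[symmetric] using G_comp by blast
  qed
qed

lemma flips_abs: "\<bar>flips Q x\<bar> = \<bar>x\<bar>"
  by (induction Q arbitrary: x) (auto simp: flips_Cons fl_def)

text \<open>Two flips generate elements of type D, so for paths of equal length the quotient of the flips is in \<open>W\<^bsub>O\<plusminus>\<^esub>\<close>. It lies in the symmetric
  group only if it changes no sign at all.\<close>

lemma orthogonal_paths:
  fixes C :: "'k mpol set"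
  assumes m: "2 \<le> m" "m \<le> l" and C: "dual_hom_bases l (insert 1 (OS m)) ({1, - 1} \<union> OS m) C Cd" and z: "\<zeta> \<in> sperm l"
    and PQ: "P \<in> paths m n" "Q \<in> paths m n"
  shows "(\<Sum>c\<in>C. act (\<zeta> \<circ> flips P) c * act (\<zeta> \<circ> flips Q) (Cd c)) = (if flips P = flips Q then act (\<zeta> \<circ> flips Q) (prod_sums m) else 0)"
proof -
  have L: "LE 1 m = {1..int m}" using m by (auto simp: LE_def)
  note a1 = adapted_Oe[OF m disjI1[OF refl]] and a2 = adapted_Opm[OF m]
  have pl: "set P \<subseteq> {1..int l}" "set Q \<subseteq> {1..int l}" using PQ m by (auto simp: paths_def)
  note fP = flips_sperm[OF pl(1)] and fQ = flips_sperm[OF pl(2)]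
  define v where "v = flips (rev Q @ P)"
  have v: "inv (\<zeta> \<circ> flips Q) \<circ> (\<zeta> \<circ> flips P) = v"
  proof -
    have "inv (flips Q) \<circ> inv \<zeta> \<circ> (\<zeta> \<circ> flips P) = inv (flips Q) \<circ> (inv \<zeta> \<circ> \<zeta>) \<circ> flips P" by (simp add: comp_assoc)
    then show ?thesis unfolding v_def flips_append flips_rev[OF pl(2), symmetric] sperm_inv_comp[OF z fQ] sperm_inv_o[OF z] by simp
  qed
  have vG: "v \<in> G ({1, - 1} \<union> OS m)" unfolding v_def using PQ by (intro flips_even_G m) (auto simp: paths_def)
  have "v \<in> G (insert 1 (OS m)) \<longleftrightarrow> flips P = flips Q"
  proof
    assume "flips P = flips Q"
    then have "v = id" using v sperm_inv_o[OF sperm_comp[OF z fQ]] by metis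
    then show "v \<in> G (insert 1 (OS m))" by (simp only: G_id)
  next
    assume vI: "v \<in> G (insert 1 (OS m))"
    have vs: "v \<in> sperm l" using vG G_sperm[OF adapted_sub[OF a2]] by auto
    have "v a = a" if a: "1 \<le> a" "a \<le> int l" for a
    proof (cases "a \<le> int m")
      case True
      then have "v a \<in> {1..int m}" using adapted_mem[OF a1(1) vI, of a] a unfolding L by auto
      then show ?thesis using flips_abs[of "rev Q @ P" a] a by (simp add: v_def)
    next
      case False
      then show ?thesis using vI a unfolding a1(2) GS_def L by auto
    qed
    then have "v = id" by (intro sperm_eqI[OF vs id_sperm]) simp
    then have "flips Q \<circ> (inv (flips Q) \<circ> flips P) = flips Q" unfolding v_def flips_append flips_rev[OF pl(2)] by simp
    then show "flips P = flips Q" unfolding comp_assoc[symmetric] sperm_o_inv[OF fQ] by simp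
  qed
  moreover have "(\<Sum>c\<in>C. act (\<zeta> \<circ> flips P) c * act (\<zeta> \<circ> flips Q) (Cd c)) = (if v \<in> G (insert 1 (OS m)) then act (\<zeta> \<circ> flips Q) (\<Prod>(PosL (LD m) - PosL (LE 1 m))) else 0)"
  proof -
    have sub: "insert 1 (OS m) \<subseteq> {1, - 1} \<union> OS m" "LE 1 m \<subseteq> LD m" by (auto simp: L LD_def)
    show ?thesis using dual_bases_orthogonal_twisted[OF a1(1) a2 sub C sperm_comp[OF z fP] sperm_comp[OF z fQ]] vG unfolding v by blast
  qed
  ultimately show ?thesis unfolding prod_roots_D[OF m(1)] by simp
qed

lemma orthogonal_positions:
  fixes B :: "'k mpol set"
  assumes l3: "3 \<le> l" and e: "e = 1 \<or> e = - 1" and B: "dual_hom_bases l (insert e (OS (l - 1))) (insert e (OS l)) B d" and z: "\<zeta> \<in> sperm l"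
    and k: "k \<in> {1..int l}" "k' \<in> {1..int l}"
  shows "(\<Sum>b\<in>B. act (\<zeta> \<circ> sp (int l) k \<circ> et e) b * act (\<zeta> \<circ> sp (int l) k' \<circ> et e) (d b)) =
     (if k = k' then (\<Prod>j\<in>{1..int l} - {k}. rt (\<zeta> j) (\<zeta> k)) else 0)"
proof -
  have m: "2 \<le> l - 1" "l - 1 \<le> l" using l3 by auto
  note a1 = adapted_Oe[OF m e] and a2 = adapted_Oe[OF l2 le_refl e]
  have LL: "LE e (l - 1) = LE e l - {int l}" using l3 e by (auto simp: LE_def)
  have L: "a \<noteq> 0 \<and> \<bar>a\<bar> \<le> int l \<and> - a \<notin> LE e l" if "a \<in> LE e l" for a using that l3 e by (auto simp: LE_def)
  have lL: "int l \<in> LE e l" using l3 by (auto simp: LE_def)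
  let ?t = "\<zeta> \<circ> sp (int l) k \<circ> et e" and ?t' = "\<zeta> \<circ> sp (int l) k' \<circ> et e"
  have s: "?t \<in> sperm l" "?t' \<in> sperm l" "sp (int l) k' \<circ> et e \<in> sperm l" using k by (auto intro!: sperm_comp z spl_sperm)
  have sub: "insert e (OS (l - 1)) \<subseteq> insert e (OS l)" "LE e (l - 1) \<subseteq> LE e l" by (auto simp: OS_def LE_def)
  define v where "v = inv ?t' \<circ> ?t"
  have vs: "v \<in> sperm l" unfolding v_def by (intro sperm_comp sperm_inv s)
  have tim: "(\<zeta> \<circ> sp (int l) k \<circ> et e) ` LE e l = \<zeta> ` {1..int l}" if "k \<in> {1..int l}" for k
  proof -
    have "et e ` LE e l = {1..int l}" unfolding LE_et[OF e, symmetric, of l, OF order_trans[OF one_le_numeral l2]] by (simp add: image_comp et_et comp_def)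
    moreover have "sp (int l) k ` {1..int l} = {1..int l}" using that by (intro sp_image) auto
    ultimately show ?thesis by (simp only: image_comp[symmetric])
  qed
  have "v ` LE e l = inv ?t' ` (?t ` LE e l)" unfolding v_def by (simp only: image_comp)
  also have "?t ` LE e l = ?t' ` LE e l" by (simp only: tim[OF k(1)] tim[OF k(2)])
  also have "inv ?t' ` (?t' ` LE e l) = LE e l" using sperm_inv_f[OF s(2)] by (simp only: image_image image_ident)
  finally have "v ` LE e l = LE e l" .
  moreover have "v a = a" if "a \<notin> LE e l" "- a \<notin> LE e l" for a
  proof -
    have "a = 0 \<or> int l < \<bar>a\<bar>"
    proof (rule ccontr)
      assume "\<not> ?thesis"
      then have "a = 1 \<or> a = - 1 \<or> (2 \<le> a \<and> a \<le> int l) \<or> (2 \<le> - a \<and> - a \<le> int l)" by arith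
      then show False using that e by (auto simp: LE_def)
    qed
    then show ?thesis using sperm_0[OF vs] sperm_out[OF vs] by auto
  qed
  ultimately have vK: "v \<in> G (insert e (OS l))" unfolding a2(2) GS_def using vs by simp
  have vl: "v (int l) = int l \<longleftrightarrow> k = k'"
  proof -
    have "et e (int l) = int l" using l3 by (simp add: et_ge2)
    then have "?t (int l) = \<zeta> k" "?t' (int l) = \<zeta> k'" by (simp_all add: sp_1)
    then have "v (int l) = int l \<longleftrightarrow> inv ?t' (\<zeta> k) = inv ?t' (\<zeta> k')" using sperm_inv_f[OF s(2), of "int l"] by (simp add: v_def)
    then show ?thesis using sperm_inj[OF sperm_inv[OF s(2)]] sperm_inj[OF z] by simp
  qed
  have "v \<in> G (insert e (OS (l - 1))) \<longleftrightarrow> k = k'"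
  proof
    assume "v \<in> G (insert e (OS (l - 1)))"
    then have "v (int l) = int l" unfolding a1(2) GS_def using LL L[OF lL] by auto
    then show "k = k'" using vl by simp
  next
    assume "k = k'"
    then have "v = id" unfolding v_def using sperm_inv_o[OF s(2)] by simp
    then show "v \<in> G (insert e (OS (l - 1)))" by (simp only: G_id)
  qed
  moreover have "(\<Sum>b\<in>B. act ?t b * act ?t' (d b)) = (if v \<in> G (insert e (OS (l - 1))) then act ?t' (\<Prod>(PosL (LE e l) - PosL (LE e (l - 1)))) else 0)"
    using dual_bases_orthogonal_twisted[OF a1(1) a2(1) sub B s(1,2)] vK unfolding v_def by blast
  moreover have "act ?t' (\<Prod>(PosL (LE e l) - PosL (LE e (l - 1)))) = (\<Prod>j\<in>{1..int l} - {k'}. rt (\<zeta> j) (\<zeta> k') :: 'k mpol)"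
  proof -
    have "\<Prod>(PosL (LE e l) - PosL (LE e (l - 1))) = (\<Prod>a\<in>LE e l - {int l}. rt a (int l) :: 'k mpol)"
      unfolding LL by (rule prod_roots_extreme(2)) (use L lL e l3 in \<open>auto simp: LE_def\<close>)
    also have "act ?t' \<dots> = (\<Prod>a\<in>LE e l - {int l}. rt (\<zeta> ((sp (int l) k' \<circ> et e) a)) (\<zeta> k'))"
      unfolding act_prod act_rt[OF s(2)] using l3 by (intro prod.cong refl) (simp add: et_ge2 sp_1)
    also have "\<dots> = (\<Prod>j\<in>(sp (int l) k' \<circ> et e) ` (LE e l - {int l}). rt (\<zeta> j) (\<zeta> k'))"
      using sperm_inj[OF s(3)] by (subst prod.reindex) (auto simp: inj_on_def)
    also have "(sp (int l) k' \<circ> et e) ` (LE e l - {int l}) = {1..int l} - {k'}"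
    proof -
      have "(sp (int l) k' \<circ> et e) ` (LE e l - {int l}) = (sp (int l) k' \<circ> et e) ` LE e l - {(sp (int l) k' \<circ> et e) (int l)}"
        using sperm_inj[OF s(3)] by (auto simp: image_iff simp del: comp_apply)
      also have "(sp (int l) k' \<circ> et e) ` LE e l = {1..int l}"
      proof -
        have "et e ` LE e l = {1..int l}" unfolding LE_et[OF e, symmetric, of l, OF order_trans[OF one_le_numeral l2]] by (simp add: image_comp et_et comp_def)
        moreover have "sp (int l) k' ` {1..int l} = {1..int l}" using k by (intro sp_image) auto
        ultimately show ?thesis by (simp only: image_comp[symmetric])
      qed
      also have "(sp (int l) k' \<circ> et e) (int l) = k'" using l3 by (simp add: et_ge2 sp_1)
      finally show ?thesis .
    qed
    finally show ?thesis .
  qed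
  ultimately show ?thesis by simp
qed

end

section \<open>Lagrange interpolation along paths\<close>

definition zF :: "int \<Rightarrow> 'k::field mpol fract" where "zF a = to_fract (Xs a)"

text \<open>The monic polynomial in \<open>t\<close> whose roots are the signed variables met along the path.\<close>

fun path_poly :: "(int \<Rightarrow> int) \<Rightarrow> int list \<Rightarrow> 'k::field mpol fract \<Rightarrow> 'k mpol fract" where
  "path_poly \<zeta> [] t = 1"
| "path_poly \<zeta> (p # P) t = (t - zF (\<zeta> p)) * path_poly (\<zeta> \<circ> fl p) P t"

lemma path_poly_append: "path_poly \<zeta> (P @ [p]) t = path_poly \<zeta> P t * (t - zF ((\<zeta> \<circ> flips P) p))"
  by (induction P arbitrary: \<zeta>) (auto simp: flips_Cons comp_assoc mult.assoc)

lemma rtF_zF: "rtF \<zeta> a b = zF (\<zeta> b) - zF (\<zeta> a)" by (simp add: rtF_def rt_def zF_def)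

text \<open>The sum is the coefficient of degree \<open>card M - 1\<close> of the Lagrange interpolation of \<open>H\<close> at the nodes \<open>y\<close>, and \<open>H\<close> has degree less than
  \<open>card M\<close>, so it equals its interpolation.\<close>

lemma lagrange_sum:
  fixes y :: "'a \<Rightarrow> 'b::field" and H :: "'b poly"
  assumes M: "finite M" "M \<noteq> {}" "inj_on y M" and H: "degree H = card M - 1" "lead_coeff H = 1"
  shows "(\<Sum>k\<in>M. poly H (y k) / (\<Prod>j\<in>M - {k}. y k - y j)) = 1"
proof -
  let ?n = "card M"
  have n: "?n > 0" using M by (simp add: card_gt_0_iff)
  define L where "L k = (\<Prod>j\<in>M - {k}. [:- y j, 1:])" for k
  define c where "c k = poly H (y k) / (\<Prod>j\<in>M - {k}. y k - y j)" for k
  have dL: "degree (L k) = ?n - 1" "lead_coeff (L k) = 1" if "k \<in> M" for k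
  proof -
    show "degree (L k) = ?n - 1" unfolding L_def using M(1) that by (subst degree_prod_eq_sum_degree) auto
    show "lead_coeff (L k) = 1" unfolding L_def by (simp add: lead_coeff_prod)
  qed
  have cL: "coeff (L k) (?n - 1) = 1" if "k \<in> M" for k using dL[OF that] by simp
  have nz: "(\<Prod>j\<in>M - {k}. y k - y j) \<noteq> 0" if "k \<in> M" for k
    using M that by (auto simp: inj_on_def)
  define R where "R = (\<Sum>k\<in>M. smult (c k) (L k)) - H"
  have "poly R (y i) = 0" if i: "i \<in> M" for i
  proof -
    have z: "poly (L k) (y i) = 0" if "k \<in> M" "k \<noteq> i" for k
      unfolding L_def poly_prod using M(1) i that by (intro prod_zero) auto
    have "(\<Sum>k\<in>M. c k * poly (L k) (y i)) = (\<Sum>k\<in>M. if k = i then c i * poly (L i) (y i) else 0)"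
      by (intro sum.cong refl) (auto simp: z)
    also have "\<dots> = c i * poly (L i) (y i)" using M(1) i by simp
    also have "poly (L i) (y i) = (\<Prod>j\<in>M - {i}. y i - y j)" by (simp add: L_def poly_prod)
    also have "c i * \<dots> = poly H (y i)" using nz[OF i] by (simp add: c_def)
    finally show ?thesis by (simp add: R_def poly_sum)
  qed
  then have sub: "y ` M \<subseteq> {x. poly R x = 0}" by auto
  have dR: "degree R \<le> ?n - 1" unfolding R_def
    by (intro degree_diff_le degree_sum_le) (use M H dL in \<open>auto intro: order_trans[OF degree_smult_le]\<close>)
  have "R = 0"
  proof (rule ccontr)
    assume R: "R \<noteq> 0"
    have "?n \<le> card {x. poly R x = 0}" using card_mono[OF poly_roots_finite[OF R] sub] M by (simp add: card_image)
    also have "\<dots> \<le> degree R" by (rule card_poly_roots_bound[OF R])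
    finally show False using dR n by simp
  qed
  then have "coeff R (?n - 1) = 0" by simp
  then have "(\<Sum>k\<in>M. c k * coeff (L k) (?n - 1)) = coeff H (?n - 1)" by (simp add: R_def coeff_sum)
  moreover have "(\<Sum>k\<in>M. c k * coeff (L k) (?n - 1)) = (\<Sum>k\<in>M. c k)"
    by (intro sum.cong refl) (simp only: cL mult_1_right)
  ultimately have "(\<Sum>k\<in>M. c k) = coeff H (?n - 1)" by simp
  then show ?thesis using H by (simp add: c_def)
qed

context typeD begin

lemma zF_inj: "a \<noteq> 0 \<Longrightarrow> b \<noteq> 0 \<Longrightarrow> (zF a :: 'k mpol fract) = zF b \<longleftrightarrow> a = b"
  by (simp add: zF_def Xs_inj)
lemma zF_neg: "a \<noteq> 0 \<Longrightarrow> zF (- a) = (- zF a :: 'k mpol fract)" by (simp add: zF_def Xs_uminus)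

text \<open>The coordinates that a path meets an odd number of times.\<close>

definition flipped :: "int list \<Rightarrow> int set" where "flipped P = {i \<in> {1..int l}. flips P i = - i}"

lemma flipped_snoc: assumes p: "p \<in> {1..int l}" shows "flipped (P @ [p]) = (if p \<in> flipped P then flipped P - {p} else insert p (flipped P))"
proof -
  have fp: "flips (P @ [p]) i = (if i = p then - flips P p else flips P i)" if i: "i \<in> {1..int l}" for i
  proof -
    have "flips P (- p) = - flips P p"
    proof (induction P)
      case (Cons a P) then show ?case by (simp add: flips_Cons) (simp add: fl_def)
    qed simp
    then show ?thesis using i p by (auto simp: flips_append flips_Cons fl_def)
  qed
  have pm: "flips P p = p \<or> flips P p = - p" using flips_abs[of P p] by (simp add: abs_eq_iff)
  show ?thesis
  proof (intro set_eqI)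
    fix i
    show "i \<in> flipped (P @ [p]) \<longleftrightarrow> i \<in> (if p \<in> flipped P then flipped P - {p} else insert p (flipped P))"
      using fp[of i] pm p by (cases "i = p") (auto simp: flipped_def)
  qed
qed

text \<open>Successive visits of a path to a coordinate \<open>i\<close> have alternating signs, so each pair of visits contributes \<open>t\<^sup>2 - x\<^sub>i\<^sup>2\<close> and a last
  unpaired one contributes \<open>t - x\<^sub>i\<close>.\<close>

lemma path_poly_poly:
  assumes P: "set P \<subseteq> {1..int l}"
  shows "\<exists>H :: 'k mpol fract poly. lead_coeff H = 1 \<and> card (flipped P) + 2 * degree H = length P \<and>
     (\<forall>t. path_poly id P t = (\<Prod>i\<in>flipped P. t - zF i) * poly H (t * t))"
  using P
proof (induction P rule: rev_induct)
  case Nil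
  have "flipped [] = {}" by (auto simp: flipped_def)
  then show ?case by (intro exI[of _ 1]) simp
next
  case (snoc p P)
  then have "set P \<subseteq> {1..int l}" by simp
  from snoc.IH[OF this] obtain H :: "'k mpol fract poly" where H: "lead_coeff H = 1" "card (flipped P) + 2 * degree H = length P"
     "\<And>t. path_poly id P t = (\<Prod>i\<in>flipped P. t - zF i) * poly H (t * t)" by blast
  have p: "p \<in> {1..int l}" "p \<noteq> 0" using snoc by auto
  have fin: "finite (flipped P)" by (rule finite_subset[of _ "{1..int l}"]) (auto simp: flipped_def)
  have pm: "flips P p = p \<or> flips P p = - p" using flips_abs[of P p] by (simp add: abs_eq_iff)
  show ?case
  proof (cases "p \<in> flipped P")
    case True
    then have fp: "flips P p = - p" by (simp add: flipped_def)
    have H0: "H \<noteq> 0" using H(1) by auto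
    \<comment> \<open>The second visit to \<open>p\<close> completes the factor \<open>t\<^sup>2 - x\<^sub>p\<^sup>2\<close>.\<close>
    define H' where "H' = [:- (zF p * zF p), 1:] * H"
    have "lead_coeff H' = 1" using H(1) by (simp add: H'_def lead_coeff_mult del: mult_pCons_left)
    moreover have "degree H' = Suc (degree H)" unfolding H'_def using H0 by (subst degree_mult_eq) auto
    moreover have "card (flipped P) = Suc (card (flipped P - {p}))" using fin True by (metis card_Suc_Diff1)
    moreover have "path_poly id (P @ [p]) t = (\<Prod>i\<in>flipped P - {p}. t - zF i) * poly H' (t * t)" for t
    proof -
      have "path_poly id (P @ [p]) t = (\<Prod>i\<in>flipped P. t - zF i) * poly H (t * t) * (t + zF p)"
        unfolding path_poly_append H(3) by (simp add: fp zF_neg[OF p(2)])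
      also have "(\<Prod>i\<in>flipped P. t - zF i) = (t - zF p) * (\<Prod>i\<in>flipped P - {p}. t - zF i)" by (rule prod.remove[OF fin True])
      also have "(t - zF p) * (\<Prod>i\<in>flipped P - {p}. t - zF i) * poly H (t * t) * (t + zF p) = (\<Prod>i\<in>flipped P - {p}. t - zF i) * poly H' (t * t)"
        by (simp add: H'_def algebra_simps)
      finally show ?thesis .
    qed
    ultimately show ?thesis using H(2) True
      unfolding flipped_snoc[OF p(1), of P] if_P[OF True] by (intro exI[of _ H'] conjI allI) (assumption | simp)+
  next
    case False
    then have fp: "flips P p = p" using pm p by (auto simp: flipped_def)
    have "path_poly id (P @ [p]) t = (\<Prod>i\<in>insert p (flipped P). t - zF i) * poly H (t * t)" for t
      unfolding path_poly_append H(3) using fin False by (simp add: fp)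
    then show ?thesis using H(1,2) False fin
      unfolding flipped_snoc[OF p(1), of P] if_not_P[OF False] by (intro exI[of _ H] conjI allI) (assumption | simp)+
  qed
qed

lemma flipped_eq: "flips P = flips Q \<Longrightarrow> flipped P = flipped Q" by (simp add: flipped_def)

text \<open>The terms with \<open>k\<close> in the flipped set \<open>S\<close> vanish. For the others the factors \<open>x\<^sub>k - x\<^sub>i\<close> with \<open>i\<close> in \<open>S\<close> cancel, since flipping turns
  \<open>x\<^sub>k + z\<^sub>i\<close> into \<open>x\<^sub>k - x\<^sub>i\<close>; what remains is \<open>lagrange_sum\<close> at the squares.\<close>

lemma lagrange_paths:
  assumes P: "P \<in> paths l (l - 1)" and Q: "Q \<in> paths l (l - 1)" and eq: "flips P = flips Q"
  shows "(\<Sum>k\<in>{1..int l}. path_poly id P (zF k) * path_poly id Q (zF k) / ((\<Prod>r\<in>{1..int l} - {k}. zF k - zF r) * (\<Prod>r\<in>{1..int l} - {k}. zF k + zF (flips Q r)))) = (1 :: 'k mpol fract)"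
proof -
  have Pl: "set P \<subseteq> {1..int l}" "length P = l - 1" and Ql: "set Q \<subseteq> {1..int l}" "length Q = l - 1" using P Q by (auto simp: paths_def)
  define S where "S = flipped Q"
  define M where "M = {1..int l} - S"
  have SP: "flipped P = S" unfolding S_def by (rule flipped_eq[OF eq])
  have S1: "S \<subseteq> {1..int l}" by (auto simp: S_def flipped_def)
  have fin: "finite S" "finite M" using S1 by (auto simp: M_def intro: finite_subset)
  have cM: "card M = l - card S" unfolding M_def using S1 fin by (simp add: card_Diff_subset)
  obtain H1 :: "'k mpol fract poly" where H1: "lead_coeff H1 = 1" "card S + 2 * degree H1 = l - 1"
     "\<And>t. path_poly id P t = (\<Prod>i\<in>S. t - zF i) * poly H1 (t * t)" using path_poly_poly[OF Pl(1)] unfolding SP Pl(2) by auto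
  obtain H2 :: "'k mpol fract poly" where H2: "lead_coeff H2 = 1" "card S + 2 * degree H2 = l - 1"
     "\<And>t. path_poly id Q t = (\<Prod>i\<in>S. t - zF i) * poly H2 (t * t)" using path_poly_poly[OF Ql(1)] unfolding S_def[symmetric] Ql(2) by auto
  let ?y = "\<lambda>k :: int. zF k * zF k :: 'k mpol fract"
  have zz: "(zF a :: 'k mpol fract) - zF b \<noteq> 0" "(zF a :: 'k mpol fract) + zF b \<noteq> 0" if "a \<in> {1..int l}" "b \<in> {1..int l}" "a \<noteq> b" for a b
  proof -
    show "(zF a :: 'k mpol fract) - zF b \<noteq> 0" using zF_inj[of a b] that by auto
    have "(zF a :: 'k mpol fract) \<noteq> zF (- b)" using zF_inj[of a "- b"] that by auto
    then have "(zF a :: 'k mpol fract) \<noteq> - zF b" using zF_neg[of b] that by simp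
    then show "(zF a :: 'k mpol fract) + zF b \<noteq> 0" unfolding eq_neg_iff_add_eq_0 .
  qed
  have H12: "H1 \<noteq> 0" "H2 \<noteq> 0" using H1(1) H2(1) by auto
  have deg: "degree (H1 * H2) = card M - 1" "lead_coeff (H1 * H2) = 1"
  proof -
    show "degree (H1 * H2) = card M - 1" unfolding degree_mult_eq[OF H12] cM using H1(2) H2(2) by arith
    show "lead_coeff (H1 * H2) = 1" by (simp only: lead_coeff_mult H1(1) H2(1) mult_1)
  qed
  have Mne: "M \<noteq> {}" using H1(2) cM l2 fin by (metis One_nat_def Suc_diff_1 card.empty diff_is_0_eq le_add1 not_less_eq_eq order_trans pos2 zero_less_diff less_le_trans)
  have inj: "inj_on ?y M"
  proof (rule inj_onI, rule ccontr)
    fix a b assume ab: "a \<in> M" "b \<in> M" "?y a = ?y b" "a \<noteq> b"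
    have "(zF a - zF b) * (zF a + zF b) = (0 :: 'k mpol fract)" using ab(3) by (simp add: algebra_simps)
    then show False using zz[of a b] ab M_def by auto
  qed
  have trm: "path_poly id P (zF k) * path_poly id Q (zF k) / ((\<Prod>r\<in>{1..int l} - {k}. zF k - zF r) * (\<Prod>r\<in>{1..int l} - {k}. zF k + zF (flips Q r)))
     = poly (H1 * H2) (?y k) / (\<Prod>j\<in>M - {k}. ?y k - ?y j)" if k: "k \<in> M" for k
  proof -
    let ?a = "\<Prod>i\<in>S. zF k - zF i :: 'k mpol fract"
    have kS: "k \<notin> S" "k \<in> {1..int l}" using k by (auto simp: M_def)
    have "zF k - zF i \<noteq> (0 :: 'k mpol fract)" if "i \<in> S" for i using zz(1)[of k i] kS S1 that by blast
    then have a0: "?a \<noteq> 0" using fin(1) by simp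
    have D: "{1..int l} - {k} = S \<union> (M - {k})" "S \<inter> (M - {k}) = {}" using kS S1 by (auto simp: M_def)
    have e1: "(\<Prod>r\<in>{1..int l} - {k}. zF k - zF r) = ?a * (\<Prod>r\<in>M - {k}. zF k - zF r)"
      unfolding D(1) by (rule prod.union_disjoint) (use fin D in auto)
    have "(\<Prod>r\<in>{1..int l} - {k}. zF k + zF (flips Q r)) = (\<Prod>r\<in>S. zF k + zF (flips Q r)) * (\<Prod>r\<in>M - {k}. zF k + zF (flips Q r))"
      unfolding D(1) by (rule prod.union_disjoint) (use fin D in auto)
    also have "(\<Prod>r\<in>S. zF k + zF (flips Q r)) = ?a"
    proof (intro prod.cong refl)
      fix r assume "r \<in> S"
      then have "flips Q r = - r" "r \<noteq> 0" by (auto simp: S_def flipped_def)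
      then show "zF k + zF (flips Q r) = (zF k - zF r :: 'k mpol fract)" by (simp add: zF_neg)
    qed
    also have "(\<Prod>r\<in>M - {k}. zF k + zF (flips Q r)) = (\<Prod>r\<in>M - {k}. zF k + zF r :: 'k mpol fract)"
    proof (intro prod.cong refl)
      fix r assume "r \<in> M - {k}"
      then have "flips Q r \<noteq> - r" by (auto simp: M_def S_def flipped_def)
      then have "flips Q r = r" using flips_abs[of Q r] by (simp add: abs_eq_iff)
      then show "zF k + zF (flips Q r) = (zF k + zF r :: 'k mpol fract)" by simp
    qed
    finally have e2: "(\<Prod>r\<in>{1..int l} - {k}. zF k + zF (flips Q r)) = ?a * (\<Prod>r\<in>M - {k}. zF k + zF r)" .
    have e3: "(\<Prod>j\<in>M - {k}. ?y k - ?y j) = (\<Prod>r\<in>M - {k}. zF k - zF r) * (\<Prod>r\<in>M - {k}. zF k + zF r)"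
      unfolding prod.distrib[symmetric] by (intro prod.cong refl) (simp add: algebra_simps)
    show ?thesis unfolding e1 e2 e3 H1(3) H2(3) poly_mult using a0 by simp
  qed
  have zero: "path_poly id P (zF k) * path_poly id Q (zF k) / ((\<Prod>r\<in>{1..int l} - {k}. zF k - zF r) * (\<Prod>r\<in>{1..int l} - {k}. zF k + zF (flips Q r))) = (0 :: 'k mpol fract)" if k: "k \<in> S" for k
  proof -
    have "(\<Prod>i\<in>S. zF k - zF i :: 'k mpol fract) = 0" by (rule prod_zero[OF fin(1)]) (use k in auto)
    then show ?thesis unfolding H1(3) by simp
  qed
  have "(\<Sum>k\<in>{1..int l}. path_poly id P (zF k) * path_poly id Q (zF k) / ((\<Prod>r\<in>{1..int l} - {k}. zF k - zF r) * (\<Prod>r\<in>{1..int l} - {k}. zF k + zF (flips Q r))))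
     = (\<Sum>k\<in>M. poly (H1 * H2) (?y k) / (\<Prod>j\<in>M - {k}. ?y k - ?y j))"
    by (rule sum.mono_neutral_cong_right) (use zero trm in \<open>auto simp: M_def\<close>)
  also have "\<dots> = 1" by (rule lagrange_sum[OF fin(2) Mne inj deg])
  finally show ?thesis .
qed

text \<open>The trace from \<open>I\<close> to \<open>O\<close> chooses a coordinate \<open>k\<close> different from the first one to play the role of \<open>x\<^sub>l\<close>. Relabelling by \<open>sp l k\<close> and renaming the path
  entry accordingly presents the remaining point in the form that \<open>val\<close> uses for \<open>l - 1\<close> coordinates.\<close>

lemma trace_I_formula:
  fixes h :: "'k mpol"
  assumes l3: "3 \<le> l" and e: "e = 1 \<or> e = - 1" and z: "\<zeta> \<in> sperm l" and q: "q \<in> {1..int l}" and h: "h \<in> inv_ring l (OS (l - 1))"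
  shows "to_fract (act (\<zeta> \<circ> sp 1 q \<circ> et e) (tr l (OS (l - 1)) (OS l) h)) =
    (\<Sum>k\<in>{1..int l} - {q}. to_fract (act (\<zeta> \<circ> sp (int l) k \<circ> sp 1 (sp (int l) k q) \<circ> et e) h) / (\<Prod>j\<in>{1..int l} - {q} - {k}. rtF \<zeta> j k))"
proof -
  have m: "2 \<le> l - 1" "l - 1 \<le> l" using l3 by auto
  note a1 = adapted_O[OF m] and a2 = adapted_O[OF l2 le_refl]
  have LL: "LO (l - 1) = LO l - {int l}" using l3 by (auto simp: LO_def)
  have L: "a \<noteq> 0 \<and> \<bar>a\<bar> \<le> int l \<and> - a \<notin> LO l" if "a \<in> LO l" for a using that by (auto simp: LO_def)
  have lL: "int l \<in> LO l" using l3 by (auto simp: LO_def)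
  let ?t = "\<zeta> \<circ> sp 1 q \<circ> et e"
  have ts: "?t \<in> sperm l" by (intro sperm_comp z sp1_sperm[OF q] et_sperm)
  have sub: "OS (l - 1) \<subseteq> OS l" by (auto simp: OS_def)
  have pr: "\<Prod>(PosL (LO l) - PosL (LO (l - 1))) = (\<Prod>a\<in>LO l - {int l}. rt a (int l) :: 'k mpol)"
    unfolding LL by (rule prod_roots_extreme(2)) (use L lL l3 in \<open>auto simp: LO_def\<close>)
  have q0: "1 \<noteq> (0::int)" "q \<noteq> 0" "1 \<noteq> - q" using q by auto
  have s1s: "sp 1 q \<in> sperm l" by (rule sp1_sperm[OF q])
  have inj1: "inj (sp 1 q)" using sperm_bij[OF s1s] bij_is_inj by blast
  have im1: "sp 1 q ` LO l = {1..int l} - {q}"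
  proof -
    have "LO l = {1..int l} - {1}" by (auto simp: LO_def)
    then have "sp 1 q ` LO l = sp 1 q ` {1..int l} - sp 1 q ` {1}" using image_set_diff[OF inj1, of "{1..int l}" "{1}"] by (simp only:)
    also have "sp 1 q ` {1..int l} = {1..int l}" using q by (intro sp_image) auto
    finally show ?thesis by (simp add: sp_1)
  qed
  have etLE: "et e ` LE e l = {1..int l}"
    unfolding LE_et[OF e, symmetric, of l, OF order_trans[OF one_le_numeral l2]] by (simp add: image_image et_et)
  have eL: "e \<in> LE e l" "int l \<in> LE e l" using l3 by (auto simp: LE_def)
  have LOE: "LO (l - 1) = LE e l - {e, int l}" using l3 e by (auto simp: LO_def LE_def)
  have "to_fract (act ?t (tr l (OS (l - 1)) (OS l) h)) =
    (\<Sum>k\<in>LO l. to_fract (act (?t \<circ> sp (int l) k) h) / to_fract (act (?t \<circ> sp (int l) k) (\<Prod>a\<in>LO l - {int l}. rt a (int l))))"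
    using trace_single_coset[OF a1 a2 sub LL lL L h ts] unfolding pr .
  also have "\<dots> = (\<Sum>k\<in>LO l. to_fract (act (\<zeta> \<circ> sp (int l) (sp 1 q k) \<circ> sp 1 (sp (int l) (sp 1 q k) q) \<circ> et e) h) / (\<Prod>j\<in>{1..int l} - {q} - {sp 1 q k}. rtF \<zeta> j (sp 1 q k)))"
  proof (intro sum.cong refl)
    fix k' assume k': "k' \<in> LO l"
    define k where "k = sp 1 q k'"
    have k: "k \<in> {1..int l} - {q}" unfolding k_def im1[symmetric] using k' by blast
    have kl: "k \<in> {1..int l}" and kq: "k \<noteq> q" using k by auto
    have k'l: "k' \<in> {1..int l}" "2 \<le> k'" using k' by (auto simp: LO_def)
    define q' where "q' = sp (int l) k q"
    have q': "q' \<in> {1..int l}" "q' \<noteq> int l"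
    proof -
      have "sp (int l) k ` {1..int l} = {1..int l}" using kl by (intro sp_image) auto
      then show "q' \<in> {1..int l}" unfolding q'_def using q by blast
      show "q' \<noteq> int l" unfolding q'_def using q kl kq by (auto simp: sp_def)
    qed
    have q'q: "sp (int l) k q' = q" unfolding q'_def using kl by (intro sp_invol) auto
    let ?A = "?t \<circ> sp (int l) k'" and ?B = "\<zeta> \<circ> sp (int l) k \<circ> sp 1 q' \<circ> et e"
    have As: "?A \<in> sperm l" by (intro sperm_comp ts spl_sperm k'l)
    have Bs: "?B \<in> sperm l" by (intro sperm_comp z spl_sperm sp1_sperm et_sperm kl q')
    have Al: "?A (int l) = \<zeta> k" using k'l by (simp add: sp_1 et_ge2 k_def)
    have Bl: "?B (int l) = \<zeta> k" using l3 q' by (simp add: et_ge2 sp_other sp_1)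
    have "sp (int l) k' e = e" using k'l l3 e by (auto intro: sp_other)
    then have Ae: "?A e = \<zeta> q" by (simp add: et_e(1)[OF e] sp_1)
    have Be: "?B e = \<zeta> q" by (simp add: et_e(1)[OF e] sp_1 q'q)
    have A1: "?A 1 = ?B 1"
    proof (cases "e = 1")
      case True then show ?thesis using Ae Be by (simp only:)
    next
      case False
      then have "e = - 1" using e by simp
      then have "?A (- 1) = ?B (- 1)" using Ae Be by (simp only:)
      then show ?thesis using sperm_odd[OF As, of 1] sperm_odd[OF Bs, of 1] by (simp only: neg_equal_iff_equal)
    qed
    have Aim: "?A ` LE e l = \<zeta> ` {1..int l}"
    proof -
      have "sp (int l) k' ` LE e l = LE e l"
      proof -
        have "sp (int l) k' \<in> GS (LE e l)" using k'l l3 e eL by (intro sp_GS) (auto simp: LE_def)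
        then show ?thesis by (simp add: GS_def)
      qed
      moreover have "sp 1 q ` {1..int l} = {1..int l}" using q by (intro sp_image) auto
      ultimately show ?thesis by (simp only: image_comp[symmetric] etLE)
    qed
    have Bim: "?B ` LE e l = \<zeta> ` {1..int l}"
    proof -
      have "sp (int l) k ` {1..int l} = {1..int l}" "sp 1 q' ` {1..int l} = {1..int l}" by ((intro sp_image; use kl q' in auto), (intro sp_image; use kl q' in auto))
      then show ?thesis by (simp only: image_comp[symmetric] etLE)
    qed
    have AL: "?A ` LO (l - 1) = ?A ` LE e l - {?A e, ?A (int l)}" unfolding LOE using image_set_diff[OF bij_is_inj[OF sperm_bij[OF As]]] by (simp only: image_insert image_empty)
    have BL: "?B ` LO (l - 1) = ?B ` LE e l - {?B e, ?B (int l)}" unfolding LOE using image_set_diff[OF bij_is_inj[OF sperm_bij[OF Bs]]] by (simp only: image_insert image_empty)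
    have num: "act ?A h = act ?B h"
    proof (rule act_eqI[OF adapted_sub[OF a1(1)] a1(2) h As Bs])
      show "?A ` LO (l - 1) = ?B ` LO (l - 1)" by (simp only: AL BL Aim Bim Al Bl Ae Be)
      fix a assume "1 \<le> a" "a \<le> int l" "a \<notin> LO (l - 1)"
      then have "a = 1 \<or> a = int l" using l3 by (auto simp: LO_def)
      then show "?A a = ?B a" using A1 Al Bl by (elim disjE) (simp_all only:)
    qed
    have den: "to_fract (act ?A (\<Prod>a\<in>LO l - {int l}. rt a (int l))) = (\<Prod>j\<in>{1..int l} - {q} - {k}. rtF \<zeta> j k :: 'k mpol fract)"
    proof -
      let ?s = "sp 1 q \<circ> sp (int l) k'"
      have ss: "?s \<in> sperm l" by (intro sperm_comp s1s spl_sperm k'l)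
      have Aa: "?A a = \<zeta> (?s a)" if "a \<in> LO l - {int l}" for a
      proof -
        have "sp (int l) k' a \<ge> 2" using that k'l l3 by (auto simp: sp_def LO_def)
        then show ?thesis by (simp add: et_ge2)
      qed
      have "to_fract (act ?A (\<Prod>a\<in>LO l - {int l}. rt a (int l))) = (\<Prod>a\<in>LO l - {int l}. rtF \<zeta> (?s a) k :: 'k mpol fract)"
        unfolding act_prod to_fract_prod act_rt[OF As] Al by (intro prod.cong refl) (simp only: Aa rtF_def)
      also have "\<dots> = (\<Prod>j\<in>?s ` (LO l - {int l}). rtF \<zeta> j k)"
        using sperm_inj[OF ss] by (subst prod.reindex) (auto simp: inj_on_def)
      also have "?s ` (LO l - {int l}) = {1..int l} - {q} - {k}"
      proof -
        have "?s ` (LO l - {int l}) = ?s ` LO l - {?s (int l)}"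
          using image_set_diff[OF bij_is_inj[OF sperm_bij[OF ss]], of "LO l" "{int l}"] by (simp only: image_insert image_empty)
        also have "?s ` LO l = sp 1 q ` (sp (int l) k' ` LO l)" by (simp only: image_comp)
        also have "sp (int l) k' ` LO l = LO l" using k'l l3 by (intro sp_image) (auto simp: LO_def)
        also have "?s (int l) = k" by (simp add: sp_1 k_def)
        finally show ?thesis unfolding im1 .
      qed
      finally show ?thesis .
    qed
    show "to_fract (act ?A h) / to_fract (act ?A (\<Prod>a\<in>LO l - {int l}. rt a (int l))) =
      to_fract (act (\<zeta> \<circ> sp (int l) (sp 1 q k') \<circ> sp 1 (sp (int l) (sp 1 q k') q) \<circ> et e) h) / (\<Prod>j\<in>{1..int l} - {q} - {sp 1 q k'}. rtF \<zeta> j (sp 1 q k'))"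
      unfolding num den k_def[symmetric] q'_def[symmetric] ..
  qed
  also have "\<dots> = (\<Sum>k\<in>sp 1 q ` LO l. to_fract (act (\<zeta> \<circ> sp (int l) k \<circ> sp 1 (sp (int l) k q) \<circ> et e) h) / (\<Prod>j\<in>{1..int l} - {q} - {k}. rtF \<zeta> j k))"
    by (subst sum.reindex[OF inj_on_subset[OF inj1 subset_UNIV]]) (simp add: comp_def)
  finally show ?thesis unfolding im1 .
qed

end

section \<open>The kernel of the map u\<close>

lemma val_append: "length us = length P \<Longrightarrow> val n i \<zeta> (us @ vs) (P @ Q) = val n i \<zeta> us P * val n (i + length us) (\<zeta> \<circ> flips P) vs Q"
proof (induction us arbitrary: i \<zeta> P)
  case (Cons f us)
  then obtain p P' where P: "P = p # P'" "length us = length P'" by (cases P) auto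
  show ?case unfolding P append_Cons val.simps flips_Cons using Cons.IH[OF P(2), of "Suc i" "\<zeta> \<circ> fl p"]
    by (simp only: comp_assoc mult.assoc list.size add_Suc_right add_Suc add_0_right plus_1_eq_Suc One_nat_def)
qed simp

lemma val_replicate: "val n i \<zeta> (replicate r 1) P = 1"
  by (induction r arbitrary: i \<zeta> P) (simp, case_tac P, simp_all)

lemma val_prod: "length gs = length Q \<Longrightarrow> val n i \<zeta> gs Q =
   (\<Prod>j<length gs. act (\<zeta> \<circ> flips (take j Q) \<circ> sp 1 (Q ! j) \<circ> et (sgn_idx n (i + j))) (gs ! j))"
proof (induction gs arbitrary: i \<zeta> Q)
  case (Cons g gs)
  then obtain q Q' where Q: "Q = q # Q'" "length gs = length Q'" by (cases Q) auto
  show ?case unfolding Q val.simps Cons.IH[OF Q(2)]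
    by (simp add: prod.lessThan_Suc_shift flips_Cons comp_assoc Q(2) del: comp_apply prod.lessThan_Suc)
qed simp

lemma path_poly_prod: "path_poly \<zeta> Q t = (\<Prod>j<length Q. t - zF ((\<zeta> \<circ> flips (take j Q)) (Q ! j)))"
proof (induction Q arbitrary: \<zeta>)
  case (Cons q Q)
  show ?case unfolding path_poly.simps Cons.IH by (simp add: prod.lessThan_Suc_shift flips_Cons del: prod.lessThan_Suc)
qed simp

lemma fl_other: "0 < k \<Longrightarrow> 0 < q \<Longrightarrow> q \<noteq> k \<Longrightarrow> fl q k = k" by (simp add: fl_def)

lemma path_poly_zero: "k \<in> set Q \<Longrightarrow> 0 < k \<Longrightarrow> (\<And>q. q \<in> set Q \<Longrightarrow> 0 < q) \<Longrightarrow> \<zeta> k = k \<Longrightarrow> path_poly \<zeta> Q (zF k) = 0"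
proof (induction Q arbitrary: \<zeta>)
  case (Cons q Q)
  show ?case
  proof (cases "q = k")
    case False
    then have a: "k \<in> set Q" and b: "(\<zeta> \<circ> fl q) k = k" using Cons.prems by (auto simp: fl_other)
    have c: "0 < q'" if "q' \<in> set Q" for q' using Cons.prems(3) that by simp
    show ?thesis unfolding path_poly.simps by (subst Cons.IH[of "\<zeta> \<circ> fl q", OF a Cons.prems(2) c b]) simp_all
  qed (use Cons.prems in simp)
qed simp

text \<open>A coordinate that the path avoids keeps its sign.\<close>

lemma flips_fixed: "k \<notin> set Q \<Longrightarrow> 0 < k \<Longrightarrow> (\<And>q. q \<in> set Q \<Longrightarrow> 0 < q) \<Longrightarrow> flips Q k = k"
  by (induction Q) (auto simp: flips_Cons fl_other)

lemma paths_nth: "Q \<in> paths m n \<Longrightarrow> j < n \<Longrightarrow> Q ! j \<in> {1..int m}"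
  by (auto simp: paths_def subset_iff)

context typeD begin

lemma flips_map: "k \<in> {1..int l} \<Longrightarrow> sp (int l) k \<circ> flips (map (sp (int l) k) P) = flips P \<circ> sp (int l) k"
proof (induction P)
  case (Cons p P)
  note s = spl_sperm[OF Cons.prems]
  have i: "sp (int l) k (sp (int l) k x) = x" for x using Cons.prems by (intro sp_invol) auto
  have "sp (int l) k \<circ> fl (sp (int l) k p) = fl p \<circ> sp (int l) k"
    using fl_conj[OF s, of "sp (int l) k p"] by (simp add: fun_eq_iff i)
  then have "sp (int l) k \<circ> flips (map (sp (int l) k) (p # P)) = fl p \<circ> (sp (int l) k \<circ> flips (map (sp (int l) k) P))"
    by (simp only: list.map flips_Cons comp_assoc[symmetric])
  then show ?case unfolding Cons.IH[OF Cons.prems] flips_Cons comp_assoc .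
qed simp

text \<open>Invariants under the group of the own sign do not see which coordinate comes first.\<close>

lemma eval_own:
  fixes g :: "'k mpol"
  assumes m: "2 \<le> m" "m \<le> l" and e: "e = 1 \<or> e = - 1" and z: "\<zeta> \<in> sperm l" and g: "g \<in> inv_ring l (insert e (OS m))" and k: "k \<in> {1..int m}"
  shows "act (\<zeta> \<circ> sp 1 k \<circ> et e) g = act (\<zeta> \<circ> et e) g"
proof -
  note a2 = adapted_Oe[OF m e]
  have kl: "k \<in> {1..int l}" using k m by auto
  show ?thesis
  proof (rule act_eqI[OF adapted_sub[OF a2(1)] a2(2) g])
    show "\<zeta> \<circ> sp 1 k \<circ> et e \<in> sperm l" "\<zeta> \<circ> et e \<in> sperm l" using kl by (auto intro!: sperm_comp z sp1_sperm)
    have 1: "et e ` LE e m = {1..int m}"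
      unfolding LE_et[OF e, symmetric, of m, OF order_trans[OF one_le_numeral m(1)]] by (simp add: image_image et_et)
    have 2: "sp 1 k ` {1..int m} = {1..int m}" using k by (intro sp_image) auto
    show "(\<zeta> \<circ> sp 1 k \<circ> et e) ` LE e m = (\<zeta> \<circ> et e) ` LE e m" by (simp only: image_comp[symmetric] 1 2)
    fix a assume a: "1 \<le> a" "a \<le> int l" "a \<notin> LE e m" "- a \<notin> LE e m"
    then have "a > int m" using e by (cases "a = 1") (auto simp: LE_def)
    then show "(\<zeta> \<circ> sp 1 k \<circ> et e) a = (\<zeta> \<circ> et e) a" using k m by (simp add: et_ge2 sp_other)
  qed
qed

text \<open>The left factor does not depend on the path, and the right one only on its total flip.\<close>

lemma val_ends:
  fixes a b :: "'k mpol"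
  assumes m: "2 \<le> m" "m \<le> l" and n: "1 \<le> n" and z: "\<zeta> \<in> sperm l" and Q: "Q \<in> paths m n"
    and a: "a \<in> inv_ring l (insert (sgn_idx n 0) (OS m))" and b: "b \<in> inv_ring l (insert 1 (OS m))"
  shows "val n 0 \<zeta> (ends n a b) Q = act (\<zeta> \<circ> et (sgn_idx n 0)) a * act (\<zeta> \<circ> flips Q) b"
proof -
  have e1: "(- 1 :: int) = 1 \<or> (- 1 :: int) = - 1" by simp
  have b': "b \<in> inv_ring l (insert (- (- 1)) (OS m))" using b by simp
  have last: "act (\<eta> \<circ> sp 1 q \<circ> et (- 1)) b = act (\<eta> \<circ> fl q) b" if "\<eta> \<in> sperm l" "q \<in> {1..int m}" for \<eta> q
    using eval_adjacent[OF m e1 that(1) b' that(2)] by simp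
  show ?thesis
  proof (cases "n = 1")
    case True
    then obtain q where q: "Q = [q]" "q \<in> {1..int m}" using Q by (auto simp: paths_def length_Suc_conv)
    have s: "sgn_idx (Suc 0) 0 = - 1" by (simp add: sgn_idx_def)
    have "val n 0 \<zeta> (ends n a b) Q = act (\<zeta> \<circ> sp 1 q \<circ> et (- 1)) a * act (\<zeta> \<circ> sp 1 q \<circ> et (- 1)) b"
      by (simp add: True q(1) ends_def s act_mult)
    also have "\<dots> = act (\<zeta> \<circ> et (- 1)) a * act (\<zeta> \<circ> fl q) b"
      unfolding last[OF z q(2)] using eval_own[OF m e1 z _ q(2)] a True s by simp
    finally show ?thesis using True s q(1) by (simp add: flips_Cons)
  next
    case False
    then have "n = Suc (Suc (n - 2))" using n by simp
    then obtain r where r: "n = Suc (Suc r)" ..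
    obtain q R where Q1: "Q = q # R" "length R = Suc r" using Q r by (auto simp: paths_def length_Suc_conv)
    define P where "P = butlast R"
    define q' where "q' = last R"
    have R: "R = P @ [q']" "length P = r" using Q1(2) unfolding P_def q'_def using append_butlast_last_id[of R] by (cases "R = []"; simp)+
    have qs: "q \<in> {1..int m}" "q' \<in> {1..int m}" "set P \<subseteq> {1..int m}" using Q Q1 R by (auto simp: paths_def)
    have zs: "\<zeta> \<circ> fl q \<circ> flips P \<in> sperm l" using qs m by (intro sperm_comp z flq_sperm flips_sperm) auto
    have s: "sgn_idx n (Suc r) = - 1" using r by (simp add: sgn_idx_def)
    have e: "ends n a b = a # (replicate r 1 @ [b])" by (simp add: ends_def r)
    have "val n 0 \<zeta> (ends n a b) Q = act (\<zeta> \<circ> sp 1 q \<circ> et (sgn_idx n 0)) a * (1 * (act (\<zeta> \<circ> fl q \<circ> flips P \<circ> sp 1 q' \<circ> et (sgn_idx n (Suc r))) b))"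
      unfolding e Q1(1) R(1) val.simps using R(2) by (subst val_append) (simp_all add: val_replicate)
    also have "\<dots> = act (\<zeta> \<circ> et (sgn_idx n 0)) a * act (\<zeta> \<circ> fl q \<circ> flips P \<circ> fl q') b"
      unfolding s last[OF zs qs(2)] eval_own[OF m sgn_idx_cases z a qs(1)] by simp
    also have "\<zeta> \<circ> fl q \<circ> flips P \<circ> fl q' = \<zeta> \<circ> flips Q"
      unfolding Q1(1) R(1) flips_Cons flips_append flips_Nil by (simp add: comp_assoc)
    finally show ?thesis .
  qed
qed

text \<open>The first slot carries the iterated trace, a sum over paths \<open>P\<close> in which \<open>c\<close> is evaluated at the end of \<open>P\<close>; the last slot evaluates the dual
  element at the end of \<open>Q\<close>. Orthogonality compares the two ends.\<close>

lemma u_kernel: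
  fixes C :: "'k mpol set"
  assumes m: "2 \<le> m" "m \<le> l" and n: "1 \<le> n" and z: "\<zeta> \<in> sperm l" and Q: "Q \<in> paths m n"
    and C: "dual_hom_bases l (insert 1 (OS m)) ({1, - 1} \<union> OS m) C Cd" and fs: "set fs \<subseteq> inv_ring l (OS m)" "length fs = n"
  shows "(\<Sum>c\<in>C. to_fract (val n 0 \<zeta> (ends n (F l n (OS m) fs c) (Cd c)) Q)) =
    (\<Sum>P\<in>paths m n. (if flips P = flips Q then path_wt m \<zeta> P * to_fract (act (\<zeta> \<circ> flips Q) (prod_sums m)) else 0) * to_fract (val n 0 \<zeta> fs P))"
proof -
  have CI: "C \<subseteq> inv_ring l (insert 1 (OS m))" "Cd ` C \<subseteq> inv_ring l (insert 1 (OS m))" "finite C"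
    using C by (auto simp: dual_hom_bases_def hom_basis_def)
  have "(\<Sum>c\<in>C. to_fract (val n 0 \<zeta> (ends n (F l n (OS m) fs c) (Cd c)) Q)) =
    (\<Sum>c\<in>C. \<Sum>P\<in>paths m n. path_wt m \<zeta> P * to_fract (val n 0 \<zeta> fs P) * to_fract (act (\<zeta> \<circ> flips P) c * act (\<zeta> \<circ> flips Q) (Cd c)))"
  proof (intro sum.cong refl)
    fix c assume c: "c \<in> C"
    have c1: "c \<in> inv_ring l (insert 1 (OS m))" "Cd c \<in> inv_ring l (insert 1 (OS m))" using CI c by auto
    have len: "0 + length fs = n" using fs by simp
    have Fin: "F l n (OS m) fs c \<in> inv_ring l (insert (sgn_idx n 0) (OS m))"
      unfolding F_def by (rule nest_in[OF m fs(1) len c1(1)])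
    show "to_fract (val n 0 \<zeta> (ends n (F l n (OS m) fs c) (Cd c)) Q) =
      (\<Sum>P\<in>paths m n. path_wt m \<zeta> P * to_fract (val n 0 \<zeta> fs P) * to_fract (act (\<zeta> \<circ> flips P) c * act (\<zeta> \<circ> flips Q) (Cd c)))"
      unfolding val_ends[OF m n z Q Fin c1(2)] unfolding to_fract_mult F_def nest_formula[OF m fs(1) len c1(1) z] fs(2) sum_distrib_right
      by (intro sum.cong refl) (simp only: mult_ac)
  qed
  also have "\<dots> = (\<Sum>P\<in>paths m n. path_wt m \<zeta> P * to_fract (val n 0 \<zeta> fs P) * to_fract (\<Sum>c\<in>C. act (\<zeta> \<circ> flips P) c * act (\<zeta> \<circ> flips Q) (Cd c)))"
    unfolding to_fract_sum sum_distrib_left by (rule sum.swap)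
  also have "\<dots> = (\<Sum>P\<in>paths m n. (if flips P = flips Q then path_wt m \<zeta> P * to_fract (act (\<zeta> \<circ> flips Q) (prod_sums m)) else 0) * to_fract (val n 0 \<zeta> fs P))"
  proof (intro sum.cong refl)
    fix P assume P: "P \<in> paths m n"
    show "path_wt m \<zeta> P * to_fract (val n 0 \<zeta> fs P) * to_fract (\<Sum>c\<in>C. act (\<zeta> \<circ> flips P) c * act (\<zeta> \<circ> flips Q) (Cd c)) =
      (if flips P = flips Q then path_wt m \<zeta> P * to_fract (act (\<zeta> \<circ> flips Q) (prod_sums m)) else 0) * to_fract (val n 0 \<zeta> fs P)"
      unfolding orthogonal_paths[OF m C z P Q] by (cases "flips P = flips Q") (simp_all only: simp_thms if_True if_False to_fract_0 mult_zero_left mult_zero_right mult_ac)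
  qed
  finally show ?thesis .
qed

text \<open>Exchanging \<open>k\<close> with \<open>l\<close> in the point and in the path has no effect on invariants of \<open>O\<close>.\<close>

lemma val_relabel:
  fixes fs :: "'k mpol list"
  assumes k: "k \<in> {1..int l}"
  shows "set fs \<subseteq> inv_ring l (OS l) \<Longrightarrow> set P \<subseteq> {1..int l} \<Longrightarrow> \<zeta> \<in> sperm l \<Longrightarrow> length fs = length P \<Longrightarrow>
     val n i (\<zeta> \<circ> sp (int l) k) fs (map (sp (int l) k) P) = val n i \<zeta> fs P"
proof (induction fs arbitrary: i \<zeta> P)
  case (Cons f fs)
  then obtain p P' where P: "P = p # P'" by (cases P) auto
  note a = adapted_O[OF l2 le_refl]
  note s = spl_sperm[OF k]
  let ?e = "sgn_idx n i"
  note e = sgn_idx_cases[of n i]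
  let ?k = "sp (int l) k"
  have p: "p \<in> {1..int l}" using Cons.prems P by auto
  have im: "?k ` {1..int l} = {1..int l}" using k by (intro sp_image) auto
  have kp: "?k p \<in> {1..int l}" using im p by blast
  have i: "?k (?k x) = x" for x using k by (intro sp_invol) auto
  have z: "\<zeta> \<in> sperm l" by fact
  have As: "\<zeta> \<circ> ?k \<circ> sp 1 (?k p) \<circ> et ?e \<in> sperm l" by (intro sperm_comp z s sp1_sperm[OF kp] et_sperm)
  have Bs: "\<zeta> \<circ> sp 1 p \<circ> et ?e \<in> sperm l" by (intro sperm_comp z sp1_sperm[OF p] et_sperm)
  have LO: "LO l = LE ?e l - {?e}" using e by (auto simp: LO_def LE_def)
  have etLE: "et ?e ` LE ?e l = {1..int l}"
    unfolding LE_et[OF e, symmetric, of l, OF order_trans[OF one_le_numeral l2]] by (simp add: image_image et_et)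
  have im1: "sp 1 (?k p) ` {1..int l} = {1..int l}" "sp 1 p ` {1..int l} = {1..int l}"
    using p kp by (intro sp_image; auto)+
  let ?A = "\<zeta> \<circ> ?k \<circ> sp 1 (?k p) \<circ> et ?e" and ?B = "\<zeta> \<circ> sp 1 p \<circ> et ?e"
  have Ae: "?A ?e = \<zeta> p" "?B ?e = \<zeta> p" by (simp_all add: et_e(1)[OF e] sp_1 i)
  have A1: "?A 1 = ?B 1"
  proof (cases "?e = 1")
    case True then show ?thesis using Ae by (simp only:)
  next
    case False
    then have "?e = - 1" using e by simp
    then have "?A (- 1) = ?B (- 1)" using Ae by (simp only:)
    then show ?thesis using sperm_odd[OF As, of 1] sperm_odd[OF Bs, of 1] by (simp only: neg_equal_iff_equal)
  qed
  have "act ?A f = act ?B f"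
  proof (rule act_eqI[OF adapted_sub[OF a(1)] a(2) _ As Bs])
    show "f \<in> inv_ring l (OS l)" using Cons.prems by simp
    have "?A ` LO l = ?A ` LE ?e l - {?A ?e}" unfolding LO using image_set_diff[OF bij_is_inj[OF sperm_bij[OF As]], of "LE ?e l" "{?e}"] by (simp only: image_insert image_empty)
    also have "?A ` LE ?e l = \<zeta> ` {1..int l}" by (simp only: image_comp[symmetric] etLE im im1)
    also have "\<dots> = ?B ` LE ?e l" by (simp only: image_comp[symmetric] etLE im1)
    also have "?B ` LE ?e l - {?A ?e} = ?B ` LO l" unfolding LO Ae(1) Ae(2)[symmetric]
      using image_set_diff[OF bij_is_inj[OF sperm_bij[OF Bs]], of "LE ?e l" "{?e}"] by (simp only: image_insert image_empty)
    finally show "?A ` LO l = ?B ` LO l" .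
    fix x assume "1 \<le> x" "x \<le> int l" "x \<notin> LO l"
    then have "x = 1" by (simp add: LO_def)
    then show "?A x = ?B x" using A1 by (simp only:)
  qed
  moreover have "\<zeta> \<circ> ?k \<circ> fl (?k p) = \<zeta> \<circ> fl p \<circ> ?k"
    using fl_conj[OF s, of "?k p"] by (simp add: fun_eq_iff i)
  moreover have "val n (Suc i) (\<zeta> \<circ> fl p \<circ> ?k) fs (map ?k P') = val n (Suc i) (\<zeta> \<circ> fl p) fs P'"
    using Cons.prems P by (intro Cons.IH sperm_comp z flq_sperm) auto
  ultimately show ?case unfolding P list.map val.simps by (simp only:)
qed simp

text \<open>The weight of a path that avoids \<open>k\<close> has, in each step, one more factor for \<open>l\<close> coordinates than for \<open>l - 1\<close>; these factors make up the
  path polynomial at \<open>x\<^sub>k\<close>.\<close>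

lemma path_wt_relabel:
  assumes k: "k \<in> {1..int l}"
  shows "set P \<subseteq> {1..int l} - {k} \<Longrightarrow> \<zeta> \<in> sperm l \<Longrightarrow> \<zeta> k = k \<Longrightarrow>
     path_wt (l - 1) (\<zeta> \<circ> sp (int l) k) (map (sp (int l) k) P) = path_wt l \<zeta> P * (path_poly \<zeta> P (zF k) :: 'k mpol fract)"
proof (induction P arbitrary: \<zeta>)
  case (Cons p P)
  note s = spl_sperm[OF k]
  let ?k = "sp (int l) k"
  have p: "p \<in> {1..int l}" "p \<noteq> k" using Cons.prems by auto
  have i: "?k (?k x) = x" for x using k by (intro sp_invol) auto
  have c: "\<zeta> \<circ> ?k \<circ> fl (?k p) = \<zeta> \<circ> fl p \<circ> ?k"
    using fl_conj[OF s, of "?k p"] by (simp add: fun_eq_iff i)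
  have z: "\<zeta> \<in> sperm l" by fact
  have flk: "(\<zeta> \<circ> fl p) k = k" using Cons.prems p k by (simp add: fl_def)
  have IH: "path_wt (l - 1) (\<zeta> \<circ> fl p \<circ> ?k) (map ?k P) = path_wt l (\<zeta> \<circ> fl p) P * (path_poly (\<zeta> \<circ> fl p) P (zF k) :: 'k mpol fract)"
    using Cons.prems p flk by (intro Cons.IH sperm_comp z flq_sperm) auto
  have "(\<Prod>j\<in>{1..int (l - 1)} - {?k p}. rtF (\<zeta> \<circ> ?k) (?k p) j) = (\<Prod>j\<in>{1..int l} - {p} - {k}. rtF \<zeta> p j :: 'k mpol fract)"
  proof (rule prod.reindex_bij_witness[of _ ?k ?k])
    have S: "{1..int (l - 1)} = {1..int l} - {int l}" using l2 by auto
    have im: "?k ` {1..int l} = {1..int l}" using k by (intro sp_image) auto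
    have m: "?k x \<in> {1..int l} \<longleftrightarrow> x \<in> {1..int l}" for x using im i by (metis imageI)
    have kl: "?k x = k \<longleftrightarrow> x = int l" "?k x = int l \<longleftrightarrow> x = k" "?k x = ?k p \<longleftrightarrow> x = p" "?k x = p \<longleftrightarrow> x = ?k p" for x
      using i sp_1[of "int l" k] sp_2[of "int l" k] by metis+
    show "?k a \<in> {1..int l} - {p} - {k}" if "a \<in> {1..int (l - 1)} - {?k p}" for a
      using that unfolding S by (simp only: Diff_iff m kl singleton_iff) simp
    show "?k a \<in> {1..int (l - 1)} - {?k p}" if "a \<in> {1..int l} - {p} - {k}" for a
      using that unfolding S by (simp only: Diff_iff m kl singleton_iff) simp
    show "?k (?k a) = a" for a by (rule i)
    then show "?k (?k a) = a" for a .
    show "rtF \<zeta> p (?k a) = (rtF (\<zeta> \<circ> ?k) (?k p) a :: 'k mpol fract)" for a by (simp add: rtF_def i)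
  qed
  moreover have "(\<Prod>j\<in>{1..int l} - {p}. rtF \<zeta> p j) = (zF k - zF (\<zeta> p)) * (\<Prod>j\<in>{1..int l} - {p} - {k}. rtF \<zeta> p j :: 'k mpol fract)"
  proof -
    have "rtF \<zeta> p k = (zF k - zF (\<zeta> p) :: 'k mpol fract)" by (simp add: rtF_zF Cons.prems(3))
    then show ?thesis using prod.remove[of "{1..int l} - {p}" k "\<lambda>j. rtF \<zeta> p j :: 'k mpol fract"] k p by simp
  qed
  moreover have "(zF k - zF (\<zeta> p) :: 'k mpol fract) \<noteq> 0"
    using zF_inj[of k "\<zeta> p"] sperm_inj[OF z, of k p] sperm_eq0[OF z, of p] Cons.prems(3) p k by auto
  ultimately show ?case unfolding list.map path_wt.simps c IH path_poly.simps by simp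
qed simp

end

section \<open>The kernel of the map v\<close>

text \<open>A sum over functions that is concentrated on the constant ones.\<close>

lemma sum_PiE_const:
  fixes f :: "(nat \<Rightarrow> 'b) \<Rightarrow> 'c::comm_monoid_add"
  assumes n: "0 < n" and A: "\<And>j. j < n \<Longrightarrow> finite (A j)"
    and z: "\<And>\<kappa>. \<kappa> \<in> PiE {..<n} A \<Longrightarrow> (\<exists>j. Suc j < n \<and> \<kappa> j \<noteq> \<kappa> (Suc j)) \<Longrightarrow> f \<kappa> = 0"
  shows "(\<Sum>\<kappa>\<in>PiE {..<n} A. f \<kappa>) = (\<Sum>k\<in>(\<Inter>j<n. A j). f (\<lambda>j\<in>{..<n}. k))"
proof -
  let ?c = "\<lambda>k. (\<lambda>j\<in>{..<n}. k) :: nat \<Rightarrow> 'b"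
  have inj: "inj_on ?c (\<Inter>j<n. A j)"
  proof (rule inj_onI)
    fix x y assume "?c x = ?c y"
    from fun_cong[OF this, of 0] show "x = y" using n by simp
  qed
  have sub: "?c ` (\<Inter>j<n. A j) \<subseteq> PiE {..<n} A"
  proof (rule image_subsetI)
    fix k assume "k \<in> (\<Inter>j<n. A j)"
    then show "?c k \<in> PiE {..<n} A" unfolding restrict_PiE_iff by auto
  qed
  have "(\<Sum>\<kappa>\<in>PiE {..<n} A. f \<kappa>) = (\<Sum>\<kappa>\<in>?c ` (\<Inter>j<n. A j). f \<kappa>)"
  proof (rule sum.mono_neutral_right[OF _ sub])
    show "finite (PiE {..<n} A)" using A by (intro finite_PiE) auto
    show "\<forall>\<kappa>\<in>PiE {..<n} A - ?c ` (\<Inter>j<n. A j). f \<kappa> = 0"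
    proof
      fix \<kappa> assume k: "\<kappa> \<in> PiE {..<n} A - ?c ` (\<Inter>j<n. A j)"
      have "\<exists>j. Suc j < n \<and> \<kappa> j \<noteq> \<kappa> (Suc j)"
      proof (rule ccontr)
        assume ne: "\<not> ?thesis"
        have s: "\<kappa> (Suc j) = \<kappa> j" if "Suc j < n" for j
        proof (rule ccontr)
          assume "\<kappa> (Suc j) \<noteq> \<kappa> j"
          then have "\<kappa> j \<noteq> \<kappa> (Suc j)" by simp
          then show False using ne that by blast
        qed
        have c: "\<kappa> j = \<kappa> 0" if "j < n" for j using that by (induction j) (auto simp: s)
        have kP: "\<kappa> \<in> PiE {..<n} A" using k by blast
        have "\<kappa> = ?c (\<kappa> 0)"
        proof
          fix j show "\<kappa> j = ?c (\<kappa> 0) j" using c[of j] PiE_arb[OF kP, of j] by (cases "j < n") auto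
        qed
        moreover have "\<kappa> 0 \<in> (\<Inter>j<n. A j)"
        proof
          fix j assume "j \<in> {..<n}"
          then have "\<kappa> j = \<kappa> 0" "\<kappa> j \<in> A j" using PiE_mem[OF kP, of j] by (intro c, simp_all)
          then show "\<kappa> 0 \<in> A j" by (simp only:)
        qed
        ultimately show False using k by blast
      qed
      then show "f \<kappa> = 0" using z k by blast
    qed
  qed
  also have "\<dots> = (\<Sum>k\<in>(\<Inter>j<n. A j). f (?c k))" by (simp add: sum.reindex[OF inj])
  finally show ?thesis .
qed

context typeD begin

text \<open>The traces in the \<open>n\<close> slots choose coordinates \<open>\<kappa> 0, \<dots>, \<kappa> (n - 1)\<close>; the sum over the dual bases at the tensor sign \<open>i\<close> forces \<open>\<kappa> (i - 1) = \<kappa> i\<close>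
  (\<open>orthogonal_positions\<close>). For constant \<open>\<kappa>\<close>, most of the denominators cancel against the products from orthogonality and leave the path polynomial.\<close>

lemma T_formula:
  fixes gs :: "'k mpol list" and E :: "nat \<Rightarrow> 'k mpol set"
  assumes l3: "3 \<le> l" and n: "n = l - 1" and Q: "Q \<in> paths l n"
    and E: "\<And>i. 1 \<le> i \<Longrightarrow> i \<le> n - 1 \<Longrightarrow> dual_hom_bases l (insert (sgn_idx n i) (OS (l - 1))) (insert (sgn_idx n i) (OS l)) (E i) (Ed i)"
    and gs: "set gs \<subseteq> inv_ring l (OS (l - 1))" "length gs = n"
  shows "(\<Sum>b\<in>(\<Pi>\<^sub>E i\<in>{1..n - 1}. E i). to_fract (val n 0 id (map (\<lambda>j. tr l (OS (l - 1)) (OS l)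
          ((if j = 0 then 1 else Ed j (b j)) * gs ! j * (if j = n - 1 then 1 else b (Suc j)))) [0..<n]) Q)) =
    (\<Sum>k\<in>{1..int l}. path_poly id Q (zF k) / (\<Prod>r\<in>{1..int l} - {k}. zF k - zF r) * to_fract (val n 0 (sp (int l) k) gs (map (sp (int l) k) Q)))"
proof -
  have n2: "2 \<le> n" using n l3 by simp
  have m: "2 \<le> l - 1" "l - 1 \<le> l" using l3 by auto
  note a1 = adapted_O[OF m] and a2 = adapted_O[OF l2 le_refl]
  have I: "OS (l - 1) \<subseteq> N l" by (rule adapted_sub[OF a1(1)])
  have lenQ: "length Q = n" using Q by (simp add: paths_def)
  have Ql: "set Q \<subseteq> {1..int l}" using Q by (simp add: paths_def)
  define q where "q j = Q ! j" for j
  have q: "q j \<in> {1..int l}" if "j < n" for j unfolding q_def by (rule paths_nth[OF Q that])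
  define \<zeta> where "\<zeta> j = flips (take j Q)" for j
  have zs: "\<zeta> j \<in> sperm l" for j unfolding \<zeta>_def by (rule flips_sperm) (use Ql set_take_subset[of j Q] in blast)
  have zSuc: "\<zeta> (Suc j) = \<zeta> j \<circ> fl (q j)" if "j < n" for j
    unfolding \<zeta>_def q_def using that lenQ by (simp add: take_Suc_conv_app_nth flips_append flips_Cons)
  define e where "e j = sgn_idx n j" for j
  have e: "e j = 1 \<or> e j = - 1" for j unfolding e_def by (rule sgn_idx_cases)
  have eSuc: "e (Suc j) = - e j" if "j < n" for j unfolding e_def by (rule sgn_idx_Suc[OF that])
  \<comment> \<open>\<open>A j\<close> contains the possible choices in slot \<open>j\<close>, \<open>U j k\<close> is the evaluation there, \<open>D j k\<close> the denominator of the trace and \<open>M i k\<close> the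
  product that orthogonality produces at the tensor sign \<open>i\<close>.\<close>
  define A where "A j = {1..int l} - {q j}" for j
  define U where "U j k h = to_fract (act (\<zeta> j \<circ> sp (int l) k \<circ> sp 1 (sp (int l) k (q j)) \<circ> et (e j)) h)" for j k and h :: "'k mpol"
  define D where "D j k = (\<Prod>r\<in>{1..int l} - {q j} - {k}. rtF (\<zeta> j) r k :: 'k mpol fract)" for j k
  define M where "M j k = (\<Prod>r\<in>{1..int l} - {k}. rtF (\<zeta> j) r k :: 'k mpol fract)" for j k
  define h where "h b j = (if j = 0 then 1 else Ed j (b j)) * gs ! j * (if j = n - 1 then 1 else b (Suc j))" for b :: "nat \<Rightarrow> 'k mpol" and j
  let ?B = "\<Pi>\<^sub>E i\<in>{1..n - 1}. E i"
  have EI: "x \<in> inv_ring l (insert (e i) (OS (l - 1)))" "Ed i x \<in> inv_ring l (insert (e i) (OS (l - 1)))" if "1 \<le> i" "i \<le> n - 1" "x \<in> E i" for i x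
    using E[OF that(1,2)] that(3) by (auto simp: dual_hom_bases_def hom_basis_def e_def)
  have finE: "finite (E i)" if "1 \<le> i" "i \<le> n - 1" for i using E[OF that] by (auto simp: dual_hom_bases_def hom_basis_def)
  have sub: "inv_ring l (insert (e i) (OS (l - 1))) \<subseteq> (inv_ring l (OS (l - 1)) :: 'k mpol set)" for i by (rule inv_ring_OE[OF m e])
  have hI: "h b j \<in> inv_ring l (OS (l - 1))" if b: "b \<in> ?B" and j: "j < n" for b j
  proof -
    have 1: "(if j = 0 then 1 else Ed j (b j)) \<in> inv_ring l (OS (l - 1))"
    proof (cases "j = 0")
      case False
      then have "1 \<le> j" "j \<le> n - 1" "b j \<in> E j" using b j by auto
      then show ?thesis using EI(2)[of j "b j"] sub False by auto
    next
      case True then show ?thesis using inv_ring_closed(5)[OF I] by simp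
    qed
    have 2: "(if j = n - 1 then 1 else b (Suc j)) \<in> inv_ring l (OS (l - 1))"
    proof (cases "j = n - 1")
      case False
      then have "1 \<le> Suc j" "Suc j \<le> n - 1" "b (Suc j) \<in> E (Suc j)" using b j by auto
      then show ?thesis using EI(1)[of "Suc j" "b (Suc j)"] sub False by auto
    next
      case True then show ?thesis using inv_ring_closed(5)[OF I] by simp
    qed
    have 3: "gs ! j \<in> inv_ring l (OS (l - 1))" using gs j by auto
    show ?thesis unfolding h_def by (intro inv_ring_closed(2)[OF I] 1 2 3)
  qed
  have step1: "to_fract (val n 0 id (map (\<lambda>j. tr l (OS (l - 1)) (OS l) (h b j)) [0..<n]) Q) = (\<Sum>\<kappa>\<in>PiE {..<n} A. \<Prod>j<n. U j (\<kappa> j) (h b j) / D j (\<kappa> j))"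
    if b: "b \<in> ?B" for b
  proof -
    have "to_fract (val n 0 id (map (\<lambda>j. tr l (OS (l - 1)) (OS l) (h b j)) [0..<n]) Q) =
      (\<Prod>j<n. to_fract (act (\<zeta> j \<circ> sp 1 (q j) \<circ> et (e j)) (tr l (OS (l - 1)) (OS l) (h b j))))"
      by (subst val_prod) (simp_all add: lenQ to_fract_prod \<zeta>_def q_def e_def id_comp del: comp_apply)
    also have "\<dots> = (\<Prod>j<n. \<Sum>k\<in>A j. U j k (h b j) / D j k)"
    proof (intro prod.cong refl)
      fix j assume "j \<in> {..<n}"
      then have j: "j < n" by simp
      show "to_fract (act (\<zeta> j \<circ> sp 1 (q j) \<circ> et (e j)) (tr l (OS (l - 1)) (OS l) (h b j))) = (\<Sum>k\<in>A j. U j k (h b j) / D j k)"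
        unfolding trace_I_formula[OF l3 e zs q[OF j] hI[OF b j]] A_def U_def D_def ..
    qed
    also have "\<dots> = (\<Sum>\<kappa>\<in>PiE {..<n} A. \<Prod>j<n. U j (\<kappa> j) (h b j) / D j (\<kappa> j))"
      by (rule prod_sum_PiE) (auto simp: A_def)
    finally show ?thesis .
  qed
  define R where "R \<kappa> = (\<Prod>j<n. U j (\<kappa> j) (gs ! j) / D j (\<kappa> j))" for \<kappa>
  \<comment> \<open>The factors \<open>b i\<close> and \<open>Ed i (b i)\<close> of the slots \<open>i - 1\<close> and \<open>i\<close> are collected at the tensor sign between them.\<close>
  have step2: "(\<Prod>j<n. U j (\<kappa> j) (h b j) / D j (\<kappa> j)) = R \<kappa> * (\<Prod>i\<in>{1..n - 1}. U (i - 1) (\<kappa> (i - 1)) (b i) * U i (\<kappa> i) (Ed i (b i)))" for \<kappa> b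
  proof -
    have Um: "U j k (x * y) = U j k x * U j k y" for j k x y by (simp add: U_def act_mult)
    have U1: "U j k 1 = 1" for j k by (simp add: U_def)
    have "(\<Prod>j<n. U j (\<kappa> j) (h b j) / D j (\<kappa> j)) = R \<kappa> * ((\<Prod>j<n. U j (\<kappa> j) (if j = 0 then 1 else Ed j (b j))) * (\<Prod>j<n. U j (\<kappa> j) (if j = n - 1 then 1 else b (Suc j))))"
      unfolding R_def h_def prod.distrib[symmetric] Um by (intro prod.cong refl) (simp add: mult_ac)
    also have "(\<Prod>j<n. U j (\<kappa> j) (if j = 0 then 1 else Ed j (b j))) = (\<Prod>i\<in>{1..n - 1}. U i (\<kappa> i) (Ed i (b i)))"
    proof (rule prod.mono_neutral_cong_right)
      show "\<forall>i\<in>{..<n} - {1..n - 1}. U i (\<kappa> i) (if i = 0 then 1 else Ed i (b i)) = 1"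
      proof
        fix i assume "i \<in> {..<n} - {1..n - 1}"
        then have "i = 0" by auto
        then show "U i (\<kappa> i) (if i = 0 then 1 else Ed i (b i)) = 1" by (simp add: U1)
      qed
    qed (use n2 in auto)
    also have "(\<Prod>j<n. U j (\<kappa> j) (if j = n - 1 then 1 else b (Suc j))) = (\<Prod>j<n - 1. U j (\<kappa> j) (b (Suc j)))"
      by (rule prod.mono_neutral_cong_right) (use n2 U1 in auto)
    also have "\<dots> = (\<Prod>i\<in>{1..n - 1}. U (i - 1) (\<kappa> (i - 1)) (b i))"
      by (rule prod.reindex_bij_witness[of _ "\<lambda>i. i - 1" Suc]) auto
    also have "(\<Prod>i\<in>{1..n - 1}. U i (\<kappa> i) (Ed i (b i))) * (\<Prod>i\<in>{1..n - 1}. U (i - 1) (\<kappa> (i - 1)) (b i)) = (\<Prod>i\<in>{1..n - 1}. U (i - 1) (\<kappa> (i - 1)) (b i) * U i (\<kappa> i) (Ed i (b i)))"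
      by (simp add: prod.distrib mult.commute)
    finally show ?thesis .
  qed
  \<comment> \<open>Orthogonality at the tensor sign \<open>i\<close>; \<open>eval_adjacent\<close> moves the evaluation of slot \<open>i - 1\<close> to the point of slot \<open>i\<close>.\<close>
  have step3: "(\<Sum>x\<in>E i. U (i - 1) k x * U i k' (Ed i x)) = (if k = k' then M i k else 0)"
    if i: "1 \<le> i" "i \<le> n - 1" and k: "k \<in> A (i - 1)" "k' \<in> A i" for i k k'
  proof -
    have kl: "k \<in> {1..int l}" "k \<noteq> q (i - 1)" "k' \<in> {1..int l}" "k' \<noteq> q i" using k by (auto simp: A_def)
    have i1: "i - 1 < n" "i < n" "Suc (i - 1) = i" using i n2 by auto
    have S: "{1..int (l - 1)} = {1..int l} - {int l}" using l2 by auto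
    have qq: "sp (int l) k (q j) \<in> {1..int (l - 1)}" if "k \<in> {1..int l}" "k \<noteq> q j" "j < n" for k j
    proof -
      have "sp (int l) k ` {1..int l} = {1..int l}" using that by (intro sp_image) auto
      then have "sp (int l) k (q j) \<in> {1..int l}" using q[OF that(3)] by blast
      moreover have "sp (int l) k (q j) \<noteq> int l" using that q[OF that(3)] by (auto simp: sp_def)
      ultimately show ?thesis unfolding S by simp
    qed
    have "(\<Sum>x\<in>E i. U (i - 1) k x * U i k' (Ed i x)) = (\<Sum>x\<in>E i. to_fract (act (\<zeta> i \<circ> sp (int l) k \<circ> et (e i)) x) * to_fract (act (\<zeta> i \<circ> sp (int l) k' \<circ> et (e i)) (Ed i x)))"
    proof (intro sum.cong refl)
      fix x assume x: "x \<in> E i"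
      have s1: "\<zeta> (i - 1) \<circ> sp (int l) k \<in> sperm l" by (intro sperm_comp zs spl_sperm kl)
      have s2: "\<zeta> i \<circ> sp (int l) k' \<in> sperm l" by (intro sperm_comp zs spl_sperm kl)
      have x1: "x \<in> inv_ring l (insert (- e (i - 1)) (OS (l - 1)))" using EI(1)[OF i x] eSuc[OF i1(1)] i1(3) by simp
      have ki: "sp (int l) k (sp (int l) k y) = y" for y using kl by (intro sp_invol) auto
      have cm: "\<zeta> (i - 1) \<circ> sp (int l) k \<circ> fl (sp (int l) k (q (i - 1))) = \<zeta> i \<circ> sp (int l) k"
        using zSuc[OF i1(1)] i1(3) fl_conj[OF spl_sperm[OF kl(1)], of "sp (int l) k (q (i - 1))"] by (simp add: fun_eq_iff ki)
      have "U (i - 1) k x = to_fract (act (\<zeta> i \<circ> sp (int l) k \<circ> et (e i)) x)"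
        unfolding U_def eval_adjacent[OF m e s1 x1 qq[OF kl(1,2) i1(1)]] cm using eSuc[OF i1(1)] i1(3) by simp
      moreover have "U i k' (Ed i x) = to_fract (act (\<zeta> i \<circ> sp (int l) k' \<circ> et (e i)) (Ed i x))"
        unfolding U_def eval_own[OF m e s2 EI(2)[OF i x] qq[OF kl(3,4) i1(2)]] ..
      ultimately show "U (i - 1) k x * U i k' (Ed i x) = to_fract (act (\<zeta> i \<circ> sp (int l) k \<circ> et (e i)) x) * to_fract (act (\<zeta> i \<circ> sp (int l) k' \<circ> et (e i)) (Ed i x))"
        by simp
    qed
    also have "\<dots> = to_fract (\<Sum>x\<in>E i. act (\<zeta> i \<circ> sp (int l) k \<circ> et (e i)) x * act (\<zeta> i \<circ> sp (int l) k' \<circ> et (e i)) (Ed i x))"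
      by (simp add: to_fract_sum del: comp_apply)
    also have "\<dots> = (if k = k' then M i k else 0)"
      unfolding orthogonal_positions[OF l3 e E[OF i, folded e_def] zs kl(1,3)] by (simp add: M_def to_fract_prod rtF_def)
    finally show ?thesis .
  qed
  define W where "W \<kappa> = R \<kappa> * (\<Prod>i\<in>{1..n - 1}. if \<kappa> (i - 1) = \<kappa> i then M i (\<kappa> (i - 1)) else 0)" for \<kappa>
  have step4: "(\<Sum>b\<in>?B. to_fract (val n 0 id (map (\<lambda>j. tr l (OS (l - 1)) (OS l) (h b j)) [0..<n]) Q)) = (\<Sum>\<kappa>\<in>PiE {..<n} A. W \<kappa>)"
  proof -
    have "(\<Sum>b\<in>?B. to_fract (val n 0 id (map (\<lambda>j. tr l (OS (l - 1)) (OS l) (h b j)) [0..<n]) Q)) =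
      (\<Sum>b\<in>?B. \<Sum>\<kappa>\<in>PiE {..<n} A. R \<kappa> * (\<Prod>i\<in>{1..n - 1}. U (i - 1) (\<kappa> (i - 1)) (b i) * U i (\<kappa> i) (Ed i (b i))))"
      by (intro sum.cong refl) (simp only: step1 step2)
    also have "\<dots> = (\<Sum>\<kappa>\<in>PiE {..<n} A. R \<kappa> * (\<Sum>b\<in>?B. \<Prod>i\<in>{1..n - 1}. U (i - 1) (\<kappa> (i - 1)) (b i) * U i (\<kappa> i) (Ed i (b i))))"
      unfolding sum_distrib_left by (rule sum.swap)
    also have "\<dots> = (\<Sum>\<kappa>\<in>PiE {..<n} A. W \<kappa>)"
    proof (intro sum.cong refl)
      fix \<kappa> assume k: "\<kappa> \<in> PiE {..<n} A"
      have "(\<Sum>b\<in>?B. \<Prod>i\<in>{1..n - 1}. U (i - 1) (\<kappa> (i - 1)) (b i) * U i (\<kappa> i) (Ed i (b i))) =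
        (\<Prod>i\<in>{1..n - 1}. \<Sum>x\<in>E i. U (i - 1) (\<kappa> (i - 1)) x * U i (\<kappa> i) (Ed i x))"
        by (rule prod_sum_PiE[symmetric]) (use finE in auto)
      also have "\<dots> = (\<Prod>i\<in>{1..n - 1}. if \<kappa> (i - 1) = \<kappa> i then M i (\<kappa> (i - 1)) else 0)"
      proof (intro prod.cong refl step3)
        fix i assume i: "i \<in> {1..n - 1}"
        then show "1 \<le> i" "i \<le> n - 1" by auto
        have "i - 1 < n" "i < n" using i n2 by auto
        then show "\<kappa> (i - 1) \<in> A (i - 1)" "\<kappa> i \<in> A i" using PiE_mem[OF k] by auto
      qed
      finally show "R \<kappa> * (\<Sum>b\<in>?B. \<Prod>i\<in>{1..n - 1}. U (i - 1) (\<kappa> (i - 1)) (b i) * U i (\<kappa> i) (Ed i (b i))) = W \<kappa>"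
        by (simp add: W_def)
    qed
    finally show ?thesis .
  qed
  have n0: "0 < n" using n2 by simp
  have "(\<Sum>\<kappa>\<in>PiE {..<n} A. W \<kappa>) = (\<Sum>k\<in>(\<Inter>j<n. A j). W (\<lambda>j\<in>{..<n}. k))"
  proof (rule sum_PiE_const[OF n0])
    fix \<kappa> :: "nat \<Rightarrow> int" assume "\<exists>j. Suc j < n \<and> \<kappa> j \<noteq> \<kappa> (Suc j)"
    then obtain j where j: "Suc j < n" "\<kappa> j \<noteq> \<kappa> (Suc j)" by blast
    have "(\<Prod>i\<in>{1..n - 1}. if \<kappa> (i - 1) = \<kappa> i then M i (\<kappa> (i - 1)) else 0) = 0"
      by (rule prod_zero) (use j in \<open>auto intro!: bexI[of _ "Suc j"]\<close>)
    then show "W \<kappa> = 0" by (simp add: W_def)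
  qed (simp add: A_def)
  also have "\<dots> = (\<Sum>k\<in>(\<Inter>j<n. A j). path_poly id Q (zF k) / (\<Prod>r\<in>{1..int l} - {k}. zF k - zF r) * to_fract (val n 0 (sp (int l) k) gs (map (sp (int l) k) Q)))"
  proof (intro sum.cong refl)
    fix k assume k: "k \<in> (\<Inter>j<n. A j)"
    have kA: "k \<in> A j" if "j < n" for j using k that by blast
    have kl: "k \<in> {1..int l}" using kA[OF n0] by (simp add: A_def)
    have kq: "k \<noteq> q j" if "j < n" for j using kA[OF that] by (simp add: A_def)
    have kQ: "k \<notin> set Q" using kq lenQ by (auto simp: in_set_conv_nth q_def)
    have zk: "\<zeta> j k = k" for j unfolding \<zeta>_def
      using kQ kl Ql set_take_subset[of j Q] by (intro flips_fixed) auto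
    have Dn0: "D j k \<noteq> 0" if "j < n" for j
    proof -
      have "rtF (\<zeta> j) r k \<noteq> (0 :: 'k mpol fract)" if "r \<in> {1..int l} - {q j} - {k}" for r using that kl by (intro rtF_nz zs) auto
      then show ?thesis by (simp add: D_def)
    qed
    \<comment> \<open>The products \<open>M\<close> and the denominators \<open>D\<close> differ by the single root that belongs to the path entry.\<close>
    have MD: "M j k = (zF k - zF (\<zeta> j (q j))) * D j k" if j: "j < n" for j
    proof -
      have "q j \<in> {1..int l} - {k}" using q[OF j] kq[OF j] by auto
      then have "M j k = rtF (\<zeta> j) (q j) k * (\<Prod>r\<in>{1..int l} - {k} - {q j}. rtF (\<zeta> j) r k)" unfolding M_def by (intro prod.remove) auto
      also have "{1..int l} - {k} - {q j} = {1..int l} - {q j} - {k}" by blast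
      finally show ?thesis unfolding D_def rtF_zF zk .
    qed
    have M0: "M 0 k = (\<Prod>r\<in>{1..int l} - {k}. zF k - zF r)" by (simp add: M_def \<zeta>_def rtF_zF)
    have M0n: "M 0 k \<noteq> 0"
    proof -
      have "rtF (\<zeta> 0) r k \<noteq> (0 :: 'k mpol fract)" if "r \<in> {1..int l} - {k}" for r using that kl by (intro rtF_nz zs) auto
      then show ?thesis by (simp add: M_def)
    qed
    have npQ: "path_poly id Q (zF k) = (\<Prod>j<n. zF k - zF (\<zeta> j (q j)) :: 'k mpol fract)"
      unfolding path_poly_prod lenQ by (simp add: \<zeta>_def q_def)
    have S: "{..<n} = insert 0 {1..n - 1}" using n2 by auto
    have "(\<Prod>j<n. M j k) = path_poly id Q (zF k) * (\<Prod>j<n. D j k)" unfolding npQ prod.distrib[symmetric] by (intro prod.cong refl) (simp add: MD)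
    moreover have "(\<Prod>j<n. M j k) = M 0 k * (\<Prod>i\<in>{1..n - 1}. M i k)" unfolding S by simp
    ultimately have MM: "(\<Prod>i\<in>{1..n - 1}. M i k) = path_poly id Q (zF k) * (\<Prod>j<n. D j k) / M 0 k" using M0n by (simp add: field_simps)
    have Dall: "(\<Prod>j<n. D j k) \<noteq> 0" using Dn0 by simp
    have "W (\<lambda>j\<in>{..<n}. k) = (\<Prod>j<n. U j k (gs ! j) / D j k) * (\<Prod>i\<in>{1..n - 1}. M i k)"
      unfolding W_def R_def by (intro arg_cong2[of _ _ _ _ "(*)"] prod.cong refl) auto
    also have "\<dots> = path_poly id Q (zF k) / M 0 k * (\<Prod>j<n. U j k (gs ! j))"
      unfolding MM prod_dividef using Dall by simp
    also have "(\<Prod>j<n. U j k (gs ! j)) = to_fract (val n 0 (sp (int l) k) gs (map (sp (int l) k) Q))"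
    proof -
      have "val n 0 (sp (int l) k) gs (map (sp (int l) k) Q) = (\<Prod>j<n. act (sp (int l) k \<circ> flips (map (sp (int l) k) (take j Q)) \<circ> sp 1 (sp (int l) k (q j)) \<circ> et (e j)) (gs ! j))"
        using gs(2) lenQ by (subst val_prod) (simp_all add: take_map q_def e_def del: comp_apply)
      then show ?thesis unfolding flips_map[OF kl] U_def by (simp add: to_fract_prod \<zeta>_def del: comp_apply)
    qed
    finally show "W (\<lambda>j\<in>{..<n}. k) = path_poly id Q (zF k) / (\<Prod>r\<in>{1..int l} - {k}. zF k - zF r) * to_fract (val n 0 (sp (int l) k) gs (map (sp (int l) k) Q))"
      unfolding M0 .
  qed
  also have "\<dots> = (\<Sum>k\<in>{1..int l}. path_poly id Q (zF k) / (\<Prod>r\<in>{1..int l} - {k}. zF k - zF r) * to_fract (val n 0 (sp (int l) k) gs (map (sp (int l) k) Q)))"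
  proof (rule sum.mono_neutral_left)
    show "(\<Inter>j<n. A j) \<subseteq> {1..int l}"
    proof
      fix k assume "k \<in> (\<Inter>j<n. A j)"
      then have "k \<in> A 0" using n0 by blast
      then show "k \<in> {1..int l}" by (simp add: A_def)
    qed
    show "\<forall>k\<in>{1..int l} - (\<Inter>j<n. A j). path_poly id Q (zF k) / (\<Prod>r\<in>{1..int l} - {k}. zF k - zF r) * to_fract (val n 0 (sp (int l) k) gs (map (sp (int l) k) Q)) = (0 :: 'k mpol fract)"
    proof
      fix k assume k: "k \<in> {1..int l} - (\<Inter>j<n. A j)"
      then obtain j0 where "j0 < n" "k \<in> {1..int l}" "k \<notin> A j0" by blast
      then obtain j where j: "j < n" "k = q j" by (auto simp: A_def)
      then have "k \<in> set Q" using lenQ by (auto simp: q_def)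
      then have "path_poly id Q (zF k) = (0 :: 'k mpol fract)" using k Ql by (intro path_poly_zero) auto
      then show "path_poly id Q (zF k) / (\<Prod>r\<in>{1..int l} - {k}. zF k - zF r) * to_fract (val n 0 (sp (int l) k) gs (map (sp (int l) k) Q)) = (0 :: 'k mpol fract)" by simp
    qed
  qed simp
  finally show ?thesis unfolding step4[symmetric] h_def .
qed

text \<open>For fixed \<open>k\<close> the inner sum is the kernel of \<open>u\<close> for the \<open>l - 1\<close> coordinates other than \<open>k\<close>, which \<open>path_wt_relabel\<close> and \<open>val_relabel\<close> express by
  paths in \<open>l\<close> coordinates. The remaining sum over \<open>k\<close> is \<open>lagrange_paths\<close>.\<close>

lemma v_kernel:
  fixes D :: "'k mpol set" and fs :: "'k mpol list"
  assumes l3: "3 \<le> l" and n: "n = l - 1" and Q: "Q \<in> paths l n"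
    and D: "dual_hom_bases l (insert 1 (OS (l - 1))) ({1, - 1} \<union> OS (l - 1)) D Dd" and fs: "set fs \<subseteq> inv_ring l (OS l)" "length fs = n"
  shows "(\<Sum>k\<in>{1..int l}. path_poly id Q (zF k) / (\<Prod>r\<in>{1..int l} - {k}. zF k - zF r) *
      (\<Sum>d\<in>D. to_fract (val n 0 (sp (int l) k) (ends n (F l n (OS (l - 1)) fs d) (Dd d)) (map (sp (int l) k) Q)))) =
    (\<Sum>P\<in>paths l n. (if flips P = flips Q then path_wt l id P * to_fract (act (flips Q) (prod_sums l)) else 0) * to_fract (val n 0 id fs P))"
proof -
  have n1: "1 \<le> n" using n l3 by simp
  have m: "2 \<le> l - 1" "l - 1 \<le> l" using l3 by auto
  have Ql: "set Q \<subseteq> {1..int l}" "length Q = n" using Q by (auto simp: paths_def)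
  have fQs: "flips Q \<in> sperm l" by (rule flips_sperm[OF Ql(1)])
  have fsI: "set fs \<subseteq> inv_ring l (OS (l - 1))"
  proof -
    have "OS (l - 1) \<subseteq> OS l" by (auto simp: OS_def)
    from inv_ring_mono[OF this OS_sub_N[OF l2 le_refl]] show ?thesis using fs(1) by blast
  qed
  have S: "{1..int (l - 1)} = {1..int l} - {int l}" using l2 by auto
  define KT where "KT k = path_poly id Q (zF k) / (\<Prod>r\<in>{1..int l} - {k}. zF k - zF r :: 'k mpol fract)" for k
  define DQ where "DQ k = to_fract (act (flips Q \<circ> sp (int l) k) (prod_sums (l - 1) :: 'k mpol))" for k
  have inner: "(\<Sum>d\<in>D. to_fract (val n 0 (sp (int l) k) (ends n (F l n (OS (l - 1)) fs d) (Dd d)) (map (sp (int l) k) Q))) =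
     (\<Sum>P\<in>paths l n. (if flips P = flips Q then path_wt l id P * path_poly id P (zF k) * DQ k else 0) * to_fract (val n 0 id fs P))"
    if k: "k \<in> {1..int l}" "k \<notin> set Q" for k
  proof -
    let ?k = "sp (int l) k"
    note s = spl_sperm[OF k(1)]
    have i: "?k (?k x) = x" for x using k by (intro sp_invol) auto
    have im: "?k ` {1..int l} = {1..int l}" using k by (intro sp_image) auto
    have mp: "map ?k P \<in> paths (l - 1) n" if "P \<in> paths l n" "k \<notin> set P" for P
    proof -
      have "?k x \<in> {1..int l} - {int l}" if "x \<in> set P" for x
      proof -
        have "x \<in> {1..int l}" "x \<noteq> k" using that \<open>P \<in> paths l n\<close> \<open>k \<notin> set P\<close> by (auto simp: paths_def)
        moreover have "?k x \<noteq> int l" using i[of x] \<open>x \<noteq> k\<close> by (metis sp_1)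
        ultimately show ?thesis using im by blast
      qed
      then show ?thesis using that unfolding paths_def S by auto
    qed
    have Q': "map ?k Q \<in> paths (l - 1) n" by (rule mp[OF Q k(2)])
    have fm: "flips (map ?k P) = flips (map ?k Q) \<longleftrightarrow> flips P = flips Q" for P
    proof -
      have e: "?k \<circ> flips (map ?k P) \<circ> ?k = flips P" for P
      proof -
        have "?k \<circ> ?k = id" by (simp add: fun_eq_iff i)
        then show ?thesis unfolding flips_map[OF k(1)] comp_assoc by simp
      qed
      have e2: "flips (map ?k P) = ?k \<circ> flips P \<circ> ?k" for P unfolding e[of P, symmetric] by (simp add: fun_eq_iff i)
      show ?thesis using e e2 by metis
    qed
    have "(\<Sum>d\<in>D. to_fract (val n 0 ?k (ends n (F l n (OS (l - 1)) fs d) (Dd d)) (map ?k Q))) =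
      (\<Sum>P\<in>paths (l - 1) n. (if flips P = flips (map ?k Q) then path_wt (l - 1) ?k P * to_fract (act (?k \<circ> flips (map ?k Q)) (prod_sums (l - 1))) else 0) * to_fract (val n 0 ?k fs P))"
      by (rule u_kernel[OF m n1 s Q' D fsI fs(2)])
    also have "\<dots> = (\<Sum>P\<in>{P \<in> paths l n. k \<notin> set P}. (if flips (map ?k P) = flips (map ?k Q) then path_wt (l - 1) ?k (map ?k P) * to_fract (act (?k \<circ> flips (map ?k Q)) (prod_sums (l - 1))) else 0) * to_fract (val n 0 ?k fs (map ?k P)))"
    proof (rule sum.reindex_bij_witness[of _ "map ?k" "map ?k"])
      fix P assume P: "P \<in> paths (l - 1) n"
      show mm: "map ?k (map ?k P) = P" by (simp add: i comp_def)
      have "?k x \<in> {1..int l} - {k}" if "x \<in> set P" for x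
      proof -
        have "x \<in> {1..int l}" "x \<noteq> int l" using that P unfolding paths_def S by auto
        moreover have "?k x \<noteq> k" using i[of x] \<open>x \<noteq> int l\<close> by (metis sp_2)
        ultimately show ?thesis using im by blast
      qed
      then have "set (map ?k P) \<subseteq> {1..int l} - {k}" by (simp add: image_subset_iff)
      moreover have "length (map ?k P) = n" using P by (simp add: paths_def)
      ultimately show "map ?k P \<in> {P \<in> paths l n. k \<notin> set P}" unfolding paths_def by blast
      show "(if flips (map ?k (map ?k P)) = flips (map ?k Q) then path_wt (l - 1) ?k (map ?k (map ?k P)) * to_fract (act (?k \<circ> flips (map ?k Q)) (prod_sums (l - 1))) else 0) * to_fract (val n 0 ?k fs (map ?k (map ?k P))) =
        (if flips P = flips (map ?k Q) then path_wt (l - 1) ?k P * to_fract (act (?k \<circ> flips (map ?k Q)) (prod_sums (l - 1))) else 0) * to_fract (val n 0 ?k fs P)" unfolding mm ..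
    next
      fix P assume P: "P \<in> {P \<in> paths l n. k \<notin> set P}"
      show "map ?k (map ?k P) = P" by (simp add: i comp_def)
      show "map ?k P \<in> paths (l - 1) n" using P by (intro mp) auto
    qed
    also have "\<dots> = (\<Sum>P\<in>{P \<in> paths l n. k \<notin> set P}. (if flips P = flips Q then path_wt l id P * path_poly id P (zF k) * DQ k else 0) * to_fract (val n 0 id fs P))"
    proof (intro sum.cong refl)
      fix P assume P: "P \<in> {P \<in> paths l n. k \<notin> set P}"
      then have Pl: "set P \<subseteq> {1..int l} - {k}" "set P \<subseteq> {1..int l}" "length fs = length P" using fs(2) by (auto simp: paths_def)
      have w: "path_wt (l - 1) ?k (map ?k P) = path_wt l id P * (path_poly id P (zF k) :: 'k mpol fract)"
        using path_wt_relabel[OF k(1) Pl(1) id_sperm] by (simp only: id_comp id_apply)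
      have v: "val n 0 ?k fs (map ?k P) = val n 0 id fs P"
        using val_relabel[OF k(1) fs(1) Pl(2) id_sperm Pl(3)] by (simp only: id_comp)
      have d: "to_fract (act (?k \<circ> flips (map ?k Q)) (prod_sums (l - 1))) = DQ k" unfolding flips_map[OF k(1)] DQ_def ..
      show "(if flips (map ?k P) = flips (map ?k Q) then path_wt (l - 1) ?k (map ?k P) * to_fract (act (?k \<circ> flips (map ?k Q)) (prod_sums (l - 1))) else 0) * to_fract (val n 0 ?k fs (map ?k P)) =
        (if flips P = flips Q then path_wt l id P * path_poly id P (zF k) * DQ k else 0) * to_fract (val n 0 id fs P)"
        unfolding fm w v d ..
    qed
    also have "\<dots> = (\<Sum>P\<in>paths l n. (if flips P = flips Q then path_wt l id P * path_poly id P (zF k) * DQ k else 0) * to_fract (val n 0 id fs P))"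
    proof (rule sum.mono_neutral_left[OF finite_paths])
      show "\<forall>P\<in>paths l n - {P \<in> paths l n. k \<notin> set P}. (if flips P = flips Q then path_wt l id P * path_poly id P (zF k) * DQ k else 0) * to_fract (val n 0 id fs P) = 0"
      proof
        fix P assume P: "P \<in> paths l n - {P \<in> paths l n. k \<notin> set P}"
        then have "path_poly id P (zF k) = (0 :: 'k mpol fract)" using k by (intro path_poly_zero) (auto simp: paths_def)
        then show "(if flips P = flips Q then path_wt l id P * path_poly id P (zF k) * DQ k else 0) * to_fract (val n 0 id fs P) = 0" by simp
      qed
    qed auto
    finally show ?thesis .
  qed
  have "(\<Sum>k\<in>{1..int l}. KT k * (\<Sum>d\<in>D. to_fract (val n 0 (sp (int l) k) (ends n (F l n (OS (l - 1)) fs d) (Dd d)) (map (sp (int l) k) Q)))) =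
    (\<Sum>k\<in>{1..int l}. \<Sum>P\<in>paths l n. KT k * ((if flips P = flips Q then path_wt l id P * path_poly id P (zF k) * DQ k else 0) * to_fract (val n 0 id fs P)))"
  proof (intro sum.cong refl)
    fix k assume k: "k \<in> {1..int l}"
    show "KT k * (\<Sum>d\<in>D. to_fract (val n 0 (sp (int l) k) (ends n (F l n (OS (l - 1)) fs d) (Dd d)) (map (sp (int l) k) Q))) =
      (\<Sum>P\<in>paths l n. KT k * ((if flips P = flips Q then path_wt l id P * path_poly id P (zF k) * DQ k else 0) * to_fract (val n 0 id fs P)))"
    proof (cases "k \<in> set Q")
      case True
      then have "path_poly id Q (zF k) = (0 :: 'k mpol fract)" using k Ql by (intro path_poly_zero) auto
      then have "KT k = 0" by (simp add: KT_def)
      then show ?thesis by simp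
    next
      case False
      show ?thesis unfolding inner[OF k False] by (rule sum_distrib_left)
    qed
  qed
  also have "\<dots> = (\<Sum>P\<in>paths l n. \<Sum>k\<in>{1..int l}. KT k * ((if flips P = flips Q then path_wt l id P * path_poly id P (zF k) * DQ k else 0) * to_fract (val n 0 id fs P)))"
    by (rule sum.swap)
  also have "\<dots> = (\<Sum>P\<in>paths l n. (if flips P = flips Q then path_wt l id P * to_fract (act (flips Q) (prod_sums l)) else 0) * to_fract (val n 0 id fs P))"
  proof (intro sum.cong refl)
    fix P assume P: "P \<in> paths l n"
    show "(\<Sum>k\<in>{1..int l}. KT k * ((if flips P = flips Q then path_wt l id P * path_poly id P (zF k) * DQ k else 0) * to_fract (val n 0 id fs P))) =
      (if flips P = flips Q then path_wt l id P * to_fract (act (flips Q) (prod_sums l)) else 0) * to_fract (val n 0 id fs P)"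
    proof (cases "flips P = flips Q")
      case True
      \<comment> \<open>The quotient of the products of sums for \<open>l\<close> and for \<open>l - 1\<close> coordinates.\<close>
      define EQ where "EQ k = (\<Prod>r\<in>{1..int l} - {k}. zF k + zF (flips Q r) :: 'k mpol fract)" for k
      have key: "KT k * path_poly id P (zF k) * DQ k = path_poly id P (zF k) * path_poly id Q (zF k) / ((\<Prod>r\<in>{1..int l} - {k}. zF k - zF r) * EQ k) * to_fract (act (flips Q) (prod_sums l))"
        if k: "k \<in> {1..int l}" for k
      proof (cases "k \<in> set Q")
        case True
        then have "path_poly id Q (zF k) = (0 :: 'k mpol fract)" using k Ql by (intro path_poly_zero) auto
        then show ?thesis by (simp add: KT_def)
      next
        case False
        have fk: "flips Q k = k" using False k Ql by (intro flips_fixed) auto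
        have ks: "flips Q \<circ> sp (int l) k \<in> sperm l" by (intro sperm_comp fQs spl_sperm k)
        have "act (flips Q) (prod_sums l) = act (flips Q) (act (sp (int l) k) (prod_sums l :: 'k mpol))" unfolding act_prod_sums_sp[OF k] ..
        also have "\<dots> = act (flips Q \<circ> sp (int l) k) (prod_sums (l - 1)) * (\<Prod>i\<in>{1..<int l}. act (flips Q \<circ> sp (int l) k) (rt (- i) (int l)))"
          unfolding act_comp[OF fQs] prod_sums_last[OF l2] act_mult act_prod ..
        finally have "to_fract (act (flips Q) (prod_sums l)) = DQ k * (\<Prod>i\<in>{1..<int l}. to_fract (act (flips Q \<circ> sp (int l) k) (rt (- i) (int l))))"
          unfolding DQ_def by (simp add: to_fract_prod del: comp_apply)
        also have "(\<Prod>i\<in>{1..<int l}. to_fract (act (flips Q \<circ> sp (int l) k) (rt (- i) (int l)))) = EQ k"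
          unfolding EQ_def
        proof (rule prod.reindex_bij_witness[of _ "sp (int l) k" "sp (int l) k"])
          have i: "sp (int l) k (sp (int l) k x) = x" for x using k by (intro sp_invol) auto
          have im: "sp (int l) k ` {1..int l} = {1..int l}" using k by (intro sp_image) auto
          fix a assume a: "a \<in> {1..<int l}"
          show "sp (int l) k (sp (int l) k a) = a" by (rule i)
          have "sp (int l) k a \<noteq> k" using i[of a] a by (metis atLeastLessThan_iff less_irrefl sp_2)
          moreover have "sp (int l) k a \<in> {1..int l}" using im a by (metis atLeastAtMost_iff atLeastLessThan_iff imageI less_imp_le)
          ultimately show "sp (int l) k a \<in> {1..int l} - {k}" by simp
          have "(flips Q \<circ> sp (int l) k) (int l) = k" by (simp add: sp_1 fk)
          moreover have "(flips Q \<circ> sp (int l) k) (- a) = - flips Q (sp (int l) k a)" using sperm_odd[OF ks, of a] by simp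
          moreover have "flips Q (sp (int l) k a) \<noteq> 0" using sperm_eq0[OF ks, of a] a by simp
          ultimately show "zF k + zF (flips Q (sp (int l) k a)) = (to_fract (act (flips Q \<circ> sp (int l) k) (rt (- a) (int l))) :: 'k mpol fract)"
            unfolding act_rt[OF ks] by (simp add: rt_def zF_def Xs_uminus)
        next
          have i: "sp (int l) k (sp (int l) k x) = x" for x using k by (intro sp_invol) auto
          have im: "sp (int l) k ` {1..int l} = {1..int l}" using k by (intro sp_image) auto
          fix a assume a: "a \<in> {1..int l} - {k}"
          show "sp (int l) k (sp (int l) k a) = a" by (rule i)
          have "sp (int l) k a \<noteq> int l" using i[of a] a by (metis Diff_iff singletonI sp_1)
          moreover have "sp (int l) k a \<in> {1..int l}" using im a by blast
          ultimately show "sp (int l) k a \<in> {1..<int l}" by auto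
        qed
        finally have d: "to_fract (act (flips Q) (prod_sums l)) = DQ k * EQ k" .
        have "EQ k \<noteq> 0"
        proof -
          have "zF k + zF (flips Q r) \<noteq> (0 :: 'k mpol fract)" if r: "r \<in> {1..int l} - {k}" for r
          proof
            assume z: "zF k + zF (flips Q r) = (0 :: 'k mpol fract)"
            have r0: "flips Q r \<noteq> 0" "\<bar>flips Q r\<bar> = \<bar>r\<bar>" using sperm_eq0[OF fQs, of r] r flips_abs by auto
            have "zF k = (zF (- flips Q r) :: 'k mpol fract)" using z unfolding zF_neg[OF r0(1)] eq_neg_iff_add_eq_0 .
            then have "k = - flips Q r" using zF_inj[of k "- flips Q r"] k r0 by auto
            then show False using r0(2) r k by auto
          qed
          then show ?thesis by (simp add: EQ_def)
        qed
        then show ?thesis unfolding d KT_def by simp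
      qed
      have "(\<Sum>k\<in>{1..int l}. KT k * (path_wt l id P * path_poly id P (zF k) * DQ k * to_fract (val n 0 id fs P))) =
         (\<Sum>k\<in>{1..int l}. path_wt l id P * to_fract (val n 0 id fs P) * (KT k * path_poly id P (zF k) * DQ k))"
        by (intro sum.cong refl) (simp only: mult_ac)
      also have "\<dots> = (\<Sum>k\<in>{1..int l}. path_wt l id P * to_fract (val n 0 id fs P) * to_fract (act (flips Q) (prod_sums l)) * (path_poly id P (zF k) * path_poly id Q (zF k) / ((\<Prod>r\<in>{1..int l} - {k}. zF k - zF r) * EQ k)))"
      proof (intro sum.cong refl)
        fix k assume k: "k \<in> {1..int l}"
        show "path_wt l id P * to_fract (val n 0 id fs P) * (KT k * path_poly id P (zF k) * DQ k) =
          path_wt l id P * to_fract (val n 0 id fs P) * to_fract (act (flips Q) (prod_sums l)) * (path_poly id P (zF k) * path_poly id Q (zF k) / ((\<Prod>r\<in>{1..int l} - {k}. zF k - zF r) * EQ k))"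
          unfolding key[OF k] by (simp only: mult_ac)
      qed
      also have "\<dots> = path_wt l id P * to_fract (val n 0 id fs P) * to_fract (act (flips Q) (prod_sums l)) * (\<Sum>k\<in>{1..int l}. path_poly id P (zF k) * path_poly id Q (zF k) / ((\<Prod>r\<in>{1..int l} - {k}. zF k - zF r) * EQ k))"
        unfolding sum_distrib_left ..
      also have "(\<Sum>k\<in>{1..int l}. path_poly id P (zF k) * path_poly id Q (zF k) / ((\<Prod>r\<in>{1..int l} - {k}. zF k - zF r) * EQ k)) = 1"
        unfolding EQ_def by (rule lagrange_paths[OF P[unfolded n] Q[unfolded n] True])
      finally show ?thesis using True by (simp only: if_True mult_ac mult_1_left simp_thms)
    next
      case False
      then show ?thesis by (simp only: if_False mult_zero_left mult_zero_right sum.neutral_const)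
    qed
  qed
  finally show ?thesis unfolding KT_def .
qed

end

section \<open>Linear extension to formal sums\<close>

text \<open>The linear extension of \<open>g\<close> from generators to formal sums, with values in a ring.\<close>

definition vext :: "('a \<Rightarrow> 'r::comm_ring_1) \<Rightarrow> ('a \<Rightarrow>\<^sub>0 int) \<Rightarrow> 'r" where
  "vext g p = (\<Sum>x\<in>Poly_Mapping.keys p. of_int (Poly_Mapping.lookup p x) * g x)"

lemma vext_superset: "finite A \<Longrightarrow> Poly_Mapping.keys p \<subseteq> A \<Longrightarrow> vext g p = (\<Sum>x\<in>A. of_int (Poly_Mapping.lookup p x) * g x)"
  unfolding vext_def by (rule sum.mono_neutral_left) (auto simp: in_keys_iff)
lemma vext_0 [simp]: "vext g 0 = 0" by (simp add: vext_def)
lemma vext_frag_of [simp]: "vext g (frag_of x) = g x" by (simp add: vext_def keys_frag_of)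
lemma vext_diff: "vext g (p - q) = vext g p - vext g q"
proof -
  let ?A = "Poly_Mapping.keys p \<union> Poly_Mapping.keys q"
  have "Poly_Mapping.keys (p - q) \<subseteq> ?A" by (rule keys_diff)
  then show ?thesis by (simp add: vext_superset[of ?A] lookup_minus sum_subtractf left_diff_distrib)
qed
lemma vext_uminus: "vext g (- p) = - vext g p" using vext_diff[of g 0 p] by simp
lemma vext_add: "vext g (p + q) = vext g p + vext g q" using vext_diff[of g p "- q"] by (simp add: vext_uminus)
lemma vext_sum: "vext g (sum f A) = (\<Sum>a\<in>A. vext g (f a))"
  by (induction A rule: infinite_finite_induct) (auto simp: vext_add)
lemma vext_cong: "(\<And>x. x \<in> Poly_Mapping.keys p \<Longrightarrow> f x = g x) \<Longrightarrow> vext f p = vext g p" by (simp add: vext_def)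
lemma vext_frag_extend: "vext g (frag_extend h p) = vext (\<lambda>x. vext g (h x)) p"
  using subset_UNIV by (induction p rule: frag_induction) (auto simp: frag_extend_diff vext_diff)
lemma frag_extend_extend: "frag_extend h (frag_extend g p) = frag_extend (\<lambda>x. frag_extend h (g x)) p"
  using subset_UNIV by (induction p rule: frag_induction) (auto simp: frag_extend_diff)
lemma vext_lin: "vext (\<lambda>x. \<Sum>a\<in>A. c a * g a x) p = (\<Sum>a\<in>A. c a * vext (g a) p)"
  using subset_UNIV by (induction p rule: frag_induction) (auto simp: vext_diff right_diff_distrib sum_subtractf)
lemma vext_scale: "vext (\<lambda>x. c * g x) p = c * vext g p"
  using subset_UNIV by (induction p rule: frag_induction) (auto simp: vext_diff right_diff_distrib)
lemma to_fract_vext: "to_fract (vext g p) = vext (\<lambda>x. to_fract (g x)) p"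
  using subset_UNIV by (induction p rule: frag_induction) (auto simp: vext_diff)

section \<open>Tensor products as quotients\<close>

text \<open>The tuples whose formal sums represent the tensors.\<close>

definition gens :: "'r::comm_ring_1 chain \<Rightarrow> 'r list set" where
  "gens T = {fs. length fs = tlen T \<and> set fs \<subseteq> fac T}"

lemma tens_free_iff: "p \<in> tens_free T \<longleftrightarrow> Poly_Mapping.keys p \<subseteq> gens T" by (auto simp: tens_free_def gens_def)
lemma tens_free_0 [simp]: "0 \<in> tens_free T" by (simp add: tens_free_iff)
lemma tens_free_frag: "fs \<in> gens T \<Longrightarrow> frag_of fs \<in> tens_free T" by (simp add: tens_free_iff keys_frag_of)
lemma tens_free_diff: "p \<in> tens_free T \<Longrightarrow> q \<in> tens_free T \<Longrightarrow> p - q \<in> tens_free T"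
  using keys_diff[of p q] by (auto simp: tens_free_iff)
lemma tens_free_add: "p \<in> tens_free T \<Longrightarrow> q \<in> tens_free T \<Longrightarrow> p + q \<in> tens_free T"
  using keys_add[of p q] by (auto simp: tens_free_iff)
lemma tens_free_sum: "(\<And>a. a \<in> A \<Longrightarrow> f a \<in> tens_free T) \<Longrightarrow> sum f A \<in> tens_free T"
  by (induction A rule: infinite_finite_induct) (auto intro: tens_free_add)
lemma tens_free_extend: "p \<in> tens_free T \<Longrightarrow> (\<And>fs. fs \<in> gens T \<Longrightarrow> h fs \<in> tens_free T') \<Longrightarrow> frag_extend h p \<in> tens_free T'"
  using keys_frag_extend[of h p] by (auto simp: tens_free_iff) blast
lemma tens_free_induct [consumes 1, case_names zero one diff]:
  assumes "p \<in> tens_free T" "P 0" "\<And>fs. fs \<in> gens T \<Longrightarrow> P (frag_of fs)" "\<And>a b. P a \<Longrightarrow> P b \<Longrightarrow> P (a - b)"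
  shows "P p"
  using assms(1) unfolding tens_free_iff by (induction p rule: frag_induction) (auto simp: assms)

lemma tens_rel_uminus: "p \<in> tens_rel T \<Longrightarrow> - p \<in> tens_rel T" using tens_rel.diff[OF tens_rel.zero] by fastforce
lemma tens_rel_add: "p \<in> tens_rel T \<Longrightarrow> q \<in> tens_rel T \<Longrightarrow> p + q \<in> tens_rel T"
  using tens_rel.diff[of p T "- q"] tens_rel_uminus[of q T] by simp
lemma tens_rel_sum: "(\<And>a. a \<in> A \<Longrightarrow> f a \<in> tens_rel T) \<Longrightarrow> sum f A \<in> tens_rel T"
  by (induction A rule: infinite_finite_induct) (auto intro: tens_rel_add tens_rel.zero)

text \<open>To respect the relations it suffices to respect the generating ones.\<close>

lemma tens_rel_extend:
  assumes p: "p \<in> tens_rel T"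
    and a: "\<And>us vs f g. length us + 1 + length vs = tlen T \<Longrightarrow> set us \<subseteq> fac T \<Longrightarrow> set vs \<subseteq> fac T \<Longrightarrow> f \<in> fac T \<Longrightarrow> g \<in> fac T \<Longrightarrow>
      h (us @ (f + g) # vs) - h (us @ f # vs) - h (us @ g # vs) \<in> tens_rel T'"
    and b: "\<And>us vs f g a. length us + 2 + length vs = tlen T \<Longrightarrow> set us \<subseteq> fac T \<Longrightarrow> set vs \<subseteq> fac T \<Longrightarrow> f \<in> fac T \<Longrightarrow> g \<in> fac T \<Longrightarrow> a \<in> scal T (length us + 1) \<Longrightarrow>
      h (us @ (f * a) # g # vs) - h (us @ f # lact T a g # vs) \<in> tens_rel T'"
  shows "frag_extend h p \<in> tens_rel T'"
  using p by (induction rule: tens_rel.induct) (auto simp: frag_extend_diff a b intro: tens_rel.zero tens_rel.diff)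

lemma tclass_self: "p \<in> tens_free T \<Longrightarrow> p \<in> tclass T p" by (simp add: tclass_def tens_rel.zero)
lemma tclass_eqI: assumes "p - q \<in> tens_rel T" shows "tclass T p = tclass T q"
proof -
  have "r - p \<in> tens_rel T \<longleftrightarrow> r - q \<in> tens_rel T" for r
    using tens_rel_add[of "r - p" T "p - q"] tens_rel.diff[of "r - q" T "p - q"] assms by auto
  then show ?thesis by (simp add: tclass_def)
qed
lemma tclass_eqD: "p \<in> tens_free T \<Longrightarrow> tclass T p = tclass T q \<Longrightarrow> p - q \<in> tens_rel T"
  using tclass_self[of p T] by (auto simp: tclass_def)
lemma tensorsE: assumes "t \<in> tensors T" obtains p where "p \<in> tens_free T" "t = tclass T p"
  using assms by (auto simp: tensors_def)
lemma tclass_tensors: "p \<in> tens_free T \<Longrightarrow> tclass T p \<in> tensors T" by (simp add: tensors_def)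

lemma tmap_tclass:
  assumes p: "p \<in> tens_free T" and r: "\<And>p. p \<in> tens_rel T \<Longrightarrow> frag_extend h p \<in> tens_rel T'"
  shows "tmap T T' h (tclass T p) = tclass T' (frag_extend h p)"
proof -
  have "tclass T' (frag_extend h q) = tclass T' (frag_extend h p)" if "q \<in> tclass T p" for q
    using that r[of "q - p"] by (intro tclass_eqI) (auto simp: tclass_def frag_extend_diff)
  then have "(\<Union>q\<in>tclass T p. tclass T' (frag_extend h q)) = tclass T' (frag_extend h p)"
    using tclass_self[OF p] by blast
  then show ?thesis using p by (simp add: tmap_def tclass_tensors)
qed

lemma tadd_tclass: assumes "p \<in> tens_free T" "q \<in> tens_free T"
  shows "tadd T (tclass T p) (tclass T q) = tclass T (p + q)"
proof -
  have "tclass T (p' + q') = tclass T (p + q)" if "p' \<in> tclass T p" "q' \<in> tclass T q" for p' q'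
    using that tens_rel_add[of "p' - p" T "q' - q"] by (intro tclass_eqI) (auto simp: tclass_def algebra_simps)
  then show ?thesis unfolding tadd_def using tclass_self[OF assms(1)] tclass_self[OF assms(2)] by blast
qed

lemma left_rel:
  assumes h: "\<And>f. f \<in> fac T \<Longrightarrow> h f \<in> fac T" "\<And>f g. f \<in> fac T \<Longrightarrow> g \<in> fac T \<Longrightarrow> h (f + g) = h f + h g"
    "\<And>f a i. f \<in> fac T \<Longrightarrow> a \<in> scal T i \<Longrightarrow> h (f * a) = h f * a" and p: "p \<in> tens_rel T"
  shows "frag_extend (\<lambda>fs. frag_of (h (hd fs) # tl fs)) p \<in> tens_rel T"
proof (rule tens_rel_extend[OF p])
  fix us vs f g assume a: "length us + 1 + length vs = tlen T" "set us \<subseteq> fac T" "set vs \<subseteq> fac T" "f \<in> fac T" "g \<in> fac T"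
  show "frag_of (h (hd (us @ (f + g) # vs)) # tl (us @ (f + g) # vs)) - frag_of (h (hd (us @ f # vs)) # tl (us @ f # vs)) - frag_of (h (hd (us @ g # vs)) # tl (us @ g # vs)) \<in> tens_rel T"
  proof (cases us)
    case Nil
    then show ?thesis using tens_rel.additive[of "[]" vs T "h f" "h g"] a h by simp
  next
    case (Cons u us')
    then show ?thesis using tens_rel.additive[of "h u # us'" vs T f g] a h by simp
  qed
next
  fix us vs f g x assume a: "length us + 2 + length vs = tlen T" "set us \<subseteq> fac T" "set vs \<subseteq> fac T" "f \<in> fac T" "g \<in> fac T" "x \<in> scal T (length us + 1)"
  show "frag_of (h (hd (us @ (f * x) # g # vs)) # tl (us @ (f * x) # g # vs)) - frag_of (h (hd (us @ f # lact T x g # vs)) # tl (us @ f # lact T x g # vs)) \<in> tens_rel T"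
  proof (cases us)
    case Nil
    then show ?thesis using tens_rel.balanced[of "[]" vs T "h f" g x] a h by simp
  next
    case (Cons u us')
    then show ?thesis using tens_rel.balanced[of "h u # us'" vs T f g x] a h by simp
  qed
qed

lemma right_rel:
  assumes h: "\<And>f. f \<in> fac T \<Longrightarrow> h f \<in> fac T" "\<And>f g. f \<in> fac T \<Longrightarrow> g \<in> fac T \<Longrightarrow> h (f + g) = h f + h g"
    "\<And>f a i. f \<in> fac T \<Longrightarrow> a \<in> scal T i \<Longrightarrow> h (lact T a f) = lact T a (h f)" and p: "p \<in> tens_rel T"
  shows "frag_extend (\<lambda>fs. frag_of (butlast fs @ [h (last fs)])) p \<in> tens_rel T"
proof (rule tens_rel_extend[OF p])
  fix us vs f g assume a: "length us + 1 + length vs = tlen T" "set us \<subseteq> fac T" "set vs \<subseteq> fac T" "f \<in> fac T" "g \<in> fac T"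
  show "frag_of (butlast (us @ (f + g) # vs) @ [h (last (us @ (f + g) # vs))]) - frag_of (butlast (us @ f # vs) @ [h (last (us @ f # vs))]) - frag_of (butlast (us @ g # vs) @ [h (last (us @ g # vs))]) \<in> tens_rel T"
  proof (cases vs rule: rev_cases)
    case Nil
    then show ?thesis using tens_rel.additive[of us "[]" T "h f" "h g"] a h by (simp add: butlast_append)
  next
    case (snoc vs' v)
    then show ?thesis using tens_rel.additive[of us "vs' @ [h v]" T f g] a h by (simp add: butlast_append)
  qed
next
  fix us vs f g x assume a: "length us + 2 + length vs = tlen T" "set us \<subseteq> fac T" "set vs \<subseteq> fac T" "f \<in> fac T" "g \<in> fac T" "x \<in> scal T (length us + 1)"
  show "frag_of (butlast (us @ (f * x) # g # vs) @ [h (last (us @ (f * x) # g # vs))]) - frag_of (butlast (us @ f # lact T x g # vs) @ [h (last (us @ f # lact T x g # vs))]) \<in> tens_rel T"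
  proof (cases vs rule: rev_cases)
    case Nil
    then show ?thesis using tens_rel.balanced[of us "[]" T f "h g" x] a h by (simp add: butlast_append)
  next
    case (snoc vs' v)
    then show ?thesis using tens_rel.balanced[of us "vs' @ [h v]" T f g x] a h by (simp add: butlast_append)
  qed
qed

section \<open>Paths separate tensors\<close>

type_synonym 'k tuple_sum = "'k mpol list \<Rightarrow>\<^sub>0 int"

text \<open>Truncations of \<open>Xten l n (OS m)\<close> to the first \<open>k\<close> factors, with the signs of the full chain; they make induction on the number of factors possible.\<close>

definition XT :: "nat \<Rightarrow> nat \<Rightarrow> nat \<Rightarrow> nat \<Rightarrow> 'k::field mpol chain" where
  "XT l m n k = \<lparr>tlen = k, fac = inv_ring l (OS m), scal = (\<lambda>i. inv_ring l (insert (sgn_idx n i) (OS m))), lact = (*)\<rparr>"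

lemma XT_simps [simp]: "tlen (XT l m n k) = k" "fac (XT l m n k) = inv_ring l (OS m)"
  "scal (XT l m n k) i = inv_ring l (insert (sgn_idx n i) (OS m))" "lact (XT l m n k) = (*)"
  by (simp_all add: XT_def)

lemma Xten_XT: "Xten l n (OS m) = XT l m n n" by (simp add: Xten_def XT_def)

lemma paths_split: "Q \<in> paths m (a + b) \<Longrightarrow> take a Q \<in> paths m a \<and> drop a Q \<in> paths m b \<and> Q = take a Q @ drop a Q"
  using set_take_subset[of a Q] set_drop_subset[of a Q] by (auto simp: paths_def)

context typeD begin

text \<open>A scalar is invariant under the group of its tensor sign, which is the own sign of the factor on the right
  (\<open>eval_own\<close>) and the opposite of that of the factor on the left (\<open>eval_adjacent\<close>).\<close>

lemma val_vanishes_on_rel: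
  assumes m: "2 \<le> m" "m \<le> l" and k: "k \<le> n" and z: "\<zeta> \<in> sperm l" and Q: "Q \<in> paths m k"
    and p: "(p :: 'k tuple_sum) \<in> tens_rel (XT l m n k)"
  shows "vext (\<lambda>fs. val n 0 \<zeta> fs Q) p = 0"
  using p
proof (induction rule: tens_rel.induct)
  case (diff p q) then show ?case by (simp add: vext_diff)
next
  case (additive us vs f g)
  have "Q \<in> paths m (length us + (1 + length vs))" using additive(1) Q by (simp add: add.assoc)
  from paths_split[OF this] obtain Q1 Q2 where Q12: "Q1 \<in> paths m (length us)" "Q2 \<in> paths m (1 + length vs)" "Q = Q1 @ Q2" by blast
  obtain q Q3 where Q2: "Q2 = q # Q3" using Q12(2) by (cases Q2) (auto simp: paths_def)
  have len: "length us = length Q1" using Q12 by (simp add: paths_def)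
  show ?case unfolding Q12(3) Q2 by (simp add: vext_diff vext_add val_append[OF len] act_add algebra_simps del: comp_apply)
next
  case (balanced us vs f g a)
  have "Q \<in> paths m (length us + (2 + length vs))" using balanced(1) Q by (simp add: add.assoc)
  from paths_split[OF this] obtain Q1 Q2 where Q12: "Q1 \<in> paths m (length us)" "Q2 \<in> paths m (2 + length vs)" "Q = Q1 @ Q2" by blast
  obtain q r Q3 where Q2: "Q2 = q # r # Q3" using Q12(2) by (cases Q2; cases "tl Q2") (auto simp: paths_def)
  have len: "length us = length Q1" using Q12 by (simp add: paths_def)
  have qr: "q \<in> {1..int m}" "r \<in> {1..int m}" "set Q1 \<subseteq> {1..int m}" using Q12 Q2 by (auto simp: paths_def)
  define e where "e = sgn_idx n (length us)"
  have e: "e = 1 \<or> e = - 1" "- e = 1 \<or> - e = - 1" unfolding e_def using sgn_idx_cases[of n "length us"] by auto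
  have e': "sgn_idx n (Suc (length us)) = - e" unfolding e_def using balanced(1) k by (intro sgn_idx_Suc) simp
  have a: "a \<in> inv_ring l (insert (- e) (OS m))" using balanced(6) e' by simp
  define \<eta> where "\<eta> = \<zeta> \<circ> flips Q1"
  have s: "\<eta> \<in> sperm l" "\<eta> \<circ> fl q \<in> sperm l" unfolding \<eta>_def using qr m by (auto intro!: sperm_comp z flips_sperm flq_sperm)
  have key: "act (\<eta> \<circ> sp 1 q \<circ> et e) a = act (\<eta> \<circ> fl q \<circ> sp 1 r \<circ> et (- e)) a"
    unfolding eval_adjacent[OF m e(1) s(1) a qr(1)] eval_own[OF m e(2) s(2) a qr(2)] ..
  show ?case unfolding Q12(3) Q2
    by (simp add: vext_diff val_append[OF len] act_mult e' e_def[symmetric] \<eta>_def[symmetric] key algebra_simps del: comp_apply)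
qed simp

text \<open>The \<open>d a\<close> are the coefficients of \<open>\<Prod>j\<in>{2..l}. y - x\<^sub>j\<close>. They are dual, up to sign, to the powers of \<open>x\<^sub>\<epsilon>\<close>: the trace is a sum over the
  first coordinate \<open>k\<close>, and \<open>\<Prod>j\<noteq>k. y - x\<^sub>j\<close> at \<open>y = x\<^sub>1\<close> vanishes unless \<open>k = 1\<close>.\<close>

lemma power_basis_expansion:
  assumes e: "e = 1 \<or> e = - 1" and f: "(f :: 'k mpol) \<in> inv_ring l (OS l)"
  shows "\<exists>s. (\<forall>a<l. s a \<in> inv_ring l (insert e (OS l))) \<and> f = (\<Sum>a<l. s a * Xs e ^ a)"
proof -
  note a1 = adapted_O[OF l2 le_refl] and a2 = adapted_Oe[OF l2 le_refl e]
  have O: "OS l \<subseteq> N l" by (rule adapted_sub[OF a1(1)])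
  define pp where "pp \<sigma> = (\<Prod>j\<in>{2..int l}. [:- Xs (\<sigma> j), 1:] :: 'k mpol poly)" for \<sigma> :: "int \<Rightarrow> int"
  define d where "d a = coeff (pp id) a" for a
  have mp: "map_poly (act \<sigma>) (\<Prod>j\<in>A. [:- Xs (g j), 1:]) = (\<Prod>j\<in>A. [:- Xs (\<sigma> (g j)), 1:] :: 'k mpol poly)" if s: "\<sigma> \<in> sperm l" for \<sigma> A and g :: "int \<Rightarrow> int"
  proof (induction A rule: infinite_finite_induct)
    case (insert x F)
    have hom: "map_poly (act \<sigma>) (p * q) = map_poly (act \<sigma>) p * map_poly (act \<sigma>) (q :: 'k mpol poly)" for p q
      by (rule poly_eqI) (simp add: coeff_map_poly coeff_mult act_sum act_mult)
    have "map_poly (act \<sigma>) [:- Xs (g x), 1:] = [:- Xs (\<sigma> (g x)), 1 :: 'k mpol:]"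
      by (simp add: map_poly_pCons act_uminus act_Xs[OF s])
    then show ?case using insert by (simp add: hom del: mult_pCons_left)
  qed simp_all
  have act_d: "act \<sigma> (d a) = coeff (pp \<sigma>) a" if s: "\<sigma> \<in> sperm l" for \<sigma> a
    unfolding d_def pp_def using mp[OF s, of id "{2..int l}"] by (metis (no_types, lifting) act_0 coeff_map_poly id_apply prod.cong)
  have dO: "d a \<in> inv_ring l (OS l)" for a
  proof -
    have "act \<sigma> (d a) = d a" if s: "\<sigma> \<in> G (OS l)" for \<sigma>
    proof -
      have ss: "\<sigma> \<in> sperm l" using s G_sperm[OF O] by auto
      have "\<sigma> ` {2..int l} = {2..int l}" using s unfolding a1(2) GS_def LO_def by auto
      moreover have "inj_on \<sigma> {2..int l}" using sperm_inj[OF ss] by (auto simp: inj_on_def)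
      ultimately have "pp \<sigma> = pp id" unfolding pp_def using prod.reindex[of \<sigma> "{2..int l}" "\<lambda>j. [:- Xs j, 1:] :: 'k mpol poly"] by simp
      have "act \<sigma> (d a) = coeff (pp \<sigma>) a" by (rule act_d[OF ss])
      also have "\<dots> = d a" unfolding d_def \<open>pp \<sigma> = pp id\<close> ..
      finally show ?thesis .
    qed
    moreover have "d a \<in> Rl l"
    proof -
      have "\<forall>a. coeff (\<Prod>j\<in>A. [:- Xs j, 1:] :: 'k mpol poly) a \<in> Rl l" if "finite A" "A \<subseteq> {2..int l}" for A
        using that
      proof (induction A)
        case (insert x F)
        have x: "(Xs x :: 'k mpol) \<in> Rl l" using insert by (auto simp: Xs_def intro!: X_in_Rl)
        have "coeff ([:- Xs x, 1:] * p) a \<in> Rl l" if "\<forall>a. coeff p a \<in> Rl l" for p :: "'k mpol poly" and a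
        proof -
          have "coeff ([:- Xs x, 1:] * p) a = - Xs x * coeff p a + (case a of 0 \<Rightarrow> 0 | Suc b \<Rightarrow> coeff p b)"
            by (simp add: coeff_pCons)
          then show ?thesis using that x by (cases a) (auto intro!: Rl_add Rl_mult Rl_uminus Rl_diff)
        qed
        then show ?case using insert by (simp del: mult_pCons_left)
      qed (auto simp: coeff_1)
      then show ?thesis unfolding d_def pp_def by simp
    qed
    ultimately show ?thesis by (simp add: inv_ring_iff[OF O])
  qed
  have deg: "degree (pp \<sigma>) = l - 1" for \<sigma>
    unfolding pp_def by (subst degree_prod_eq_sum_degree) (use l2 in auto)
  have ev: "(\<Sum>a<l. coeff (pp \<sigma>) a * y ^ a) = (\<Prod>j\<in>{2..int l}. y - Xs (\<sigma> j))" for \<sigma> y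
  proof -
    have "{..l - 1} = {..<l}" using l2 by auto
    then have "(\<Sum>a<l. coeff (pp \<sigma>) a * y ^ a) = poly (pp \<sigma>) y" using deg[of \<sigma>] by (simp add: poly_altdef)
    then show ?thesis by (simp add: pp_def poly_prod)
  qed
  define s where "s a = (- 1) ^ (l - 1) * tr l (OS l) (insert e (OS l)) (f * d a)" for a
  have fd: "f * d a \<in> inv_ring l (OS l)" for a by (intro inv_ring_closed(2)[OF O] f dO)
  have E: "insert e (OS l) \<subseteq> N l" by (rule adapted_sub[OF a2(1)])
  have m1: "((- 1) ^ r :: 'k mpol) \<in> inv_ring l (insert e (OS l))" for r
    using inv_ring_closed(5)[OF E] inv_ring_closed(3)[OF E inv_ring_closed(5)[OF E]] by (cases "even r") simp_all
  have sE: "s a \<in> inv_ring l (insert e (OS l))" for a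
    unfolding s_def by (intro inv_ring_closed(2)[OF E] m1 trace_Oe_inv[OF l2 le_refl e fd])
  have tr: "to_fract (act (et e) (tr l (OS l) (insert e (OS l)) (f * d a))) =
     (\<Sum>k\<in>{1..int l}. to_fract (act (sp 1 k \<circ> et e) f) * to_fract (coeff (pp (sp 1 k \<circ> et e)) a) / (\<Prod>j\<in>{1..int l} - {k}. zF j - zF k))" for a
  proof -
    have "to_fract (act (et e) (tr l (OS l) (insert e (OS l)) (f * d a))) =
      (\<Sum>k\<in>{1..int l}. to_fract (act (sp 1 k \<circ> et e) (f * d a)) / (\<Prod>j\<in>{1..int l} - {k}. zF j - zF k))"
      using trace_Oe_formula[OF l2 le_refl e id_sperm fd] by (simp only: id_comp rtF_zF id_apply)
    also have "\<dots> = (\<Sum>k\<in>{1..int l}. to_fract (act (sp 1 k \<circ> et e) f) * to_fract (coeff (pp (sp 1 k \<circ> et e)) a) / (\<Prod>j\<in>{1..int l} - {k}. zF j - zF k))"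
    proof (intro sum.cong refl)
      fix k assume "k \<in> {1..int l}"
      then have "sp 1 k \<circ> et e \<in> sperm l" by (intro sperm_comp sp1_sperm et_sperm)
      from act_d[OF this] show "to_fract (act (sp 1 k \<circ> et e) (f * d a)) / (\<Prod>j\<in>{1..int l} - {k}. zF j - zF k) =
        to_fract (act (sp 1 k \<circ> et e) f) * to_fract (coeff (pp (sp 1 k \<circ> et e)) a) / (\<Prod>j\<in>{1..int l} - {k}. zF j - zF k)"
        by (simp only: act_mult to_fract_mult)
    qed
    finally show ?thesis .
  qed
  have "to_fract (act (et e) (\<Sum>a<l. s a * Xs e ^ a)) = to_fract (act (et e) f)"
  proof -
    have Y: "act (et e) (Xs e) = (Xs 1 :: 'k mpol)" by (simp only: act_Xs[OF et_sperm] et_e(1)[OF e])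
    have pm: "act (et e) ((- 1) ^ r) = ((- 1) ^ r :: 'k mpol)" for r by (simp add: act_power act_uminus)
    have pf: "to_fract ((- 1) ^ r) = ((- 1) ^ r :: 'k mpol fract)" for r by (cases "even r") simp_all
    have "to_fract (act (et e) (\<Sum>a<l. s a * Xs e ^ a)) = (\<Sum>a<l. (- 1) ^ (l - 1) * to_fract (act (et e) (tr l (OS l) (insert e (OS l)) (f * d a))) * to_fract (Xs 1 ^ a))"
      unfolding act_sum act_mult s_def pm unfolding act_power Y to_fract_sum to_fract_mult pf ..
    also have "\<dots> = (\<Sum>a<l. \<Sum>k\<in>{1..int l}. (- 1) ^ (l - 1) * to_fract (act (sp 1 k \<circ> et e) f) / (\<Prod>j\<in>{1..int l} - {k}. zF j - zF k) * to_fract (coeff (pp (sp 1 k \<circ> et e)) a * Xs 1 ^ a))"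
      unfolding tr sum_distrib_left sum_distrib_right by (intro sum.cong refl) (simp add: field_simps)
    also have "\<dots> = (\<Sum>k\<in>{1..int l}. (- 1) ^ (l - 1) * to_fract (act (sp 1 k \<circ> et e) f) / (\<Prod>j\<in>{1..int l} - {k}. zF j - zF k) * to_fract (\<Sum>a<l. coeff (pp (sp 1 k \<circ> et e)) a * Xs 1 ^ a))"
      unfolding to_fract_sum sum_distrib_left by (rule sum.swap)
    also have "\<dots> = (\<Sum>k\<in>{1..int l}. if k = 1 then to_fract (act (et e) f) else 0)"
    proof (intro sum.cong refl)
      fix k assume k: "k \<in> {1..int l}"
      show "(- 1) ^ (l - 1) * to_fract (act (sp 1 k \<circ> et e) f) / (\<Prod>j\<in>{1..int l} - {k}. zF j - zF k) * to_fract (\<Sum>a<l. coeff (pp (sp 1 k \<circ> et e)) a * Xs 1 ^ a) =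
        (if k = 1 then to_fract (act (et e) f) else 0)"
      proof (cases "k = 1")
        case True
        have S: "{1..int l} - {1} = {2..int l}" by auto
        have "to_fract (\<Sum>a<l. coeff (pp (sp 1 k \<circ> et e)) a * Xs 1 ^ a) = (\<Prod>j\<in>{2..int l}. zF 1 - zF j :: 'k mpol fract)"
          unfolding ev to_fract_prod by (intro prod.cong refl) (simp add: True sp_self et_ge2 zF_def)
        also have "\<dots> = (\<Prod>j\<in>{2..int l}. (- 1) * (zF j - zF 1))" by simp
        also have "\<dots> = (- 1) ^ (l - 1) * (\<Prod>j\<in>{2..int l}. zF j - zF 1)" unfolding prod.distrib by (simp del: of_nat_diff add: nat_diff_distrib nat_minus_as_int)
        finally have A: "to_fract (\<Sum>a<l. coeff (pp (sp 1 k \<circ> et e)) a * Xs 1 ^ a) = (- 1) ^ (l - 1) * (\<Prod>j\<in>{2..int l}. zF j - zF 1 :: 'k mpol fract)" .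
        have nz: "(\<Prod>j\<in>{2..int l}. zF j - zF 1 :: 'k mpol fract) \<noteq> 0" using zF_inj[of _ 1] by auto
        have "(- 1) ^ (l - 1) * (- 1) ^ (l - 1) = (1 :: 'k mpol fract)" by (simp flip: power_add power_mult_distrib)
        then have "(- 1) ^ (l - 1) * x / (\<Prod>j\<in>{2..int l}. zF j - zF 1) * ((- 1) ^ (l - 1) * (\<Prod>j\<in>{2..int l}. zF j - zF 1)) = x" for x :: "'k mpol fract"
          using nz by (simp add: field_simps del: prod_zero_iff)
        then show ?thesis unfolding A unfolding True S sp_self id_comp by simp
      next
        case False
        have "(\<Prod>j\<in>{2..int l}. Xs 1 - Xs ((sp 1 k \<circ> et e) j)) = (0 :: 'k mpol)"
          by (rule prod_zero) (use k False in \<open>auto intro!: bexI[of _ k] simp: et_ge2 sp_2\<close>)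
        then show ?thesis unfolding ev using False by simp
      qed
    qed
    also have "\<dots> = to_fract (act (et e) f)" using l2 by simp
    finally show ?thesis .
  qed
  then have "f = (\<Sum>a<l. s a * Xs e ^ a)" by (simp add: act_inj[OF et_sperm])
  with sE show ?thesis by (intro exI[of _ s] conjI allI impI)
qed

lemma Xs_e_O: assumes e: "e = 1 \<or> e = - 1" shows "(Xs e :: 'k mpol) \<in> inv_ring l (OS l)"
proof -
  have O: "OS l \<subseteq> N l" by (rule OS_sub_N[OF l2 le_refl])
  have "(Xs e :: 'k mpol) \<in> Rl l" using e l2 by (auto simp: Xs_def intro!: X_in_Rl Rl_uminus)
  moreover have "act (sr i) (Xs e) = (Xs e :: 'k mpol)" if "i \<in> OS l" for i
  proof -
    have "sr i \<in> sperm l" using that O by (intro sr_sperm) auto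
    moreover have "sr i e = e" using that e by (intro sp_other) (auto simp: OS_def)
    ultimately show ?thesis by (simp add: act_Xs)
  qed
  ultimately show ?thesis by (simp add: inv_ring_iff'[OF O])
qed

text \<open>The Vandermonde argument: a polynomial with more roots than its degree is zero.\<close>

lemma poly_vanish:
  fixes c :: "nat \<Rightarrow> 'a::idom"
  assumes "finite A" "inj_on z A" "card A = r" "\<And>x. x \<in> A \<Longrightarrow> (\<Sum>a<r. c a * z x ^ a) = 0" "a < r"
  shows "c a = 0"
proof -
  define p where "p = (\<Sum>a<r. monom (c a) a)"
  have cp: "coeff p a = (if a < r then c a else 0)" for a by (simp add: p_def coeff_sum)
  have "poly p (z x) = 0" if "x \<in> A" for x using assms(4)[OF that] by (simp add: p_def poly_sum poly_monom)
  then have sub: "z ` A \<subseteq> {y. poly p y = 0}" by auto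
  have "p = 0"
  proof (rule ccontr)
    assume p: "p \<noteq> 0"
    have "r = card (z ` A)" using assms by (simp add: card_image)
    also have "\<dots> \<le> card {y. poly p y = 0}" by (rule card_mono[OF poly_roots_finite[OF p] sub])
    also have "\<dots> \<le> degree p" by (rule card_poly_roots_bound[OF p])
    also have "degree p < r"
    proof -
      have "coeff p (degree p) \<noteq> 0" using p by simp
      then show ?thesis unfolding cp by (meson)
    qed
    finally show False by simp
  qed
  then show ?thesis using cp[of a] assms(5) by simp
qed

lemma append_rel:
  assumes p: "(p :: 'k tuple_sum) \<in> tens_rel (XT l m n k)" and g: "g \<in> inv_ring l (OS m)"
  shows "frag_extend (\<lambda>fs. frag_of (fs @ [g])) p \<in> tens_rel (XT l m n (Suc k))"
proof (rule tens_rel_extend[OF p])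
  fix us vs :: "'k mpol list" and f h :: "'k mpol" assume a: "length us + 1 + length vs = tlen (XT l m n k)" "set us \<subseteq> fac (XT l m n k)" "set vs \<subseteq> fac (XT l m n k)" "f \<in> fac (XT l m n k)" "h \<in> fac (XT l m n k)"
  show "frag_of ((us @ (f + h) # vs) @ [g]) - frag_of ((us @ f # vs) @ [g]) - frag_of ((us @ h # vs) @ [g]) \<in> tens_rel (XT l m n (Suc k))"
    using tens_rel.additive[of us "vs @ [g]" "XT l m n (Suc k)" f h] a g by simp
next
  fix us vs :: "'k mpol list" and f h x :: "'k mpol" assume a: "length us + 2 + length vs = tlen (XT l m n k)" "set us \<subseteq> fac (XT l m n k)" "set vs \<subseteq> fac (XT l m n k)" "f \<in> fac (XT l m n k)" "h \<in> fac (XT l m n k)" "x \<in> scal (XT l m n k) (length us + 1)"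
  show "frag_of ((us @ (f * x) # h # vs) @ [g]) - frag_of ((us @ f # lact (XT l m n k) x h # vs) @ [g]) \<in> tens_rel (XT l m n (Suc k))"
    using tens_rel.balanced[of us "vs @ [g]" "XT l m n (Suc k)" f h x] a g by simp
qed

lemma last_sum_rel:
  assumes us: "length us + 1 = k" "set us \<subseteq> inv_ring l (OS l)" and A: "finite A" and g: "\<And>a. a \<in> A \<Longrightarrow> (g a :: 'k mpol) \<in> inv_ring l (OS l)"
  shows "frag_of (us @ [\<Sum>a\<in>A. g a]) - (\<Sum>a\<in>A. frag_of (us @ [g a])) \<in> tens_rel (XT l l n k)"
  using A g
proof (induction A)
  have O: "OS l \<subseteq> N l" by (rule OS_sub_N[OF l2 le_refl])
  have Z: "(0 :: 'k mpol) \<in> inv_ring l (OS l)" by (rule inv_ring_closed(4)[OF O])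
  {
    case empty
    have "- frag_of (us @ [0]) \<in> tens_rel (XT l l n k)" using tens_rel.additive[of us "[]" "XT l l n k" "0 :: 'k mpol" 0] us Z by simp
    then show ?case using tens_rel_uminus by fastforce
  next
    case (insert x A)
    have sA: "(\<Sum>a\<in>A. g a) \<in> inv_ring l (OS l)" by (rule inv_ring_sum[OF O]) (use insert in auto)
    have 1: "frag_of (us @ [g x + (\<Sum>a\<in>A. g a)]) - frag_of (us @ [g x]) - frag_of (us @ [\<Sum>a\<in>A. g a]) \<in> tens_rel (XT l l n k)"
      using tens_rel.additive[of us "[]" "XT l l n k" "g x" "\<Sum>a\<in>A. g a"] us sA insert by simp
    have 2: "frag_of (us @ [\<Sum>a\<in>A. g a]) - (\<Sum>a\<in>A. frag_of (us @ [g a])) \<in> tens_rel (XT l l n k)" using insert by simp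
    show ?case using tens_rel_add[OF 1 2] insert by (simp add: algebra_simps)
  }
qed

text \<open>Expanding the last factor in powers and moving the coefficients across the last tensor sign.\<close>

lemma expand_last:
  fixes s :: "'k mpol \<Rightarrow> nat \<Rightarrow> 'k mpol"
  assumes k: "1 \<le> k" and e: "e = sgn_idx n k"
    and s: "\<And>f. f \<in> inv_ring l (OS l) \<Longrightarrow> (\<forall>a<l. s f a \<in> inv_ring l (insert e (OS l))) \<and> f = (\<Sum>a<l. s f a * Xs e ^ a)"
    and p: "p \<in> tens_free (XT l l n (Suc k))"
  shows "p - (\<Sum>a<l. frag_extend (\<lambda>fs. frag_of (fs @ [Xs e ^ a])) (frag_extend (\<lambda>fs. frag_of (butlast (butlast fs) @ [last (butlast fs) * s (last fs) a])) p)) \<in> tens_rel (XT l l n (Suc k))"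
  using p
proof (induction rule: tens_free_induct)
  case zero then show ?case by (simp add: tens_rel.zero)
next
  case (diff a b)
  from tens_rel.diff[OF this] show ?case by (simp add: frag_extend_diff sum_subtractf algebra_simps)
next
  case (one fs)
  have ee: "e = 1 \<or> e = - 1" unfolding e by (rule sgn_idx_cases)
  have O: "OS l \<subseteq> N l" by (rule OS_sub_N[OF l2 le_refl])
  have fs: "length fs = Suc k" "set fs \<subseteq> inv_ring l (OS l)" using one by (auto simp: gens_def)
  obtain us g where 1: "fs = us @ [g]" using fs(1) by (cases fs rule: rev_cases) auto
  obtain us' f where 2: "us = us' @ [f]" using fs(1) k 1 by (cases us rule: rev_cases) auto
  have us': "length us' + 1 = k" "set us' \<subseteq> inv_ring l (OS l)" "f \<in> inv_ring l (OS l)" "g \<in> inv_ring l (OS l)" using fs 1 2 by auto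
  note sg = s[OF us'(4)]
  have Y: "Xs e ^ a \<in> (inv_ring l (OS l) :: 'k mpol set)" for a
    by (induction a) (auto intro!: inv_ring_closed[OF O] Xs_e_O[OF ee])
  have sO: "s g a \<in> inv_ring l (OS l)" if "a < l" for a using sg that inv_ring_OE[OF l2 le_refl ee] by auto
  have "frag_of ((us' @ [f]) @ [\<Sum>a<l. s g a * Xs e ^ a]) - (\<Sum>a<l. frag_of ((us' @ [f]) @ [s g a * Xs e ^ a])) \<in> tens_rel (XT l l n (Suc k))"
    by (rule last_sum_rel) (use us' sO Y in \<open>auto intro!: inv_ring_closed(2)[OF O]\<close>)
  then have A: "frag_of fs - (\<Sum>a<l. frag_of ((us' @ [f]) @ [s g a * Xs e ^ a])) \<in> tens_rel (XT l l n (Suc k))"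
    unfolding 1 2 using sg by (simp only:)
  have B: "(\<Sum>a<l. frag_of (us' @ (f * s g a) # (Xs e ^ a) # []) - frag_of (us' @ f # (s g a * Xs e ^ a) # [])) \<in> tens_rel (XT l l n (Suc k))"
  proof (rule tens_rel_sum)
    fix a assume "a \<in> {..<l}"
    then have sE: "s g a \<in> scal (XT l l n (Suc k)) (length us' + 1)" using sg us' e by simp
    show "frag_of (us' @ (f * s g a) # (Xs e ^ a) # []) - frag_of (us' @ f # (s g a * Xs e ^ a) # []) \<in> tens_rel (XT l l n (Suc k))"
      using tens_rel.balanced[of us' "[]" "XT l l n (Suc k)" f "Xs e ^ a" "s g a"] us' Y sE by simp
  qed
  from tens_rel.diff[OF A B] show ?case unfolding 1 2 by (simp add: butlast_append sum_subtractf)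
qed

text \<open>By induction on the number of factors. Expanding the last factor in powers of \<open>x\<^sub>\<epsilon>\<close> writes the tensor through tensors with one factor fewer. The
  evaluations along the \<open>l\<close> prolongations of a path \<open>Q\<close> are the values of a polynomial of degree less than \<open>l\<close>, with the evaluations of these
  shorter tensors along \<open>Q\<close> as coefficients, at \<open>l\<close> distinct points.\<close>

lemma paths_separate_tensors:
  assumes "1 \<le> k" "k \<le> n" "(p :: 'k tuple_sum) \<in> tens_free (XT l l n k)" "\<And>Q. Q \<in> paths l k \<Longrightarrow> vext (\<lambda>fs. val n 0 id fs Q) p = 0"
  shows "p \<in> tens_rel (XT l l n k)"
  using assms
proof (induction k arbitrary: p rule: dec_induct)
  case base
  have O: "OS l \<subseteq> N l" by (rule OS_sub_N[OF l2 le_refl])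
  have Q: "[1] \<in> paths l 1" using l2 by (auto simp: paths_def)
  have "\<exists>f \<in> inv_ring l (OS l). p - frag_of [f] \<in> tens_rel (XT l l n 1)" using base(2)
  proof (induction rule: tens_free_induct)
    case zero
    have "- frag_of [0 :: 'k mpol] \<in> tens_rel (XT l l n 1)" using tens_rel.additive[of "[]" "[]" "XT l l n 1" "0 :: 'k mpol" 0] inv_ring_closed(4)[OF O] by simp
    then show ?case using inv_ring_closed(4)[OF O] by (intro bexI[of _ 0]) simp
  next
    case (one fs)
    then obtain f where "fs = [f]" "f \<in> inv_ring l (OS l)" by (auto simp: gens_def length_Suc_conv)
    then show ?case by (intro bexI[of _ f]) (simp_all add: tens_rel.zero)
  next
    case (diff a b)
    then obtain f g where fg: "f \<in> inv_ring l (OS l)" "g \<in> inv_ring l (OS l)" "a - frag_of [f] \<in> tens_rel (XT l l n 1)" "b - frag_of [g] \<in> tens_rel (XT l l n 1)" by blast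
    have d: "f - g \<in> inv_ring l (OS l)" using inv_ring_closed(1)[OF O fg(1) inv_ring_closed(3)[OF O fg(2)]] by simp
    have "frag_of [f] - frag_of [f - g] - frag_of [g] \<in> tens_rel (XT l l n 1)"
      using tens_rel.additive[of "[]" "[]" "XT l l n 1" "f - g" g] fg d by simp
    from tens_rel_add[OF tens_rel.diff[OF fg(3,4)] this] have "a - b - frag_of [f - g] \<in> tens_rel (XT l l n 1)" by (simp add: algebra_simps)
    then show ?case using d by blast
  qed
  then obtain f where f: "f \<in> inv_ring l (OS l)" "p - frag_of [f] \<in> tens_rel (XT l l n 1)" by blast
  have "vext (\<lambda>fs. val n 0 id fs [1]) (p - frag_of [f]) = 0"
    by (rule val_vanishes_on_rel[OF l2 le_refl base(1) id_sperm Q f(2)])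
  then have "val n 0 id [f] [1] = 0" using base(3)[OF Q] by (simp only: vext_diff vext_frag_of) simp
  then have "act (id \<circ> sp 1 1 \<circ> et (sgn_idx n 0)) f = act (id \<circ> sp 1 1 \<circ> et (sgn_idx n 0)) 0" by (simp only: val.simps act_0 mult_1_right)
  moreover have "id \<circ> sp 1 1 \<circ> et (sgn_idx n 0) \<in> sperm l" by (intro sperm_comp id_sperm et_sperm sp1_sperm) (use l2 in auto)
  ultimately have "f = 0" by (simp only: act_inj)
  have "- frag_of [0 :: 'k mpol] \<in> tens_rel (XT l l n 1)" using tens_rel.additive[of "[]" "[]" "XT l l n 1" "0 :: 'k mpol" 0] inv_ring_closed(4)[OF O] by simp
  from tens_rel.diff[OF f(2) this] show ?case using \<open>f = 0\<close> by simp
next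
  case (step k)
  define e where "e = sgn_idx n k"
  have ee: "e = 1 \<or> e = - 1" unfolding e_def by (rule sgn_idx_cases)
  have O: "OS l \<subseteq> N l" by (rule OS_sub_N[OF l2 le_refl])
  have "\<exists>s. \<forall>f\<in>inv_ring l (OS l). (\<forall>a<l. s f a \<in> inv_ring l (insert e (OS l))) \<and> f = (\<Sum>a<l. s f a * Xs e ^ a :: 'k mpol)"
    by (rule bchoice) (use power_basis_expansion[OF ee] in blast)
  then obtain s where s: "\<And>f. f \<in> inv_ring l (OS l) \<Longrightarrow> (\<forall>a<l. s f a \<in> inv_ring l (insert e (OS l))) \<and> f = (\<Sum>a<l. s f a * Xs e ^ a :: 'k mpol)" by blast
  \<comment> \<open>The coefficient of the \<open>a\<close>-th power, a formal sum of shorter tuples.\<close>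
  define Dp where "Dp a = frag_extend (\<lambda>fs. frag_of (butlast (butlast fs) @ [last (butlast fs) * s (last fs) a])) p" for a
  have ex: "p - (\<Sum>a<l. frag_extend (\<lambda>fs. frag_of (fs @ [Xs e ^ a])) (Dp a)) \<in> tens_rel (XT l l n (Suc k))"
    unfolding Dp_def by (rule expand_last[OF step(1) e_def s step(5)])
  have Y: "Xs e ^ a \<in> (inv_ring l (OS l) :: 'k mpol set)" for a
    by (induction a) (auto intro!: inv_ring_closed[OF O] Xs_e_O[OF ee])
  have Df: "Dp a \<in> tens_free (XT l l n k)" if a: "a < l" for a
    unfolding Dp_def
  proof (rule tens_free_extend[OF step(5)])
    fix fs :: "'k mpol list" assume "fs \<in> gens (XT l l n (Suc k))"
    then have fs: "length fs = Suc k" "set fs \<subseteq> inv_ring l (OS l)" by (auto simp: gens_def)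
    obtain us g where 1: "fs = us @ [g]" using fs(1) by (cases fs rule: rev_cases) auto
    obtain us' f where 2: "us = us' @ [f]" using fs(1) step(1) 1 by (cases us rule: rev_cases) auto
    have us': "length us' + 1 = k" "set us' \<subseteq> inv_ring l (OS l)" "f \<in> inv_ring l (OS l)" "g \<in> inv_ring l (OS l)" using fs 1 2 by auto
    have "s g a \<in> inv_ring l (OS l)" using s[OF us'(4)] a inv_ring_OE[OF l2 le_refl ee] by auto
    then show "frag_of (butlast (butlast fs) @ [last (butlast fs) * s (last fs) a]) \<in> tens_free (XT l l n k)"
      unfolding 1 2 using us' by (intro tens_free_frag) (auto simp: gens_def butlast_append intro!: inv_ring_closed(2)[OF O])
  qed
  have V: "vext (\<lambda>fs. val n 0 id fs Q) (Dp a) = 0" if Q: "Q \<in> paths l k" and a: "a < l" for Q a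
  proof (rule poly_vanish[where A = "{1..int l}" and z = "\<lambda>q. Xs (flips Q q)" and r = l and c = "\<lambda>a. vext (\<lambda>fs. val n 0 id fs Q) (Dp a)"])
    have Ql: "set Q \<subseteq> {1..int l}" "length Q = k" using Q by (auto simp: paths_def)
    have fs: "flips Q \<in> sperm l" by (rule flips_sperm[OF Ql(1)])
    show "inj_on (\<lambda>q. Xs (flips Q q) :: 'k mpol) {1..int l}"
      by (rule inj_onI) (auto simp: Xs_inj sperm_eq0[OF fs] sperm_inj[OF fs])
    fix q assume q: "q \<in> {1..int l}"
    have Qq: "Q @ [q] \<in> paths l (Suc k)" using Ql q by (auto simp: paths_def)
    have sg: "flips Q \<circ> sp 1 q \<circ> et e \<in> sperm l" by (intro sperm_comp fs sp1_sperm[OF q] et_sperm)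
    have Yq: "act (flips Q \<circ> sp 1 q \<circ> et e) (Xs e) = (Xs (flips Q q) :: 'k mpol)"
      unfolding act_Xs[OF sg] by (simp only: comp_apply et_e(1)[OF ee]) (simp add: sp_def)
    have val1: "val n 0 id (fs @ [Xs e ^ a]) (Q @ [q]) = Xs (flips Q q) ^ a * val n 0 id fs Q" if "fs \<in> gens (XT l l n k)" for fs :: "'k mpol list" and a
    proof -
      have "length fs = length Q" using that Ql by (simp add: gens_def)
      then show ?thesis unfolding val_append[OF \<open>length fs = length Q\<close>] val.simps id_comp e_def[symmetric] add_0_left
        by (simp only: Ql(2) \<open>length fs = length Q\<close> e_def[symmetric] act_power Yq mult_1_left mult_1_right mult.commute)
    qed
    have "0 = vext (\<lambda>fs. val n 0 id fs (Q @ [q])) (p - (\<Sum>a<l. frag_extend (\<lambda>fs. frag_of (fs @ [Xs e ^ a])) (Dp a)))"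
      by (rule val_vanishes_on_rel[OF l2 le_refl _ id_sperm Qq ex, symmetric]) (use step in simp)
    also have "\<dots> = - (\<Sum>a<l. vext (\<lambda>fs. val n 0 id (fs @ [Xs e ^ a]) (Q @ [q])) (Dp a))"
      unfolding vext_diff step(6)[OF Qq] vext_sum vext_frag_extend vext_frag_of by (rule diff_0)
    also have "(\<Sum>a<l. vext (\<lambda>fs. val n 0 id (fs @ [Xs e ^ a]) (Q @ [q])) (Dp a)) = (\<Sum>a<l. vext (\<lambda>fs. val n 0 id fs Q) (Dp a) * Xs (flips Q q) ^ a)"
    proof (intro sum.cong refl)
      fix a assume "a \<in> {..<l}"
      then have "Poly_Mapping.keys (Dp a) \<subseteq> gens (XT l l n k)" using Df by (simp add: tens_free_iff)
      then have "vext (\<lambda>fs. val n 0 id (fs @ [Xs e ^ a]) (Q @ [q])) (Dp a) = vext (\<lambda>fs. Xs (flips Q q) ^ a * val n 0 id fs Q) (Dp a)"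
        by (intro vext_cong val1) auto
      then show "vext (\<lambda>fs. val n 0 id (fs @ [Xs e ^ a]) (Q @ [q])) (Dp a) = vext (\<lambda>fs. val n 0 id fs Q) (Dp a) * Xs (flips Q q) ^ a"
        unfolding vext_scale by (simp only: mult.commute)
    qed
    finally show "(\<Sum>a<l. vext (\<lambda>fs. val n 0 id fs Q) (Dp a) * Xs (flips Q q) ^ a) = 0" by simp
  qed (use a in auto)
  have "p = p - (\<Sum>a<l. frag_extend (\<lambda>fs. frag_of (fs @ [Xs e ^ a])) (Dp a)) + (\<Sum>a<l. frag_extend (\<lambda>fs. frag_of (fs @ [Xs e ^ a])) (Dp a))" by simp
  also have "\<dots> \<in> tens_rel (XT l l n (Suc k))"
  proof (rule tens_rel_add[OF ex tens_rel_sum])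
    fix a assume "a \<in> {..<l}"
    then have alphaF: "a < l" by simp
    have "Dp a \<in> tens_rel (XT l l n k)" by (rule step(3)[OF _ Df[OF alphaF] V[OF _ alphaF]]) (use step(4) in simp)
    then show "frag_extend (\<lambda>fs. frag_of (fs @ [Xs e ^ a])) (Dp a) \<in> tens_rel (XT l l n (Suc k))" by (rule append_rel[OF _ Y])
  qed
  finally show ?case .
qed

end

section \<open>The maps on formal sums\<close>

context typeD begin

lemma tens_rel_free:
  assumes m: "2 \<le> m" "m \<le> l" and p: "(p :: 'k tuple_sum) \<in> tens_rel (XT l m n k)"
  shows "p \<in> tens_free (XT l m n k)"
  using p
proof (induction rule: tens_rel.induct)
  case (additive us vs f g)
  then show ?case using inv_ring_closed(1)[OF OS_sub_N[OF m]]
    by (intro tens_free_diff tens_free_frag) (auto simp: gens_def)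
next
  case (balanced us vs f g a)
  have "a \<in> inv_ring l (OS m)" using balanced(6) inv_ring_OE[OF m sgn_idx_cases] by auto
  then show ?case using balanced inv_ring_closed(2)[OF OS_sub_N[OF m]]
    by (intro tens_free_diff tens_free_frag) (auto simp: gens_def)
qed (auto intro: tens_free_diff)

lemma nest_additive:
  fixes f g c :: "'k mpol"
  assumes m: "2 \<le> m" "m \<le> l" and fg: "f \<in> inv_ring l (OS m)" "g \<in> inv_ring l (OS m)"
    and vs: "set vs \<subseteq> inv_ring l (OS m)" and c: "c \<in> inv_ring l (insert 1 (OS m))"
  shows "set us \<subseteq> inv_ring l (OS m) \<Longrightarrow> i + length us + 1 + length vs = n \<Longrightarrow>
    nest l n (OS m) i (us @ (f + g) # vs) c = nest l n (OS m) i (us @ f # vs) c + nest l n (OS m) i (us @ g # vs) c"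
proof (induction us arbitrary: i)
  note O = OS_sub_N[OF m]
  have ta: "tr l (OS m) (insert (sgn_idx n i) (OS m)) (a + b) = tr l (OS m) (insert (sgn_idx n i) (OS m)) a + tr l (OS m) (insert (sgn_idx n i) (OS m)) b"
    if "a \<in> inv_ring l (OS m)" "b \<in> inv_ring l (OS m)" for a b :: "'k mpol" and i
    by (rule tr_add[OF adapted_O(1)[OF m] adapted_Oe(1)[OF m sgn_idx_cases] subset_insertI _ that]) (auto simp: LO_def LE_def)
  {
    case Nil
    then have "nest l n (OS m) (Suc i) vs c \<in> inv_ring l (OS m)"
      using nest_in[OF m vs _ c, of "Suc i" n] inv_ring_OE[OF m sgn_idx_cases] by auto
    then show ?case using ta[of "f * nest l n (OS m) (Suc i) vs c" "g * nest l n (OS m) (Suc i) vs c" i] fg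
      by (simp add: distrib_right inv_ring_closed(2)[OF O])
  next
    case (Cons u us)
    have N: "nest l n (OS m) (Suc i) (us @ h # vs) c \<in> inv_ring l (OS m)" if "h \<in> inv_ring l (OS m)" for h
      using nest_in[OF m _ _ c, of "us @ h # vs" "Suc i" n] inv_ring_OE[OF m sgn_idx_cases] Cons(2,3) vs that by auto
    show ?case using ta[of "u * nest l n (OS m) (Suc i) (us @ f # vs) c" "u * nest l n (OS m) (Suc i) (us @ g # vs) c" i] Cons N[OF fg(1)] N[OF fg(2)]
      by (simp add: distrib_left inv_ring_closed(2)[OF O])
  }
qed

text \<open>Traces are linear over the invariants, so a scalar may pass out of the trace at its own tensor sign.\<close>

lemma nest_balanced:
  fixes f g a c :: "'k mpol"
  assumes m: "2 \<le> m" "m \<le> l" and g: "g \<in> inv_ring l (OS m)"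
    and vs: "set vs \<subseteq> inv_ring l (OS m)" and c: "c \<in> inv_ring l (insert 1 (OS m))"
  shows "i + length us + 2 + length vs = n \<Longrightarrow> a \<in> inv_ring l (insert (sgn_idx n (i + length us + 1)) (OS m)) \<Longrightarrow>
    nest l n (OS m) i (us @ (f * a) # g # vs) c = nest l n (OS m) i (us @ f # (a * g) # vs) c"
proof (induction us arbitrary: i)
  case Nil
  let ?x = "nest l n (OS m) (Suc (Suc i)) vs c"
  have "?x \<in> inv_ring l (OS m)"
    using nest_in[OF m vs _ c, of "Suc (Suc i)" n] inv_ring_OE[OF m sgn_idx_cases] Nil(1) by auto
  then have gx: "g * ?x \<in> inv_ring l (OS m)" using g by (intro inv_ring_closed(2)[OF OS_sub_N[OF m]])
  have "tr l (OS m) (insert (sgn_idx n (Suc i)) (OS m)) (a * (g * ?x)) = a * tr l (OS m) (insert (sgn_idx n (Suc i)) (OS m)) (g * ?x)"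
    by (rule tr_linear[OF adapted_O(1)[OF m] adapted_Oe(1)[OF m sgn_idx_cases] subset_insertI _ _ gx]) (use Nil in \<open>auto simp: LO_def LE_def\<close>)
  then show ?case by (simp add: mult.assoc)
next
  case (Cons u us)
  then show ?case using Cons.IH[of "Suc i"] by simp
qed

lemma ends_gens:
  assumes m: "2 \<le> m" "m \<le> l" and n: "1 \<le> n" and ab: "a \<in> inv_ring l (OS m)" "(b :: 'k mpol) \<in> inv_ring l (OS m)"
  shows "ends n a b \<in> gens (XT l m n' n)"
  using n ab inv_ring_closed(2,5)[OF OS_sub_N[OF m]] by (auto simp: ends_def gens_def)

lemma ends_additive:
  assumes m: "2 \<le> m" "m \<le> l" and n: "1 \<le> n" and ab: "a \<in> inv_ring l (OS m)" "a' \<in> inv_ring l (OS m)" "(b :: 'k mpol) \<in> inv_ring l (OS m)"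
  shows "frag_of (ends n (a + a') b) - frag_of (ends n a b) - frag_of (ends n a' b) \<in> tens_rel (XT l m n' n)"
proof (cases "n = 1")
  case True
  then show ?thesis using tens_rel.additive[of "[]" "[]" "XT l m n' n" "a * b" "a' * b"] ab inv_ring_closed(2)[OF OS_sub_N[OF m]]
    by (simp add: ends_def distrib_right)
next
  case False
  have "set (replicate (n - 2) 1 @ [b]) \<subseteq> inv_ring l (OS m)" using ab inv_ring_closed(5)[OF OS_sub_N[OF m]] by auto
  then show ?thesis using tens_rel.additive[of "[]" "replicate (n - 2) 1 @ [b]" "XT l m n' n" a a'] ab False n
    by (simp add: ends_def)
qed

text \<open>\<open>Fsum\<close> and \<open>T_map\<close> on formal sums, before passing to tensors.\<close>

definition Fsum_free :: "nat \<Rightarrow> nat \<Rightarrow> 'k mpol set \<Rightarrow> ('k mpol \<Rightarrow> 'k mpol) \<Rightarrow> 'k mpol list \<Rightarrow> ('k tuple_sum)" where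
  "Fsum_free m n C Cd fs = (\<Sum>c\<in>C. frag_of (ends n (F l n (OS m) fs c) (Cd c)))"

lemma OS_sub: "2 \<le> m \<Longrightarrow> m \<le> l \<Longrightarrow> inv_ring l (OS l) \<subseteq> (inv_ring l (OS m) :: 'k mpol set)"
  by (rule inv_ring_mono[OF _ OS_sub_N[OF l2 le_refl]]) (auto simp: OS_def)

lemma OS_sub_E: "2 \<le> m \<Longrightarrow> m \<le> l \<Longrightarrow> e = 1 \<or> e = - 1 \<Longrightarrow> inv_ring l (insert e (OS l)) \<subseteq> (inv_ring l (insert e (OS m)) :: 'k mpol set)"
  by (rule inv_ring_mono[OF _ adapted_sub[OF adapted_Oe(1)[OF l2 le_refl]]]) (auto simp: OS_def)

lemma F_in:
  assumes m: "2 \<le> m" "m \<le> l" and fs: "set fs \<subseteq> inv_ring l (OS m)" "length fs = n" and c: "(c :: 'k mpol) \<in> inv_ring l (insert 1 (OS m))"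
  shows "F l n (OS m) fs c \<in> inv_ring l (OS m)"
  using nest_in[OF m fs(1) _ c, of 0 n] fs inv_ring_OE[OF m sgn_idx_cases] by (auto simp: F_def)

lemma Fsum_free_closed:
  assumes m: "2 \<le> m" "m \<le> l" and n: "1 \<le> n" and C: "dual_hom_bases l (insert 1 (OS m)) K C Cd"
    and fs: "fs \<in> gens (XT l l n n)"
  shows "Fsum_free m n C Cd fs \<in> tens_free (XT l m n n)"
  unfolding Fsum_free_def
proof (intro tens_free_sum tens_free_frag ends_gens m n)
  fix c assume c: "c \<in> C"
  then have cc: "c \<in> inv_ring l (insert 1 (OS m))" "Cd c \<in> inv_ring l (insert 1 (OS m))" using C by (auto simp: dual_hom_bases_def hom_basis_def)
  show "Cd c \<in> inv_ring l (OS m)" using cc inv_ring_OE[OF m, of 1] by auto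
  show "F l n (OS m) fs c \<in> inv_ring l (OS m)" using fs OS_sub[OF m] by (intro F_in m cc) (auto simp: gens_def)
qed

lemma Fsum_free_rel:
  assumes m: "2 \<le> m" "m \<le> l" and n: "1 \<le> n" and C: "dual_hom_bases l (insert 1 (OS m)) K C Cd"
    and p: "p \<in> tens_rel (XT l l n n)"
  shows "frag_extend (Fsum_free m n C Cd) p \<in> tens_rel (XT l m n n)"
proof (rule tens_rel_extend[OF p])
  have cc: "c \<in> inv_ring l (insert 1 (OS m))" "Cd c \<in> inv_ring l (OS m)" if "c \<in> C" for c
    using C that inv_ring_OE[OF m, of 1] by (auto simp: dual_hom_bases_def hom_basis_def)
  note sub = OS_sub[OF m]
  {
    fix us vs :: "'k mpol list" and f g :: "'k mpol" assume a: "length us + 1 + length vs = tlen (XT l l n n)" "set us \<subseteq> fac (XT l l n n)" "set vs \<subseteq> fac (XT l l n n)" "f \<in> fac (XT l l n n)" "g \<in> fac (XT l l n n)"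
    have "frag_of (ends n (F l n (OS m) (us @ (f + g) # vs) c) (Cd c)) - frag_of (ends n (F l n (OS m) (us @ f # vs) c) (Cd c)) - frag_of (ends n (F l n (OS m) (us @ g # vs) c) (Cd c)) \<in> tens_rel (XT l m n n)" if c: "c \<in> C" for c
    proof -
      have s: "f \<in> inv_ring l (OS m)" "g \<in> inv_ring l (OS m)" "set us \<subseteq> inv_ring l (OS m)" "set vs \<subseteq> inv_ring l (OS m)" using a sub by auto
      have "F l n (OS m) (us @ (f + g) # vs) c = F l n (OS m) (us @ f # vs) c + F l n (OS m) (us @ g # vs) c"
        unfolding F_def by (rule nest_additive[OF m s(1,2,4) cc(1)[OF c] s(3)]) (use a in simp)
      moreover have "F l n (OS m) (us @ h # vs) c \<in> inv_ring l (OS m)" if "h \<in> inv_ring l (OS m)" for h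
        using s that a by (intro F_in m cc(1)[OF c]) auto
      ultimately show ?thesis using ends_additive[OF m n _ _ cc(2)[OF c]] s by simp
    qed
    from tens_rel_sum[OF this] show "Fsum_free m n C Cd (us @ (f + g) # vs) - Fsum_free m n C Cd (us @ f # vs) - Fsum_free m n C Cd (us @ g # vs) \<in> tens_rel (XT l m n n)"
      unfolding Fsum_free_def sum_subtractf .
  }
  {
    fix us vs :: "'k mpol list" and f g x :: "'k mpol" assume a: "length us + 2 + length vs = tlen (XT l l n n)" "set us \<subseteq> fac (XT l l n n)" "set vs \<subseteq> fac (XT l l n n)" "f \<in> fac (XT l l n n)" "g \<in> fac (XT l l n n)" "x \<in> scal (XT l l n n) (length us + 1)"
    have "F l n (OS m) (us @ (f * x) # g # vs) c = F l n (OS m) (us @ f # (x * g) # vs) c" if c: "c \<in> C" for c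
      unfolding F_def by (rule nest_balanced[OF m _ _ cc(1)[OF c]]) (use a in \<open>auto intro: subsetD[OF OS_sub_E[OF m sgn_idx_cases]] subsetD[OF sub]\<close>)
    then have "Fsum_free m n C Cd (us @ (f * x) # g # vs) = Fsum_free m n C Cd (us @ f # (x * g) # vs)" unfolding Fsum_free_def by simp
    then show "Fsum_free m n C Cd (us @ (f * x) # g # vs) - Fsum_free m n C Cd (us @ f # lact (XT l l n n) x g # vs) \<in> tens_rel (XT l m n n)"
      by (simp add: tens_rel.zero)
  }
qed

text \<open>The entries of the matrix of \<open>u\<close>.\<close>

definition u_coeff :: "nat \<Rightarrow> int list \<Rightarrow> int list \<Rightarrow> 'k mpol fract" where
  "u_coeff n P Q = (if flips P = flips Q then path_wt l id P * to_fract (act (flips Q) (prod_sums l)) else 0)"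

lemma gensD: "fs \<in> gens (XT l m n k) \<Longrightarrow> set fs \<subseteq> inv_ring l (OS m)" "fs \<in> gens (XT l m n k) \<Longrightarrow> length fs = k"
  by (auto simp: gens_def)

lemma vext_u:
  assumes n: "1 \<le> n" and C: "dual_hom_bases l (insert 1 (OS l)) ({1, - 1} \<union> OS l) C Cd"
    and p: "p \<in> tens_free (XT l l n n)" and Q: "Q \<in> paths l n"
  shows "to_fract (vext (\<lambda>fs. val n 0 id fs Q) (frag_extend (Fsum_free l n C Cd) p)) = (\<Sum>P\<in>paths l n. u_coeff n P Q * to_fract (vext (\<lambda>fs. val n 0 id fs P) p))"
proof -
  have "to_fract (vext (\<lambda>fs. val n 0 id fs Q) (frag_extend (Fsum_free l n C Cd) p)) = vext (\<lambda>fs. \<Sum>P\<in>paths l n. u_coeff n P Q * to_fract (val n 0 id fs P)) p"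
    unfolding vext_frag_extend to_fract_vext
  proof (rule vext_cong)
    fix fs assume "fs \<in> Poly_Mapping.keys p"
    then have fs: "fs \<in> gens (XT l l n n)" using p by (auto simp: tens_free_iff)
    show "vext (\<lambda>fs. to_fract (val n 0 id fs Q)) (Fsum_free l n C Cd fs) = (\<Sum>P\<in>paths l n. u_coeff n P Q * to_fract (val n 0 id fs P))"
      unfolding Fsum_free_def vext_sum vext_frag_of u_coeff_def u_kernel[OF l2 le_refl n id_sperm Q C gensD[OF fs]] id_comp ..
  qed
  then show ?thesis unfolding vext_lin to_fract_vext .
qed

definition T_free :: "nat \<Rightarrow> (nat \<Rightarrow> 'k mpol set) \<Rightarrow> (nat \<Rightarrow> 'k mpol \<Rightarrow> 'k mpol) \<Rightarrow> 'k mpol list \<Rightarrow> ('k tuple_sum)" where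
  "T_free n E Ed gs = (\<Sum>b \<in> (\<Pi>\<^sub>E i \<in> {1..n - 1}. E i).
        frag_of (map (\<lambda>j. tr l (OS (l - 1)) (OS l)
          ((if j = 0 then 1 else Ed j (b j)) * gs ! j * (if j = n - 1 then 1 else b (Suc j))))
        [0..<n]))"

context
  fixes n :: nat and E :: "nat \<Rightarrow> 'k mpol set" and Ed
  assumes l3: "3 \<le> l" and n: "n = l - 1"
    and E: "\<And>i. 1 \<le> i \<Longrightarrow> i \<le> n - 1 \<Longrightarrow> dual_hom_bases l (insert (sgn_idx n i) (OS (l - 1))) (insert (sgn_idx n i) (OS l)) (E i) (Ed i)"
begin

lemma T_free_closed:
  assumes gs: "gs \<in> gens (XT l (l - 1) n n)"
  shows "T_free n E Ed gs \<in> tens_free (XT l l n n)"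
  unfolding T_free_def
proof (intro tens_free_sum tens_free_frag)
  fix b assume b: "b \<in> (\<Pi>\<^sub>E i \<in> {1..n - 1}. E i)"
  have m: "2 \<le> l - 1" "l - 1 \<le> l" using l3 by auto
  note O = OS_sub_N[OF m]
  have EI: "x \<in> inv_ring l (OS (l - 1))" "Ed i x \<in> inv_ring l (OS (l - 1))" if "1 \<le> i" "i \<le> n - 1" "x \<in> E i" for i x
  proof -
    note d = E[OF that(1,2), unfolded dual_hom_bases_def hom_basis_def]
    have "E i \<subseteq> inv_ring l (insert (sgn_idx n i) (OS (l - 1)))" by (rule d[THEN conjunct1, THEN conjunct2, THEN conjunct1])
    from subsetD[OF inv_ring_OE[OF m sgn_idx_cases] subsetD[OF this that(3)]] show "x \<in> inv_ring l (OS (l - 1))" .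
    have "Ed i ` E i \<subseteq> inv_ring l (insert (sgn_idx n i) (OS (l - 1)))" by (rule d[THEN conjunct2, THEN conjunct2, THEN conjunct1, THEN conjunct2, THEN conjunct1])
    from subsetD[OF inv_ring_OE[OF m sgn_idx_cases] subsetD[OF this imageI[OF that(3)]]] show "Ed i x \<in> inv_ring l (OS (l - 1))" .
  qed
  have "tr l (OS (l - 1)) (OS l) ((if j = 0 then 1 else Ed j (b j)) * gs ! j * (if j = n - 1 then 1 else b (Suc j))) \<in> inv_ring l (OS l)" if j: "j < n" for j
  proof (rule tr_inv[OF adapted_O(1)[OF m] adapted_O(1)[OF l2 le_refl]])
    have bi: "b i \<in> E i" if "1 \<le> i" "i \<le> n - 1" for i using b that by (auto simp: PiE_iff)
    have 1: "(if j = 0 then 1 else Ed j (b j)) \<in> inv_ring l (OS (l - 1))" using EI(2)[OF _ _ bi, of j] j inv_ring_closed(5)[OF O] by auto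
    have 2: "(if j = n - 1 then 1 else b (Suc j)) \<in> inv_ring l (OS (l - 1))" using EI(1)[OF _ _ bi, of "Suc j"] j inv_ring_closed(5)[OF O] by auto
    have 3: "gs ! j \<in> inv_ring l (OS (l - 1))" using gensD[OF gs] j nth_mem[of j gs] by auto
    show "(if j = 0 then 1 else Ed j (b j)) * gs ! j * (if j = n - 1 then 1 else b (Suc j)) \<in> inv_ring l (OS (l - 1))"
      by (intro inv_ring_closed(2)[OF O] 1 2 3)
  qed (auto simp: OS_def LO_def)
  then show "map (\<lambda>j. tr l (OS (l - 1)) (OS l) ((if j = 0 then 1 else Ed j (b j)) * gs ! j * (if j = n - 1 then 1 else b (Suc j)))) [0..<n] \<in> gens (XT l l n n)"
    by (auto simp: gens_def)
qed

lemma vext_T: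
  assumes p: "p \<in> tens_free (XT l (l - 1) n n)" and Q: "Q \<in> paths l n"
  shows "to_fract (vext (\<lambda>fs. val n 0 id fs Q) (frag_extend (T_free n E Ed) p)) =
    (\<Sum>k\<in>{1..int l}. path_poly id Q (zF k) / (\<Prod>r\<in>{1..int l} - {k}. zF k - zF r) * to_fract (vext (\<lambda>gs. val n 0 (sp (int l) k) gs (map (sp (int l) k) Q)) p))"
proof -
  have "to_fract (vext (\<lambda>fs. val n 0 id fs Q) (frag_extend (T_free n E Ed) p)) = vext (\<lambda>gs. \<Sum>k\<in>{1..int l}. path_poly id Q (zF k) / (\<Prod>r\<in>{1..int l} - {k}. zF k - zF r) * to_fract (val n 0 (sp (int l) k) gs (map (sp (int l) k) Q))) p"
    unfolding vext_frag_extend to_fract_vext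
  proof (rule vext_cong)
    fix gs assume "gs \<in> Poly_Mapping.keys p"
    then have gs: "gs \<in> gens (XT l (l - 1) n n)" using p by (auto simp: tens_free_iff)
    show "vext (\<lambda>fs. to_fract (val n 0 id fs Q)) (T_free n E Ed gs) = (\<Sum>k\<in>{1..int l}. path_poly id Q (zF k) / (\<Prod>r\<in>{1..int l} - {k}. zF k - zF r) * to_fract (val n 0 (sp (int l) k) gs (map (sp (int l) k) Q)))"
      unfolding T_free_def vext_sum vext_frag_of by (rule T_formula[OF l3 n Q E gensD[OF gs]])
  qed
  then show ?thesis unfolding vext_lin to_fract_vext .
qed

text \<open>All evaluations of the image of a relation are combinations of evaluations of that relation in \<open>l - 1\<close> coordinates.\<close>

lemma T_free_rel:
  assumes p: "p \<in> tens_rel (XT l (l - 1) n n)"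
  shows "frag_extend (T_free n E Ed) p \<in> tens_rel (XT l l n n)"
proof (rule paths_separate_tensors)
  have m: "2 \<le> l - 1" "l - 1 \<le> l" using l3 by auto
  note pf = tens_rel_free[OF m p]
  show "1 \<le> n" "n \<le> n" using n l3 by auto
  show "frag_extend (T_free n E Ed) p \<in> tens_free (XT l l n n)" by (rule tens_free_extend[OF pf T_free_closed])
  fix Q assume Q: "Q \<in> paths l n"
  have "path_poly id Q (zF k) / (\<Prod>r\<in>{1..int l} - {k}. zF k - zF r) * to_fract (vext (\<lambda>gs. val n 0 (sp (int l) k) gs (map (sp (int l) k) Q)) p) = 0" if k: "k \<in> {1..int l}" for k
  proof (cases "k \<in> set Q")
    case True
    have "path_poly id Q (zF k) = (0 :: 'k mpol fract)" by (rule path_poly_zero[OF True]) (use k Q in \<open>auto simp: paths_def\<close>)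
    then show ?thesis by simp
  next
    case False
    have S: "{1..int (l - 1)} = {1..int l} - {int l}" using l2 by auto
    have "map (sp (int l) k) Q \<in> paths (l - 1) n"
    proof -
      have sk: "sp (int l) k x \<in> {1..int l} - {int l}" if "x \<in> {1..int l}" "x \<noteq> k" for x using that k by (auto simp: sp_def)
      have Qk: "x \<in> {1..int l} \<and> x \<noteq> k" if "x \<in> set Q" for x using False Q that by (auto simp: paths_def)
      have "set (map (sp (int l) k) Q) \<subseteq> {1..int l} - {int l}"
        unfolding set_map by (rule image_subsetI) (use sk Qk in simp)
      then show ?thesis using Q unfolding paths_def S by simp
    qed
    from val_vanishes_on_rel[OF m le_refl spl_sperm[OF k] this p] show ?thesis by simp
  qed
  then have "to_fract (vext (\<lambda>fs. val n 0 id fs Q) (frag_extend (T_free n E Ed) p)) = 0"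
    unfolding vext_T[OF pf Q] by (intro sum.neutral) blast
  then show "vext (\<lambda>fs. val n 0 id fs Q) (frag_extend (T_free n E Ed) p) = 0" by (simp only: to_fract_eq_0_iff)
qed

text \<open>Both sides have the same kernel, and paths separate tensors.\<close>

lemma T_Fsum_eq_u:
  assumes C: "dual_hom_bases l (insert 1 (OS l)) ({1, - 1} \<union> OS l) C Cd"
    and D: "dual_hom_bases l (insert 1 (OS (l - 1))) ({1, - 1} \<union> OS (l - 1)) D Dd"
    and p: "p \<in> tens_free (XT l l n n)"
  shows "frag_extend (T_free n E Ed) (frag_extend (Fsum_free (l - 1) n D Dd) p) - frag_extend (Fsum_free l n C Cd) p \<in> tens_rel (XT l l n n)"
proof (rule paths_separate_tensors)
  have m: "2 \<le> l - 1" "l - 1 \<le> l" using l3 by auto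
  show n1: "1 \<le> n" "n \<le> n" using n l3 by auto
  have Dfree: "frag_extend (Fsum_free (l - 1) n D Dd) p \<in> tens_free (XT l (l - 1) n n)" by (rule tens_free_extend[OF p Fsum_free_closed[OF m n1(1) D]])
  show "frag_extend (T_free n E Ed) (frag_extend (Fsum_free (l - 1) n D Dd) p) - frag_extend (Fsum_free l n C Cd) p \<in> tens_free (XT l l n n)"
    by (intro tens_free_diff tens_free_extend[OF Dfree] T_free_closed tens_free_extend[OF p] Fsum_free_closed[OF l2 le_refl n1(1) C])
  fix Q assume Q: "Q \<in> paths l n"
  have "to_fract (vext (\<lambda>fs. val n 0 id fs Q) (frag_extend (T_free n E Ed) (frag_extend (Fsum_free (l - 1) n D Dd) p))) =
    vext (\<lambda>fs. \<Sum>k\<in>{1..int l}. path_poly id Q (zF k) / (\<Prod>r\<in>{1..int l} - {k}. zF k - zF r) *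
      (\<Sum>d\<in>D. to_fract (val n 0 (sp (int l) k) (ends n (F l n (OS (l - 1)) fs d) (Dd d)) (map (sp (int l) k) Q)))) p"
    apply (subst vext_T[OF Dfree Q])
    apply (subst vext_lin)
    unfolding to_fract_vext vext_frag_extend Fsum_free_def vext_sum vext_frag_of to_fract_sum ..
  also have "\<dots> = vext (\<lambda>fs. \<Sum>P\<in>paths l n. u_coeff n P Q * to_fract (val n 0 id fs P)) p"
  proof (rule vext_cong)
    fix fs assume "fs \<in> Poly_Mapping.keys p"
    then have fs: "fs \<in> gens (XT l l n n)" using p by (auto simp: tens_free_iff)
    show "(\<Sum>k\<in>{1..int l}. path_poly id Q (zF k) / (\<Prod>r\<in>{1..int l} - {k}. zF k - zF r) *
      (\<Sum>d\<in>D. to_fract (val n 0 (sp (int l) k) (ends n (F l n (OS (l - 1)) fs d) (Dd d)) (map (sp (int l) k) Q)))) = (\<Sum>P\<in>paths l n. u_coeff n P Q * to_fract (val n 0 id fs P))"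
      unfolding u_coeff_def by (rule v_kernel[OF l3 n Q D gensD[OF fs]])
  qed
  also have "\<dots> = (\<Sum>P\<in>paths l n. u_coeff n P Q * to_fract (vext (\<lambda>fs. val n 0 id fs P) p))"
    unfolding vext_lin to_fract_vext ..
  also have "\<dots> = to_fract (vext (\<lambda>fs. val n 0 id fs Q) (frag_extend (Fsum_free l n C Cd) p))"
    by (rule vext_u[OF n1(1) C p Q, symmetric])
  finally show "vext (\<lambda>fs. val n 0 id fs Q) (frag_extend (T_free n E Ed) (frag_extend (Fsum_free (l - 1) n D Dd) p) - frag_extend (Fsum_free l n C Cd) p) = 0"
    by (simp only: vext_diff to_fract_eq_iff right_minus_eq)
qed

end

text \<open>For one factor and two coordinates, different paths flip different coordinates, and the weight cancels the only sum \<open>z\<^sub>1 + z\<^sub>2\<close>.\<close>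

lemma u_identity_l2:
  assumes l: "l = 2" and C: "dual_hom_bases l (insert 1 (OS l)) ({1, - 1} \<union> OS l) C Cd"
    and p: "p \<in> tens_free (XT l l 1 1)"
  shows "frag_extend (Fsum_free l 1 C Cd) p - p \<in> tens_rel (XT l l 1 1)"
proof (rule paths_separate_tensors)
  show "frag_extend (Fsum_free l 1 C Cd) p - p \<in> tens_free (XT l l 1 1)"
    by (intro tens_free_diff tens_free_extend[OF p] Fsum_free_closed[OF l2 le_refl _ C] p) simp
  fix Q assume Q: "Q \<in> paths l 1"
  have K: "u_coeff 1 P Q = (if P = Q then 1 else 0)" if P: "P \<in> paths l 1" for P
  proof -
    obtain q p where q': "Q = [q]" "1 \<le> q \<and> q \<le> 2" and pp': "P = [p]" "1 \<le> p \<and> p \<le> 2"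
      using Q P l by (auto simp: paths_def length_Suc_conv)
    have q: "Q = [q]" "q = 1 \<or> q = 2" and pp: "P = [p]" "p = 1 \<or> p = 2" using q' pp' by auto
    have fl: "fl p = fl q \<longleftrightarrow> p = q"
    proof
      assume "fl p = fl q"
      then have "fl p p = fl q p" by simp
      then show "p = q" using q pp by (auto simp: fl_def split: if_splits)
    qed simp
    have S: "{1..int 2} - {1} = {2}" "{1..int 2} - {2} = {1}" "{1..int 2} = {1, 2}" "{1..<1::int} = {}" "{1..<2::int} = {1}" by auto
    have D: "prod_sums l = (rt (- 1) 2 :: 'k mpol)" unfolding prod_sums_def l S by (simp add: S(5))
    have "path_wt l id [q] * to_fract (act (fl q) (prod_sums l)) = (1 :: 'k mpol fract)"
    proof -
      have fs: "fl q \<in> sperm l" using q l by (intro flq_sperm) auto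
      have a: "act (fl q) (rt (- 1) 2) = (rt (fl q (- 1)) (fl q 2) :: 'k mpol)" by (rule act_rt[OF fs])
      show ?thesis using q(2)
      proof
        assume "q = 1"
        then show ?thesis unfolding D unfolding a unfolding path_wt.simps l S rtF_def using rt_nz[of 1 2] by (simp add: fl_def S(1)[simplified])
      next
        assume q2: "q = 2"
        have "rt (- 1) (- 2) = (rt 2 1 :: 'k mpol)" by (simp add: rt_def Xs_uminus)
        then show ?thesis using q2 unfolding D unfolding a unfolding path_wt.simps l S rtF_def using rt_nz[of 2 1] by (simp add: fl_def insert_Diff_if S(2)[simplified])
      qed
    qed
    then show ?thesis unfolding u_coeff_def q(1) pp(1) flips_Cons flips_Nil comp_id fl by auto
  qed
  have fin: "finite (paths l 1)" by (rule finite_paths)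
  have "to_fract (vext (\<lambda>fs. val 1 0 id fs Q) (frag_extend (Fsum_free l 1 C Cd) p)) = (\<Sum>P\<in>paths l 1. if P = Q then to_fract (vext (\<lambda>fs. val 1 0 id fs P) p) else 0)"
    unfolding vext_u[OF order_refl C p Q] by (intro sum.cong refl) (simp only: K mult_1_left mult_zero_left if_distribR if_distrib[of "\<lambda>x. x * _"])
  also have "\<dots> = to_fract (vext (\<lambda>fs. val 1 0 id fs Q) p)" using fin Q by simp
  finally show "vext (\<lambda>fs. val 1 0 id fs Q) (frag_extend (Fsum_free l 1 C Cd) p - p) = 0"
    by (simp only: vext_diff to_fract_eq_iff right_minus_eq)
qed simp_all

end

section \<open>The isomorphism kappa\<close>

text \<open>A recursive form of the map underlying \<open>kappa\<close>; it splits along concatenations.\<close>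

fun kappa_list :: "nat \<Rightarrow> nat \<Rightarrow> 'k::field mpol list \<Rightarrow> 'k mpol list" where
  "kappa_list n i [] = []"
| "kappa_list n i (f # fs) = (gam ^^ (n - 1 - i)) f # kappa_list n (Suc i) fs"

lemma length_kappa_list [simp]: "length (kappa_list n i fs) = length fs" by (induction fs arbitrary: i) auto
lemma kappa_list_nth: "j < length fs \<Longrightarrow> kappa_list n i fs ! j = (gam ^^ (n - 1 - (i + j))) (fs ! j)"
proof (induction fs arbitrary: i j)
  case (Cons f fs)
  then show ?case by (cases j) auto
qed simp
lemma kappa_list_map: "length fs = n \<Longrightarrow> map (\<lambda>j. (gam ^^ (n - 1 - j)) (fs ! j)) [0..<n] = kappa_list n 0 fs"
  by (rule nth_equalityI) (simp_all add: kappa_list_nth)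
lemma kappa_list_append: "kappa_list n i (us @ vs) = kappa_list n i us @ kappa_list n (i + length us) vs"
  by (induction us arbitrary: i) auto

context typeD begin

lemma fl1_sperm: "fl 1 \<in> sperm l" using l2 by (intro fl_sperm) simp

lemma gam_act: "gam = (act (fl 1) :: 'k mpol \<Rightarrow> 'k mpol)"
proof -
  have "X(1 := - X 1) = (\<lambda>i. Xs (fl 1 (int i)) :: 'k mpol)" by (auto simp: fun_eq_iff fl_def Xs_def)
  then show ?thesis by (simp add: gam_def act_def)
qed

lemma gam_gam: "gam (gam f) = (f :: 'k mpol)"
proof -
  have "fl 1 \<circ> fl 1 = id" by (simp add: fun_eq_iff fl_invol)
  then show ?thesis unfolding gam_act act_comp[OF fl1_sperm] by simp
qed

lemma gam_pow: "(gam ^^ k) = (if even k then id else (gam :: 'k mpol \<Rightarrow> 'k mpol))"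
  by (induction k) (auto simp: fun_eq_iff gam_gam)

lemma gam_add: "gam (f + g) = gam f + (gam g :: 'k mpol)" by (simp add: gam_act act_add)
lemma gam_mult: "gam (f * g) = gam f * (gam g :: 'k mpol)" by (simp add: gam_act act_mult)
lemma gam_pow_add: "(gam ^^ k) (f + g) = (gam ^^ k) f + ((gam ^^ k) g :: 'k mpol)" by (simp add: gam_pow gam_add)
lemma gam_pow_mult: "(gam ^^ k) (f * g) = (gam ^^ k) f * ((gam ^^ k) g :: 'k mpol)" by (simp add: gam_pow gam_mult)
lemma gam_pow_invol: "(gam ^^ k) ((gam ^^ k) f) = (f :: 'k mpol)" by (simp add: gam_pow gam_gam)

lemma gam_O: assumes f: "(f :: 'k mpol) \<in> inv_ring l (OS l)" shows "gam f \<in> inv_ring l (OS l)"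
proof -
  have O: "OS l \<subseteq> N l" by (rule OS_sub_N[OF l2 le_refl])
  have "act (sr i) (act (fl 1) f) = act (fl 1) f" if i: "i \<in> OS l" for i
  proof -
    have s: "sr i \<in> sperm l" using i O by (intro sr_sperm) auto
    have "sr i \<circ> fl 1 = fl 1 \<circ> sr i"
    proof
      fix x
      have "sr i 1 = 1" using i by (auto simp: OS_def sp_def)
      then show "(sr i \<circ> fl 1) x = (fl 1 \<circ> sr i) x" using fl_conj[OF s, of 1 x] by simp
    qed
    moreover have "act (sr i) f = f" using f i by (simp add: inv_ring_iff'[OF O])
    ultimately show ?thesis using act_comp[OF s, of "fl 1" f] act_comp[OF fl1_sperm, of "sr i" f] by simp
  qed
  then show ?thesis using act_Rl[OF fl1_sperm inv_ring_Rl[OF f]] by (simp add: inv_ring_iff'[OF O] gam_act)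
qed

text \<open>The sign change \<open>x\<^sub>1 \<mapsto> - x\<^sub>1\<close> exchanges the roles of \<open>1\<close> and \<open>- 1\<close>.\<close>

lemma gam_E: assumes e: "e = 1 \<or> e = - 1" and f: "(f :: 'k mpol) \<in> inv_ring l (insert e (OS l))" shows "gam f \<in> inv_ring l (insert (- e) (OS l))"
proof -
  have e': "- e = 1 \<or> - e = - 1" using e by auto
  have E: "insert e (OS l) \<subseteq> N l" by (rule adapted_sub[OF adapted_Oe(1)[OF l2 le_refl e]])
  have E': "insert (- e) (OS l) \<subseteq> N l" by (rule adapted_sub[OF adapted_Oe(1)[OF l2 le_refl e']])
  have fO: "f \<in> inv_ring l (OS l)" using f inv_ring_OE[OF l2 le_refl e] by auto
  have O: "OS l \<subseteq> N l" by (rule OS_sub_N[OF l2 le_refl])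
  have s: "sr e \<in> sperm l" "sr (- e) \<in> sperm l" by (rule sr_sperm[OF subsetD[OF E insertI1]], rule sr_sperm[OF subsetD[OF E' insertI1]])
  have "sr (- e) \<circ> fl 1 = fl 1 \<circ> sr e"
  proof
    fix x :: int
    have "(sr (- e) \<circ> fl 1) x = (fl 1 \<circ> sr e) x" if "e = 1" unfolding that by (simp add: fl_def sp_def)
    moreover have "(sr (- e) \<circ> fl 1) x = (fl 1 \<circ> sr e) x" if "e = - 1" unfolding that by (simp add: fl_def sp_def)
    ultimately show "(sr (- e) \<circ> fl 1) x = (fl 1 \<circ> sr e) x" using e by blast
  qed
  moreover have "act (sr e) f = f" using f by (simp add: inv_ring_iff'[OF E])
  ultimately have "act (sr (- e)) (act (fl 1) f) = act (fl 1) f"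
    using act_comp[OF s(2), of "fl 1" f] act_comp[OF fl1_sperm, of "sr e" f] by (simp del: comp_apply)
  moreover have "act (sr i) (act (fl 1) f) = act (fl 1) f" if "i \<in> OS l" for i
    using gam_O[OF fO] that by (simp add: inv_ring_iff'[OF O] gam_act)
  moreover have "act (fl 1) f \<in> Rl l" by (rule act_Rl[OF fl1_sperm inv_ring_Rl[OF fO]])
  ultimately show ?thesis unfolding inv_ring_iff'[OF E'] gam_act by blast
qed

lemma gam_pow_O: "(f :: 'k mpol) \<in> inv_ring l (OS l) \<Longrightarrow> (gam ^^ k) f \<in> inv_ring l (OS l)"
  by (simp add: gam_pow gam_O)

lemma gam_pow_E: assumes f: "(f :: 'k mpol) \<in> inv_ring l (insert 1 (OS l))" shows "(gam ^^ (n - i)) f \<in> inv_ring l (insert (sgn_idx n i) (OS l))"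
  using f gam_E[of 1 f] by (cases "even (n - i)") (simp_all add: gam_pow sgn_idx_def del: even_diff_nat)

lemma gam_pow_E': assumes f: "(f :: 'k mpol) \<in> inv_ring l (insert (sgn_idx n i) (OS l))" shows "(gam ^^ (n - i)) f \<in> inv_ring l (insert 1 (OS l))"
  using f gam_E[of "- 1" f] by (cases "even (n - i)") (simp_all add: gam_pow sgn_idx_def del: even_diff_nat)

lemma kappa_list_kk: "kappa_list n i (kappa_list n i fs) = (fs :: 'k mpol list)"
  by (induction fs arbitrary: i) (simp_all add: gam_pow_invol)

lemma kappa_list_set: "set fs \<subseteq> inv_ring l (OS l) \<Longrightarrow> set (kappa_list n i fs) \<subseteq> (inv_ring l (OS l) :: 'k mpol set)"
  by (induction fs arbitrary: i) (auto simp: gam_pow_O)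

lemma Bpow_simps [simp]: "tlen (Bpow l n :: 'k mpol chain) = n" "fac (Bpow l n :: 'k mpol chain) = inv_ring l (OS l)"
  "scal (Bpow l n :: 'k mpol chain) i = inv_ring l (insert 1 (OS l))" "lact (Bpow l n :: 'k mpol chain) a f = gam a * f"
  by (simp_all add: Bpow_def Aring_def O2_OS)

lemma gens_Bpow: "gens (Bpow l n) = (gens (XT l l n n) :: 'k mpol list set)" by (simp add: gens_def)
lemma free_Bpow: "tens_free (Bpow l n) = (tens_free (XT l l n n) :: ('k tuple_sum) set)" unfolding set_eq_iff tens_free_iff gens_Bpow by simp

text \<open>The map \<open>kappa\<close> on formal sums. As a map of formal sums it is an involution, which makes its inverse explicit.\<close>

definition kappa_free :: "nat \<Rightarrow> ('k tuple_sum) \<Rightarrow> ('k tuple_sum)" where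
  "kappa_free n p = frag_extend (\<lambda>fs. frag_of (kappa_list n 0 fs)) p"

lemma kappa_free_kf: "kappa_free n (kappa_free n p) = p"
  unfolding kappa_free_def frag_extend_extend by (simp add: kappa_list_kk frag_expansion[symmetric])

lemma kappa_free_diff: "kappa_free n (p - q) = kappa_free n p - kappa_free n q" by (simp add: kappa_free_def frag_extend_diff)

lemma kappa_free_free: "p \<in> tens_free (XT l l n n) \<Longrightarrow> kappa_free n p \<in> tens_free (XT l l n n)"
  unfolding kappa_free_def by (erule tens_free_extend) (auto simp: gens_def kappa_list_set intro!: tens_free_frag dest: subsetD[OF kappa_list_set])

text \<open>Moving a scalar across the tensor sign \<open>i\<close> twists it by \<open>\<gamma>\<close>, which is absorbed by the difference of the exponents
  of \<open>\<gamma>\<close> on the two sides; the exponent \<open>n - i\<close> turns \<open>A\<close> into the invariants of the sign \<open>\<epsilon>\<^sub>i\<close>.\<close>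

lemma kappa_free_rel: assumes p: "p \<in> tens_rel (Bpow l n)" shows "kappa_free n p \<in> tens_rel (XT l l n n)"
  unfolding kappa_free_def
proof (rule tens_rel_extend[OF p])
  fix us vs :: "'k mpol list" and f g :: "'k mpol" assume a: "length us + 1 + length vs = tlen (Bpow l n :: 'k mpol chain)" "set us \<subseteq> fac (Bpow l n)" "set vs \<subseteq> fac (Bpow l n)" "f \<in> fac (Bpow l n)" "g \<in> fac (Bpow l n)"
  show "frag_of (kappa_list n 0 (us @ (f + g) # vs)) - frag_of (kappa_list n 0 (us @ f # vs)) - frag_of (kappa_list n 0 (us @ g # vs)) \<in> tens_rel (XT l l n n)"
    unfolding kappa_list_append kappa_list.simps gam_pow_add
    by (rule tens_rel.additive) (use a kappa_list_set gam_pow_O in simp_all)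
next
  fix us vs :: "'k mpol list" and f g x :: "'k mpol" assume a: "length us + 2 + length vs = tlen (Bpow l n :: 'k mpol chain)" "set us \<subseteq> fac (Bpow l n)" "set vs \<subseteq> fac (Bpow l n)" "f \<in> fac (Bpow l n)" "g \<in> fac (Bpow l n)" "x \<in> scal (Bpow l n) (length us + 1)"
  let ?x = "(gam ^^ (n - 1 - length us)) x"
  have e: "n - 1 - length us = Suc (n - 1 - Suc (length us))" using a(1) by simp
  have gx: "(gam ^^ (n - 1 - Suc (length us))) (gam x) = ?x" unfolding e funpow.simps comp_apply by (rule funpow_swap1[symmetric])
  have xE: "?x \<in> inv_ring l (insert (sgn_idx n (length us + 1)) (OS l))" using gam_pow_E[of x n "length us + 1"] a(6) by simp
  have "frag_of (kappa_list n 0 us @ ((gam ^^ (n - 1 - length us)) f * ?x) # (gam ^^ (n - 1 - Suc (length us))) g # kappa_list n (Suc (Suc (length us))) vs) -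
    frag_of (kappa_list n 0 us @ ((gam ^^ (n - 1 - length us)) f) # lact (XT l l n n) ?x ((gam ^^ (n - 1 - Suc (length us))) g) # kappa_list n (Suc (Suc (length us))) vs) \<in> tens_rel (XT l l n n)"
    by (rule tens_rel.balanced) (use a kappa_list_set gam_pow_O xE in simp_all)
  then show "frag_of (kappa_list n 0 (us @ (f * x) # g # vs)) - frag_of (kappa_list n 0 (us @ f # lact (Bpow l n) x g # vs)) \<in> tens_rel (XT l l n n)"
    unfolding kappa_list_append kappa_list.simps gam_pow_mult Bpow_simps XT_simps gx add_0_left .
qed

lemma kappa_free_rel': assumes p: "p \<in> tens_rel (XT l l n n)" shows "kappa_free n p \<in> tens_rel (Bpow l n)"
  unfolding kappa_free_def
proof (rule tens_rel_extend[OF p])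
  fix us vs :: "'k mpol list" and f g :: "'k mpol" assume a: "length us + 1 + length vs = tlen (XT l l n n :: 'k mpol chain)" "set us \<subseteq> fac (XT l l n n)" "set vs \<subseteq> fac (XT l l n n)" "f \<in> fac (XT l l n n)" "g \<in> fac (XT l l n n)"
  show "frag_of (kappa_list n 0 (us @ (f + g) # vs)) - frag_of (kappa_list n 0 (us @ f # vs)) - frag_of (kappa_list n 0 (us @ g # vs)) \<in> tens_rel (Bpow l n)"
    unfolding kappa_list_append kappa_list.simps gam_pow_add
    by (rule tens_rel.additive) (use a kappa_list_set gam_pow_O in simp_all)
next
  fix us vs :: "'k mpol list" and f g x :: "'k mpol" assume a: "length us + 2 + length vs = tlen (XT l l n n :: 'k mpol chain)" "set us \<subseteq> fac (XT l l n n)" "set vs \<subseteq> fac (XT l l n n)" "f \<in> fac (XT l l n n)" "g \<in> fac (XT l l n n)" "x \<in> scal (XT l l n n) (length us + 1)"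
  let ?x = "(gam ^^ (n - 1 - length us)) x"
  have e: "n - 1 - length us = Suc (n - 1 - Suc (length us))" using a(1) by simp
  have gx: "(gam ^^ (n - 1 - Suc (length us))) x = gam ?x" unfolding e by (simp add: gam_gam)
  have xE: "?x \<in> inv_ring l (insert 1 (OS l))" using gam_pow_E'[of x n "length us + 1"] a(6) by simp
  have "frag_of (kappa_list n 0 us @ ((gam ^^ (n - 1 - length us)) f * ?x) # (gam ^^ (n - 1 - Suc (length us))) g # kappa_list n (Suc (Suc (length us))) vs) -
    frag_of (kappa_list n 0 us @ ((gam ^^ (n - 1 - length us)) f) # lact (Bpow l n) ?x ((gam ^^ (n - 1 - Suc (length us))) g) # kappa_list n (Suc (Suc (length us))) vs) \<in> tens_rel (Bpow l n)"
    by (rule tens_rel.balanced) (use a kappa_list_set gam_pow_O xE in simp_all)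
  then show "frag_of (kappa_list n 0 (us @ (f * x) # g # vs)) - frag_of (kappa_list n 0 (us @ f # lact (XT l l n n) x g # vs)) \<in> tens_rel (Bpow l n)"
    unfolding kappa_list_append kappa_list.simps gam_pow_mult Bpow_simps XT_simps gx add_0_left .
qed

lemma kappa_tclass: assumes p: "p \<in> tens_free (XT l l n n)" shows "kappa l n (tclass (Bpow l n) p) = tclass (XT l l n n) (kappa_free n p :: 'k tuple_sum)"
proof -
  let ?h = "\<lambda>fs :: 'k mpol list. frag_of (map (\<lambda>j. (gam ^^ (n - 1 - j)) (fs ! j)) [0..<n])"
  have eq: "frag_extend ?h q = kappa_free n q" if "q \<in> tens_free (XT l l n n)" for q
    unfolding kappa_free_def
  proof (rule frag_extend_eq)
    fix fs assume "fs \<in> Poly_Mapping.keys q"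
    then have "length fs = n" using that by (auto simp: tens_free_def)
    then show "?h fs = frag_of (kappa_list n 0 fs)" by (simp only: kappa_list_map)
  qed
  have fr: "q \<in> tens_free (XT l l n n)" if "q \<in> tens_rel (Bpow l n)" for q :: "'k tuple_sum"
    using kappa_free_free[OF tens_rel_free[OF l2 le_refl kappa_free_rel[OF that]]] by (simp only: kappa_free_kf)
  have "kappa l n (tclass (Bpow l n) p) = tclass (Xten l n (O2 l)) (frag_extend ?h p)"
    unfolding kappa_def
  proof (rule tmap_tclass)
    show "p \<in> tens_free (Bpow l n)" using p by (simp add: free_Bpow)
    fix q :: "'k tuple_sum" assume q: "q \<in> tens_rel (Bpow l n)"
    show "frag_extend ?h q \<in> tens_rel (Xten l n (O2 l))" unfolding O2_OS Xten_XT eq[OF fr[OF q]] by (rule kappa_free_rel[OF q])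
  qed
  then show ?thesis using p by (simp only: O2_OS Xten_XT eq)
qed

lemma kappa_inv: assumes q: "q \<in> tens_free (XT l l n n)"
  shows "inv_into (tensors (Bpow l n)) (kappa l n) (tclass (XT l l n n) q) = tclass (Bpow l n) (kappa_free n q :: 'k tuple_sum)"
proof (rule inv_into_f_eq)
  show "inj_on (kappa l n) (tensors (Bpow l n :: 'k mpol chain))"
  proof (rule inj_onI)
    fix s t assume st: "s \<in> tensors (Bpow l n :: 'k mpol chain)" "t \<in> tensors (Bpow l n)" "kappa l n s = kappa l n t"
    obtain p where p: "p \<in> tens_free (XT l l n n)" "s = tclass (Bpow l n) p" using st(1) by (elim tensorsE) (simp add: free_Bpow)
    obtain p' where p': "p' \<in> tens_free (XT l l n n)" "t = tclass (Bpow l n) p'" using st(2) by (elim tensorsE) (simp add: free_Bpow)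
    have "kappa_free n p - kappa_free n p' \<in> tens_rel (XT l l n n)"
      using st(3) unfolding p(2) p'(2) kappa_tclass[OF p(1)] kappa_tclass[OF p'(1)] by (rule tclass_eqD[OF kappa_free_free[OF p(1)]])
    from kappa_free_rel'[OF this] have "p - p' \<in> tens_rel (Bpow l n)" by (simp only: kappa_free_diff kappa_free_kf)
    then show "s = t" unfolding p p' by (rule tclass_eqI)
  qed
  show "tclass (Bpow l n) (kappa_free n q) \<in> tensors (Bpow l n)" using kappa_free_free[OF q] by (intro tclass_tensors) (simp add: free_Bpow)
  show "kappa l n (tclass (Bpow l n) (kappa_free n q)) = tclass (XT l l n n) q" by (simp only: kappa_tclass[OF kappa_free_free[OF q]] kappa_free_kf)
qed

text \<open>Since \<open>kappa_free\<close> is its own inverse on formal sums, conjugation by \<open>kappa\<close> is composition with it on both sides.\<close>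

lemma kappa_conj_tclass:
  assumes f: "\<And>q. q \<in> tens_free (XT l l n n) \<Longrightarrow> \<phi> (tclass (XT l l n n) q) = tclass (XT l l n n) (\<Phi> q)"
    and fr: "\<And>q. q \<in> tens_free (XT l l n n) \<Longrightarrow> \<Phi> q \<in> tens_free (XT l l n n)" and p: "p \<in> tens_free (XT l l n n)"
  shows "kappa_conj l n \<phi> (tclass (Bpow l n) p) = tclass (Bpow l n) (kappa_free n (\<Phi> (kappa_free n p :: 'k tuple_sum)))"
proof -
  have t: "tclass (Bpow l n) p \<in> tensors (Bpow l n)" using p by (intro tclass_tensors) (simp add: free_Bpow)
  have "kappa_conj l n \<phi> (tclass (Bpow l n) p) = inv_into (tensors (Bpow l n)) (kappa l n) (\<phi> (kappa l n (tclass (Bpow l n) p)))"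
    unfolding kappa_conj_def using t by (rule restrict_apply')
  also have "\<dots> = tclass (Bpow l n) (kappa_free n (\<Phi> (kappa_free n p)))"
    unfolding kappa_tclass[OF p] f[OF kappa_free_free[OF p]] by (rule kappa_inv[OF fr[OF kappa_free_free[OF p]]])
  finally show ?thesis .
qed

end

section \<open>Bimodule endomorphisms and the comparison\<close>

definition head_mult :: "'r::comm_ring_1 \<Rightarrow> ('r list \<Rightarrow>\<^sub>0 int) \<Rightarrow> ('r list \<Rightarrow>\<^sub>0 int)" where
  "head_mult a p = frag_extend (\<lambda>fs. frag_of ((a * hd fs) # tl fs)) p"
definition last_mult :: "'r::comm_ring_1 \<Rightarrow> ('r list \<Rightarrow>\<^sub>0 int) \<Rightarrow> ('r list \<Rightarrow>\<^sub>0 int)" where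
  "last_mult a p = frag_extend (\<lambda>fs. frag_of (butlast fs @ [last fs * a])) p"

context typeD begin

lemma head_mult_free: assumes n: "1 \<le> n" and a: "a \<in> inv_ring l (OS l)" and p: "(p :: 'k tuple_sum) \<in> tens_free (XT l l n n)"
  shows "head_mult a p \<in> tens_free (XT l l n n)"
  unfolding head_mult_def
proof (rule tens_free_extend[OF p])
  fix fs :: "'k mpol list" assume "fs \<in> gens (XT l l n n)"
  moreover obtain f fs' where "fs = f # fs'" using calculation n by (cases fs) (auto simp: gens_def)
  ultimately show "frag_of ((a * hd fs) # tl fs) \<in> tens_free (XT l l n n)"
    using a inv_ring_closed(2)[OF OS_sub_N[OF l2 le_refl]] by (intro tens_free_frag) (auto simp: gens_def)
qed

lemma last_mult_free: assumes n: "1 \<le> n" and a: "a \<in> inv_ring l (OS l)" and p: "(p :: 'k tuple_sum) \<in> tens_free (XT l l n n)"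
  shows "last_mult a p \<in> tens_free (XT l l n n)"
  unfolding last_mult_def
proof (rule tens_free_extend[OF p])
  fix fs :: "'k mpol list" assume "fs \<in> gens (XT l l n n)"
  moreover obtain f fs' where "fs = fs' @ [f]" using calculation n by (cases fs rule: rev_cases) (auto simp: gens_def)
  ultimately show "frag_of (butlast fs @ [last fs * a]) \<in> tens_free (XT l l n n)"
    using a inv_ring_closed(2)[OF OS_sub_N[OF l2 le_refl]] by (intro tens_free_frag) (auto simp: gens_def)
qed

lemma kappa_free_head_mult: assumes n: "1 \<le> n" and p: "(p :: 'k tuple_sum) \<in> tens_free (XT l l n n)"
  shows "kappa_free n (head_mult (gam a) p) = head_mult ((gam ^^ n) a) (kappa_free n p)"
  unfolding kappa_free_def head_mult_def frag_extend_extend frag_extend_of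
proof (rule frag_extend_eq)
  fix fs assume "fs \<in> Poly_Mapping.keys p"
  then have "fs \<in> gens (XT l l n n)" using p by (auto simp: tens_free_iff)
  then obtain f fs' where fs: "fs = f # fs'" using n by (cases fs) (auto simp: gens_def)
  have "(gam ^^ (n - 1)) (gam a) = (gam ^^ n) a" using funpow_swap1[of gam "n - 1" a] n by (cases n) simp_all
  then show "frag_of (kappa_list n 0 ((gam a * hd fs) # tl fs)) = frag_of (((gam ^^ n) a * hd (kappa_list n 0 fs)) # tl (kappa_list n 0 fs))"
    unfolding fs kappa_list.simps list.sel gam_pow_mult by simp
qed

lemma kappa_free_head_mult': assumes n: "1 \<le> n" and q: "(q :: 'k tuple_sum) \<in> tens_free (XT l l n n)"
  shows "kappa_free n (head_mult ((gam ^^ n) a) q) = head_mult (gam a) (kappa_free n q)"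
proof -
  have "kappa_free n (kappa_free n (head_mult (gam a) (kappa_free n q))) = kappa_free n (head_mult ((gam ^^ n) a) (kappa_free n (kappa_free n q)))"
    unfolding kappa_free_head_mult[OF n kappa_free_free[OF q]] ..
  then show ?thesis by (simp only: kappa_free_kf)
qed

lemma kappa_free_last_mult: assumes n: "1 \<le> n" and p: "(p :: 'k tuple_sum) \<in> tens_free (XT l l n n)"
  shows "kappa_free n (last_mult a p) = last_mult a (kappa_free n p)"
  unfolding kappa_free_def last_mult_def frag_extend_extend frag_extend_of
proof (rule frag_extend_eq)
  fix fs assume "fs \<in> Poly_Mapping.keys p"
  then have g: "fs \<in> gens (XT l l n n)" using p by (auto simp: tens_free_iff)
  then obtain f fs' where fs: "fs = fs' @ [f]" using n by (cases fs rule: rev_cases) (auto simp: gens_def)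
  have "n - 1 - length fs' = 0" using g fs by (simp add: gens_def)
  then show "frag_of (kappa_list n 0 (butlast fs @ [last fs * a])) = frag_of (butlast (kappa_list n 0 fs) @ [last (kappa_list n 0 fs) * a])"
    unfolding fs by (simp add: kappa_list_append)
qed

lemma ends_head_mult: "1 \<le> n \<Longrightarrow> ends n (a * x) b = (a * hd (ends n x b)) # tl (ends n x b)"
  by (auto simp: ends_def mult.assoc)

lemma F_head_mult:
  fixes fs :: "'k mpol list"
  assumes n: "1 \<le> n" and a: "a \<in> inv_ring l (insert (sgn_idx n 0) (OS l))" and c: "c \<in> inv_ring l (insert 1 (OS l))"
    and fs: "fs \<in> gens (XT l l n n)"
  shows "F l n (OS l) ((a * hd fs) # tl fs) c = a * F l n (OS l) fs c"
proof -
  obtain f fs' where f: "fs = f # fs'" using n fs by (cases fs) (auto simp: gens_def)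
  note O = OS_sub_N[OF l2 le_refl]
  have "nest l n (OS l) (Suc 0) fs' c \<in> inv_ring l (OS l)"
    using nest_in[OF l2 le_refl _ _ c, of fs' "Suc 0" n] inv_ring_OE[OF l2 le_refl sgn_idx_cases] fs f by (auto simp: gens_def)
  then have x: "f * nest l n (OS l) (Suc 0) fs' c \<in> inv_ring l (OS l)" using fs f by (intro inv_ring_closed(2)[OF O]) (auto simp: gens_def)
  have "tr l (OS l) (insert (sgn_idx n 0) (OS l)) (a * (f * nest l n (OS l) (Suc 0) fs' c)) = a * tr l (OS l) (insert (sgn_idx n 0) (OS l)) (f * nest l n (OS l) (Suc 0) fs' c)"
    by (rule tr_linear[OF adapted_O(1)[OF l2 le_refl] adapted_Oe(1)[OF l2 le_refl sgn_idx_cases] subset_insertI _ a x]) (auto simp: LO_def LE_def)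
  then show ?thesis unfolding f F_def nest.simps list.sel mult.assoc .
qed

context
  fixes n :: nat and C :: "'k mpol set" and Cd
  assumes n: "1 \<le> n" and C: "dual_hom_bases l (insert 1 (OS l)) ({1, - 1} \<union> OS l) C Cd"
begin

text \<open>Here the maps of formal sums agree exactly, as the outermost trace is linear.\<close>

lemma u_head_mult:
  assumes a: "a \<in> inv_ring l (insert (sgn_idx n 0) (OS l))" and p: "(p :: 'k tuple_sum) \<in> tens_free (XT l l n n)"
  shows "frag_extend (Fsum_free l n C Cd) (head_mult a p) = head_mult a (frag_extend (Fsum_free l n C Cd) p)"
  unfolding head_mult_def frag_extend_extend frag_extend_of
proof (rule frag_extend_eq)
  fix fs assume "fs \<in> Poly_Mapping.keys p"
  then have fs: "fs \<in> gens (XT l l n n)" using p by (auto simp: tens_free_iff)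
  have fin: "finite C" and CE: "C \<subseteq> inv_ring l (insert 1 (OS l))" using C by (auto simp: dual_hom_bases_def hom_basis_def)
  have "Fsum_free l n C Cd ((a * hd fs) # tl fs) = (\<Sum>c\<in>C. frag_of ((a * hd (ends n (F l n (OS l) fs c) (Cd c))) # tl (ends n (F l n (OS l) fs c) (Cd c))))"
    unfolding Fsum_free_def
  proof (intro sum.cong refl)
    fix c assume "c \<in> C"
    then have "c \<in> inv_ring l (insert 1 (OS l))" using CE by blast
    from F_head_mult[OF n a this fs] show "frag_of (ends n (F l n (OS l) ((a * hd fs) # tl fs) c) (Cd c)) = frag_of ((a * hd (ends n (F l n (OS l) fs c) (Cd c))) # tl (ends n (F l n (OS l) fs c) (Cd c)))"
      by (simp only: ends_head_mult[OF n])
  qed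
  also have "\<dots> = frag_extend (\<lambda>fs. frag_of ((a * hd fs) # tl fs)) (Fsum_free l n C Cd fs)"
    unfolding Fsum_free_def frag_extend_sum[OF fin] by (simp add: comp_def)
  finally show "Fsum_free l n C Cd ((a * hd fs) # tl fs) = frag_extend (\<lambda>fs. frag_of ((a * hd fs) # tl fs)) (Fsum_free l n C Cd fs)" .
qed

lemma val_last_mult:
  fixes a :: "'k mpol"
  assumes a: "a \<in> inv_ring l (insert 1 (OS l))" and fs: "fs \<in> gens (XT l l n n)" and Q: "Q \<in> paths l n"
  shows "val n 0 id (butlast fs @ [last fs * a]) Q = act (flips Q) a * val n 0 id fs Q"
proof -
  obtain f fs' where f: "fs = fs' @ [f]" using n fs by (cases fs rule: rev_cases) (auto simp: gens_def)
  obtain q Q' where q: "Q = Q' @ [q]" using n Q by (cases Q rule: rev_cases) (auto simp: paths_def)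
  have len: "length fs' = length Q'" "length Q' = n - 1" using fs Q f q by (auto simp: gens_def paths_def)
  have Ql: "set Q' \<subseteq> {1..int l}" "q \<in> {1..int l}" using Q q by (auto simp: paths_def)
  have e: "sgn_idx n (n - 1) = - 1" using n by (simp add: sgn_idx_def)
  have a': "a \<in> inv_ring l (insert (- (- 1)) (OS l))" using a by simp
  have "act (flips Q' \<circ> sp 1 q \<circ> et (- 1)) a = act (flips Q' \<circ> fl q \<circ> et (- (- 1))) a"
    by (rule eval_adjacent[OF l2 le_refl _ flips_sperm[OF Ql(1)] a' Ql(2)]) simp
  also have "flips Q' \<circ> fl q \<circ> et (- (- 1)) = flips Q" unfolding q flips_append flips_Cons flips_Nil by simp
  finally have k: "act (flips Q' \<circ> sp 1 q \<circ> et (- 1)) a = act (flips Q) a" .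
  have bl: "butlast fs @ [last fs * a] = fs' @ [f * a]" by (simp add: f)
  show ?thesis unfolding bl unfolding f
    by (subst (1 2) q) (simp only: val_append[OF len(1)] val.simps add_0_left len e id_comp act_mult k mult_1_right mult.assoc mult.commute mult.left_commute)
qed

text \<open>Evaluation along \<open>Q\<close> turns right multiplication by \<open>a\<close> into multiplication by \<open>a\<close> at the total flip of \<open>Q\<close>, and the matrix of \<open>u\<close> couples
  only paths with equal total flip.\<close>

lemma u_last_mult:
  assumes a: "a \<in> inv_ring l (insert 1 (OS l))" and p: "(p :: 'k tuple_sum) \<in> tens_free (XT l l n n)"
  shows "frag_extend (Fsum_free l n C Cd) (last_mult a p) - last_mult a (frag_extend (Fsum_free l n C Cd) p) \<in> tens_rel (XT l l n n)"
proof (rule paths_separate_tensors[OF n le_refl])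
  have aO: "a \<in> inv_ring l (OS l)" using a inv_ring_OE[OF l2 le_refl, of 1] by auto
  have Uf: "frag_extend (Fsum_free l n C Cd) q \<in> tens_free (XT l l n n)" if "q \<in> tens_free (XT l l n n)" for q
    by (rule tens_free_extend[OF that Fsum_free_closed[OF l2 le_refl n C]])
  note lf = last_mult_free[OF n aO p]
  show "frag_extend (Fsum_free l n C Cd) (last_mult a p) - last_mult a (frag_extend (Fsum_free l n C Cd) p) \<in> tens_free (XT l l n n)"
    by (intro tens_free_diff Uf lf last_mult_free[OF n aO] p)
  have vl: "vext (\<lambda>fs. val n 0 id fs Q) (last_mult a q) = act (flips Q) a * vext (\<lambda>fs. val n 0 id fs Q) q"
    if "q \<in> tens_free (XT l l n n)" "Q \<in> paths l n" for q Q
  proof -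
    have "vext (\<lambda>fs. val n 0 id fs Q) (last_mult a q) = vext (\<lambda>fs. act (flips Q) a * val n 0 id fs Q) q"
      unfolding last_mult_def vext_frag_extend vext_frag_of
    proof (rule vext_cong)
      fix fs assume "fs \<in> Poly_Mapping.keys q"
      then have "fs \<in> gens (XT l l n n)" using that(1) by (auto simp: tens_free_iff)
      then show "val n 0 id (butlast fs @ [last fs * a]) Q = act (flips Q) a * val n 0 id fs Q" by (rule val_last_mult[OF a _ that(2)])
    qed
    then show ?thesis unfolding vext_scale .
  qed
  fix Q assume Q: "Q \<in> paths l n"
  have "to_fract (vext (\<lambda>fs. val n 0 id fs Q) (frag_extend (Fsum_free l n C Cd) (last_mult a p))) =
    (\<Sum>P\<in>paths l n. u_coeff n P Q * to_fract (act (flips P) a * vext (\<lambda>fs. val n 0 id fs P) p))"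
    unfolding vext_u[OF n C lf Q] by (intro sum.cong refl) (simp only: vl[OF p])
  also have "\<dots> = to_fract (act (flips Q) a) * (\<Sum>P\<in>paths l n. u_coeff n P Q * to_fract (vext (\<lambda>fs. val n 0 id fs P) p))"
    unfolding sum_distrib_left u_coeff_def by (intro sum.cong refl) (simp add: mult_ac)
  also have "\<dots> = to_fract (act (flips Q) a * vext (\<lambda>fs. val n 0 id fs Q) (frag_extend (Fsum_free l n C Cd) p))"
    unfolding to_fract_mult vext_u[OF n C p Q] ..
  finally show "vext (\<lambda>fs. val n 0 id fs Q) (frag_extend (Fsum_free l n C Cd) (last_mult a p) - last_mult a (frag_extend (Fsum_free l n C Cd) p)) = 0"
    by (simp only: vext_diff vl[OF Uf[OF p] Q] to_fract_eq_iff right_minus_eq)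
qed

lemma u_map_tclass: assumes q: "q \<in> tens_free (XT l l n n)"
  shows "u_map l n C Cd (tclass (XT l l n n) q) = tclass (XT l l n n) (frag_extend (Fsum_free l n C Cd) q)"
  unfolding u_map_def Fsum_def O2_OS Xten_XT Fsum_free_def[symmetric]
  using tmap_tclass[OF q Fsum_free_rel[OF l2 le_refl n C]] by (simp only: eta_contract_eq)

lemma bold_u_tclass: assumes p: "p \<in> tens_free (XT l l n n)"
  shows "bold_u l n C Cd (tclass (Bpow l n) p) = tclass (Bpow l n) (kappa_free n (frag_extend (Fsum_free l n C Cd) (kappa_free n p)))"
  unfolding bold_u_def
  by (rule kappa_conj_tclass[where \<Phi> = "frag_extend (Fsum_free l n C Cd)", OF u_map_tclass _ p]) (assumption | erule tens_free_extend, rule Fsum_free_closed[OF l2 le_refl n C])+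

lemma bold_u_endo: "bold_u l n C Cd \<in> bimod_endos (Bpow l n) (Aring l)"
proof -
  let ?B = "Bpow l n :: 'k mpol chain"
  let ?G = "\<lambda>p. kappa_free n (frag_extend (Fsum_free l n C Cd) (kappa_free n p))"
  have fr: "tens_free ?B = tens_free (XT l l n n)" by (rule free_Bpow)
  have Uf: "frag_extend (Fsum_free l n C Cd) q \<in> tens_free (XT l l n n)" if "q \<in> tens_free (XT l l n n)" for q
    by (rule tens_free_extend[OF that Fsum_free_closed[OF l2 le_refl n C]])
  have Gf: "?G p \<in> tens_free (XT l l n n)" if "p \<in> tens_free (XT l l n n)" for p by (intro kappa_free_free Uf that)
  have O: "OS l \<subseteq> N l" by (rule OS_sub_N[OF l2 le_refl])
  have A: "Aring l = (inv_ring l (insert 1 (OS l)) :: 'k mpol set)" by (simp add: Aring_def O2_OS)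
  have AO: "a \<in> inv_ring l (OS l)" if "a \<in> Aring l" for a :: "'k mpol" using that inv_ring_OE[OF l2 le_refl, of 1] unfolding A by auto
  show ?thesis unfolding bimod_endos_def
  proof (intro CollectI conjI ballI PiE_I)
    fix t assume "t \<in> tensors ?B"
    then obtain p where p: "p \<in> tens_free (XT l l n n)" "t = tclass ?B p" by (elim tensorsE) (simp add: fr)
    show "bold_u l n C Cd t \<in> tensors ?B" unfolding p(2) bold_u_tclass[OF p(1)] by (rule tclass_tensors) (simp only: fr Gf[OF p(1)])
  next
    fix t assume "t \<notin> tensors ?B"
    then show "bold_u l n C Cd t = undefined" by (simp add: bold_u_def kappa_conj_def)
  next
    fix s t assume st: "s \<in> tensors ?B" "t \<in> tensors ?B"
    obtain p where p: "p \<in> tens_free ?B" "s = tclass ?B p" using st(1) by (elim tensorsE)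
    obtain q where q: "q \<in> tens_free ?B" "t = tclass ?B q" using st(2) by (elim tensorsE)
    note p1 = p(1)[unfolded fr] and q1 = q(1)[unfolded fr]
    have pq: "p + q \<in> tens_free (XT l l n n)" by (rule tens_free_add[OF p1 q1])
    have add: "?G (p + q) = ?G p + ?G q" unfolding kappa_free_def frag_extend_add ..
    show "bold_u l n C Cd (tadd ?B s t) = tadd ?B (bold_u l n C Cd s) (bold_u l n C Cd t)"
      unfolding p(2) q(2) tadd_tclass[OF p(1) q(1)] bold_u_tclass[OF pq] bold_u_tclass[OF p1] bold_u_tclass[OF q1] add
      by (rule tadd_tclass[symmetric]) (simp_all only: fr Gf p1 q1)
  next
    fix a :: "'k mpol" and t assume a: "a \<in> Aring l" and "t \<in> tensors ?B"
    then obtain p where p: "p \<in> tens_free (XT l l n n)" "t = tclass ?B p" by (elim tensorsE) (simp add: fr)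
    have aO: "a \<in> inv_ring l (OS l)" by (rule AO[OF a])
    have L: "left_mult ?B a (tclass ?B q) = tclass ?B (head_mult (gam a) q)" if q: "q \<in> tens_free (XT l l n n)" for q
      unfolding left_mult_def head_mult_def Bpow_simps
    proof (rule tmap_tclass)
      show "q \<in> tens_free ?B" using q by (simp only: fr)
      fix r :: "'k tuple_sum" assume r: "r \<in> tens_rel ?B"
      show "frag_extend (\<lambda>fs. frag_of ((gam a * hd fs) # tl fs)) r \<in> tens_rel ?B"
        by (rule left_rel[OF _ _ _ r]) (simp_all add: inv_ring_closed(2)[OF O] gam_O[OF aO] distrib_left mult.assoc)
    qed
    have r: "(gam ^^ n) a \<in> inv_ring l (insert (sgn_idx n 0) (OS l))" using gam_pow_E[of a n 0] a A by simp
    have "?G (head_mult (gam a) p) = head_mult (gam a) (?G p)"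
      unfolding kappa_free_head_mult[OF n p(1)] u_head_mult[OF r kappa_free_free[OF p(1)]] by (rule kappa_free_head_mult'[OF n Uf[OF kappa_free_free[OF p(1)]]])
    then show "bold_u l n C Cd (left_mult ?B a t) = left_mult ?B a (bold_u l n C Cd t)"
      unfolding p(2) L[OF p(1)] bold_u_tclass[OF p(1)] L[OF Gf[OF p(1)]] bold_u_tclass[OF head_mult_free[OF n gam_O[OF aO] p(1)]] by (simp only:)
  next
    fix a :: "'k mpol" and t assume a: "a \<in> Aring l" and "t \<in> tensors ?B"
    then obtain p where p: "p \<in> tens_free (XT l l n n)" "t = tclass ?B p" by (elim tensorsE) (simp add: fr)
    have aO: "a \<in> inv_ring l (OS l)" by (rule AO[OF a])
    have R: "right_mult ?B a (tclass ?B q) = tclass ?B (last_mult a q)" if q: "q \<in> tens_free (XT l l n n)" for q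
      unfolding right_mult_def last_mult_def
    proof (rule tmap_tclass)
      show "q \<in> tens_free ?B" using q by (simp only: fr)
      fix r :: "'k tuple_sum" assume r: "r \<in> tens_rel ?B"
      show "frag_extend (\<lambda>fs. frag_of (butlast fs @ [last fs * a])) r \<in> tens_rel ?B"
        by (rule right_rel[where h = "\<lambda>f. f * a", OF _ _ _ r]) (simp_all add: inv_ring_closed(2)[OF O] aO distrib_right mult.assoc)
    qed
    have "kappa_free n (frag_extend (Fsum_free l n C Cd) (last_mult a (kappa_free n p)) - last_mult a (frag_extend (Fsum_free l n C Cd) (kappa_free n p))) \<in> tens_rel ?B"
      by (rule kappa_free_rel'[OF u_last_mult[OF a[unfolded A] kappa_free_free[OF p(1)]]])
    then have "?G (last_mult a p) - last_mult a (?G p) \<in> tens_rel ?B"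
      by (simp only: kappa_free_diff kappa_free_last_mult[OF n p(1)] kappa_free_last_mult[OF n Uf[OF kappa_free_free[OF p(1)]]])
    then show "bold_u l n C Cd (right_mult ?B a t) = right_mult ?B a (bold_u l n C Cd t)"
      unfolding p(2) R[OF p(1)] bold_u_tclass[OF p(1)] R[OF Gf[OF p(1)]] bold_u_tclass[OF last_mult_free[OF n aO p(1)]] by (rule tclass_eqI)
  qed
qed

end

lemma bold_v_eq_bold_u:
  assumes C: "dual_hom_bases l (insert 1 (OS l)) ({1, - 1} \<union> OS l) C Cd"
    and D: "l - 1 \<ge> 2 \<Longrightarrow> dual_hom_bases l (insert 1 (OS (l - 1))) ({1, - 1} \<union> OS (l - 1)) D Dd"
    and E: "\<And>i. 1 \<le> i \<Longrightarrow> i \<le> l - 1 - 1 \<Longrightarrow> dual_hom_bases l (insert (sgn_idx (l - 1) i) (OS (l - 1))) (insert (sgn_idx (l - 1) i) (OS l)) (E i) (Ed i)"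
  shows "bold_v l (l - 1) D Dd E Ed = (bold_u l (l - 1) C Cd :: 'k mpol tensor \<Rightarrow> 'k mpol tensor)"
proof (rule ext)
  define n where "n = l - 1"
  have n: "1 \<le> n" using l2 by (simp add: n_def)
  fix t :: "'k mpol tensor"
  show "bold_v l (l - 1) D Dd E Ed t = bold_u l (l - 1) C Cd t"
  proof (cases "t \<in> tensors (Bpow l n)")
    case False
    then show ?thesis unfolding n_def[symmetric] bold_v_def bold_u_def kappa_conj_def by (cases "n = 1") simp_all
  next
    case True
    then obtain p where p: "p \<in> tens_free (XT l l n n)" "t = tclass (Bpow l n) p" by (elim tensorsE) (simp add: free_Bpow)
    have U: "bold_u l n C Cd t = tclass (Bpow l n) (kappa_free n (frag_extend (Fsum_free l n C Cd) (kappa_free n p)))"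
      unfolding p(2) by (rule bold_u_tclass[OF n C p(1)])
    show ?thesis
    proof (cases "l = 2")
      case l_2: True
      then have n1: "n = 1" by (simp add: n_def)
      have "frag_extend (Fsum_free l 1 C Cd) (kappa_free 1 p) - kappa_free 1 p \<in> tens_rel (XT l l 1 1)"
        by (rule u_identity_l2[OF l_2 C]) (use kappa_free_free[OF p(1)] n1 in simp)
      from kappa_free_rel'[OF this] have "kappa_free n (frag_extend (Fsum_free l n C Cd) (kappa_free n p)) - p \<in> tens_rel (Bpow l n)"
        unfolding kappa_free_diff kappa_free_kf n1 .
      from tclass_eqI[OF this] show ?thesis unfolding n_def[symmetric] U using True by (simp add: bold_v_def n1 p(2))
    next
      case False
      then have l3: "3 \<le> l" using l2 by simp
      have m: "2 \<le> l - 1" "l - 1 \<le> l" using l3 by auto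
      note D' = D[OF m(1)]
      have E': "dual_hom_bases l (insert (sgn_idx n i) (OS (l - 1))) (insert (sgn_idx n i) (OS l)) (E i) (Ed i)" if "1 \<le> i" "i \<le> n - 1" for i
        using E that unfolding n_def by blast
      have Tf: "frag_extend (T_free n E Ed) (frag_extend (Fsum_free (l - 1) n D Dd) q) \<in> tens_free (XT l l n n)" if q: "q \<in> tens_free (XT l l n n)" for q
        by (rule tens_free_extend[OF tens_free_extend[OF q Fsum_free_closed[OF m n D']] T_free_closed[OF l3 n_def E']])
      have In: "Iset l n = OS (l - 1)" unfolding n_def by (rule Iset_OS[OF l2])
      have V: "(T_map l n (Iset l n) E Ed \<circ> Fsum l n (Iset l n) D Dd) (tclass (XT l l n n) q) = tclass (XT l l n n) (frag_extend (T_free n E Ed) (frag_extend (Fsum_free (l - 1) n D Dd) q))"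
        if q: "q \<in> tens_free (XT l l n n)" for q
      proof -
        have F: "Fsum l n (Iset l n) D Dd (tclass (XT l l n n) q) = tclass (XT l (l - 1) n n) (frag_extend (Fsum_free (l - 1) n D Dd) q)"
          unfolding Fsum_def O2_OS In Xten_XT Fsum_free_def[symmetric]
          using tmap_tclass[OF q Fsum_free_rel[OF m n D']] by (simp only: eta_contract_eq)
        have T: "T_map l n (Iset l n) E Ed (tclass (XT l (l - 1) n n) r) = tclass (XT l l n n) (frag_extend (T_free n E Ed) r)"
          if r: "r \<in> tens_free (XT l (l - 1) n n)" for r
          unfolding T_map_def O2_OS In Xten_XT T_free_def[symmetric]
          using tmap_tclass[OF r T_free_rel[OF l3 n_def E']] by (simp only: eta_contract_eq)
        show ?thesis unfolding comp_apply F by (rule T[OF tens_free_extend[OF q Fsum_free_closed[OF m n D']]])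
      qed
      have "bold_v l n D Dd E Ed t = kappa_conj l n (T_map l n (Iset l n) E Ed \<circ> Fsum l n (Iset l n) D Dd) t"
        using m by (simp add: bold_v_def n_def)
      also have "\<dots> = tclass (Bpow l n) (kappa_free n (frag_extend (T_free n E Ed) (frag_extend (Fsum_free (l - 1) n D Dd) (kappa_free n p))))"
        unfolding p(2) by (rule kappa_conj_tclass[where \<Phi> = "\<lambda>q. frag_extend (T_free n E Ed) (frag_extend (Fsum_free (l - 1) n D Dd) q)", OF V Tf p(1)])
      also have "\<dots> = tclass (Bpow l n) (kappa_free n (frag_extend (Fsum_free l n C Cd) (kappa_free n p)))"
        by (rule tclass_eqI) (simp only: kappa_free_diff[symmetric] kappa_free_rel'[OF T_Fsum_eq_u[OF l3 n_def E' C D' kappa_free_free[OF p(1)]]])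
      finally show ?thesis unfolding n_def[symmetric] U .
    qed
  qed
qed

end

theorem theorem4p28:
  fixes l :: nat
    and C D :: "'k::field mpol set" and E :: "nat \<Rightarrow> 'k mpol set"
    and Cd Dd :: "'k mpol \<Rightarrow> 'k mpol" and Ed :: "nat \<Rightarrow> 'k mpol \<Rightarrow> 'k mpol"
  assumes char: "CHAR('k) \<noteq> 2"
    and l: "l \<ge> 2"
    and C: "dual_hom_bases l (insert 1 (O2 l)) ({1, -1} \<union> O2 l) C Cd"
    and D: "l - 1 \<ge> 2 \<Longrightarrow>
      dual_hom_bases l (insert 1 (Iset l (l - 1))) ({1, -1} \<union> Iset l (l - 1)) D Dd"
    and E: "\<And>i. 1 \<le> i \<Longrightarrow> i \<le> l - 1 - 1 \<Longrightarrow>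
      dual_hom_bases l (insert (sgn_idx (l - 1) i) (Iset l (l - 1)))
        (insert (sgn_idx (l - 1) i) (O2 l)) (E i) (Ed i)"
  shows "bold_u l (l - 1) C Cd \<in> bimod_endos (Bpow l (l - 1)) (Aring l) \<and>
    bold_v l (l - 1) D Dd E Ed \<in> bimod_endos (Bpow l (l - 1)) (Aring l) \<and>
    bold_v l (l - 1) D Dd E Ed = bold_u l (l - 1) C Cd"
proof -
  \<comment> \<open>If 2 vanishes, the characteristic divides 2, and it is neither 1 nor 2.\<close>
  have two: "(2 :: 'k) \<noteq> 0"
  proof
    assume "(2 :: 'k) = 0"
    then have "of_nat 2 = (0 :: 'k)" by simp
    then have dvd: "CHAR('k) dvd 2" by (simp only: of_nat_eq_0_iff_char_dvd)
    then have "CHAR('k) \<le> 2" by (rule dvd_imp_le) simp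
    moreover have "CHAR('k) \<noteq> 0"
    proof
      assume "CHAR('k) = 0"
      with dvd have "(0 :: nat) dvd 2" by (simp only:)
      then show False by simp
    qed
    moreover have "CHAR('k) \<noteq> 1" using CHAR_not_1'[where 'a = 'k] by simp
    ultimately show False using char by linarith
  qed
  interpret typeD l "TYPE('k)" by unfold_locales (use l two in auto)
  note C' = C[unfolded O2_OS] and D' = D[unfolded Iset_OS[OF l]] and E' = E[unfolded O2_OS Iset_OS[OF l]]
  have n: "1 \<le> l - 1" using l by simp
  have U: "bold_u l (l - 1) C Cd \<in> bimod_endos (Bpow l (l - 1)) (Aring l)" by (rule bold_u_endo[OF n C'])
  have V: "bold_v l (l - 1) D Dd E Ed = bold_u l (l - 1) C Cd" by (rule bold_v_eq_bold_u[OF C' D' E'])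
  from U V show ?thesis by simp
qed

end
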